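(* Let $\kappa$ be an infinitesimal class and let $\mathcal S$ be a finite set of branches of analytic curves at $(\mathbb C^2,0)$. Then there exists a germ of meromorphic function $h$ at $(\mathbb C^2,0)$ whose indeterminacy structure is given by $\kappa$ and such that the set of all branches of $h=0$ and $h=\infty$ contains $\mathcal S$.
   Context: A sequence of quadratic blow-ups $\pi:(\tilde M,\mathcal D)\to(\mathbb C^2,0)$ is a finite composition of point blow-ups, the first centred at $0$ and each subsequent one centred at a point of the exceptional divisor already obtained; $\mathcal D=\pi^{-1}(0)$, and its irreducible components are called components. An upper star denotes strict transform. A branch is an irreducible germ of complex analytic curve at $0\in\mathbb C^2$. Infinitesimal classes: for a component $D\subset\mathcal D$, the infinitesimal class $\kappa(D)$ consists, up to isomorphism of sequences of blow-ups over $(\mathbb C^2,0)$, of all pairs $(\pi',D')$ where $\pi':(\tilde M',\mathcal D')\to(\mathbb C^2,0)$ is a sequence of blow-ups, $D'\subset\mathcal D'$ a component, and either $\pi'=\pi\circ\varsigma$ with $D'=\varsigma^*D$, or $\pi=\pi'\circ\varsigma'$ with $D=\varsigma'^*D'$, for some sequence of blow-ups $\varsigma$ or $\varsigma'$. For a union $\mathcal D^*$ of components of $\mathcal D$, $\kappa(\mathcal D^* )$ is the family of sequences of blow-ups that simultaneously realize all the classes $\kappa(D)$, $D\subset\mathcal D^*$, and for which no two of the components corresponding to components of $\mathcal D^*$ intersect. In the claim, $\kappa=\kappa(\mathcal D^* )$ is the infinitesimal class of a union of components of the exceptional divisor of some sequence of blow-ups. Indeterminacy structure: let $\mathcal H$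 be the germ of singular holomorphic foliation defined by the level curves of $h$. Its (minimal) reduction of singularities is the minimal sequence of blow-ups $\pi$ such that the strict transform foliation has finitely many singularities over $\mathcal D=\pi^{-1}(0)$, all simple (given by a vector field with non-nilpotent linear part whose eigenvalues have ratio outside $\mathbb Q_+$), it has no singularities and no tangency points on the non-invariant components of $\mathcal D$, and two non-invariant components do not intersect. The non-invariant components of $\mathcal D$ are called dicritical; equivalently they are the components not contained in a level set of the lifted map $\tilde h=h\circ\pi:\tilde M\to\mathbb P^1_{\mathbb C}$. The indeterminacy structure of $h$ is the information of these dicritical components; it is given by $\kappa$ when the dicritical components are exactly those determined by $\kappa$, i.e. the infinitesimal class of the union of all dicritical components is $\kappa$. *)

theory Defs
  imports "HOL-Analysis.Analysis"
begin

section \<open>Holomorphic germs at the origin of the complex plane\<close>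

text \<open>
  Germs at the origin are represented by globally defined functions (or sets) of which only the
  behaviour near the origin is used; values elsewhere are irrelevant.
\<close>

type_synonym C2 = "complex \<times> complex"

definition germ_eq :: "(C2 \<Rightarrow> complex) \<Rightarrow> (C2 \<Rightarrow> complex) \<Rightarrow> bool" where
  "germ_eq f g \<longleftrightarrow> (\<forall>\<^sub>F z in nhds 0. f z = g z)"

definition holomorphic_germ :: "(C2 \<Rightarrow> complex) \<Rightarrow> bool" where
  "holomorphic_germ f \<longleftrightarrow>
     (\<exists>U. open U \<and> 0 \<in> U \<and>
       (\<forall>z\<in>U. \<exists>a b. (f has_derivative (\<lambda>(s, t). a * s + b * t)) (at z)))"

definition germ_dvd :: "(C2 \<Rightarrow> complex) \<Rightarrow> (C2 \<Rightarrow> complex) \<Rightarrow> bool" where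
  "germ_dvd d f \<longleftrightarrow> (\<exists>k. holomorphic_germ k \<and> germ_eq f (\<lambda>z. d z * k z))"

text \<open>The units of the ring of holomorphic germs are the germs not vanishing at the origin.\<close>

definition coprime_germs :: "(C2 \<Rightarrow> complex) \<Rightarrow> (C2 \<Rightarrow> complex) \<Rightarrow> bool" where
  "coprime_germs f g \<longleftrightarrow>
     (\<forall>d. holomorphic_germ d \<and> germ_dvd d f \<and> germ_dvd d g \<longrightarrow> d 0 \<noteq> 0)"

text \<open>
  A meromorphic germ is given by its numerator and denominator in lowest terms (the ring of
  holomorphic germs is factorial, so every meromorphic germ is of this form).
\<close>

type_synonym fraction = "(C2 \<Rightarrow> complex) \<times> (C2 \<Rightarrow> complex)"

definition meromorphic_germ :: "fraction \<Rightarrow> bool" where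
  "meromorphic_germ h \<longleftrightarrow>
     holomorphic_germ (fst h) \<and> holomorphic_germ (snd h) \<and>
     \<not> germ_eq (snd h) (\<lambda>_. 0) \<and> coprime_germs (fst h) (snd h)"

section \<open>Germs of analytic curves and branches\<close>

definition germ_subset :: "C2 set \<Rightarrow> C2 set \<Rightarrow> bool" where
  "germ_subset X Y \<longleftrightarrow> (\<forall>\<^sub>F z in nhds 0. z \<in> X \<longrightarrow> z \<in> Y)"

definition same_germ :: "C2 set \<Rightarrow> C2 set \<Rightarrow> bool" where
  "same_germ X Y \<longleftrightarrow> germ_subset X Y \<and> germ_subset Y X"

definition curve_germ :: "C2 set \<Rightarrow> bool" where
  "curve_germ C \<longleftrightarrow>
     (\<exists>f. holomorphic_germ f \<and> \<not> germ_eq f (\<lambda>_. 0) \<and> f 0 = 0 \<and> same_germ C {z. f z = 0})"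

definition branch :: "C2 set \<Rightarrow> bool" where
  "branch C \<longleftrightarrow> curve_germ C \<and>
     (\<forall>C1 C2. curve_germ C1 \<and> curve_germ C2 \<and> same_germ C (C1 \<union> C2) \<longrightarrow>
        same_germ C C1 \<or> same_germ C C2)"

definition branches_of :: "C2 set \<Rightarrow> C2 set set" where
  "branches_of X = {C. branch C \<and> germ_subset C X}"

definition zero_branches :: "fraction \<Rightarrow> C2 set set" where
  "zero_branches h = branches_of {z. fst h z = 0}"

definition pole_branches :: "fraction \<Rightarrow> C2 set set" where
  "pole_branches h = branches_of {z. snd h z = 0}"

section \<open>Sequences of blow-ups\<close>

text \<open>
  The exceptional line of the blow-up of a point with local coordinates \<open>(x, y)\<close> is the set of
  directions at that point: \<open>Slope a\<close> is the direction \<open>y = a x\<close> and \<open>Vertical\<close> is \<open>x = 0\<close>.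
  A point infinitely near to the origin is the list of the directions leading to it: \<open>[]\<close> is the
  origin and \<open>p @ [a]\<close> is the point of direction \<open>a\<close> on the exceptional line of the blow-up
  of \<open>p\<close>.
\<close>

datatype direction = Slope complex | Vertical

type_synonym point = "direction list"

text \<open>
  \<open>blow a\<close> is the blow-down map in the standard coordinates centred at the point \<open>a\<close> of the
  exceptional line.  Thus \<open>chart p\<close> is the expression of the composed blow-down map to the
  original plane in coordinates centred at \<open>p\<close>.  These are coordinates of the blown-up surface
  near \<open>p\<close> only.
\<close>

fun blow :: "direction \<Rightarrow> C2 \<Rightarrow> C2" where
  "blow (Slope a) (u, v) = (u, u * (v + a))"
| "blow Vertical (u, v) = (u * v, v)"

fun chart :: "point \<Rightarrow> C2 \<Rightarrow> C2" where
  "chart [] = id"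
| "chart (a # p) = blow a \<circ> chart p"

text \<open>
  A sequence of blow-ups is represented by the set of its centres.  Two sequences of blow-ups are
  isomorphic over the germ of the plane at the origin iff they have the same centres up to order,
  so this set stands for the isomorphism class.  \<open>fibre T\<close> is the set of points over the origin
  (the points of the exceptional divisor, as soon as \<open>T\<close> is nonempty).
\<close>

type_synonym blowup_seq = "point set"

definition fibre :: "blowup_seq \<Rightarrow> point set" where
  "fibre T = (if T = {} then {[]} else {p @ [a] | p a. p \<in> T \<and> p @ [a] \<notin> T})"

text \<open>\<open>continues T T'\<close>: \<open>T'\<close> is \<open>T\<close> followed by some sequence of blow-ups.\<close>

inductive continues :: "blowup_seq \<Rightarrow> blowup_seq \<Rightarrow> bool" for T where
  refl: "continues T T"
| step: "continues T T' \<Longrightarrow> p \<in> fibre T' \<Longrightarrow> continues T (insert p T')"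

definition is_blowup_seq :: "blowup_seq \<Rightarrow> bool" where
  "is_blowup_seq T \<longleftrightarrow> continues {} T"

text \<open>
  The components of the exceptional divisor of \<open>T\<close> are labelled by the centres: the component
  \<open>q \<in> T\<close> is the strict transform of the exceptional line of the blow-up of \<open>q\<close>; in particular
  taking strict transforms of components under further blow-ups preserves labels.
  \<open>component_at q p\<close> is this strict transform in the coordinates at \<open>p\<close>: for \<open>p = q @ a # r\<close>, the
  closure of the inverse image of the exceptional line \<open>{w. blow a w = 0}\<close> minus its point \<open>0\<close>.
\<close>

definition component_at :: "point \<Rightarrow> point \<Rightarrow> C2 set" where
  "component_at q p =
     {z. \<exists>a r. p = q @ a # r \<and> z \<in> closure {w. chart r w \<noteq> 0 \<and> blow a (chart r w) = 0}}"

definition on_component :: "point \<Rightarrow> point \<Rightarrow> bool" where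
  "on_component q p \<longleftrightarrow> 0 \<in> component_at q p"

definition components_meet :: "blowup_seq \<Rightarrow> point \<Rightarrow> point \<Rightarrow> bool" where
  "components_meet T q q' \<longleftrightarrow> (\<exists>p\<in>fibre T. on_component q p \<and> on_component q' p)"

section \<open>Infinitesimal classes\<close>

text \<open>
  A component is a pair of a sequence \<open>T\<close> and a label in \<open>T\<close>.  The class of a component is the
  equivalence class for the equivalence relation generated by passing to the strict transform
  under further blow-ups.  If \<open>T\<close> is the shortest sequence in which the component \<open>q\<close> appears, all
  members of the class are strict transforms of \<open>(T, q)\<close>, see \<open>inf_class_iff\<close>; passing to the generated
  equivalence makes the class independent of the choice of \<open>T\<close>.
\<close>

definition lifts_to :: "blowup_seq \<times> point \<Rightarrow> blowup_seq \<times> point \<Rightarrow> bool" where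
  "lifts_to D D' \<longleftrightarrow>
     is_blowup_seq (fst D) \<and> snd D \<in> fst D \<and> continues (fst D) (fst D') \<and> snd D' = snd D"

definition inf_class :: "blowup_seq \<Rightarrow> point \<Rightarrow> (blowup_seq \<times> point) set" where
  "inf_class T q = {D'. equivclp lifts_to (T, q) D'}"

text \<open>
  Members of the class of a union \<open>Q\<close> of components carry the set \<open>Q'\<close> of the components
  corresponding to those in \<open>Q\<close>.
\<close>

definition inf_class_union :: "blowup_seq \<Rightarrow> point set \<Rightarrow> (blowup_seq \<times> point set) set" where
  "inf_class_union T Q =
     {(T', Q'). is_blowup_seq T' \<and>
        (\<forall>q\<in>Q. \<exists>q'. (T', q') \<in> inf_class T q) \<and>
        Q' = {q'. \<exists>q\<in>Q. (T', q') \<in> inf_class T q} \<and>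
        (\<forall>q\<in>Q'. \<forall>q'\<in>Q'. q \<noteq> q' \<longrightarrow> \<not> components_meet T' q q')}"

definition infinitesimal_class :: "(blowup_seq \<times> point set) set \<Rightarrow> bool" where
  "infinitesimal_class \<kappa> \<longleftrightarrow> (\<exists>T Q. is_blowup_seq T \<and> Q \<subseteq> T \<and> \<kappa> = inf_class_union T Q)"

section \<open>Foliations\<close>

definition pd1 :: "(C2 \<Rightarrow> complex) \<Rightarrow> C2 \<Rightarrow> complex" where
  "pd1 f z = deriv (\<lambda>s. f (s, snd z)) (fst z)"

definition pd2 :: "(C2 \<Rightarrow> complex) \<Rightarrow> C2 \<Rightarrow> complex" where
  "pd2 f z = deriv (\<lambda>t. f (fst z, t)) (snd z)"

text \<open>The pair \<open>(A, B)\<close> stands for the 1-form \<open>A dx + B dy\<close>.\<close>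

type_synonym oneform = "(C2 \<Rightarrow> complex) \<times> (C2 \<Rightarrow> complex)"

definition form_eval :: "oneform \<Rightarrow> C2 \<Rightarrow> C2 \<Rightarrow> complex" where
  "form_eval \<eta> z w = fst \<eta> z * fst w + snd \<eta> z * snd w"

definition pullback :: "(C2 \<Rightarrow> C2) \<Rightarrow> oneform \<Rightarrow> oneform" where
  "pullback \<phi> \<omega> =
     (\<lambda>z. fst \<omega> (\<phi> z) * pd1 (fst \<circ> \<phi>) z + snd \<omega> (\<phi> z) * pd1 (snd \<circ> \<phi>) z,
      \<lambda>z. fst \<omega> (\<phi> z) * pd2 (fst \<circ> \<phi>) z + snd \<omega> (\<phi> z) * pd2 (snd \<circ> \<phi>) z)"

text \<open>
  \<open>defines_foliation \<eta> \<omega>\<close>: the 1-form \<open>\<eta>\<close> is obtained from \<open>\<omega>\<close> by cancelling the greatest common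
  divisor of the coefficients, so it has at most an isolated zero and defines the same singular
  foliation germ as \<open>\<omega>\<close>.
\<close>

definition defines_foliation :: "oneform \<Rightarrow> oneform \<Rightarrow> bool" where
  "defines_foliation \<eta> \<omega> \<longleftrightarrow>
     holomorphic_germ (fst \<eta>) \<and> holomorphic_germ (snd \<eta>) \<and> coprime_germs (fst \<eta>) (snd \<eta>) \<and>
     (\<exists>k. holomorphic_germ k \<and> \<not> germ_eq k (\<lambda>_. 0) \<and>
        germ_eq (fst \<omega>) (\<lambda>z. k z * fst \<eta> z) \<and> germ_eq (snd \<omega>) (\<lambda>z. k z * snd \<eta> z))"

text \<open>For \<open>h = f / g\<close> this is \<open>g df - f dg\<close>, that is \<open>g\<^sup>2 dh\<close>.\<close>

definition level_form :: "fraction \<Rightarrow> oneform" where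
  "level_form h =
     (\<lambda>z. snd h z * pd1 (fst h) z - fst h z * pd1 (snd h) z,
      \<lambda>z. snd h z * pd2 (fst h) z - fst h z * pd2 (snd h) z)"

definition level_foliation :: "fraction \<Rightarrow> oneform \<Rightarrow> bool" where
  "level_foliation h \<omega> \<longleftrightarrow> defines_foliation \<omega> (level_form h)"

text \<open>\<open>\<eta>\<close> defines the strict transform of the foliation \<open>\<omega> = 0\<close> in the coordinates at \<open>p\<close>.\<close>

definition transform_at :: "oneform \<Rightarrow> point \<Rightarrow> oneform \<Rightarrow> bool" where
  "transform_at \<omega> p \<eta> \<longleftrightarrow> defines_foliation \<eta> (pullback (chart p) \<omega>)"

definition singular_at :: "oneform \<Rightarrow> point \<Rightarrow> bool" where
  "singular_at \<omega> p \<longleftrightarrow> (\<exists>\<eta>. transform_at \<omega> p \<eta> \<and> fst \<eta> 0 = 0 \<and> snd \<eta> 0 = 0)"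

text \<open>Linear part at the origin of the vector field \<open>(B, -A)\<close> spanning the kernel of \<open>A dx + B dy\<close>.\<close>

definition linear_part :: "oneform \<Rightarrow> complex^2^2" where
  "linear_part \<eta> =
     vector [vector [pd1 (snd \<eta>) 0, pd2 (snd \<eta>) 0],
             vector [- pd1 (fst \<eta>) 0, - pd2 (fst \<eta>) 0]]"

definition nilpotent_matrix :: "complex^2^2 \<Rightarrow> bool" where
  "nilpotent_matrix L \<longleftrightarrow> (\<exists>n. ((\<lambda>M. L ** M) ^^ n) (mat 1) = 0)"

text \<open>
  \<open>l\<close> and \<open>m\<close> are the eigenvalues with multiplicity.  A zero eigenvalue is allowed
  (saddle-nodes are simple): only positive rational ratios are excluded.
\<close>

definition simple_singularity_at :: "oneform \<Rightarrow> point \<Rightarrow> bool" where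
  "simple_singularity_at \<omega> p \<longleftrightarrow>
     (\<exists>\<eta>. transform_at \<omega> p \<eta> \<and> fst \<eta> 0 = 0 \<and> snd \<eta> 0 = 0 \<and>
        \<not> nilpotent_matrix (linear_part \<eta>) \<and>
        (\<forall>l m. (\<forall>t. det (mat t - linear_part \<eta>) = (t - l) * (t - m)) \<longrightarrow>
           \<not> (\<exists>r::rat. r > 0 \<and> l = of_rat r * m)))"

text \<open>
  If \<open>component_at q p\<close> passes through the origin, then it is one of the two coordinate axes (see
  \<open>component_at_axis\<close> below), hence equal to its tangent space at each of its points.  The vectors
  \<open>w\<close> in the next two definitions therefore range over the tangent space of the component.
\<close>

definition invariant_at :: "oneform \<Rightarrow> point \<Rightarrow> point \<Rightarrow> bool" where
  "invariant_at \<omega> q p \<longleftrightarrow>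
     (\<exists>\<eta>. transform_at \<omega> p \<eta> \<and>
        (\<forall>\<^sub>F z in nhds 0. z \<in> component_at q p \<longrightarrow> (\<forall>w\<in>component_at q p. form_eval \<eta> z w = 0)))"

definition tangent_at :: "oneform \<Rightarrow> point \<Rightarrow> point \<Rightarrow> bool" where
  "tangent_at \<omega> q p \<longleftrightarrow>
     (\<exists>\<eta>. transform_at \<omega> p \<eta> \<and> \<not> (fst \<eta> 0 = 0 \<and> snd \<eta> 0 = 0) \<and>
        (\<forall>w\<in>component_at q p. form_eval \<eta> 0 w = 0))"

definition dicritical :: "oneform \<Rightarrow> blowup_seq \<Rightarrow> point \<Rightarrow> bool" where
  "dicritical \<omega> T q \<longleftrightarrow>
     q \<in> T \<and> \<not> (\<forall>p\<in>fibre T. on_component q p \<longrightarrow> invariant_at \<omega> q p)"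

definition reduces :: "oneform \<Rightarrow> blowup_seq \<Rightarrow> bool" where
  "reduces \<omega> T \<longleftrightarrow> is_blowup_seq T \<and>
     finite {p \<in> fibre T. singular_at \<omega> p} \<and>
     (\<forall>p\<in>fibre T. singular_at \<omega> p \<longrightarrow> simple_singularity_at \<omega> p) \<and>
     (\<forall>q p. dicritical \<omega> T q \<and> p \<in> fibre T \<and> on_component q p \<longrightarrow>
        \<not> singular_at \<omega> p \<and> \<not> tangent_at \<omega> q p) \<and>
     (\<forall>q q'. dicritical \<omega> T q \<and> dicritical \<omega> T q' \<and> q \<noteq> q' \<longrightarrow> \<not> components_meet T q q')"

definition minimal_reduction :: "oneform \<Rightarrow> blowup_seq \<Rightarrow> bool" where
  "minimal_reduction \<omega> T \<longleftrightarrow> reduces \<omega> T \<and> (\<forall>T'. reduces \<omega> T' \<longrightarrow> continues T T')"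

definition indeterminacy_structure :: "fraction \<Rightarrow> (blowup_seq \<times> point set) set \<Rightarrow> bool" where
  "indeterminacy_structure h \<kappa> \<longleftrightarrow>
     (\<exists>\<omega> T. level_foliation h \<omega> \<and> minimal_reduction \<omega> T \<and>
        inf_class_union T {q. dicritical \<omega> T q} = \<kappa>)"

section \<open>Components are coordinate axes\<close>

lemma chart_0: "chart r 0 = 0"
proof (induction r)
  case (Cons b r)
  then show ?case by (cases b) (auto simp: zero_prod_def)
qed simp

lemma continuous_blow: "continuous_on UNIV (blow b)"
proof (cases b)
  case (Slope c)
  have "blow b = (\<lambda>z. (fst z, fst z * (snd z + c)))" by (auto simp: Slope)
  then show ?thesis by (auto intro!: continuous_intros)
next
  case Vertical
  have "blow b = (\<lambda>z. (fst z * snd z, snd z))" by (auto simp: Vertical)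
  then show ?thesis by (auto intro!: continuous_intros)
qed

lemma continuous_chart: "continuous_on UNIV (chart r)"
proof (induction r)
  case (Cons b r)
  have "continuous_on UNIV (blow b \<circ> chart r)"
    by (intro continuous_on_compose Cons continuous_on_subset[OF continuous_blow]) auto
  then show ?case by simp
qed (simp add: id_def)

lemma vertical_line:
  "{w. chart r w \<noteq> 0 \<and> fst (chart r w) = 0} \<in> {{}, {0} \<times> (- {0})}"
proof (induction r)
  case Nil
  show ?case by (auto simp: zero_prod_def)
next
  case (Cons b r)
  show ?case
  proof (cases b)
    case (Slope c)
    have "blow b z = 0" if "fst (blow b z) = 0" for z
      using that by (cases z) (auto simp: Slope zero_prod_def)
    then have "{w. chart (b # r) w \<noteq> 0 \<and> fst (chart (b # r) w) = 0} = {}"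
      unfolding chart.simps o_def by blast
    then show ?thesis by simp
  next
    case Vertical
    have "blow b z \<noteq> 0 \<and> fst (blow b z) = 0 \<longleftrightarrow> z \<noteq> 0 \<and> fst z = 0" for z
      by (cases z) (auto simp: Vertical zero_prod_def)
    then show ?thesis using Cons by simp
  qed
qed

lemma horizontal_line:
  "{w. chart r w \<noteq> 0 \<and> snd (chart r w) = 0} = UNIV \<times> {0} - {0} \<or>
   0 \<notin> closure {w. chart r w \<noteq> 0 \<and> snd (chart r w) = 0}"
proof (induction r)
  case Nil
  show ?case by (auto simp: zero_prod_def)
next
  case (Cons b r)
  show ?case
  proof (cases b)
    case (Slope c)
    show ?thesis
    proof (cases "c = 0")
      case True
      have "blow b z \<noteq> 0 \<and> snd (blow b z) = 0 \<longleftrightarrow> z \<noteq> 0 \<and> snd z = 0" for z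
        by (cases z) (auto simp: Slope True zero_prod_def)
      then show ?thesis using Cons by simp
    next
      case False
      let ?Y = "{w. snd (chart r w) = - c}"
      have "closed ?Y"
        by (intro closed_Collect_eq continuous_intros continuous_chart)
      moreover have "{w. chart (b # r) w \<noteq> 0 \<and> snd (chart (b # r) w) = 0} \<subseteq> ?Y"
      proof clarsimp
        fix x y assume "blow b (chart r (x, y)) \<noteq> 0" "snd (blow b (chart r (x, y))) = 0"
        then show "snd (chart r (x, y)) = - c"
          by (cases "chart r (x, y)") (auto simp: Slope zero_prod_def eq_neg_iff_add_eq_0)
      qed
      ultimately have "closure {w. chart (b # r) w \<noteq> 0 \<and> snd (chart (b # r) w) = 0} \<subseteq> ?Y"
        by (rule closure_minimal[rotated])
      moreover have "0 \<notin> ?Y" using False by (simp add: chart_0)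
      ultimately show ?thesis by blast
    qed
  next
    case Vertical
    have "blow b z = 0" if "snd (blow b z) = 0" for z
      using that by (cases z) (auto simp: Vertical zero_prod_def)
    then have "{w. chart (b # r) w \<noteq> 0 \<and> snd (chart (b # r) w) = 0} = {}"
      unfolding chart.simps o_def by blast
    then show ?thesis by (metis closure_empty empty_iff)
  qed
qed

lemma component_at_axis:
  assumes "on_component q p"
  shows "component_at q p = {0} \<times> UNIV \<or> component_at q p = UNIV \<times> {0}"
proof -
  obtain a r where p: "p = q @ a # r"
    using assms by (auto simp: on_component_def component_at_def)
  have comp: "component_at q p = closure {w. chart r w \<noteq> 0 \<and> blow a (chart r w) = 0}"
    by (auto simp: component_at_def p)
  have dense: "closure (- {0 :: complex}) = UNIV"
    by (simp add: closure_complement)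
  show ?thesis
  proof (cases a)
    case (Slope c)
    have "blow a z = 0 \<longleftrightarrow> fst z = 0" for z by (cases z) (auto simp: Slope zero_prod_def)
    then have c: "component_at q p = closure {w. chart r w \<noteq> 0 \<and> fst (chart r w) = 0}"
      by (simp add: comp)
    then have "{w. chart r w \<noteq> 0 \<and> fst (chart r w) = 0} = {0} \<times> (- {0})"
      using vertical_line[of r] assms by (auto simp only: on_component_def closure_empty)
    then show ?thesis using dense c by (simp add: closure_Times)
  next
    case Vertical
    have "blow a z = 0 \<longleftrightarrow> snd z = 0" for z by (cases z) (auto simp: Vertical zero_prod_def)
    then have c: "component_at q p = closure {w. chart r w \<noteq> 0 \<and> snd (chart r w) = 0}"
      by (simp add: comp)
    then have "{w. chart r w \<noteq> 0 \<and> snd (chart r w) = 0} = UNIV \<times> {0} - {0}"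
      using horizontal_line[of r] assms by (auto simp only: on_component_def)
    also have "\<dots> = (- {0}) \<times> {0}" by (auto simp: zero_prod_def)
    finally show ?thesis using dense c by (simp add: closure_Times)
  qed
qed

section \<open>Infinitesimal classes in terms of centres\<close>

lemma is_blowup_seq_iff:
  "is_blowup_seq T \<longleftrightarrow> finite T \<and> (\<forall>p a. p @ [a] \<in> T \<longrightarrow> p \<in> T)"
  and continues_iff:
  "is_blowup_seq T \<Longrightarrow> continues T T' \<longleftrightarrow> is_blowup_seq T' \<and> T \<subseteq> T'"
proof -
  let ?P = "\<lambda>T. finite T \<and> (\<forall>p a. p @ [a] \<in> T \<longrightarrow> p \<in> T)"
  have grow: "continues T T' \<Longrightarrow> ?P T \<Longrightarrow> ?P T' \<and> T \<subseteq> T'" for T T'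
    by (induction rule: continues.induct) (auto simp: fibre_def split: if_splits)
  have extend: "continues T T'" if "?P T" "?P T'" "T \<subseteq> T'" for T T'
    using that
  proof (induction "card (T' - T)" arbitrary: T')
    case 0
    then show ?case by (simp add: continues.refl)
  next
    case (Suc n)
    then have fin: "finite (T' - T)" and ne: "T' - T \<noteq> {}" by auto
    have "\<exists>p\<in>T' - T. \<forall>p'\<in>T' - T. length p' \<le> length p"
    proof -
      have "Max (length ` (T' - T)) \<in> length ` (T' - T)" using fin ne by (intro Max_in) auto
      then obtain p where "p \<in> T' - T" "length p = Max (length ` (T' - T))" by auto
      moreover have "length p' \<le> Max (length ` (T' - T))" if "p' \<in> T' - T" for p'
        using fin that by (intro Max_ge) auto
      ultimately show ?thesis by (intro bexI[of _ p]) auto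
    qed
    then obtain p where p: "p \<in> T' - T" and longest: "\<forall>p'\<in>T' - T. length p' \<le> length p" ..
    have leaf: "p @ [a] \<notin> T'" for a
    proof
      assume a: "p @ [a] \<in> T'"
      then have "p @ [a] \<in> T' - T" using Suc.prems(1) p by blast
      with longest have "length (p @ [a]) \<le> length p" by (rule bspec)
      then show False by simp
    qed
    let ?U = "T' - {p}"
    have "?U - T = (T' - T) - {p}" by blast
    then have "card (?U - T) = n"
      using Suc.hyps(2) p by (simp add: card_Diff_singleton)
    moreover have U: "?P ?U" "T \<subseteq> ?U" using Suc.prems p leaf by auto
    ultimately have "continues T ?U" using Suc.hyps(1)[of ?U] Suc.prems(1) by blast
    moreover have "p \<in> fibre ?U"
    proof (cases p rule: rev_cases)
      case Nil
      have "x = []" if "x \<in> T'" for x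
        using that
      proof (induction x rule: rev_induct)
        case (snoc a x)
        then have "x = []" using Suc.prems(2) by blast
        then show ?case using snoc.prems leaf[of a] Nil by simp
      qed simp
      then show ?thesis using Nil by (auto simp: fibre_def)
    next
      case (snoc r a)
      then show ?thesis using p Suc.prems(2) by (auto simp: fibre_def)
    qed
    ultimately have "continues T (insert p ?U)" by (rule continues.step)
    then show ?case using p by (simp add: insert_absorb)
  qed
  have empty: "?P {}" by simp
  show iff: "is_blowup_seq T \<longleftrightarrow> ?P T" for T
  proof
    assume "is_blowup_seq T"
    from grow[OF this[unfolded is_blowup_seq_def] empty] show "?P T" by (rule conjunct1)
  next
    assume "?P T"
    from extend[OF empty this] show "is_blowup_seq T" by (simp add: is_blowup_seq_def)
  qed
  assume T: "is_blowup_seq T"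
  show "continues T T' \<longleftrightarrow> is_blowup_seq T' \<and> T \<subseteq> T'"
  proof
    assume "continues T T'"
    from grow[OF this T[unfolded iff]] show "is_blowup_seq T' \<and> T \<subseteq> T'" unfolding iff .
  next
    assume "is_blowup_seq T' \<and> T \<subseteq> T'"
    then show "continues T T'" using extend[of T T'] T unfolding iff by simp
  qed
qed

lemma inf_class_iff:
  assumes "is_blowup_seq T" "q \<in> T"
  shows "inf_class T q = {(T', q'). is_blowup_seq T' \<and> q' \<in> T' \<and> q' = q}"
proof -
  have sym: "lifts_to D D' \<Longrightarrow> is_blowup_seq (fst D) \<and> is_blowup_seq (fst D') \<and>
      snd D \<in> fst D \<and> snd D' \<in> fst D' \<and> snd D' = snd D" for D D'
    by (auto simp: lifts_to_def continues_iff)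
  have "is_blowup_seq (fst D') \<and> snd D' \<in> fst D' \<and> snd D' = q"
    if "equivclp lifts_to (T, q) D'" for D'
    using that
  proof (induction rule: equivclp_induct)
    case base
    then show ?case using assms by simp
  next
    case (step D D')
    from step.hyps(2) show ?case
    proof
      assume "lifts_to D D'"
      from sym[OF this] show ?thesis using step.IH by metis
    next
      assume "lifts_to D' D"
      from sym[OF this] show ?thesis using step.IH by metis
    qed
  qed
  moreover have "equivclp lifts_to (T, q) (T', q)" if "is_blowup_seq T'" "q \<in> T'" for T'
  proof -
    have "is_blowup_seq (T \<inter> T')" using assms that by (auto simp: is_blowup_seq_iff)
    then have "lifts_to (T \<inter> T', q) (T, q)" "lifts_to (T \<inter> T', q) (T', q)"
      using assms that by (auto simp: lifts_to_def continues_iff)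
    then show ?thesis by (rule equivclp_trans[OF equivclp_sym[OF r_into_equivclp] r_into_equivclp])
  qed
  ultimately show ?thesis by (auto simp: inf_class_def)
qed

end

theory Submission
  imports Defs "HOL-Complex_Analysis.Complex_Analysis" "HOL-Computational_Algebra.Fundamental_Theorem_Algebra"
begin

text \<open>
  Germs at the origin form a ring in which infinitely near points act by substitution. Let \<open>F\<close> be a product
  of equations of the given branches and \<open>Q\<close> the set of components to be made dicritical. Blow up until
  all components of \<open>Q\<close> appear, are separated, and \<open>F\<close> has normal crossings with the divisor. By induction from
  the leaves to the root one finds a fraction \<open>N / D\<close> with \<open>F dvd N\<close> that has order \<open>0\<close> along the components in \<open>Q\<close>,
  positive order along all others, and at least three zeros on every exceptional line: the orders
  along the components are adjusted by extra smooth curves, using Weierstrass polynomials to descend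
  curves from the blown-up surface to the plane.

  On the components in \<open>Q\<close> the fraction restricts to a nonconstant rational function, and resolving
  its finitely many critical points makes the fraction monomial in local coordinates at every leaf, up to a
  Moebius transformation. There the foliation is regular or has an eigenvalue ratio in the negative rationals,
  and exactly the components in \<open>Q\<close> are not invariant. Deleting from this tree all points that have an
  infinitely near predecessor at which nothing needs to be blown up leaves the minimal reduction. It still
  contains \<open>Q\<close>, because at a regular or simple point the exceptional line is invariant with at
  most two singularities.
\<close>

section \<open>Holomorphic functions of two variables\<close>

text \<open>A component along which the fraction has nonzero order is contained in a level set,
  hence invariant. Prescribing the dicritical components therefore means prescribing orders: 0 on
  \<open>Q\<close> and positive elsewhere. Order 0 alone could leave the fraction constant on a
  component; the zeros placed on every exceptional line exclude this. The obstacle is that these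
  orders are not independent: the order along a new component is determined by the orders along the
  axes through its centre and by all curves through the centre, including those that serve
  infinitely near points. The recursion towards the root therefore controls only one number per
  axis, an upper bound for the excess of zeros over poles. Minimality compares one reduction with
  all others. It is decided pointwise: a point is bad if no reduction can have it in its fibre, and
  badness refers to the foliation and to \<open>Q\<close>, not to a tree. The analytic input is
  Cauchy's formula and its consequence, Weierstrass preparation, which serves three purposes:
  maximal contact in the resolution of curves, the description of smooth curves as graphs, and the
  descent of curves to the plane.\<close>

definition hol2 :: "C2 set \<Rightarrow> (C2 \<Rightarrow> complex) \<Rightarrow> bool" where
  "hol2 U f \<longleftrightarrow> (\<forall>z\<in>U. \<exists>a b. (f has_derivative (\<lambda>(s, t). a * s + b * t)) (at z))"

lemma holomorphic_germ_iff: "holomorphic_germ f \<longleftrightarrow> (\<exists>U. open U \<and> 0 \<in> U \<and> hol2 U f)"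
  by (simp add: holomorphic_germ_def hol2_def)

lemma hol2_subset: "hol2 U f \<Longrightarrow> V \<subseteq> U \<Longrightarrow> hol2 V f"
  by (auto simp: hol2_def)

lemma hol2_slices:
  assumes "(f has_derivative (\<lambda>(s, t). a * s + b * t)) (at z)"
  shows "((\<lambda>s. f (s, snd z)) has_field_derivative a) (at (fst z))"
    and "((\<lambda>t. f (fst z, t)) has_field_derivative b) (at (snd z))"
proof -
  have f: "(f has_derivative (\<lambda>(s, t). a * s + b * t)) (at (fst z, snd z))" using assms by simp
  have "((\<lambda>s. (s, snd z)) has_derivative (\<lambda>h. (h, 0))) (at (fst z))"
    by (auto intro!: derivative_eq_intros)
  from has_derivative_compose[OF this f]
  show "((\<lambda>s. f (s, snd z)) has_field_derivative a) (at (fst z))"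
    by (simp add: has_field_derivative_def)
  have "((\<lambda>t. (fst z, t)) has_derivative (\<lambda>h. (0, h))) (at (snd z))"
    by (auto intro!: derivative_eq_intros)
  from has_derivative_compose[OF this f]
  show "((\<lambda>t. f (fst z, t)) has_field_derivative b) (at (snd z))"
    by (simp add: has_field_derivative_def)
qed

lemma has_derivative_pd:
  assumes "(f has_derivative (\<lambda>(s, t). a * s + b * t)) (at z)"
  shows "pd1 f z = a" "pd2 f z = b"
  using hol2_slices[OF assms] by (auto simp: pd1_def pd2_def DERIV_imp_deriv)

lemma hol2_D:
  assumes "hol2 U f" "z \<in> U"
  shows "(f has_derivative (\<lambda>(s, t). pd1 f z * s + pd2 f z * t)) (at z)"
  using assms has_derivative_pd unfolding hol2_def by metis

lemma hol2_D1: "hol2 U f \<Longrightarrow> (s, t) \<in> U \<Longrightarrow> ((\<lambda>s. f (s, t)) has_field_derivative pd1 f (s, t)) (at s)"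
  and hol2_D2: "hol2 U f \<Longrightarrow> (s, t) \<in> U \<Longrightarrow> ((\<lambda>t. f (s, t)) has_field_derivative pd2 f (s, t)) (at t)"
  using hol2_slices[OF hol2_D] by fastforce+

lemma hol2I: "(\<And>z. z \<in> U \<Longrightarrow> (f has_derivative (\<lambda>(s, t). a z * s + b z * t)) (at z)) \<Longrightarrow> hol2 U f"
  by (auto simp: hol2_def)

lemma hol2_continuous_on: "hol2 U f \<Longrightarrow> continuous_on U f"
  by (meson continuous_at_imp_continuous_on has_derivative_continuous hol2_D)

lemma hol2_const [intro]: "hol2 U (\<lambda>_. c)"
  by (rule hol2I[of _ _ "\<lambda>_. 0" "\<lambda>_. 0"]) (auto simp: split_def)

lemma hol2_fst [intro]: "hol2 U fst"
  by (rule hol2I[of _ _ "\<lambda>_. 1" "\<lambda>_. 0"]) (auto intro!: derivative_eq_intros simp: fun_eq_iff)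

lemma hol2_snd [intro]: "hol2 U snd"
  by (rule hol2I[of _ _ "\<lambda>_. 0" "\<lambda>_. 1"]) (auto intro!: derivative_eq_intros simp: fun_eq_iff)

lemma hol2_add [intro]:
  assumes "hol2 U f" "hol2 U g" shows "hol2 U (\<lambda>z. f z + g z)"
proof (rule hol2I)
  fix z assume "z \<in> U"
  from has_derivative_add[OF hol2_D[OF assms(1) this] hol2_D[OF assms(2) this]]
  show "((\<lambda>z. f z + g z) has_derivative (\<lambda>(s, t). (pd1 f z + pd1 g z) * s + (pd2 f z + pd2 g z) * t)) (at z)"
    by (rule has_derivative_eq_rhs) (auto simp: fun_eq_iff algebra_simps)
qed

lemma hol2_mult [intro]:
  assumes "hol2 U f" "hol2 U g" shows "hol2 U (\<lambda>z. f z * g z)"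
proof (rule hol2I)
  fix z assume "z \<in> U"
  from has_derivative_mult[OF hol2_D[OF assms(1) this] hol2_D[OF assms(2) this]]
  show "((\<lambda>z. f z * g z) has_derivative (\<lambda>(s, t). (f z * pd1 g z + pd1 f z * g z) * s +
     (f z * pd2 g z + pd2 f z * g z) * t)) (at z)"
    by (rule has_derivative_eq_rhs) (auto simp: fun_eq_iff algebra_simps)
qed

lemma hol2_minus [intro]: "hol2 U f \<Longrightarrow> hol2 U (\<lambda>z. - f z)"
  using hol2_mult[OF hol2_const[of U "-1"]] by simp

lemma hol2_diff [intro]: "hol2 U f \<Longrightarrow> hol2 U g \<Longrightarrow> hol2 U (\<lambda>z. f z - g z)"
  using hol2_add[OF _ hol2_minus] by simp

lemma hol2_compose_holomorphic:
  assumes "hol2 U f" "g holomorphic_on V" "open V" "f ` U \<subseteq> V" shows "hol2 U (\<lambda>z. g (f z))"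
proof (rule hol2I)
  fix z assume "z \<in> U"
  then have "(g has_derivative (*) (deriv g (f z))) (at (f z))"
    using assms(2,3,4) holomorphic_derivI[of g V "f z"] has_field_derivative_imp_has_derivative by blast
  from has_derivative_compose[OF hol2_D[OF assms(1) \<open>z \<in> U\<close>] this]
  show "((\<lambda>z. g (f z)) has_derivative (\<lambda>(s, t). (deriv g (f z) * pd1 f z) * s +
     (deriv g (f z) * pd2 f z) * t)) (at z)"
    by (rule has_derivative_eq_rhs) (auto simp: fun_eq_iff algebra_simps)
qed

lemma hol2_inverse [intro]:
  assumes "hol2 U f" "\<And>z. z \<in> U \<Longrightarrow> f z \<noteq> 0" shows "hol2 U (\<lambda>z. inverse (f z))"
  by (rule hol2_compose_holomorphic[OF assms(1), of _ "- {0}"])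
    (use assms in \<open>auto intro!: holomorphic_intros\<close>)

lemma hol2_divide [intro]:
  assumes "hol2 U f" "hol2 U g" "\<And>z. z \<in> U \<Longrightarrow> g z \<noteq> 0" shows "hol2 U (\<lambda>z. f z / g z)"
  unfolding divide_inverse by (intro hol2_mult hol2_inverse assms)

lemma hol2_power [intro]: "hol2 U f \<Longrightarrow> hol2 U (\<lambda>z. f z ^ n)"
  by (induction n) auto

lemma hol2_sum [intro]: "(\<And>i. i \<in> A \<Longrightarrow> hol2 U (f i)) \<Longrightarrow> hol2 U (\<lambda>z. \<Sum>i\<in>A. f i z)"
  by (induction A rule: infinite_finite_induct) auto

lemma hol2_fst_holomorphic: "g holomorphic_on V \<Longrightarrow> open V \<Longrightarrow> hol2 (V \<times> W) (\<lambda>z. g (fst z))"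
  by (rule hol2_compose_holomorphic) auto

lemma hol2_chain:
  assumes f: "hol2 V f" and g: "hol2 U g" and h: "hol2 U h" and z: "z \<in> U" "(g z, h z) \<in> V"
  shows "((\<lambda>z. f (g z, h z)) has_derivative (\<lambda>(s, t).
     (pd1 f (g z, h z) * pd1 g z + pd2 f (g z, h z) * pd1 h z) * s +
     (pd1 f (g z, h z) * pd2 g z + pd2 f (g z, h z) * pd2 h z) * t)) (at z)"
  using has_derivative_compose[OF has_derivative_Pair[OF hol2_D[OF g z(1)] hol2_D[OF h z(1)]] hol2_D[OF f z(2)]]
  by (rule has_derivative_eq_rhs) (auto simp: fun_eq_iff algebra_simps)

lemma hol2_compose:
  assumes "hol2 V f" "hol2 U g" "hol2 U h" "\<And>z. z \<in> U \<Longrightarrow> (g z, h z) \<in> V"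
  shows "hol2 U (\<lambda>z. f (g z, h z))"
  using hol2_chain[OF assms(1-3) _ assms(4)] by (intro hol2I) auto

lemma hol2_transform:
  assumes "hol2 U f" "open U" "\<And>z. z \<in> U \<Longrightarrow> f z = g z" shows "hol2 U g"
proof (rule hol2I)
  fix z assume "z \<in> U"
  from has_derivative_transform_within_open[OF hol2_D[OF assms(1) this] assms(2) this assms(3)]
  show "(g has_derivative (\<lambda>(s, t). pd1 f z * s + pd2 f z * t)) (at z)" .
qed

section \<open>Differentiation under the integral sign\<close>

lemma open_box_in_open:
  fixes U :: "('a::topological_space \<times> 'b::topological_space) set"
  assumes "open U" "(s, t) \<in> U"
  shows "\<exists>A B. open A \<and> open B \<and> s \<in> A \<and> t \<in> B \<and> A \<times> B \<subseteq> U"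
  using open_prod_elim[OF assms] by (metis mem_Sigma_iff)

text \<open>Continuity of one of the two partial derivatives is enough for total differentiability,
  so holomorphy of an integral can be checked one variable at a time.\<close>

lemma hol2_from_partials:
  assumes U: "open U"
    and f1: "\<And>s t. (s, t) \<in> U \<Longrightarrow> ((\<lambda>s. f (s, t)) has_field_derivative f1 (s, t)) (at s)"
    and f2: "\<And>s t. (s, t) \<in> U \<Longrightarrow> ((\<lambda>t. f (s, t)) has_field_derivative f2 (s, t)) (at t)"
    and cont: "continuous_on U f2"
  shows "hol2 U f"
proof (rule hol2I)
  fix z assume z: "z \<in> U"
  obtain s t where st: "z = (s, t)" by fastforce
  obtain A B where AB: "open A" "open B" "s \<in> A" "t \<in> B" "A \<times> B \<subseteq> U"
    using open_box_in_open[OF U, of s t] z st by blast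
  obtain e where e: "e > 0" "ball t e \<subseteq> B" using AB openE by blast
  have sub: "A \<times> ball t e \<subseteq> U" using AB e by blast
  have "((\<lambda>(x, y). f (x, y)) has_derivative (\<lambda>(tx, ty). f1 (s, t) * tx + blinfun_apply (blinfun_mult_right (f2 (s, t))) ty))
     (at (s, t) within A \<times> ball t e)"
  proof (rule has_derivative_partialsI)
    show "((\<lambda>x. f (x, t)) has_derivative (\<lambda>tx. f1 (s, t) * tx)) (at s within A)"
      using f1[of s t] z st by (simp add: has_field_derivative_def has_derivative_at_withinI)
    show "((\<lambda>y. f (x, y)) has_derivative blinfun_apply (blinfun_mult_right (f2 (x, y)))) (at y within ball t e)"
      if "x \<in> A" "y \<in> ball t e" for x y
      using has_derivative_at_withinI[OF f2[of x y, unfolded has_field_derivative_def]] that sub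
      by (auto simp: subset_iff)
    have "continuous_on (A \<times> ball t e) (\<lambda>z. blinfun_mult_right (f2 z))"
      by (intro continuous_intros continuous_on_subset[OF cont] sub)
    then show "continuous (at (s, t) within A \<times> ball t e) (\<lambda>(x, y). blinfun_mult_right (f2 (x, y)))"
      using AB e by (auto simp: continuous_on_eq_continuous_within split_def)
  qed (use e in auto)
  then have "(f has_derivative (\<lambda>(s', t'). f1 z * s' + f2 z * t')) (at (s, t) within A \<times> ball t e)"
    by (simp add: st)
  then show "(f has_derivative (\<lambda>(s', t'). f1 z * s' + f2 z * t')) (at z)"
    using AB e st by (subst (asm) at_within_open) (auto intro: open_Times)
qed

text \<open>The analytic constructions below are integrals of this kind: Cauchy's formula for a
  partial derivative, the quotient by the first coordinate, and the counting integrals and the unit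
  of Weierstrass preparation.\<close>

lemma hol2_integral:
  fixes K :: "C2 \<Rightarrow> real \<Rightarrow> complex"
  assumes U: "open U"
    and K1: "\<And>s t x. (s, t) \<in> U \<Longrightarrow> x \<in> {0..1} \<Longrightarrow> ((\<lambda>s. K (s, t) x) has_field_derivative K1 (s, t) x) (at s)"
    and K2: "\<And>s t x. (s, t) \<in> U \<Longrightarrow> x \<in> {0..1} \<Longrightarrow> ((\<lambda>t. K (s, t) x) has_field_derivative K2 (s, t) x) (at t)"
    and cont: "continuous_on (U \<times> {0..1}) (\<lambda>(z, x). K z x)" "continuous_on (U \<times> {0..1}) (\<lambda>(z, x). K1 z x)"
      "continuous_on (U \<times> {0..1}) (\<lambda>(z, x). K2 z x)"
  shows "hol2 U (\<lambda>z. integral {0..1} (K z))"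
proof (rule hol2_from_partials[where ?f1.0 = "\<lambda>z. integral {0..1} (K1 z)" and ?f2.0 = "\<lambda>z. integral {0..1} (K2 z)"])
  have int: "K z integrable_on {0..1}" if "z \<in> U" for z
  proof (rule integrable_continuous_interval)
    have "continuous_on {0..1} (\<lambda>x. (\<lambda>(z, x). K z x) (z, x))"
      by (rule continuous_on_compose2[OF cont(1)]) (use that in \<open>auto intro!: continuous_intros\<close>)
    then show "continuous_on {0..1} (K z)" by simp
  qed
  show "continuous_on U (\<lambda>z. integral {0..1} (K2 z))"
    using integral_continuous_on_param[of U 0 "1::real" K2] cont(3) by simp
  fix s t assume st: "(s, t) \<in> U"
  obtain A B where AB: "open A" "open B" "s \<in> A" "t \<in> B" "A \<times> B \<subseteq> U"
    using open_box_in_open[OF U st] by blast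
  obtain e where e: "e > 0" "ball t e \<subseteq> B" using AB openE by blast
  obtain d where d: "d > 0" "ball s d \<subseteq> A" using AB openE by blast
  have sub: "(x, t) \<in> U" if "x \<in> ball s d" for x using that d AB by blast
  have sub': "(s, x) \<in> U" if "x \<in> ball t e" for x using that e AB by blast
  have "((\<lambda>s. integral (cbox 0 1) (K (s, t))) has_field_derivative integral (cbox 0 1) (K1 (s, t))) (at s within ball s d)"
  proof (rule leibniz_rule_field_derivative[where f = "\<lambda>s. K (s, t)" and fx = "\<lambda>s. K1 (s, t)"])
    show "((\<lambda>x. K (x, t) u) has_field_derivative K1 (x, t) u) (at x within ball s d)"
      if "x \<in> ball s d" "u \<in> cbox 0 1" for x u
      using that d AB by (intro has_field_derivative_at_within[OF K1]) auto
    show "K (x, t) integrable_on cbox 0 1" if "x \<in> ball s d" for x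
      using that d AB by (auto intro!: int)
    have "continuous_on (ball s d \<times> {0..1}) (\<lambda>p. (\<lambda>(z, x). K1 z x) ((fst p, t), snd p))"
      by (rule continuous_on_compose2[OF cont(2)]) (use sub in \<open>auto intro!: continuous_intros\<close>)
    then show "continuous_on (ball s d \<times> cbox 0 1) (\<lambda>(x, u). K1 (x, t) u)" by (simp add: split_def)
  qed (use d in auto)
  then show "((\<lambda>s. integral {0..1} (K (s, t))) has_field_derivative integral {0..1} (K1 (s, t))) (at s)"
    using d by (simp add: at_within_open[of s "ball s d"])
  have "((\<lambda>t. integral (cbox 0 1) (K (s, t))) has_field_derivative integral (cbox 0 1) (K2 (s, t))) (at t within ball t e)"
  proof (rule leibniz_rule_field_derivative[where f = "\<lambda>t. K (s, t)" and fx = "\<lambda>t. K2 (s, t)"])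
    show "((\<lambda>x. K (s, x) u) has_field_derivative K2 (s, x) u) (at x within ball t e)"
      if "x \<in> ball t e" "u \<in> cbox 0 1" for x u
      using that e AB by (intro has_field_derivative_at_within[OF K2]) auto
    show "K (s, x) integrable_on cbox 0 1" if "x \<in> ball t e" for x
      using that e AB by (auto intro!: int)
    have "continuous_on (ball t e \<times> {0..1}) (\<lambda>p. (\<lambda>(z, x). K2 z x) ((s, fst p), snd p))"
      by (rule continuous_on_compose2[OF cont(3)]) (use sub' in \<open>auto intro!: continuous_intros\<close>)
    then show "continuous_on (ball t e \<times> cbox 0 1) (\<lambda>(x, u). K2 (s, x) u)" by (simp add: split_def)
  qed (use e in auto)
  then show "((\<lambda>t. integral {0..1} (K (s, t))) has_field_derivative integral {0..1} (K2 (s, t))) (at t)"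
    using e by (simp add: at_within_open[of t "ball t e"])
qed (use U in auto)

section \<open>Cauchy's formula on circles and regularity of the partial derivatives\<close>

definition circ :: "real \<Rightarrow> real \<Rightarrow> complex" where
  "circ r x = of_real r * exp (2 * of_real pi * \<i> * of_real x)"

lemma norm_circ: "r \<ge> 0 \<Longrightarrow> norm (circ r x) = r"
  by (simp add: norm_mult circ_def)

lemma continuous_on_circ [continuous_intros]:
  "continuous_on A g \<Longrightarrow> continuous_on A (\<lambda>z. circ r (g z))"
  unfolding circ_def by (intro continuous_intros)

text \<open>Along this parametrization the differential of the variable is 2 pi i times
  \<open>circ\<close>, so the factor 2 pi i of Cauchy's formula cancels and an ordinary integral
  over the unit interval remains.\<close>

lemma Cauchy_integral_circ:
  assumes "continuous_on (cball z r) g" "g holomorphic_on ball z r" "w \<in> ball z r"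
  shows "integral {0..1} (\<lambda>x. g (z + circ r x) / (z + circ r x - w) ^ Suc k * circ r x) = (deriv ^^ k) g w / fact k"
proof -
  have "contour_integral (circlepath z r) (\<lambda>u. g u / (u - w) ^ Suc k) = (2 * pi * \<i>) / fact k * (deriv ^^ k) g w"
    by (rule contour_integral_unique[OF Cauchy_has_contour_integral_higher_derivative_circlepath[OF assms]])
  moreover have "contour_integral (circlepath z r) (\<lambda>u. g u / (u - w) ^ Suc k) =
      integral {0..1} (\<lambda>x. (2 * pi * \<i>) * (g (z + circ r x) / (z + circ r x - w) ^ Suc k * circ r x))"
    unfolding contour_integral_integral vector_derivative_circlepath
    by (simp add: circlepath circ_def mult_ac)
  moreover have "integral {0..1} (\<lambda>x. (2 * pi * \<i>) * (g (z + circ r x) / (z + circ r x - w) ^ Suc k * circ r x))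
      = (2 * pi * \<i>) * integral {0..1} (\<lambda>x. g (z + circ r x) / (z + circ r x - w) ^ Suc k * circ r x)"
    by (rule integral_mult_right)
  ultimately have "(2 * pi * \<i>) * integral {0..1} (\<lambda>x. g (z + circ r x) / (z + circ r x - w) ^ Suc k * circ r x)
      = (2 * pi * \<i>) * ((deriv ^^ k) g w / fact k)"
    by simp
  then show ?thesis by (subst (asm) mult_cancel_left) simp
qed

lemma hol2_holomorphic_on1: "hol2 U f \<Longrightarrow> (\<And>s. s \<in> A \<Longrightarrow> (s, t) \<in> U) \<Longrightarrow> (\<lambda>s. f (s, t)) holomorphic_on A"
  and hol2_holomorphic_on2: "hol2 U f \<Longrightarrow> (\<And>t. t \<in> A \<Longrightarrow> (s, t) \<in> U) \<Longrightarrow> (\<lambda>t. f (s, t)) holomorphic_on A"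
  unfolding holomorphic_on_def
  by (metis hol2_D1 hol2_D2 field_differentiable_at_within field_differentiable_def)+

lemma hol2_swap: "hol2 U f \<Longrightarrow> hol2 (prod.swap -` U) (\<lambda>z. f (snd z, fst z))"
  by (rule hol2_compose[of U]) auto

lemma pd2_swap: "pd2 f = (\<lambda>z. pd1 (\<lambda>z. f (snd z, fst z)) (snd z, fst z))"
  by (auto simp: pd1_def pd2_def)

lemma pd1_circ:
  assumes "hol2 U f" "cball s0 r \<times> {t} \<subseteq> U" "s \<in> ball s0 r"
  shows "pd1 f (s, t) = integral {0..1} (\<lambda>x. f (s0 + circ r x, t) / (s0 + circ r x - s) ^ 2 * circ r x)"
proof -
  have "(\<lambda>s. f (s, t)) holomorphic_on cball s0 r"
    using assms by (intro hol2_holomorphic_on1) auto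
  from Cauchy_integral_circ[OF holomorphic_on_imp_continuous_on[OF this] holomorphic_on_subset[OF this] assms(3), of 1]
  show ?thesis by (auto simp: pd1_def numeral_2_eq_2)
qed

lemma circ_sub_nonzero: "s \<in> ball s0 r \<Longrightarrow> s0 + circ r x \<noteq> s"
proof
  assume s: "s \<in> ball s0 r" and "s0 + circ r x = s"
  then have "dist s0 s = norm (circ r x)" by (auto simp: dist_norm)
  moreover have "r \<ge> 0" using s by (metis ball_empty empty_iff linear)
  ultimately show False using s norm_circ[of r x] by simp
qed

lemma circ_mem_cball: "r \<ge> 0 \<Longrightarrow> s0 + circ r x \<in> cball s0 r"
  using norm_circ[of r x] by (simp add: dist_norm)

lemma open_contains_polydisc:
  assumes "open U" "(s0, t0) \<in> (U :: C2 set)"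
  obtains r where "r > 0" "cball s0 r \<times> cball t0 r \<subseteq> U"
proof -
  obtain A B where AB: "open A" "open B" "s0 \<in> A" "t0 \<in> B" "A \<times> B \<subseteq> U"
    using open_prod_elim[OF assms] by (metis mem_Sigma_iff)
  obtain e d where "e > 0" "cball s0 e \<subseteq> A" "d > 0" "cball t0 d \<subseteq> B"
    using AB open_contains_cball by metis
  moreover have "cball s0 (min e d) \<times> cball t0 (min e d) \<subseteq> cball s0 e \<times> cball t0 d" by auto
  ultimately show thesis using AB by (intro that[of "min e d"]) (auto simp: subset_iff)
qed

text \<open>Cauchy's formula in the first variable moves the differentiation onto the kernel, so
  continuity of \<open>f\<close> itself gives continuity of its derivative.\<close>

lemma continuous_pd1:
  assumes f: "hol2 U f" and U: "open U"
  shows "continuous_on U (pd1 f)"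
proof (rule continuous_at_imp_continuous_on, rule ballI)
  fix z assume z: "z \<in> U"
  obtain s0 t0 where st: "z = (s0, t0)" by fastforce
  obtain r where r: "r > 0" "cball s0 r \<times> cball t0 r \<subseteq> U"
    using open_contains_polydisc U z st by metis
  let ?V = "ball s0 r \<times> ball t0 r"
  have "continuous_on (?V \<times> cbox 0 1) (\<lambda>p. f (s0 + circ r (snd p), snd (fst p)) / (s0 + circ r (snd p) - fst (fst p)) ^ 2 * circ r (snd p))"
    using r circ_mem_cball[of r s0] circ_sub_nonzero[of _ s0 r]
    by (intro continuous_intros continuous_on_compose2[OF hol2_continuous_on[OF f]]) (auto simp: subset_iff)
  then have "continuous_on (?V \<times> cbox 0 1) (\<lambda>(z, x). f (s0 + circ r x, snd z) / (s0 + circ r x - fst z) ^ 2 * circ r x)"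
    by (simp add: split_def)
  from integral_continuous_on_param[OF this]
  have "continuous_on ?V (\<lambda>z. integral {0..1} (\<lambda>x. f (s0 + circ r x, snd z) / (s0 + circ r x - fst z) ^ 2 * circ r x))"
    by simp
  also have "?this \<longleftrightarrow> continuous_on ?V (pd1 f)"
  proof (rule continuous_on_cong[OF HOL.refl])
    fix z assume "z \<in> ?V"
    then have "cball s0 r \<times> {snd z} \<subseteq> U" "fst z \<in> ball s0 r" using r by (auto simp: subset_iff)
    from pd1_circ[OF f this]
    show "integral {0..1} (\<lambda>x. f (s0 + circ r x, snd z) / (s0 + circ r x - fst z) ^ 2 * circ r x) = pd1 f z" by simp
  qed
  finally show "continuous (at z) (pd1 f)"
    using r st by (subst (asm) continuous_on_eq_continuous_at) (auto intro: open_Times)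
qed

lemma continuous_pd2:
  assumes f: "hol2 U f" and U: "open U"
  shows "continuous_on U (pd2 f)"
proof -
  have "continuous_on (prod.swap -` U) (pd1 (\<lambda>z. f (snd z, fst z)))"
    using assms by (intro continuous_pd1 hol2_swap open_vimage continuous_intros)
  then show ?thesis unfolding pd2_swap
    by (rule continuous_on_compose2) (auto intro!: continuous_intros)
qed

lemma deriv_inverse_square:
  assumes "a - s \<noteq> (0 :: complex)"
  shows "((\<lambda>s. c / (a - s)\<^sup>2 * b) has_field_derivative 2 * c / (a - s) ^ 3 * b) (at s)"
proof -
  define w where "w = a - s"
  have "((\<lambda>s. c / (a - s)\<^sup>2 * b) has_field_derivative (0 * w\<^sup>2 - c * (2 * (-1) * w)) / (w\<^sup>2 * w\<^sup>2) * b) (at s)"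
    using assms by (auto intro!: derivative_eq_intros simp: w_def)
  also have "(0 * w\<^sup>2 - c * (2 * (-1) * w)) / (w\<^sup>2 * w\<^sup>2) * b = 2 * c / w ^ 3 * b"
    using assms by (auto simp: power2_eq_square power3_eq_cube w_def[symmetric] mult_ac)
  finally show ?thesis by (simp add: w_def)
qed

text \<open>In the Cauchy integral for \<open>pd1 f\<close> the first variable occurs only in the
  kernel and the second only in \<open>f\<close>. The derivative in the second variable thus
  involves \<open>pd2 f\<close>, whose continuity is already available.\<close>

lemma hol2_pd1:
  assumes f: "hol2 U f" and U: "open U"
  shows "hol2 U (pd1 f)"
proof -
  have "\<exists>V. z \<in> V \<and> hol2 V (pd1 f)" if z: "z \<in> U" for z
  proof -
    obtain s0 t0 where st: "z = (s0, t0)" by fastforce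
    obtain r where r: "r > 0" "cball s0 r \<times> cball t0 r \<subseteq> U"
      using open_contains_polydisc U z st by metis
    let ?V = "ball s0 r \<times> ball t0 r"
    have V: "open ?V" by (auto intro: open_Times)
    have cU: "continuous_on (?V \<times> {0..1 :: real}) (\<lambda>p. h (s0 + circ r (snd p), snd (fst p)))"
      if "continuous_on U h" for h :: "C2 \<Rightarrow> complex"
    proof (rule continuous_on_compose2[OF that])
      show "(\<lambda>p. (s0 + circ r (snd p), snd (fst p))) ` (?V \<times> {0..1 :: real}) \<subseteq> U"
      proof (rule image_subsetI)
        fix p assume "p \<in> ?V \<times> {0..1 :: real}"
        then have "snd (fst p) \<in> cball t0 r" by (metis SigmaE ball_subset_cball fst_conv snd_conv subsetD)
        then show "(s0 + circ r (snd p), snd (fst p)) \<in> U"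
          using r circ_mem_cball[of r s0 "snd p"] by (simp add: subset_iff)
      qed
    qed (intro continuous_intros)
    have ne: "s0 + circ r (snd p) - fst (fst p) \<noteq> 0" "(s0 + circ r (snd p) - fst (fst p)) ^ n \<noteq> 0"
      if "p \<in> ?V \<times> {0..1 :: real}" for p n
    proof -
      have "fst (fst p) \<in> ball s0 r" using that by (metis SigmaE fst_conv)
      then show "s0 + circ r (snd p) - fst (fst p) \<noteq> 0" using circ_sub_nonzero by (metis eq_iff_diff_eq_0)
      then show "(s0 + circ r (snd p) - fst (fst p)) ^ n \<noteq> 0" by simp
    qed
    have "hol2 ?V (\<lambda>z. integral {0..1} (\<lambda>x. f (s0 + circ r x, snd z) / (s0 + circ r x - fst z) ^ 2 * circ r x))"
    proof (rule hol2_integral[where ?K1.0 = "\<lambda>z x. 2 * f (s0 + circ r x, snd z) / (s0 + circ r x - fst z) ^ 3 * circ r x"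
          and ?K2.0 = "\<lambda>z x. pd2 f (s0 + circ r x, snd z) / (s0 + circ r x - fst z) ^ 2 * circ r x", OF V])
      fix s t x assume st: "(s, t) \<in> ?V"
      then have ne: "s0 + circ r x - s \<noteq> 0" using circ_sub_nonzero[of s s0 r x] by auto
      show "((\<lambda>s. f (s0 + circ r x, snd (s, t)) / (s0 + circ r x - fst (s, t))\<^sup>2 * circ r x) has_field_derivative
          2 * f (s0 + circ r x, snd (s, t)) / (s0 + circ r x - fst (s, t)) ^ 3 * circ r x) (at s)"
        using deriv_inverse_square[OF ne] by simp
      have "(s0 + circ r x, t) \<in> U" using r st circ_mem_cball[of r s0] by auto
      from hol2_D2[OF f this]
      show "((\<lambda>t. f (s0 + circ r x, snd (s, t)) / (s0 + circ r x - fst (s, t))\<^sup>2 * circ r x) has_field_derivative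
          pd2 f (s0 + circ r x, snd (s, t)) / (s0 + circ r x - fst (s, t)) ^ 2 * circ r x) (at t)"
        using ne by (auto intro!: derivative_eq_intros simp: field_simps)
    qed (unfold split_def, (intro continuous_intros cU[OF hol2_continuous_on[OF f]] cU[OF continuous_pd2[OF f U]] ne ballI | assumption)+)
    then have "hol2 ?V (pd1 f)"
    proof (rule hol2_transform[OF _ V])
      fix z assume "z \<in> ?V"
      then have "cball s0 r \<times> {snd z} \<subseteq> U" "fst z \<in> ball s0 r" using r by (auto simp: subset_iff)
      from pd1_circ[OF f this]
      show "integral {0..1} (\<lambda>x. f (s0 + circ r x, snd z) / (s0 + circ r x - fst z) ^ 2 * circ r x) = pd1 f z" by simp
    qed
    then show ?thesis using st r by (intro exI[of _ ?V]) auto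
  qed
  then show ?thesis unfolding hol2_def by blast
qed

lemma hol2_pd2:
  assumes f: "hol2 U f" and U: "open U"
  shows "hol2 U (pd2 f)"
proof -
  have "hol2 (prod.swap -` U) (pd1 (\<lambda>z. f (snd z, fst z)))"
    using assms by (intro hol2_pd1 hol2_swap open_vimage continuous_intros)
  from hol2_compose[OF this hol2_snd hol2_fst] show ?thesis unfolding pd2_swap by auto
qed

text \<open>Hadamard's lemma: the quotient is the mean of \<open>pd1 f\<close> over the segment from
  (0, t) to (s, t). It lives on the same polydisc as \<open>f\<close>, which matters when the
  division is iterated.\<close>

lemma hol2_divide_fst:
  assumes f: "hol2 (ball 0 R \<times> ball 0 R) f" and 0: "\<And>t. t \<in> ball 0 R \<Longrightarrow> f (0, t) = 0"
  shows "\<exists>g. hol2 (ball 0 R \<times> ball 0 R) g \<and> (\<forall>z \<in> ball 0 R \<times> ball 0 R. f z = fst z * g z)"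
proof -
  let ?U = "ball 0 R \<times> ball 0 R :: C2 set"
  have U: "open ?U" by (auto intro: open_Times)
  have scale: "(of_real x * s, t) \<in> ?U" if "(s, t) \<in> ?U" "x \<in> {0..1}" for x s t
  proof -
    have "norm (of_real x * s) \<le> 1 * norm s" using that by (auto simp: norm_mult intro!: mult_left_le_one_le)
    then show ?thesis using that by auto
  qed
  have c: "continuous_on (?U \<times> {0..1}) (\<lambda>p. h (of_real (snd p) * fst (fst p), snd (fst p)))"
    if "continuous_on ?U h" for h :: "C2 \<Rightarrow> complex"
  proof (rule continuous_on_compose2[OF that])
    show "(\<lambda>p. (of_real (snd p) * fst (fst p), snd (fst p))) ` (?U \<times> {0..1}) \<subseteq> ?U"
    proof (rule image_subsetI)
      fix p assume p: "p \<in> ?U \<times> {0..1 :: real}"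
      then show "(of_real (snd p) * fst (fst p), snd (fst p)) \<in> ?U"
        using scale[of "fst (fst p)" "snd (fst p)" "snd p"] by (metis mem_Times_iff prod.collapse)
    qed
  qed (intro continuous_intros)
  note c1 = c[OF hol2_continuous_on[OF hol2_pd1[OF f U]]]
    c[OF continuous_pd1[OF hol2_pd1[OF f U] U]] c[OF continuous_pd2[OF hol2_pd1[OF f U] U]]
  have "hol2 ?U (\<lambda>z. integral {0..1} (\<lambda>x. pd1 f (of_real x * fst z, snd z)))"
  proof (rule hol2_integral[where ?K1.0 = "\<lambda>z x. of_real x * pd1 (pd1 f) (of_real x * fst z, snd z)"
          and ?K2.0 = "\<lambda>z x. pd2 (pd1 f) (of_real x * fst z, snd z)", OF U])
    fix s t and x :: real assume st: "(s, t) \<in> ?U" "x \<in> {0..1}"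
    show "((\<lambda>t. pd1 f (of_real x * fst (s, t), snd (s, t))) has_field_derivative pd2 (pd1 f) (of_real x * fst (s, t), snd (s, t))) (at t)"
      using hol2_D2[OF hol2_pd1[OF f U] scale[OF st]] by simp
    have "((\<lambda>s. pd1 f (of_real x * s, t)) has_field_derivative pd1 (pd1 f) (of_real x * s, t) * of_real x) (at s)"
      by (rule DERIV_chain2[where f = "\<lambda>s. pd1 f (s, t)" and g = "\<lambda>s. of_real x * s", OF hol2_D1[OF hol2_pd1[OF f U] scale[OF st]]])
        (auto intro!: derivative_eq_intros)
    then show "((\<lambda>s. pd1 f (of_real x * fst (s, t), snd (s, t))) has_field_derivative of_real x * pd1 (pd1 f) (of_real x * fst (s, t), snd (s, t))) (at s)"
      by (simp add: mult.commute)
  qed (unfold split_def, (intro continuous_intros c1)+)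
  moreover have "f z = fst z * integral {0..1} (\<lambda>x. pd1 f (of_real x * fst z, snd z))" if z: "z \<in> ?U" for z
  proof -
    obtain s t where st: "z = (s, t)" by fastforce
    have "((\<lambda>x. pd1 f (of_real x * s, t) * s) has_integral f (of_real 1 * s, t) - f (of_real 0 * s, t)) {0..1}"
    proof (rule fundamental_theorem_of_calculus)
      fix x :: real assume "x \<in> {0..1}"
      then have "((\<lambda>w. f (w * s, t)) has_field_derivative pd1 f (of_real x * s, t) * s) (at (of_real x))"
        using hol2_D1[OF f scale[of s t x]] z st
        by (intro DERIV_chain2[where f = "\<lambda>s. f (s, t)" and g = "\<lambda>w. w * s"]) (auto intro!: derivative_eq_intros)
      then show "((\<lambda>x. f (of_real x * s, t)) has_vector_derivative pd1 f (of_real x * s, t) * s) (at x within {0..1})"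
        by (rule has_vector_derivative_real_field)
    qed auto
    from integral_unique[OF this] have "f z = integral {0..1} (\<lambda>x. pd1 f (of_real x * s, t) * s)"
      using 0[of t] z st by simp
    also have "\<dots> = fst z * integral {0..1} (\<lambda>x. pd1 f (of_real x * fst z, snd z))"
      by (simp add: st mult.commute)
    finally show ?thesis .
  qed
  ultimately show ?thesis by blast
qed

text \<open>The function is restricted to the complex line through \<open>z0\<close> and
  \<open>z\<close>; convexity of \<open>U\<close> makes the set of admissible parameters connected,
  so the identity theorem in one variable applies.\<close>

lemma hol2_identity:
  assumes f: "hol2 U f" and U: "open U" "convex U" and z0: "z0 \<in> U" "\<forall>\<^sub>F z in nhds z0. f z = 0" and z: "z \<in> U"
  shows "f z = 0"
proof -
  obtain s0 t0 s t where st: "z0 = (s0, t0)" "z = (s, t)" by fastforce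
  define L where "L l = (s0 + l * (s - s0), t0 + l * (t - t0))" for l :: complex
  have L: "(L has_derivative (\<lambda>h. (h * (s - s0), h * (t - t0)))) (at l)" for l
    unfolding L_def by (auto intro!: derivative_eq_intros)
  have contL: "continuous_on UNIV L" unfolding L_def by (auto intro!: continuous_intros)
  have "L ((1 - u) *\<^sub>R x + u *\<^sub>R y) = (1 - u) *\<^sub>R L x + u *\<^sub>R L y" for u x y
    by (simp add: L_def scaleR_conv_of_real algebra_simps)
  then have "convex (L -` U)"
    using U(2) by (auto simp: convex_alt)
  then have 1: "connected (L -` U)" by (rule convex_connected)
  have 2: "open (L -` U)" using contL U(1) by (simp add: open_vimage)
  obtain W where W: "open W" "z0 \<in> W" "\<And>z. z \<in> W \<Longrightarrow> f z = 0"
    using z0 by (auto simp: eventually_nhds)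
  have 3: "(\<lambda>l. f (L l)) holomorphic_on L -` U"
    unfolding holomorphic_on_def
  proof
    fix l assume "l \<in> L -` U"
    then have "L l \<in> U" by simp
    from has_derivative_compose[OF L hol2_D[OF f this]]
    have "((\<lambda>l. f (L l)) has_field_derivative (pd1 f (L l) * (s - s0) + pd2 f (L l) * (t - t0))) (at l)"
      unfolding has_field_derivative_def
      by (rule has_derivative_eq_rhs) (auto simp: fun_eq_iff algebra_simps)
    then show "(\<lambda>l. f (L l)) field_differentiable at l within L -` U"
      using field_differentiable_at_within field_differentiable_def by blast
  qed
  have 4: "open (L -` (W \<inter> U))" using contL U(1) W by (simp add: open_vimage open_Int)
  have 5: "0 \<in> L -` (W \<inter> U)" "1 \<in> L -` U" using z0 z W st by (auto simp: L_def)
  have "f (L 1) = (\<lambda>_. 0) (1 :: complex)"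
  proof (rule analytic_continuation_open[where s = "L -` (W \<inter> U)" and s' = "L -` U" and f = "\<lambda>l. f (L l)"
          and g = "\<lambda>_. 0", OF 4 2 _ 1 _ 3])
    show "L -` (W \<inter> U) \<noteq> {}" using 5 by blast
    show "f (L l) = 0" if "l \<in> L -` (W \<inter> U)" for l using W(3) that by blast
  qed (use 5 in auto)
  then show ?thesis by (simp add: L_def st)
qed

lemma hol2_no_zero_divisors:
  assumes f: "hol2 U f" and g: "hol2 U g" and U: "open U" "convex U" and fg: "\<And>z. z \<in> U \<Longrightarrow> f z * g z = 0"
    and z: "z1 \<in> U" "f z1 \<noteq> 0" "z \<in> U"
  shows "g z = 0"
proof (rule hol2_identity[OF g U z(1) _ z(3)])
  have "isCont f z1" using has_derivative_continuous[OF hol2_D[OF f z(1)]] .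
  then have "\<forall>\<^sub>F z in nhds z1. f z \<noteq> 0"
    using z(2) tendsto_imp_eventually_ne[of f "f z1" "nhds z1" 0] by (simp add: continuous_at_imp_continuous_at_within isCont_def tendsto_nhds_iff)
  moreover have "\<forall>\<^sub>F z in nhds z1. z \<in> U" using U z by (simp add: eventually_nhds_in_open)
  ultimately show "\<forall>\<^sub>F z in nhds z1. g z = 0"
    by eventually_elim (use fg in fastforce)
qed

section \<open>Weierstrass preparation\<close>

lemma circ_mem_sphere: "e \<ge> 0 \<Longrightarrow> circ e x \<in> sphere 0 e"
  using norm_circ[of e x] by simp

text \<open>The density \<open>q\<close> has to be holomorphic only near the product of a disc with
  the circle, yet the integral is holomorphic inside. The integrands used below are quotients whose
  denominators may vanish inside the circle.\<close>

lemma hol2_circ_integral: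
  assumes q: "hol2 D q" and D: "open D" and e: "e > 0" and sub: "ball 0 d \<times> sphere 0 e \<subseteq> D"
  shows "hol2 (ball 0 d \<times> ball 0 e) (\<lambda>z. integral {0..1} (\<lambda>x. q (fst z, circ e x) / (circ e x - snd z) * circ e x))"
proof -
  let ?V = "ball 0 d \<times> ball 0 e :: C2 set"
  have V: "open ?V" by (auto intro: open_Times)
  have ne: "circ e x \<noteq> t" if "t \<in> ball 0 e" for t x
    using circ_sub_nonzero[OF that, of x] by simp
  have inD: "(s, circ e x) \<in> D" if "s \<in> ball 0 d" for s x
    using sub circ_mem_sphere[of e x] e that by (auto simp: subset_iff)
  have c: "continuous_on (?V \<times> {0..1 :: real}) (\<lambda>p. h (fst (fst p), circ e (snd p)))"
    if "continuous_on D h" for h :: "C2 \<Rightarrow> complex"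
  proof (rule continuous_on_compose2[OF that])
    show "(\<lambda>p. (fst (fst p), circ e (snd p))) ` (?V \<times> {0..1 :: real}) \<subseteq> D"
    proof (rule image_subsetI)
      fix p assume "p \<in> ?V \<times> {0..1 :: real}"
      then have "fst (fst p) \<in> ball 0 d" by (metis SigmaE fst_conv)
      then show "(fst (fst p), circ e (snd p)) \<in> D" by (rule inD)
    qed
  qed (intro continuous_intros)
  have ne': "circ e (snd p) - snd (fst p) \<noteq> 0" "(circ e (snd p) - snd (fst p)) ^ n \<noteq> 0"
    if "p \<in> ?V \<times> {0..1 :: real}" for p n
  proof -
    have "snd (fst p) \<in> ball 0 e" using that by (metis SigmaE fst_conv snd_conv)
    then show "circ e (snd p) - snd (fst p) \<noteq> 0" using ne by (metis eq_iff_diff_eq_0)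
    then show "(circ e (snd p) - snd (fst p)) ^ n \<noteq> 0" by simp
  qed
  show ?thesis
  proof (rule hol2_integral[where ?K1.0 = "\<lambda>z x. pd1 q (fst z, circ e x) / (circ e x - snd z) * circ e x"
        and ?K2.0 = "\<lambda>z x. q (fst z, circ e x) / (circ e x - snd z) ^ 2 * circ e x", OF V])
    fix s t and x :: real assume st: "(s, t) \<in> ?V"
    define C where "C = circ e x"
    have C: "C - t \<noteq> 0" using ne[of t x] st by (auto simp: C_def)
    have "((\<lambda>s. q (s, C)) has_field_derivative pd1 q (s, C)) (at s)"
      using hol2_D1[OF q inD[of s x]] st by (simp add: C_def)
    then show "((\<lambda>s. q (fst (s, t), circ e x) / (circ e x - snd (s, t)) * circ e x) has_field_derivative
        pd1 q (fst (s, t), circ e x) / (circ e x - snd (s, t)) * circ e x) (at s)"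
      using C by (auto intro!: derivative_eq_intros simp flip: C_def)
    show "((\<lambda>t. q (fst (s, t), circ e x) / (circ e x - snd (s, t)) * circ e x) has_field_derivative
        q (fst (s, t), circ e x) / (circ e x - snd (s, t)) ^ 2 * circ e x) (at t)"
      using C by (auto intro!: derivative_eq_intros simp: power2_eq_square simp flip: C_def)
  qed (unfold split_def, (intro continuous_intros c[OF hol2_continuous_on[OF q]] c[OF continuous_pd1[OF q D]] ne' ballI | assumption)+)
qed

lemma holomorphic_factor_zero_ball:
  fixes g :: "complex \<Rightarrow> complex"
  assumes g: "g holomorphic_on ball 0 R" and v: "v \<in> ball 0 R" "g v = 0" and nc: "\<not> g constant_on ball 0 R"
  obtains G k where "G holomorphic_on ball 0 R" "G v \<noteq> 0" "\<And>t. t \<in> ball 0 R \<Longrightarrow> g t = (t - v) ^ k * G t"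
proof -
    obtain h r k where h: "0 < r" "ball v r \<subseteq> ball 0 R" "h holomorphic_on ball v r"
      "\<And>w. w \<in> ball v r \<Longrightarrow> g w = (w - v) ^ k * h w" "\<And>w. w \<in> ball v r \<Longrightarrow> h w \<noteq> 0"
      using holomorphic_factor_zero_nonconstant[OF g open_ball connected_ball v nc] by metis
    define G where "G t = (if t = v then h v else g t / (t - v) ^ k)" for t
    have "(\<lambda>t. g t / (t - v) ^ k) holomorphic_on ball 0 R - {v}"
      using g by (intro holomorphic_intros) (auto intro: holomorphic_on_subset)
    then have "G holomorphic_on ball 0 R - {v}"
      by (rule holomorphic_transform) (auto simp: G_def)
    moreover have Gh: "G w = h w" if "w \<in> ball v r" for w using h(4)[OF that] by (auto simp: G_def)
    then have "G holomorphic_on ball v r"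
      using holomorphic_transform[OF h(3)] by metis
    ultimately have "G holomorphic_on (ball 0 R - {v}) \<union> ball v r"
      by (intro holomorphic_on_Un) auto
    then have G: "G holomorphic_on ball 0 R"
      by (rule holomorphic_on_subset) (use h(1) in auto)
    have gG: "g t = (t - v) ^ k * G t" if "t \<in> ball 0 R" for t
      using h(1) h(4)[of v] v(2) by (cases "t = v") (auto simp: G_def)
    have Gv: "G v \<noteq> 0" using h(1) h(5)[of v] by (simp add: G_def)
    show thesis by (rule that[OF G Gv gG])
qed

text \<open>Zeros are removed one at a time with their full multiplicity, by induction on their
  number in the closed disc.\<close>

lemma holomorphic_factor_zeros:
  assumes g: "g holomorphic_on ball 0 R" and e: "0 < e" "e < R" and ne: "\<And>t. t \<in> sphere 0 e \<Longrightarrow> g t \<noteq> 0"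
  shows "\<exists>vs G. set vs \<subseteq> ball 0 e \<and> G holomorphic_on ball 0 R \<and> (\<forall>t\<in>cball 0 e. G t \<noteq> 0) \<and>
    (\<forall>t\<in>ball 0 R. g t = (\<Prod>v\<leftarrow>vs. t - v) * G t)"
proof -
  \<comment> \<open>Infinitely many zeros would accumulate in the closed disc and force
    \<open>g\<close> to vanish at the point e of the circle.\<close>
  have "finite {t \<in> cball 0 e. g t = 0}" if g: "g holomorphic_on ball 0 R" and ne: "\<And>t. t \<in> sphere 0 e \<Longrightarrow> g t \<noteq> 0" for g
  proof (rule ccontr)
    assume inf: "infinite {t \<in> cball 0 e. g t = 0}"
    have "compact (cball (0 :: complex) e)" by simp
    with inf obtain x where x: "x \<in> cball 0 e" "x islimpt {t \<in> cball 0 e. g t = 0}"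
      unfolding compact_eq_Bolzano_Weierstrass by blast
    have "of_real e \<in> ball (0 :: complex) R" "of_real e \<in> sphere (0 :: complex) e" using e by auto
    moreover have "g (of_real e) = 0"
    proof (rule analytic_continuation[OF g, of "{t \<in> cball 0 e. g t = 0}" x])
      show "x \<in> ball 0 R" "{t \<in> cball 0 e. g t = 0} \<subseteq> ball 0 R" "of_real e \<in> ball (0 :: complex) R" using x e by auto
    qed (use x in auto)
    ultimately show False using ne by blast
  qed
  then have "\<exists>n. card {t \<in> cball 0 e. g t = 0} = n \<and> finite {t \<in> cball 0 e. g t = 0}" using g ne by blast
  then obtain n where "card {t \<in> cball 0 e. g t = 0} = n" "finite {t \<in> cball 0 e. g t = 0}" by blast
  then show ?thesis using g ne
  proof (induction n arbitrary: g)
    case 0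
    then have "{t \<in> cball 0 e. g t = 0} = {}" by (simp only: card_0_eq)
    then have "\<forall>t\<in>cball 0 e. g t \<noteq> 0" by blast
    with 0(3) show ?case by (intro exI[of _ "[]"] exI[of _ g]) (simp del: mem_cball mem_ball)
  next
    case (Suc n)
    have "{t \<in> cball 0 e. g t = 0} \<noteq> {}" using Suc.prems(1) by (metis card.empty nat.distinct(1))
    then obtain v where v: "v \<in> cball 0 e" "g v = 0" by blast
    have vb: "v \<in> ball 0 e" using v Suc.prems(4)[of v] by (cases "norm v = e") auto
    have "\<not> g constant_on ball 0 R"
    proof
      assume "g constant_on ball 0 R"
      moreover have "of_real e \<in> ball (0 :: complex) R" "v \<in> ball 0 R" using e vb by auto
      ultimately have "g (of_real e) = g v" unfolding constant_on_def by metis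
      then show False using v Suc.prems(4)[of "of_real e"] e by simp
    qed
    moreover have "v \<in> ball 0 R" using e vb by auto
    ultimately obtain G k where G: "G holomorphic_on ball 0 R" and Gv: "G v \<noteq> 0"
      and gG: "\<And>t. t \<in> ball 0 R \<Longrightarrow> g t = (t - v) ^ k * G t"
      using holomorphic_factor_zero_ball[OF Suc.prems(3) _ v(2)] by metis
    have zG: "{t \<in> cball 0 e. G t = 0} = {t \<in> cball 0 e. g t = 0} - {v}"
    proof (intro set_eqI iffI)
      fix t assume t: "t \<in> {t \<in> cball 0 e. G t = 0}"
      then have "t \<noteq> v" "t \<in> ball 0 R" using Gv e by auto
      then show "t \<in> {t \<in> cball 0 e. g t = 0} - {v}" using gG[of t] t by auto
    next
      fix t assume t: "t \<in> {t \<in> cball 0 e. g t = 0} - {v}"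
      then have "t \<noteq> v" "t \<in> ball 0 R" using e by auto
      then show "t \<in> {t \<in> cball 0 e. G t = 0}" using t gG[of t] by auto
    qed
    have "card {t \<in> cball 0 e. G t = 0} = n" "finite {t \<in> cball 0 e. G t = 0}"
      unfolding zG using Suc.prems(1,2) v by (simp_all add: card_Diff_singleton del: mem_cball)
    moreover have "G t \<noteq> 0" if "t \<in> sphere 0 e" for t
      using gG[of t] Suc.prems(4)[OF that] that e by auto
    ultimately obtain vs G' where *: "set vs \<subseteq> ball 0 e" "G' holomorphic_on ball 0 R" "\<forall>t\<in>cball 0 e. G' t \<noteq> 0"
      "\<forall>t\<in>ball 0 R. G t = (\<Prod>v\<leftarrow>vs. t - v) * G' t"
      using Suc.IH[OF _ _ G] by blast
    have "(\<Prod>v\<leftarrow>replicate k v @ vs. t - v) = (t - v) ^ k * (\<Prod>v\<leftarrow>vs. t - v)" for t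
      by (simp add: prod_list_replicate)
    with * gG vb show ?case
      by (intro exI[of _ "replicate k v @ vs"] exI[of _ G']) (auto simp: mult.assoc)
  qed
qed

lemma logderiv_prod_list:
  assumes "t \<notin> set vs" "G field_differentiable at t" "G t \<noteq> (0 :: complex)"
    and "\<forall>\<^sub>F x in nhds t. g x = (\<Prod>v\<leftarrow>vs. x - v) * G x"
  shows "deriv g t / g t = (\<Sum>v\<leftarrow>vs. 1 / (t - v)) + deriv G t / G t"
proof -
  have P: "((\<lambda>x. \<Prod>v\<leftarrow>vs. x - v) has_field_derivative (\<Prod>v\<leftarrow>vs. t - v) * (\<Sum>v\<leftarrow>vs. 1 / (t - v))) (at t)"
    using assms(1)
  proof (induction vs)
    case (Cons a vs)
    then have "t - a \<noteq> 0" by auto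
    with Cons show ?case by (auto intro!: derivative_eq_intros simp: field_simps)
  qed auto
  have nz: "(\<Prod>v\<leftarrow>vs. t - v) \<noteq> 0" using assms(1) by (auto simp: prod_list_zero_iff)
  have "(G has_field_derivative deriv G t) (at t)" using assms(2) by (simp add: DERIV_deriv_iff_field_differentiable)
  from DERIV_mult[OF P this]
  have "((\<lambda>x. (\<Prod>v\<leftarrow>vs. x - v) * G x) has_field_derivative
      (\<Prod>v\<leftarrow>vs. t - v) * (\<Sum>v\<leftarrow>vs. 1 / (t - v)) * G t + deriv G t * (\<Prod>v\<leftarrow>vs. t - v)) (at t)" .
  from DERIV_imp_deriv[OF this] deriv_cong_ev[OF assms(4) HOL.refl]
  have "deriv g t = (\<Prod>v\<leftarrow>vs. t - v) * (\<Sum>v\<leftarrow>vs. 1 / (t - v)) * G t + deriv G t * (\<Prod>v\<leftarrow>vs. t - v)" by simp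
  moreover have "g t = (\<Prod>v\<leftarrow>vs. t - v) * G t" using assms(4) eventually_nhds_x_imp_x by blast
  ultimately show ?thesis using nz assms(3) by (simp add: field_simps)
qed

text \<open>The residue theorem for h g'/g, reduced to Cauchy's formula by the factorization of
  \<open>g\<close>: each linear factor contributes the value of \<open>h\<close> at its zero, and
  the part coming from \<open>G\<close> is holomorphic on the closed disc and contributes
  nothing.\<close>

lemma circ_integral_logderiv:
  assumes e: "0 < e" "e < R" and vs: "set vs \<subseteq> ball 0 e" and G: "G holomorphic_on ball 0 R" "\<And>t. t \<in> cball 0 e \<Longrightarrow> G t \<noteq> 0"
    and g: "\<And>t. t \<in> ball 0 R \<Longrightarrow> g t = (\<Prod>v\<leftarrow>vs. t - v) * G t"
    and h: "h holomorphic_on ball 0 R"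
  shows "integral {0..1} (\<lambda>x. h (circ e x) * circ e x * (deriv g (circ e x) / g (circ e x))) = (\<Sum>v\<leftarrow>vs. h v)"
proof -
  have sub: "cball 0 e \<subseteq> ball (0 :: complex) R" using e by auto
  have circ: "circ e x \<in> sphere 0 e" "circ e x \<in> ball 0 R" "circ e x \<in> cball 0 e" for x
    using circ_mem_sphere[of e x] e by auto
  have eq: "h (circ e x) * circ e x * (deriv g (circ e x) / g (circ e x)) =
      (\<Sum>v\<leftarrow>vs. h (circ e x) / (circ e x - v) * circ e x) + h (circ e x) * circ e x * (deriv G (circ e x) / G (circ e x))" for x
  proof -
    have "\<forall>\<^sub>F t in nhds (circ e x). t \<in> ball 0 R" using circ[of x] by (intro eventually_nhds_in_open) auto
    then have "\<forall>\<^sub>F t in nhds (circ e x). g t = (\<Prod>v\<leftarrow>vs. t - v) * G t" by eventually_elim (rule g)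
    moreover have "circ e x \<notin> set vs" using circ[of x] vs by auto
    moreover have "G field_differentiable at (circ e x)"
      using G(1) circ(2)[of x] by (metis holomorphic_on_imp_differentiable_at open_ball)
    ultimately have "deriv g (circ e x) / g (circ e x) = (\<Sum>v\<leftarrow>vs. 1 / (circ e x - v)) + deriv G (circ e x) / G (circ e x)"
      using G(2)[OF circ(3)] by (intro logderiv_prod_list)
    moreover have "c * (\<Sum>v\<leftarrow>us. 1 / (u - v)) = (\<Sum>v\<leftarrow>us. h u / (u - v) * circ e x)" if "c = h u * circ e x" for c u us
      by (induction us) (auto simp: that field_simps add_divide_distrib)
    ultimately show ?thesis by (simp add: ring_distribs)
  qed
  have "continuous_on (cball 0 e) h" using h sub holomorphic_on_imp_continuous_on holomorphic_on_subset by blast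
  moreover have "h holomorphic_on ball 0 e" using h e by (auto intro: holomorphic_on_subset)
  ultimately have I1: "integral {0..1} (\<lambda>x. h (circ e x) / (circ e x - v) * circ e x) = h v" if "v \<in> ball 0 e" for v
    using Cauchy_integral_circ[of 0 e h v 0] that by simp
  have i1: "(\<lambda>x. h (circ e x) / (circ e x - v) * circ e x) integrable_on {0..1}" if "v \<in> ball 0 e" for v
  proof (intro integrable_continuous_interval continuous_intros continuous_on_compose2[OF holomorphic_on_imp_continuous_on[OF h]])
    show "\<forall>x\<in>{0..1}. circ e x - v \<noteq> 0" using circ_sub_nonzero[OF that] by simp
  next
    show "circ e ` {0..1} \<subseteq> ball 0 R" using circ(2) by blast
  qed
  \<comment> \<open>The factor t makes this function vanish at 0, so Cauchy's formula at the centre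
    evaluates its integral to 0.\<close>
  define k where "k t = h t * t * (deriv G t / G t)" for t
  have k: "k holomorphic_on ball 0 R - {t \<in> ball 0 R. G t = 0}"
    unfolding k_def by (intro holomorphic_intros holomorphic_on_subset[OF h] holomorphic_on_subset[OF G(1)]
        holomorphic_on_subset[OF holomorphic_deriv[OF G(1)]]) auto
  have kc: "cball 0 e \<subseteq> ball 0 R - {t \<in> ball 0 R. G t = 0}" using G(2) sub by auto
  have k1: "k holomorphic_on cball 0 e" using holomorphic_on_subset[OF k kc] .
  have k2: "k holomorphic_on ball 0 e" using holomorphic_on_subset[OF k1] by auto
  have "integral {0..1} (\<lambda>x. k (0 + circ e x) / (0 + circ e x - 0) ^ Suc 0 * circ e x) = (deriv ^^ 0) k 0 / fact 0"
    by (rule Cauchy_integral_circ[OF holomorphic_on_imp_continuous_on[OF k1] k2]) (use e in auto)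
  moreover have "circ e x \<noteq> 0" for x using norm_circ[of e x] e by auto
  ultimately have I2: "integral {0..1} (\<lambda>x. k (circ e x)) = 0" by (simp add: k_def mult_ac)
  have "continuous_on {0..1} (\<lambda>x. k (circ e x))"
    by (rule continuous_on_compose2[OF holomorphic_on_imp_continuous_on[OF k1]])
      (use circ in \<open>auto intro!: continuous_intros\<close>)
  then have i2: "(\<lambda>x. k (circ e x)) integrable_on {0..1}" by (rule integrable_continuous_interval)
  have i3: "(\<lambda>x. \<Sum>v\<leftarrow>us. h (circ e x) / (circ e x - v) * circ e x) integrable_on {0..1} \<and>
     integral {0..1} (\<lambda>x. \<Sum>v\<leftarrow>us. h (circ e x) / (circ e x - v) * circ e x) = (\<Sum>v\<leftarrow>us. h v)"
    if "set us \<subseteq> ball 0 e" for us using that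
  proof (induction us)
    case (Cons u us)
    then have u: "u \<in> ball 0 e" and us: "set us \<subseteq> ball 0 e" by auto
    note IH = Cons.IH[OF us]
    from integrable_add[OF i1[OF u] conjunct1[OF IH]] integral_add[OF i1[OF u] conjunct1[OF IH]]
    show ?case using IH I1[OF u] by simp
  qed (auto intro: integrable_0)
  have "integral {0..1} (\<lambda>x. h (circ e x) * circ e x * (deriv g (circ e x) / g (circ e x)))
      = integral {0..1} (\<lambda>x. (\<Sum>v\<leftarrow>vs. h (circ e x) / (circ e x - v) * circ e x) + k (circ e x))"
    unfolding eq k_def ..
  also have "\<dots> = (\<Sum>v\<leftarrow>vs. h v)"
    using integral_add[OF conjunct1[OF i3[OF vs]] i2] i3[OF vs] I2 by simp
  finally show ?thesis .
qed

text \<open>Lagrange interpolation in a form suited to parameters: each coefficient is a fixed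
  linear combination of the values at the nodes, so it is holomorphic in a parameter as soon as the
  values are.\<close>

lemma lagrange_coeffs:
  fixes T :: "nat \<Rightarrow> 'a :: field"
  assumes "inj_on T {..n}"
  obtains L where "\<And>p m. degree p \<le> n \<Longrightarrow> coeff p m = (\<Sum>j\<le>n. poly p (T j) * coeff (L j) m)"
proof -
  define L where "L j = (\<Prod>i\<in>{..n} - {j}. smult (inverse (T j - T i)) [:- T i, 1:])" for j
  have LT: "poly (L j) (T i) = (if i = j then 1 else 0)" if ij: "i \<le> n" "j \<le> n" for i j
  proof (cases "i = j")
    case True
    have "T j - T k \<noteq> 0" if "k \<in> {..n} - {j}" for k using inj_onD[OF assms, of j k] ij that by auto
    then have "(\<Prod>k\<in>{..n} - {j}. (T j - T k) * inverse (T j - T k)) = 1" by (intro prod.neutral) auto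
    then show ?thesis using True by (simp add: L_def poly_prod mult.commute right_diff_distrib left_diff_distrib)
  next
    case False
    then show ?thesis using ij by (auto simp: L_def poly_prod intro!: bexI[of _ i])
  qed
  have degL: "degree (L j) \<le> n" if "j \<le> n" for j
  proof -
    have "degree (L j) \<le> (\<Sum>i\<in>{..n} - {j}. degree (smult (inverse (T j - T i)) [:- T i, 1:]))"
      unfolding L_def by (rule order_trans[OF degree_prod_sum_le]) (auto simp: o_def)
    also have "\<dots> \<le> (\<Sum>i\<in>{..n} - {j}. 1)" by (intro sum_mono) auto
    also have "\<dots> = n" using that by simp
    finally show ?thesis .
  qed
  have "p = (\<Sum>j\<le>n. smult (poly p (T j)) (L j))" if p: "degree p \<le> n" for p
  proof (rule poly_eqI_degree[of "T ` {..n}"])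
    fix x assume "x \<in> T ` {..n}"
    then obtain i where i: "i \<le> n" "x = T i" by auto
    have "poly (\<Sum>j\<le>n. smult (poly p (T j)) (L j)) x = (\<Sum>j\<le>n. poly p (T j) * (if i = j then 1 else 0))"
      unfolding i(2) poly_sum using i(1) by (intro sum.cong) (auto simp: LT)
    also have "\<dots> = (\<Sum>j\<le>n. if i = j then poly p (T j) else 0)" by (intro sum.cong) auto
    also have "\<dots> = poly p x" using i by simp
    finally show "poly p x = poly (\<Sum>j\<le>n. smult (poly p (T j)) (L j)) x" by simp
  next
    show "degree p < card (T ` {..n})" using p by (simp add: card_image[OF assms])
    have "degree (\<Sum>j\<le>n. smult (poly p (T j)) (L j)) \<le> n"
      by (intro degree_sum_le) (auto intro: degL)
    then show "degree (\<Sum>j\<le>n. smult (poly p (T j)) (L j)) < card (T ` {..n})" by (simp add: card_image[OF assms])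
  qed
  note interp = this
  have "coeff p m = (\<Sum>j\<le>n. poly p (T j) * coeff (L j) m)" if "degree p \<le> n" for p m
    using arg_cong[OF interp[OF that], of "\<lambda>p. coeff p m"] by (simp only: coeff_sum coeff_smult)
  then show thesis by (rule that)
qed

text \<open>For every small s the function f(s, .) has \<open>n\<close> zeros in a small disc.
  Integrals of logarithmic derivatives give sums over these zeros that are holomorphic in s. Sums of
  logarithms yield the values of the monic polynomial of the zeros at n + 1 nodes, and interpolation
  yields its coefficients. The unit is the quotient of \<open>f\<close> by this polynomial, written
  as a Cauchy integral.\<close>

lemma weierstrass_preparation_analytic:
  fixes f :: "C2 \<Rightarrow> complex"
  assumes R: "0 < R" and f: "hol2 (ball 0 R \<times> ball 0 R) f"
    and g1: "g1 holomorphic_on ball 0 R" "g1 0 \<noteq> 0" "\<And>t. t \<in> ball 0 R \<Longrightarrow> f (0, t) = t ^ n * g1 t"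
  shows "\<exists>r c U. 0 < r \<and> (\<forall>k :: nat. c k holomorphic_on ball 0 r) \<and> (\<forall>k\<ge>1. c k 0 = 0) \<and> (\<forall>s. c 0 s = 1) \<and>
    hol2 (ball 0 r \<times> ball 0 r) U \<and> (\<forall>z \<in> ball 0 r \<times> ball 0 r. U z \<noteq> 0) \<and>
    (\<forall>s\<in>ball 0 r. \<forall>t\<in>ball 0 r. f (s, t) = U (s, t) * (\<Sum>k\<le>n. c k s * t ^ (n - k)))"
proof -
  let ?B = "ball 0 R \<times> ball 0 R :: C2 set"
  have B: "open ?B" by (auto intro: open_Times)
  have "isCont g1 0"
    using g1(1) R by (metis centre_in_ball continuous_on_eq_continuous_at holomorphic_on_imp_continuous_on open_ball)
  then obtain e0 where e0: "e0 > 0" "\<And>t. dist 0 t < e0 \<Longrightarrow> g1 t \<noteq> 0"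
    using continuous_at_avoid[of 0 g1 0] g1(2) by auto
  define e where "e = min e0 R / 2"
  have e: "0 < e" "e < R" "e < e0" using e0 R by (auto simp: e_def)
  have g1e: "g1 t \<noteq> 0" if "t \<in> cball 0 e" for t using e0(2)[of t] that e by auto
  define D where "D = ?B \<inter> f -` (- {0})"
  have D: "open D" unfolding D_def
    using continuous_open_preimage[OF hol2_continuous_on[OF f] B] by blast
  have fD: "hol2 D f" "\<And>z. z \<in> D \<Longrightarrow> f z \<noteq> 0" using hol2_subset[OF f] by (auto simp: D_def)
  have "{0} \<times> sphere 0 e \<subseteq> D"
    using e g1(3) g1e R by (auto simp: D_def)
  \<comment> \<open>Compactness of the circle keeps \<open>f\<close> free of zeros on it for all
    small s.\<close>
  from Elementary_Topology.tube_lemma[OF compact_sphere D this]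
  obtain X0 where "0 \<in> X0" "open X0" and X0: "X0 \<times> sphere 0 e \<subseteq> D" by blast
  then obtain d where d: "d > 0" "ball 0 d \<subseteq> X0" using openE by blast
  have sub: "ball 0 d \<times> sphere 0 e \<subseteq> D" using d X0 by blast
  have dR: "s \<in> ball 0 R" if "s \<in> ball 0 d" for s :: complex
  proof -
    have "(s, complex_of_real e) \<in> D" using sub that e by (auto simp: subset_iff)
    then show ?thesis by (auto simp: D_def)
  qed
  define F where "F s t = f (s, t)" for s t
  have Fhol: "F s holomorphic_on ball 0 R" if "s \<in> ball 0 d" for s
    unfolding F_def using dR[OF that] by (intro hol2_holomorphic_on2[OF f]) auto
  have Fnz: "F s t \<noteq> 0" if "s \<in> ball 0 d" "t \<in> sphere 0 e" for s t
    using sub that fD(2) unfolding F_def by blast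
  have "\<forall>s\<in>ball 0 d. \<exists>vs G. set vs \<subseteq> ball 0 e \<and> G holomorphic_on ball 0 R \<and> (\<forall>t\<in>cball 0 e. G t \<noteq> 0) \<and>
    (\<forall>t\<in>ball 0 R. F s t = (\<Prod>v\<leftarrow>vs. t - v) * G t)"
    using holomorphic_factor_zeros[OF Fhol e(1,2) Fnz] by blast
  then obtain vs G where vG: "\<And>s. s \<in> ball 0 d \<Longrightarrow> set (vs s) \<subseteq> ball 0 e" "\<And>s. s \<in> ball 0 d \<Longrightarrow> G s holomorphic_on ball 0 R"
    "\<And>s t. s \<in> ball 0 d \<Longrightarrow> t \<in> cball 0 e \<Longrightarrow> G s t \<noteq> 0"
    "\<And>s t. s \<in> ball 0 d \<Longrightarrow> t \<in> ball 0 R \<Longrightarrow> F s t = (\<Prod>v\<leftarrow>vs s. t - v) * G s t"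
    by metis
  define N where "N h s = integral {0..1} (\<lambda>x. h (circ e x) * circ e x * (deriv (F s) (circ e x) / F s (circ e x)))" for h s
  have Nsum: "N h s = (\<Sum>v\<leftarrow>vs s. h v)" if "h holomorphic_on ball 0 R" "s \<in> ball 0 d" for h s
    unfolding N_def by (rule circ_integral_logderiv[OF e(1,2) vG(1)[OF that(2)] vG(2)[OF that(2)] vG(3)[OF that(2)] vG(4)[OF that(2)] that(1)])
  have Nhol: "N h holomorphic_on ball 0 d" if h: "h holomorphic_on ball 0 R" for h
  proof -
    define q where "q z = h (snd z) * snd z * (pd2 f z / f z)" for z
    have "hol2 D (\<lambda>z. h (snd z))"
      by (rule hol2_compose_holomorphic[OF hol2_snd h]) (auto simp: D_def)
    then have "hol2 D q" unfolding q_def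
      by (intro hol2_mult hol2_snd hol2_divide hol2_pd2[OF fD(1) D] fD)
    from hol2_holomorphic_on1[OF hol2_circ_integral[OF this D e(1) sub], of "ball 0 d" 0]
    have "(\<lambda>s. integral {0..1} (\<lambda>x. q (s, circ e x) / (circ e x - 0) * circ e x)) holomorphic_on ball 0 d"
      using e by simp
    moreover have "circ e x \<noteq> 0" for x using norm_circ[of e x] e by auto
    ultimately show ?thesis by (simp add: N_def[abs_def] q_def pd2_def F_def[abs_def] mult_ac)
  qed
  \<comment> \<open>The number of zeros is a continuous function of s with values in the natural
    numbers, hence constant.\<close>
  have "(\<lambda>s. N (\<lambda>_. 1) s) constant_on ball 0 d"
  proof (rule continuous_discrete_range_constant[OF connected_ball])
    show "continuous_on (ball 0 d) (N (\<lambda>_. 1))" by (rule holomorphic_on_imp_continuous_on[OF Nhol[OF holomorphic_on_const]])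
    fix s assume s: "s \<in> ball (0 :: complex) d"
    have *: "N (\<lambda>_. 1) s = of_nat (length (vs s))" if "s \<in> ball 0 d" for s
      using Nsum[OF _ that, of "\<lambda>_. 1"] by (simp add: sum_list_triv)
    have ab: "1 \<le> norm (of_nat a - of_nat b :: complex)" if "a \<noteq> b" for a b :: nat
    proof -
      have "(of_nat a - of_nat b :: complex) = of_int (int a - int b)" by simp
      then have "norm (of_nat a - of_nat b :: complex) = of_int \<bar>int a - int b\<bar>" by (simp only: norm_of_int of_int_abs)
      moreover have "1 \<le> \<bar>int a - int b\<bar>" using that by linarith
      ultimately show ?thesis by linarith
    qed
    have "1 \<le> norm (N (\<lambda>_. 1) y - N (\<lambda>_. 1) s)" if y: "y \<in> ball 0 d" "N (\<lambda>_. 1) y \<noteq> N (\<lambda>_. 1) s" for y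
    proof -
      have "length (vs y) \<noteq> length (vs s)" using y(2) unfolding *[OF s] *[OF y(1)] by (simp only: of_nat_eq_iff not_False_eq_True)
      from ab[OF this] show ?thesis unfolding *[OF s] *[OF y(1)] .
    qed
    then show "\<exists>e>0. \<forall>y. y \<in> ball 0 d \<and> N (\<lambda>_. 1) y \<noteq> N (\<lambda>_. 1) s \<longrightarrow> e \<le> norm (N (\<lambda>_. 1) y - N (\<lambda>_. 1) s)"
      using zero_less_one by blast
  qed
  then obtain m where m: "\<And>s. s \<in> ball 0 d \<Longrightarrow> N (\<lambda>_. 1) s = m" unfolding constant_on_def by blast
  have "N (\<lambda>_. 1) 0 = (\<Sum>v\<leftarrow>replicate n (0 :: complex). 1)"
    unfolding N_def
  proof (rule circ_integral_logderiv[OF e(1,2) _ g1(1) g1e])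
    show "F 0 t = (\<Prod>v\<leftarrow>replicate n 0. t - v) * g1 t" if "t \<in> ball 0 R" for t
      using g1(3)[OF that] by (simp add: F_def prod_list_replicate)
  qed (use e in auto)
  then have N0: "N (\<lambda>_. 1) 0 = of_nat n" by (simp add: sum_list_replicate)
  have len: "length (vs s) = n" if "s \<in> ball 0 d" for s
  proof -
    have "N (\<lambda>_. 1) s = of_nat (length (vs s))"
      using Nsum[OF _ that, of "\<lambda>_. 1"] by (simp add: sum_list_triv)
    moreover have "N (\<lambda>_. 1) s = of_nat n" using m[OF that] m[of 0] d(1) N0 by simp
    ultimately show ?thesis by simp
  qed
  \<comment> \<open>The nodes lie to the right of the disc of radius \<open>R\<close>, so
    \<open>T j - t\<close> has positive real part there and the principal logarithm is holomorphic
    in t.\<close>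
  define T where "T j = (of_real (R + 1 + real j) :: complex)" for j
  have "inj_on T {..n}" by (auto simp: T_def inj_on_def)
  then obtain L where L: "\<And>p m. degree p \<le> n \<Longrightarrow> coeff p m = (\<Sum>j\<le>n. poly p (T j) * coeff (L j) m)"
    using lagrange_coeffs by blast
  define p where "p s = (\<Prod>v\<leftarrow>vs s. [:- v, 1:])" for s
  have poly_p: "poly (p s) t = (\<Prod>v\<leftarrow>vs s. t - v)" for s t
  proof -
    have "poly (\<Prod>v\<leftarrow>us. [:- v, 1:]) t = (\<Prod>v\<leftarrow>us. t - v)" for us
      by (induction us) (auto simp: left_diff_distrib)
    then show ?thesis by (simp add: p_def)
  qed
  have deg_p: "degree (p s) = n \<and> lead_coeff (p s) = 1" if "s \<in> ball 0 d" for s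
  proof -
    have *: "degree (\<Prod>v\<leftarrow>us. [:- v, 1:]) = length us \<and> lead_coeff (\<Prod>v\<leftarrow>us. [:- v, 1:]) = (1 :: complex)" for us
    proof (induction us)
      case (Cons u us)
      then have "(\<Prod>v\<leftarrow>us. [:- v, 1:]) \<noteq> 0" by auto
      then have "degree ([:- u, 1:] * (\<Prod>v\<leftarrow>us. [:- v, 1:])) = 1 + length us"
        using Cons by (subst degree_mult_eq) auto
      moreover have "lead_coeff ([:- u, 1:] * (\<Prod>v\<leftarrow>us. [:- v, 1:])) = 1"
        using Cons by (subst lead_coeff_mult) auto
      ultimately show ?case by simp
    qed simp
    show ?thesis using len[OF that] *[of "vs s"] unfolding p_def by metis
  qed
  \<comment> \<open>The exponential turns the sum of logarithms over the zeros into the value of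
    their polynomial at \<open>T j\<close>.\<close>
  define E where "E j s = exp (N (\<lambda>t. Ln (T j - t)) s)" for j s
  have Lnhol: "(\<lambda>t. Ln (T j - t)) holomorphic_on ball 0 R" for j
  proof (intro holomorphic_intros)
    fix t assume "t \<in> ball (0 :: complex) R"
    then have "Re t < R" using complex_Re_le_cmod[of t] by simp
    then have "Re (T j - t) > 0" by (simp add: T_def)
    then show "T j - t \<notin> \<real>\<^sub>\<le>\<^sub>0" by (auto simp: complex_nonpos_Reals_iff)
  qed
  have Ehol: "E j holomorphic_on ball 0 d" for j
    unfolding E_def by (intro holomorphic_intros Nhol Lnhol)
  have EE: "E j s = poly (p s) (T j)" if s: "s \<in> ball 0 d" for s j
  proof -
    have "exp (\<Sum>v\<leftarrow>us. Ln (T j - v)) = (\<Prod>v\<leftarrow>us. T j - v)" if "set us \<subseteq> ball 0 e" for us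
      using that
    proof (induction us)
      case (Cons u us)
      then have "Re u < R" using complex_Re_le_cmod[of u] e by simp
      then have "T j - u \<noteq> 0" by (auto simp: T_def complex_eq_iff)
      with Cons show ?case by (simp add: exp_add)
    qed simp
    then show ?thesis using Nsum[OF Lnhol s] vG(1)[OF s] by (simp add: E_def poly_p)
  qed
  define c where "c k s = (if k = 0 then 1 else if k \<le> n then \<Sum>j\<le>n. E j s * coeff (L j) (n - k) else 0)" for k s
  have c_coeff: "c k s = coeff (p s) (n - k)" if "s \<in> ball 0 d" "k \<le> n" for s k
    using that L[of "p s" "n - k"] deg_p[OF that(1)] EE[OF that(1)] by (auto simp: c_def)
  have W: "(\<Sum>k\<le>n. c k s * t ^ (n - k)) = poly (p s) t" if "s \<in> ball 0 d" for s t
  proof -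
    have "poly (p s) t = (\<Sum>i\<le>n. coeff (p s) i * t ^ i)" using deg_p[OF that] by (simp add: poly_altdef)
    also have "\<dots> = (\<Sum>k\<le>n. coeff (p s) (n - k) * t ^ (n - k))"
      by (rule sum.reindex_bij_witness[of _ "\<lambda>i. n - i" "\<lambda>i. n - i"]) auto
    finally show ?thesis using c_coeff[OF that] by (auto intro: sum.cong)
  qed
  have chol: "c k holomorphic_on ball 0 d" for k
  proof (cases "k = 0")
    case True
    then show ?thesis by (simp add: c_def[abs_def])
  next
    case False
    then show ?thesis by (cases "k \<le> n") (auto simp: c_def[abs_def] intro!: holomorphic_intros Ehol)
  qed
  have c0: "c k 0 = 0" if k: "k \<ge> 1" for k
  proof (cases "k \<le> n")
    case True
    have 0: "0 \<in> ball (0 :: complex) d" using d by simp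
    have "v = 0" if "v \<in> set (vs 0)" for v
    proof -
      have "v \<in> ball 0 e" using vG(1)[OF 0] that by blast
      moreover have "(\<Prod>u\<leftarrow>vs 0. v - u) = 0" using that by (auto simp: prod_list_zero_iff)
      ultimately have "F 0 v = 0" using vG(4)[OF 0, of v] e by auto
      then show "v = 0" using g1(3)[of v] g1e[of v] \<open>v \<in> ball 0 e\<close> e by (auto simp: F_def)
    qed
    then have "vs 0 = replicate n 0" using len[OF 0] by (metis replicate_eqI)
    then have "p 0 = monom 1 n" by (simp add: p_def prod_list_replicate monom_altdef)
    then show ?thesis using c_coeff[OF 0, of k] k True by simp
  next
    case False
    then show ?thesis using k by (simp add: c_def)
  qed
  define W2 where "W2 z = (\<Sum>k\<le>n. c k (fst z) * snd z ^ (n - k))" for z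
  have W2p: "W2 (s, t) = poly (p s) t" if "s \<in> ball 0 d" for s t using W[OF that] by (simp add: W2_def)
  have "hol2 (ball 0 d \<times> UNIV) W2" unfolding W2_def
    by (intro hol2_sum hol2_mult hol2_power hol2_snd hol2_fst_holomorphic chol open_ball)
  then have W2: "hol2 (ball 0 d \<times> ball 0 R) W2" by (rule hol2_subset) auto
  have oB: "open (ball 0 d \<times> ball 0 R :: C2 set)" by (auto intro: open_Times)
  define D' where "D' = (ball 0 d \<times> ball 0 R) \<inter> W2 -` (- {0})"
  have D': "open D'" unfolding D'_def
    using continuous_open_preimage[OF hol2_continuous_on[OF W2] oB] by blast
  have sub': "ball 0 d \<times> sphere 0 e \<subseteq> D'"
  proof (rule subsetI)
    fix z assume z: "z \<in> ball (0 :: complex) d \<times> sphere (0 :: complex) e"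
    then obtain s t where st: "z = (s, t)" "s \<in> ball 0 d" "t \<in> sphere 0 e" by blast
    then have t: "t \<in> ball 0 R" using e by simp
    have "poly (p s) t \<noteq> 0" using vG(4)[OF st(2) t] Fnz[OF st(2,3)] by (auto simp: poly_p)
    then show "z \<in> D'" using st t W2p[OF st(2)] by (simp add: D'_def)
  qed
  have "hol2 D' f" by (rule hol2_subset[OF f]) (use dR in \<open>auto simp: D'_def\<close>)
  then have "hol2 D' (\<lambda>z. f z / W2 z)"
    by (rule hol2_divide) (use hol2_subset[OF W2, of D'] in \<open>auto simp: D'_def\<close>)
  \<comment> \<open>On the circle the quotient of \<open>f\<close> by the polynomial equals
    \<open>G s\<close>, so its Cauchy integral recovers \<open>G s\<close> inside and is holomorphic
    in both variables.\<close>
  from hol2_circ_integral[OF this D' e(1) sub']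
  obtain U where U: "hol2 (ball 0 d \<times> ball 0 e) U"
    "\<And>s t. U (s, t) = integral {0..1} (\<lambda>x. f (s, circ e x) / W2 (s, circ e x) / (circ e x - t) * circ e x)" by fastforce
  have UG: "U (s, t) = G s t" if s: "s \<in> ball 0 d" and t: "t \<in> ball 0 e" for s t
  proof -
    have "cball 0 e \<subseteq> ball (0 :: complex) R" "ball 0 e \<subseteq> ball (0 :: complex) R" using e by auto
    then have "G s holomorphic_on cball 0 e" "G s holomorphic_on ball 0 e"
      using holomorphic_on_subset[OF vG(2)[OF s]] by auto
    from Cauchy_integral_circ[OF holomorphic_on_imp_continuous_on[OF this(1)] this(2) t, of 0]
    have "integral {0..1} (\<lambda>x. G s (circ e x) / (circ e x - t) * circ e x) = G s t" by simp
    moreover have "f (s, circ e x) / W2 (s, circ e x) = G s (circ e x)" for x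
    proof -
      have c: "circ e x \<in> sphere 0 e" "circ e x \<in> ball 0 R" using circ_mem_sphere[of e x] e by auto
      have "poly (p s) (circ e x) \<noteq> 0" using vG(4)[OF s c(2)] Fnz[OF s c(1)] by (auto simp: poly_p)
      then show ?thesis using vG(4)[OF s c(2)] W2p[OF s] by (simp add: F_def poly_p)
    qed
    ultimately show ?thesis by (simp add: U(2))
  qed
  define r where "r = min d e"
  show ?thesis
  proof (intro exI[of _ r] exI[of _ c] exI[of _ U] conjI allI impI ballI)
    show "r > 0" using d e by (simp add: r_def)
    show "c k holomorphic_on ball 0 r" for k
      by (rule holomorphic_on_subset[OF chol]) (auto simp: r_def)
    show "hol2 (ball 0 r \<times> ball 0 r) U" by (rule hol2_subset[OF U(1)]) (auto simp: r_def)
    have sub: "s \<in> ball 0 d" "t \<in> ball 0 e" "t \<in> cball 0 e" "t \<in> ball 0 R" if "s \<in> ball 0 r" "t \<in> ball 0 r" for s t :: complex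
      using that e by (auto simp: r_def)
    show "U z \<noteq> 0" if "z \<in> ball 0 r \<times> ball 0 r" for z
      using that sub UG vG(3) by (metis mem_Sigma_iff prod.collapse)
    show "f (s, t) = U (s, t) * (\<Sum>k\<le>n. c k s * t ^ (n - k))" if "s \<in> ball 0 r" "t \<in> ball 0 r" for s t
      using UG[OF sub(1,2)[OF that]] W[OF sub(1)[OF that]] vG(4)[OF sub(1,4)[OF that]] by (simp add: F_def poly_p)
    show "c k 0 = 0" if "k \<ge> 1" for k using c0[OF that] .
    show "c 0 s = 1" for s by (simp add: c_def)
  qed
qed

lemma holomorphic_factor_at_0:
  fixes g :: "complex \<Rightarrow> complex"
  assumes g: "g holomorphic_on ball 0 R" and w: "w \<in> ball 0 R" "g w \<noteq> 0"
  obtains h n where "h holomorphic_on ball 0 R" "h 0 \<noteq> 0" "\<And>t. t \<in> ball 0 R \<Longrightarrow> g t = t ^ n * h t"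
proof (cases "g 0 = 0")
  case False
  then show thesis using that[of g 0] g by simp
next
  case True
  have 0: "0 \<in> ball (0 :: complex) R" using w norm_ge_zero[of w] by (simp del: norm_ge_zero)
  have "\<not> g constant_on ball 0 R" using True w 0 unfolding constant_on_def by metis
  from holomorphic_factor_zero_ball[OF g 0 True this] show thesis using that by (metis diff_zero)
qed

section \<open>The ring of holomorphic germs\<close>

definition germ_rel :: "(C2 \<Rightarrow> complex) \<Rightarrow> (C2 \<Rightarrow> complex) \<Rightarrow> bool" where
  "germ_rel f g \<longleftrightarrow> holomorphic_germ f \<and> holomorphic_germ g \<and> germ_eq f g"

lemma germ_eq_refl [simp]: "germ_eq f f"
  by (simp add: germ_eq_def)

lemma germ_eq_sym: "germ_eq f g \<Longrightarrow> germ_eq g f"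
  by (auto simp: germ_eq_def eq_commute)

lemma germ_eq_trans:
  assumes "germ_eq f g" "germ_eq g h" shows "germ_eq f h"
  using assms unfolding germ_eq_def by eventually_elim simp

lemma germ_eq_op:
  assumes "germ_eq f f'" "germ_eq g g'" shows "germ_eq (\<lambda>z. p (f z) (g z)) (\<lambda>z. p (f' z) (g' z))"
  using assms unfolding germ_eq_def by eventually_elim simp

lemma germ_eq_at_0: "germ_eq f g \<Longrightarrow> f 0 = g 0"
  unfolding germ_eq_def by (rule eventually_nhds_x_imp_x)

lemma holomorphic_germ_open:
  assumes "holomorphic_germ f"
  obtains U where "open U" "0 \<in> U" "hol2 U f"
  using assms by (auto simp: holomorphic_germ_iff)

lemma holomorphic_germI: "open U \<Longrightarrow> 0 \<in> U \<Longrightarrow> hol2 U f \<Longrightarrow> holomorphic_germ f"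
  by (auto simp: holomorphic_germ_iff)

lemma holomorphic_germ_open2:
  assumes "holomorphic_germ f" "holomorphic_germ g"
  obtains U where "open U" "0 \<in> U" "hol2 U f" "hol2 U g"
proof -
  obtain U V where "open U" "0 \<in> U" "hol2 U f" "open V" "0 \<in> V" "hol2 V g"
    using assms by (metis holomorphic_germ_open)
  then show thesis by (intro that[of "U \<inter> V"]) (auto intro: hol2_subset)
qed

lemma holomorphic_germ_const [simp]: "holomorphic_germ (\<lambda>_. c)"
  by (rule holomorphic_germI[of UNIV]) auto

lemma holomorphic_germ_fst [simp]: "holomorphic_germ fst"
  by (rule holomorphic_germI[of UNIV]) auto

lemma holomorphic_germ_snd [simp]: "holomorphic_germ snd"
  by (rule holomorphic_germI[of UNIV]) auto

lemma holomorphic_germ_add [simp]: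
  assumes "holomorphic_germ f" "holomorphic_germ g" shows "holomorphic_germ (\<lambda>z. f z + g z)"
  using holomorphic_germ_open2[OF assms] holomorphic_germI hol2_add by metis

lemma holomorphic_germ_mult [simp]:
  assumes "holomorphic_germ f" "holomorphic_germ g" shows "holomorphic_germ (\<lambda>z. f z * g z)"
  using holomorphic_germ_open2[OF assms] holomorphic_germI hol2_mult by metis

lemma holomorphic_germ_minus [simp]: "holomorphic_germ f \<Longrightarrow> holomorphic_germ (\<lambda>z. - f z)"
  using holomorphic_germ_mult[OF holomorphic_germ_const[of "-1"]] by simp

lemma holomorphic_germ_diff [simp]:
  assumes "holomorphic_germ f" "holomorphic_germ g" shows "holomorphic_germ (\<lambda>z. f z - g z)"
  using holomorphic_germ_open2[OF assms] holomorphic_germI hol2_diff by metis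

lemma holomorphic_germ_pd1 [simp]: "holomorphic_germ f \<Longrightarrow> holomorphic_germ (pd1 f)"
  by (metis holomorphic_germ_open holomorphic_germI hol2_pd1)

lemma holomorphic_germ_pd2 [simp]: "holomorphic_germ f \<Longrightarrow> holomorphic_germ (pd2 f)"
  by (metis holomorphic_germ_open holomorphic_germI hol2_pd2)

lemma holomorphic_germ_tendsto:
  assumes "holomorphic_germ f" shows "(f \<longlongrightarrow> f 0) (nhds 0)"
proof -
  obtain U where U: "open U" "0 \<in> U" "hol2 U f" by (rule holomorphic_germ_open[OF assms])
  then have "isCont f 0" using has_derivative_continuous[OF hol2_D] by blast
  then show ?thesis by (simp add: isCont_def tendsto_nhds_iff)
qed

lemma holomorphic_germ_compose:
  assumes f: "holomorphic_germ f" and g: "holomorphic_germ g" "g 0 = 0" and h: "holomorphic_germ h" "h 0 = 0"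
  shows "holomorphic_germ (\<lambda>z. f (g z, h z))"
proof -
  obtain V where V: "open V" "0 \<in> V" "hol2 V f" by (rule holomorphic_germ_open[OF f])
  obtain U where U: "open U" "0 \<in> U" "hol2 U g" "hol2 U h" by (rule holomorphic_germ_open2[OF g(1) h(1)])
  have "continuous_on U (\<lambda>z. (g z, h z))"
    using U hol2_continuous_on by (intro continuous_intros) blast+
  then have W: "open (U \<inter> (\<lambda>z. (g z, h z)) -` V)"
    using U(1) V(1) by (rule continuous_open_preimage)
  show ?thesis
  proof (rule holomorphic_germI[OF W])
    show "hol2 (U \<inter> (\<lambda>z. (g z, h z)) -` V) (\<lambda>z. f (g z, h z))"
      by (rule hol2_compose[OF V(3)]) (use U hol2_subset in blast)+
  qed (use U V g h in \<open>auto simp: zero_prod_def\<close>)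
qed

lemma filterlim_germ_pair:
  assumes g: "holomorphic_germ g" "g 0 = 0" and h: "holomorphic_germ h" "h 0 = 0"
  shows "filterlim (\<lambda>z. (g z, h z)) (nhds 0) (nhds 0)"
  using tendsto_Pair[OF holomorphic_germ_tendsto[OF g(1)] holomorphic_germ_tendsto[OF h(1)]] g h
  by (simp add: zero_prod_def)

lemma germ_eq_pd:
  assumes "germ_eq f g" shows "germ_eq (pd1 f) (pd1 g)" "germ_eq (pd2 f) (pd2 g)"
proof -
  have "\<forall>\<^sub>F z in nhds 0. \<forall>\<^sub>F w in nhds z. f w = g w"
    using assms unfolding germ_eq_def by (simp add: eventually_eventually)
  then have "\<forall>\<^sub>F z in nhds 0. pd1 f z = pd1 g z \<and> pd2 f z = pd2 g z"
  proof eventually_elim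
    fix z assume z: "\<forall>\<^sub>F w in nhds z. f w = g w"
    have l1: "filterlim (\<lambda>s. (s, snd z)) (nhds z) (nhds (fst z))"
      using tendsto_Pair[of "\<lambda>s. s" "fst z" "nhds (fst z)" "\<lambda>_. snd z" "snd z"] by (simp add: filterlim_ident)
    have l2: "filterlim (\<lambda>t. (fst z, t)) (nhds z) (nhds (snd z))"
      using tendsto_Pair[of "\<lambda>_. fst z" "fst z" "nhds (snd z)" "\<lambda>s. s" "snd z"] by (simp add: filterlim_ident)
    show "pd1 f z = pd1 g z \<and> pd2 f z = pd2 g z"
      unfolding pd1_def pd2_def
      using deriv_cong_ev[OF eventually_compose_filterlim[OF z l1] HOL.refl]
        deriv_cong_ev[OF eventually_compose_filterlim[OF z l2] HOL.refl] by simp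
  qed
  then show "germ_eq (pd1 f) (pd1 g)" "germ_eq (pd2 f) (pd2 g)"
    unfolding germ_eq_def by (auto elim: eventually_mono)
qed

lemma germ_eq_compose:
  assumes "germ_eq f f'" "holomorphic_germ g" "germ_eq g g'" "g 0 = 0" "holomorphic_germ h" "germ_eq h h'" "h 0 = 0"
  shows "germ_eq (\<lambda>z. f (g z, h z)) (\<lambda>z. f' (g' z, h' z))"
  using eventually_compose_filterlim[OF assms(1)[unfolded germ_eq_def] filterlim_germ_pair[OF assms(2,4,5,7)]]
    assms(3,6) unfolding germ_eq_def
  by eventually_elim simp

\<comment> \<open>The quotient is partial: functions that are not holomorphic near the origin
  represent no germ.\<close>
quotient_type germ = "C2 \<Rightarrow> complex" / partial: germ_rel
proof (rule part_equivpI)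
  show "\<exists>f. germ_rel f f" by (rule exI[of _ "\<lambda>_. 0"]) (simp add: germ_rel_def)
  show "symp germ_rel" by (rule sympI) (auto simp: germ_rel_def germ_eq_sym)
  show "transp germ_rel" by (rule transpI) (auto simp: germ_rel_def intro: germ_eq_trans)
qed

instantiation germ :: comm_ring_1
begin

lift_definition zero_germ :: germ is "\<lambda>_. 0" by (simp add: germ_rel_def)
lift_definition one_germ :: germ is "\<lambda>_. 1" by (simp add: germ_rel_def)
lift_definition plus_germ :: "germ \<Rightarrow> germ \<Rightarrow> germ" is "\<lambda>f g z. f z + g z"
  using germ_eq_op[of _ _ _ _ "(+)"] by (auto simp: germ_rel_def)
lift_definition minus_germ :: "germ \<Rightarrow> germ \<Rightarrow> germ" is "\<lambda>f g z. f z - g z"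
  using germ_eq_op[of _ _ _ _ "(-)"] by (auto simp: germ_rel_def)
lift_definition times_germ :: "germ \<Rightarrow> germ \<Rightarrow> germ" is "\<lambda>f g z. f z * g z"
  using germ_eq_op[of _ _ _ _ "(*)"] by (auto simp: germ_rel_def)
lift_definition uminus_germ :: "germ \<Rightarrow> germ" is "\<lambda>f z. - f z"
  using germ_eq_op[of _ _ _ _ "\<lambda>a b. - a"] by (auto simp: germ_rel_def)

instance
proof
  fix a b c :: germ
  show "a + b + c = a + (b + c)" by transfer (simp add: germ_rel_def add.assoc)
  show "a + b = b + a" by transfer (simp add: germ_rel_def add.commute)
  show "0 + a = a" by transfer (simp add: germ_rel_def)
  show "- a + a = 0" by transfer (simp add: germ_rel_def)
  show "a - b = a + - b" by transfer (simp add: germ_rel_def)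
  show "a * b * c = a * (b * c)" by transfer (simp add: germ_rel_def mult.assoc)
  show "a * b = b * a" by transfer (simp add: germ_rel_def mult.commute)
  show "1 * a = a" by transfer (simp add: germ_rel_def)
  show "(a + b) * c = a * c + b * c" by transfer (simp add: germ_rel_def distrib_right)
  show "(0 :: germ) \<noteq> 1"
    by transfer (use germ_eq_at_0[of "\<lambda>_. 0" "\<lambda>_. 1"] in \<open>auto simp: germ_rel_def\<close>)
qed

end

instance germ :: idom
proof
  fix a b :: germ
  assume "a \<noteq> 0" "b \<noteq> 0"
  then show "a * b \<noteq> 0"
  proof transfer
    fix f g assume "germ_rel f f" "\<not> germ_rel f (\<lambda>_. 0)" "germ_rel g g" "\<not> germ_rel g (\<lambda>_. 0)"
    then have h: "holomorphic_germ f" "holomorphic_germ g" "\<not> germ_eq f (\<lambda>_. 0)" "\<not> germ_eq g (\<lambda>_. 0)"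
      by (auto simp: germ_rel_def)
    show "\<not> germ_rel (\<lambda>z. f z * g z) (\<lambda>_. 0)"
    proof
      assume "germ_rel (\<lambda>z. f z * g z) (\<lambda>_. 0)"
      then obtain V where V: "open V" "0 \<in> V" "\<And>z. z \<in> V \<Longrightarrow> f z * g z = 0"
        unfolding germ_rel_def germ_eq_def eventually_nhds by blast
      obtain U where U: "open U" "0 \<in> U" "hol2 U f" "hol2 U g"
        by (rule holomorphic_germ_open2[OF h(1,2)])
      have "open (U \<inter> V)" "0 \<in> U \<inter> V" using U V by auto
      then obtain e where e: "e > 0" "ball 0 e \<subseteq> U \<inter> V" using openE by blast
      have "\<exists>z\<in>ball 0 e. f z \<noteq> 0"
      proof (rule ccontr)
        assume "\<not> (\<exists>z\<in>ball 0 e. f z \<noteq> 0)"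
        then have "germ_eq f (\<lambda>_. 0)" unfolding germ_eq_def eventually_nhds
          using e by (intro exI[of _ "ball 0 e"]) auto
        then show False using h by blast
      qed
      then obtain z1 where z1: "z1 \<in> ball 0 e" "f z1 \<noteq> 0" by blast
      have "g z = 0" if "z \<in> ball 0 e" for z
      proof (rule hol2_no_zero_divisors[of "ball 0 e" f g z1 z])
        show "hol2 (ball 0 e) f" "hol2 (ball 0 e) g" using U e by (auto intro: hol2_subset)
        show "f z * g z = 0" if "z \<in> ball 0 e" for z using V(3) e(2) that by blast
      qed (use z1 that in auto)
      then have "germ_eq g (\<lambda>_. 0)" unfolding germ_eq_def eventually_nhds
        using e by (intro exI[of _ "ball 0 e"]) auto
      then show False using h by blast
    qed
  qed
qed

text \<open>The germ \<open>germ_of\<close> of a function is \<open>0\<close> if the function is not holomorphic near the origin.\<close>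

lift_definition germ_of :: "(C2 \<Rightarrow> complex) \<Rightarrow> germ" is "\<lambda>f. if holomorphic_germ f then f else (\<lambda>_. 0)"
  by (simp add: germ_rel_def)

lemma germ_of_eq_iff: "holomorphic_germ f \<Longrightarrow> holomorphic_germ g \<Longrightarrow> germ_of f = germ_of g \<longleftrightarrow> germ_eq f g"
  by transfer (simp add: germ_rel_def)

lemma germ_of_cases [cases type]:
  obtains f where "holomorphic_germ f" "F = germ_of f"
proof -
  have "holomorphic_germ (rep_germ F)"
    using Quotient3_rep_reflp[OF Quotient3_germ, of F] by (simp add: germ_rel_def)
  moreover from this have "F = germ_of (rep_germ F)"
    by (simp add: germ_of_def Quotient3_abs_rep[OF Quotient3_germ])
  ultimately show thesis by (rule that)
qed

lemma germ_of_add: "holomorphic_germ f \<Longrightarrow> holomorphic_germ g \<Longrightarrow> germ_of (\<lambda>z. f z + g z) = germ_of f + germ_of g"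
  and germ_of_diff: "holomorphic_germ f \<Longrightarrow> holomorphic_germ g \<Longrightarrow> germ_of (\<lambda>z. f z - g z) = germ_of f - germ_of g"
  and germ_of_mult: "holomorphic_germ f \<Longrightarrow> holomorphic_germ g \<Longrightarrow> germ_of (\<lambda>z. f z * g z) = germ_of f * germ_of g"
  and germ_of_minus: "holomorphic_germ f \<Longrightarrow> germ_of (\<lambda>z. - f z) = - germ_of f"
  by (transfer, simp add: germ_rel_def)+

lemma germ_of_0: "germ_of (\<lambda>_. 0) = 0" and gm_1: "germ_of (\<lambda>_. 1) = 1"
  by (transfer, simp add: germ_rel_def)+

lift_definition ev0 :: "germ \<Rightarrow> complex" is "\<lambda>f. f 0"
  by (auto simp: germ_rel_def germ_eq_at_0)

lemma ev0_germ_of: "holomorphic_germ f \<Longrightarrow> ev0 (germ_of f) = f 0" by transfer simp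

lemma ev0_simps [simp]: "ev0 0 = 0" "ev0 1 = 1" "ev0 (a + b) = ev0 a + ev0 b" "ev0 (a - b) = ev0 a - ev0 b"
  "ev0 (a * b) = ev0 a * ev0 b" "ev0 (- a) = - ev0 a"
  by (transfer, simp)+

lemma ev0_power [simp]: "ev0 (a ^ n) = ev0 a ^ n" by (induction n) auto

lemma ev0_sum [simp]: "ev0 (sum f A) = (\<Sum>i\<in>A. ev0 (f i))" by (induction A rule: infinite_finite_induct) auto

definition C :: "complex \<Rightarrow> germ" where "C c = germ_of (\<lambda>_. c)"
definition X :: germ where "X = germ_of fst"
definition Y :: germ where "Y = germ_of snd"

lemma ev0_CXY [simp]: "ev0 (C c) = c" "ev0 X = 0" "ev0 Y = 0"
  by (simp_all add: C_def X_def Y_def ev0_germ_of zero_prod_def)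

lemma C_simps: "C 0 = 0" "C 1 = 1" "C (a + b) = C a + C b" "C (a - b) = C a - C b" "C (a * b) = C a * C b" "C (- a) = - C a"
  by (simp_all add: C_def germ_of_0 gm_1 flip: germ_of_add germ_of_diff germ_of_mult germ_of_minus)

lemma C_eq_iff [simp]: "C a = C b \<longleftrightarrow> a = b" "C a = 0 \<longleftrightarrow> a = 0"
  by (metis ev0_CXY(1), metis ev0_CXY(1) C_simps(1))

lemma germ_unit_iff: "F dvd 1 \<longleftrightarrow> ev0 F \<noteq> (0 :: complex)"
proof
  assume "F dvd 1"
  then show "ev0 F \<noteq> 0" by (metis dvd_def ev0_simps(2,5) mult_zero_left zero_neq_one)
next
  assume F0: "ev0 F \<noteq> 0"
  obtain f where f: "holomorphic_germ f" "F = germ_of f" by (rule germ_of_cases)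
  have f0: "f 0 \<noteq> 0" using F0 f by (simp add: ev0_germ_of)
  obtain U where U: "open U" "0 \<in> U" "hol2 U f" by (rule holomorphic_germ_open[OF f(1)])
  have "open (U \<inter> f -` (- {0}))"
    by (rule continuous_open_preimage[OF hol2_continuous_on[OF U(3)] U(1)]) auto
  moreover have "hol2 (U \<inter> f -` (- {0})) (\<lambda>z. inverse (f z))"
    using U(3) by (intro hol2_inverse) (auto intro: hol2_subset)
  ultimately have i: "holomorphic_germ (\<lambda>z. inverse (f z))"
    using U(2) f0 by (intro holomorphic_germI) auto
  have "\<forall>\<^sub>F z in nhds 0. f z \<noteq> 0"
    using tendsto_imp_eventually_ne[OF holomorphic_germ_tendsto[OF f(1)] f0] .
  then have "germ_eq (\<lambda>z. f z * inverse (f z)) (\<lambda>_. 1)" unfolding germ_eq_def by eventually_elim simp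
  then have "F * germ_of (\<lambda>z. inverse (f z)) = 1"
    using f i by (simp add: germ_of_eq_iff flip: germ_of_mult gm_1)
  then show "F dvd 1" by (metis dvdI)
qed

text \<open>Substitution is meaningful only for germs vanishing at the origin. In the other case the
  value is set to 0, so the rules below carry the assumptions \<open>ev0 a = 0\<close> and
  \<open>ev0 b = 0\<close>.\<close>

lift_definition subst_germ :: "germ \<Rightarrow> germ \<Rightarrow> germ \<Rightarrow> germ" is
  "\<lambda>f a b. if a 0 = 0 \<and> b 0 = 0 then (\<lambda>z. f (a z, b z)) else (\<lambda>_. 0)"
proof -
  fix f f' a a' b b' assume *: "germ_rel f f'" "germ_rel a a'" "germ_rel b b'"
  then have "a 0 = a' 0" "b 0 = b' 0" by (auto simp: germ_rel_def germ_eq_at_0)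
  then show "germ_rel (if a 0 = 0 \<and> b 0 = 0 then \<lambda>z. f (a z, b z) else (\<lambda>_. 0))
     (if a' 0 = 0 \<and> b' 0 = 0 then \<lambda>z. f' (a' z, b' z) else (\<lambda>_. 0))"
    using * by (auto simp: germ_rel_def intro!: holomorphic_germ_compose germ_eq_compose)
qed

lemma subst_germ_germ_of:
  assumes "holomorphic_germ f" "holomorphic_germ a" "a 0 = 0" "holomorphic_germ b" "b 0 = 0"
  shows "subst_germ (germ_of f) (germ_of a) (germ_of b) = germ_of (\<lambda>z. f (a z, b z))"
  using assms holomorphic_germ_compose[OF assms] by transfer (auto simp: germ_rel_def)

lemma subst_germ_simps:
  assumes "ev0 a = 0" "ev0 b = 0"
  shows "subst_germ 0 a b = 0" "subst_germ 1 a b = 1" "subst_germ (f + g) a b = subst_germ f a b + subst_germ g a b"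
    "subst_germ (f - g) a b = subst_germ f a b - subst_germ g a b" "subst_germ (f * g) a b = subst_germ f a b * subst_germ g a b"
    "subst_germ (- f) a b = - subst_germ f a b" "subst_germ (C c) a b = C c" "subst_germ X a b = a" "subst_germ Y a b = b"
    "ev0 (subst_germ f a b) = ev0 f"
proof -
  obtain f' where f: "holomorphic_germ f'" "f = germ_of f'" by (rule germ_of_cases)
  obtain g' where g: "holomorphic_germ g'" "g = germ_of g'" by (rule germ_of_cases)
  obtain a' where a: "holomorphic_germ a'" "a = germ_of a'" by (rule germ_of_cases)
  obtain b' where b: "holomorphic_germ b'" "b = germ_of b'" by (rule germ_of_cases)
  have 0: "a' 0 = 0" "b' 0 = 0" using assms a b by (auto simp: ev0_germ_of)
  note h = holomorphic_germ_compose[OF _ a(1) 0(1) b(1) 0(2)]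
  show C: "subst_germ (C c) a b = C c" for c using a b 0 by (simp add: C_def subst_germ_germ_of)
  show "subst_germ X a b = a" "subst_germ Y a b = b" using a b 0 by (simp_all add: X_def Y_def subst_germ_germ_of)
  show "subst_germ 0 a b = 0" "subst_germ 1 a b = 1" using C[of 0] C[of 1] by (simp_all add: C_simps)
  show "subst_germ (f + g) a b = subst_germ f a b + subst_germ g a b"
    "subst_germ (f - g) a b = subst_germ f a b - subst_germ g a b" "subst_germ (f * g) a b = subst_germ f a b * subst_germ g a b"
    "subst_germ (- f) a b = - subst_germ f a b" "ev0 (subst_germ f a b) = ev0 f"
    using f g a b 0 h[of f'] h[of g']
    by (simp_all add: subst_germ_germ_of ev0_germ_of zero_prod_def flip: germ_of_add germ_of_diff germ_of_mult germ_of_minus)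
qed

lemma subst_germ_power: "ev0 a = 0 \<Longrightarrow> ev0 b = 0 \<Longrightarrow> subst_germ (f ^ n) a b = subst_germ f a b ^ n"
  by (induction n) (auto simp: subst_germ_simps)

lemma subst_germ_sum: "ev0 a = 0 \<Longrightarrow> ev0 b = 0 \<Longrightarrow> subst_germ (sum f A) a b = (\<Sum>i\<in>A. subst_germ (f i) a b)"
  by (induction A rule: infinite_finite_induct) (auto simp: subst_germ_simps)

lemma subst_germ_prod: "ev0 a = 0 \<Longrightarrow> ev0 b = 0 \<Longrightarrow> subst_germ (prod f A) a b = (\<Prod>i\<in>A. subst_germ (f i) a b)"
  by (induction A rule: infinite_finite_induct) (auto simp: subst_germ_simps)

lemma subst_germ_XY [simp]: "subst_germ f X Y = f"
proof (cases f)
  fix g assume "holomorphic_germ g" "f = germ_of g"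
  then show ?thesis by (simp add: X_def Y_def subst_germ_germ_of zero_prod_def)
qed

lemma subst_germ_subst_germ:
  assumes "ev0 a = 0" "ev0 b = 0" "ev0 c = 0" "ev0 d = 0"
  shows "subst_germ (subst_germ f a b) c d = subst_germ f (subst_germ a c d) (subst_germ b c d)"
proof -
  obtain f' where f: "holomorphic_germ f'" "f = germ_of f'" by (rule germ_of_cases)
  obtain a' where a: "holomorphic_germ a'" "a = germ_of a'" by (rule germ_of_cases)
  obtain b' where b: "holomorphic_germ b'" "b = germ_of b'" by (rule germ_of_cases)
  obtain c' where c: "holomorphic_germ c'" "c = germ_of c'" by (rule germ_of_cases)
  obtain d' where d: "holomorphic_germ d'" "d = germ_of d'" by (rule germ_of_cases)
  have 0: "a' 0 = 0" "b' 0 = 0" "c' 0 = 0" "d' 0 = 0" using assms a b c d by (auto simp: ev0_germ_of)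
  then show ?thesis
    using f a b c d by (simp add: subst_germ_germ_of holomorphic_germ_compose) (simp add: subst_germ_germ_of holomorphic_germ_compose flip: zero_prod_def)
qed

lift_definition dX :: "germ \<Rightarrow> germ" is pd1 by (auto simp: germ_rel_def germ_eq_pd)
lift_definition dY :: "germ \<Rightarrow> germ" is pd2 by (auto simp: germ_rel_def germ_eq_pd)

lemma dXY_germ_of: "holomorphic_germ f \<Longrightarrow> dX (germ_of f) = germ_of (pd1 f)" "holomorphic_germ f \<Longrightarrow> dY (germ_of f) = germ_of (pd2 f)"
  by (transfer, simp add: germ_rel_def)+

lemma germ_eq_pdI:
  assumes "open U" "0 \<in> U"
    and "\<And>z. z \<in> U \<Longrightarrow> (f has_derivative (\<lambda>(s, t). a z * s + b z * t)) (at z)"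
  shows "germ_eq (pd1 f) a" "germ_eq (pd2 f) b"
  using assms has_derivative_pd unfolding germ_eq_def eventually_nhds by metis+

lemma dXY_add: "dX (f + g) = dX f + dX g" "dY (f + g) = dY f + dY g"
  and dXY_mult: "dX (f * g) = f * dX g + dX f * g" "dY (f * g) = f * dY g + dY f * g"
proof -
  obtain f' where f: "holomorphic_germ f'" "f = germ_of f'" by (rule germ_of_cases)
  obtain g' where g: "holomorphic_germ g'" "g = germ_of g'" by (rule germ_of_cases)
  obtain U where U: "open U" "0 \<in> U" "hol2 U f'" "hol2 U g'" by (rule holomorphic_germ_open2[OF f(1) g(1)])
  have "((\<lambda>z. f' z + g' z) has_derivative (\<lambda>(s, t). (pd1 f' z + pd1 g' z) * s + (pd2 f' z + pd2 g' z) * t)) (at z)"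
    if "z \<in> U" for z
    by (rule has_derivative_eq_rhs[OF has_derivative_add[OF hol2_D[OF U(3) that] hol2_D[OF U(4) that]]])
      (auto simp: algebra_simps)
  from germ_eq_pdI[OF U(1,2) this]
  show "dX (f + g) = dX f + dX g" "dY (f + g) = dY f + dY g"
    using f g by (simp_all add: dXY_germ_of germ_of_eq_iff flip: germ_of_add)
  have "((\<lambda>z. f' z * g' z) has_derivative (\<lambda>(s, t). (f' z * pd1 g' z + pd1 f' z * g' z) * s + (f' z * pd2 g' z + pd2 f' z * g' z) * t)) (at z)"
    if "z \<in> U" for z
    by (rule has_derivative_eq_rhs[OF has_derivative_mult[OF hol2_D[OF U(3) that] hol2_D[OF U(4) that]]])
      (auto simp: algebra_simps)
  from germ_eq_pdI[OF U(1,2) this]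
  show "dX (f * g) = f * dX g + dX f * g" "dY (f * g) = f * dY g + dY f * g"
    using f g by (simp_all add: dXY_germ_of germ_of_eq_iff flip: germ_of_add germ_of_mult)
qed

lemma dXY_const [simp]: "dX (C c) = 0" "dY (C c) = 0" "dX X = 1" "dY X = 0" "dX Y = 0" "dY Y = 1"
  by (simp_all add: C_def X_def Y_def dXY_germ_of pd1_def[abs_def] pd2_def[abs_def] germ_of_0 gm_1)

lemma dXY_subst_germ:
  assumes "ev0 a = 0" "ev0 b = 0"
  shows "dX (subst_germ f a b) = subst_germ (dX f) a b * dX a + subst_germ (dY f) a b * dX b"
    "dY (subst_germ f a b) = subst_germ (dX f) a b * dY a + subst_germ (dY f) a b * dY b"
proof -
  obtain f' where f: "holomorphic_germ f'" "f = germ_of f'" by (rule germ_of_cases)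
  obtain a' where a: "holomorphic_germ a'" "a = germ_of a'" by (rule germ_of_cases)
  obtain b' where b: "holomorphic_germ b'" "b = germ_of b'" by (rule germ_of_cases)
  have 0: "a' 0 = 0" "b' 0 = 0" using assms a b by (auto simp: ev0_germ_of)
  obtain V where V: "open V" "0 \<in> V" "hol2 V f'" by (rule holomorphic_germ_open[OF f(1)])
  obtain U where U: "open U" "0 \<in> U" "hol2 U a'" "hol2 U b'" by (rule holomorphic_germ_open2[OF a(1) b(1)])
  have "continuous_on U (\<lambda>z. (a' z, b' z))"
    using U hol2_continuous_on by (intro continuous_intros) blast+
  then have W: "open (U \<inter> (\<lambda>z. (a' z, b' z)) -` V)" (is "open ?W")
    using U(1) V(1) by (rule continuous_open_preimage)
  have W0: "0 \<in> ?W" using U V 0 by (auto simp: zero_prod_def)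
  have h: "holomorphic_germ (\<lambda>z. pd1 f' (a' z, b' z))" "holomorphic_germ (\<lambda>z. pd2 f' (a' z, b' z))"
     "holomorphic_germ (\<lambda>z. f' (a' z, b' z))"
    using f a b 0 by (auto intro!: holomorphic_germ_compose)
  from germ_eq_pdI[OF W W0 hol2_chain[OF V(3) U(3,4)]]
  show "dX (subst_germ f a b) = subst_germ (dX f) a b * dX a + subst_germ (dY f) a b * dX b"
    "dY (subst_germ f a b) = subst_germ (dX f) a b * dY a + subst_germ (dY f) a b * dY b"
    using f a b 0 h by (simp_all add: subst_germ_germ_of dXY_germ_of germ_of_eq_iff flip: germ_of_add germ_of_mult)
qed

lemma germ_eqE:
  assumes "germ_eq f g"
  obtains V where "open V" "0 \<in> V" "\<And>z. z \<in> V \<Longrightarrow> f z = g z"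
proof -
  have "\<exists>V. open V \<and> 0 \<in> V \<and> (\<forall>z\<in>V. f z = g z)" using assms by (simp add: germ_eq_def eventually_nhds)
  then show thesis using that by blast
qed

lemma germ_eqI: "open V \<Longrightarrow> 0 \<in> V \<Longrightarrow> (\<And>z. z \<in> V \<Longrightarrow> f z = g z) \<Longrightarrow> germ_eq f g"
  unfolding germ_eq_def eventually_nhds by blast

text \<open>Restrictions to the axes x = 0 and y = 0, extended constantly to the plane. Thus
  \<open>ry c = c\<close> says that \<open>c\<close> is a germ in x alone, and
  \<open>rx c = c\<close> that it is a germ in y alone.\<close>

definition rx :: "germ \<Rightarrow> germ" where "rx f = subst_germ f 0 Y"
definition ry :: "germ \<Rightarrow> germ" where "ry f = subst_germ f X 0"
definition sw :: "germ \<Rightarrow> germ" where "sw f = subst_germ f Y X"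

fun pull :: "direction \<Rightarrow> germ \<Rightarrow> germ" where
  "pull (Slope c) f = subst_germ f X (X * (Y + C c))"
| "pull Vertical f = subst_germ f (X * Y) Y"

lemma rx_simps [simp]: "rx 0 = 0" "rx 1 = 1" "rx (f + g) = rx f + rx g" "rx (f - g) = rx f - rx g"
  "rx (f * g) = rx f * rx g" "rx (- f) = - rx f" "rx (C c) = C c" "rx X = 0" "rx Y = Y" "ev0 (rx f) = ev0 f"
  "rx (f ^ n) = rx f ^ n" "rx (sum h A) = (\<Sum>i\<in>A. rx (h i))" "rx (prod h A) = (\<Prod>i\<in>A. rx (h i))"
  by (simp_all add: rx_def subst_germ_simps subst_germ_power subst_germ_sum subst_germ_prod)

lemma ry_simps [simp]: "ry 0 = 0" "ry 1 = 1" "ry (f + g) = ry f + ry g" "ry (f - g) = ry f - ry g"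
  "ry (f * g) = ry f * ry g" "ry (- f) = - ry f" "ry (C c) = C c" "ry X = X" "ry Y = 0" "ev0 (ry f) = ev0 f"
  "ry (f ^ n) = ry f ^ n" "ry (sum h A) = (\<Sum>i\<in>A. ry (h i))" "ry (prod h A) = (\<Prod>i\<in>A. ry (h i))"
  by (simp_all add: ry_def subst_germ_simps subst_germ_power subst_germ_sum subst_germ_prod)

lemma sw_simps [simp]: "sw 0 = 0" "sw 1 = 1" "sw (f + g) = sw f + sw g" "sw (f - g) = sw f - sw g"
  "sw (f * g) = sw f * sw g" "sw (- f) = - sw f" "sw (C c) = C c" "sw X = Y" "sw Y = X" "ev0 (sw f) = ev0 f"
  "sw (f ^ n) = sw f ^ n" "sw (sum h A) = (\<Sum>i\<in>A. sw (h i))" "sw (prod h A) = (\<Prod>i\<in>A. sw (h i))"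
  by (simp_all add: sw_def subst_germ_simps subst_germ_power subst_germ_sum subst_germ_prod)

lemma pull_simps [simp]: "pull d 0 = 0" "pull d 1 = 1" "pull d (f + g) = pull d f + pull d g"
  "pull d (f - g) = pull d f - pull d g" "pull d (f * g) = pull d f * pull d g" "pull d (- f) = - pull d f"
  "pull d (C c) = C c" "ev0 (pull d f) = ev0 f" "pull d (f ^ n) = pull d f ^ n"
  "pull d (sum h A) = (\<Sum>i\<in>A. pull d (h i))" "pull d (prod h A) = (\<Prod>i\<in>A. pull d (h i))"
  by (cases d; simp add: subst_germ_simps subst_germ_power subst_germ_sum subst_germ_prod)+

declare pull.simps [simp del]

lemma pull_XY [simp]: "pull (Slope c) X = X" "pull (Slope c) Y = X * (Y + C c)" "pull Vertical X = X * Y" "pull Vertical Y = Y"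
  by (simp_all add: pull.simps subst_germ_simps)

lemma sw_sw [simp]: "sw (sw f) = f"
  by (simp add: sw_def subst_germ_subst_germ subst_germ_simps)

lemma sw_eq_iff [simp]: "sw f = sw g \<longleftrightarrow> f = g" "sw f = 0 \<longleftrightarrow> f = 0"
  by (metis sw_sw, metis sw_sw sw_simps(1))

lemma rx_sw: "rx (sw f) = sw (ry f)" and ry_sw: "ry (sw f) = sw (rx f)"
  by (simp_all add: rx_def ry_def sw_def subst_germ_subst_germ subst_germ_simps)

lemma rx_rx [simp]: "rx (rx f) = rx f" and ry_ry [simp]: "ry (ry f) = ry f"
  by (simp_all add: rx_def ry_def subst_germ_subst_germ subst_germ_simps)

lemma subst_germ_00 [simp]: "subst_germ f 0 0 = C (ev0 f)"
proof (cases f)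
  fix g assume "holomorphic_germ g" "f = germ_of g"
  then show ?thesis using subst_germ_germ_of[of g "\<lambda>_. 0" "\<lambda>_. 0"] by (simp add: germ_of_0 ev0_germ_of C_def zero_prod_def)
qed

lemma ry_rx [simp]: "ry (rx f) = C (ev0 f)" and rx_ry [simp]: "rx (ry f) = C (ev0 f)"
  by (simp_all add: rx_def ry_def subst_germ_subst_germ subst_germ_simps)

lemma rx_pull [simp]: "rx (pull Vertical f) = rx f" "rx (pull (Slope c) f) = C (ev0 f)"
  and ry_pull [simp]: "ry (pull Vertical f) = C (ev0 f)" "ry (pull (Slope 0) f) = ry f"
  by (simp_all add: rx_def ry_def pull.simps subst_germ_subst_germ subst_germ_simps C_simps)

lemma pull_Vertical_sw: "pull Vertical (sw f) = sw (pull (Slope 0) f)"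
  by (simp add: sw_def pull.simps subst_germ_subst_germ subst_germ_simps C_simps mult.commute)

section \<open>Divisibility by the coordinates and orders along the axes\<close>

lemma X_nonzero [simp]: "X \<noteq> 0" and Y_nonzero [simp]: "Y \<noteq> 0"
proof -
  have "dX 0 = 0" "dY 0 = 0" using dXY_const(1,2)[of 0] by (simp_all add: C_simps)
  then show "X \<noteq> 0" "Y \<noteq> 0" using dXY_const(3,6) by force+
qed

lemma X_dvd_iff: "X dvd f \<longleftrightarrow> rx f = 0"
proof
  assume "X dvd f"
  then show "rx f = 0" by (auto elim!: dvdE)
next
  assume 0: "rx f = 0"
  obtain f' where f: "holomorphic_germ f'" "f = germ_of f'" by (rule germ_of_cases)
  have h: "holomorphic_germ (\<lambda>z. f' (0, snd z))" using holomorphic_germ_compose[OF f(1), of "\<lambda>_. 0" snd] by simp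
  have "germ_of (\<lambda>z. f' (0, snd z)) = 0"
    using 0 f subst_germ_germ_of[OF f(1), of "\<lambda>_. 0" snd] by (simp add: rx_def Y_def germ_of_0)
  then have "germ_eq (\<lambda>z. f' (0, snd z)) (\<lambda>_. 0)" using h by (simp add: germ_of_eq_iff flip: germ_of_0)
  then obtain V :: "C2 set" where V: "open V" "0 \<in> V" "\<And>z. z \<in> V \<Longrightarrow> f' (0, snd z) = 0"
    using germ_eqE[of "\<lambda>z. f' (0, snd z)" "\<lambda>_. 0"] by blast
  obtain U where U: "open U" "0 \<in> U" "hol2 U f'" by (rule holomorphic_germ_open[OF f(1)])
  obtain R where R: "R > 0" "cball 0 R \<times> cball 0 R \<subseteq> U \<inter> V"
    using open_contains_polydisc[of "U \<inter> V" 0 0] U V by (auto simp: zero_prod_def)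
  have "hol2 (ball 0 R \<times> ball 0 R) f'" by (rule hol2_subset[OF U(3)]) (use R in auto)
  moreover have "f' (0, t) = 0" if "t \<in> ball 0 R" for t
  proof -
    have "(0, t) \<in> V" using R that by (auto simp: subset_iff)
    from V(3)[OF this] show ?thesis by simp
  qed
  ultimately obtain g where g: "hol2 (ball 0 R \<times> ball 0 R) g" "\<forall>z \<in> ball 0 R \<times> ball 0 R. f' z = fst z * g z"
    using hol2_divide_fst by blast
  have o: "open (ball 0 R \<times> ball 0 R :: C2 set)" "0 \<in> (ball 0 R \<times> ball 0 R :: C2 set)"
    using R by (auto intro: open_Times simp: zero_prod_def)
  have hg: "holomorphic_germ g" by (rule holomorphic_germI[OF o g(1)])
  have "germ_eq f' (\<lambda>z. fst z * g z)" by (rule germ_eqI[OF o]) (use g(2) in blast)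
  then have "f = X * germ_of g" using f hg by (simp add: X_def germ_of_eq_iff flip: germ_of_mult)
  then show "X dvd f" by simp
qed

lemma Y_dvd_iff: "Y dvd f \<longleftrightarrow> ry f = 0"
proof -
  have "Y dvd f \<longleftrightarrow> X dvd sw f"
  proof
    assume "Y dvd f" then show "X dvd sw f" by (auto elim!: dvdE)
  next
    assume "X dvd sw f"
    then obtain k where "sw f = X * k" by (elim dvdE)
    then have "f = Y * sw k" using sw_sw[of f] by simp
    then show "Y dvd f" by simp
  qed
  then show ?thesis by (simp add: X_dvd_iff rx_sw)
qed

text \<open>On each line t = const the function would have a zero of infinite order. The divisions
  must therefore take place on one polydisc that does not shrink with the exponent.\<close>

lemma X_power_dvd_imp_0:
  assumes "\<And>i. X ^ i dvd f" shows "f = 0"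
proof -
  obtain f' where f: "holomorphic_germ f'" "f = germ_of f'" by (rule germ_of_cases)
  obtain U where U: "open U" "0 \<in> U" "hol2 U f'" by (rule holomorphic_germ_open[OF f(1)])
  obtain R where R: "R > 0" "cball 0 R \<times> cball 0 R \<subseteq> U"
    using open_contains_polydisc[of U 0 0] U by (auto simp: zero_prod_def)
  let ?B = "ball 0 R \<times> ball 0 R :: C2 set"
  have B: "open ?B" "0 \<in> ?B" using R by (auto intro: open_Times simp: zero_prod_def)
  have hf: "hol2 ?B f'" by (rule hol2_subset[OF U(3)]) (use R in auto)
  have "\<exists>g. hol2 ?B g \<and> (\<forall>z\<in>?B. f' z = fst z ^ i * g z)" for i
  proof (induction i)
    case 0
    then show ?case using hf by auto
  next
    case (Suc i)
    then obtain g where g: "hol2 ?B g" "\<forall>z\<in>?B. f' z = fst z ^ i * g z" by blast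
    have hg: "holomorphic_germ g" by (rule holomorphic_germI[OF B g(1)])
    have Xi: "X ^ i = germ_of (\<lambda>z. fst z ^ i) \<and> holomorphic_germ (\<lambda>z. fst z ^ i)" for i
      by (induction i) (auto simp: X_def gm_1 germ_of_mult)
    have "germ_eq f' (\<lambda>z. fst z ^ i * g z)" by (rule germ_eqI[OF B]) (use g(2) in blast)
    then have "f = X ^ i * germ_of g" using f hg Xi[of i] by (simp add: germ_of_eq_iff flip: germ_of_mult)
    moreover obtain k where "f = X ^ Suc i * k" using assms[of "Suc i"] by (elim dvdE)
    ultimately have "germ_of g = X * k" using X_nonzero by (simp add: mult.assoc)
    then have "rx (germ_of g) = 0" by simp
    moreover have h: "holomorphic_germ (\<lambda>z. g (0, snd z))" using holomorphic_germ_compose[OF hg, of "\<lambda>_. 0" snd] by simp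
    ultimately have "germ_eq (\<lambda>z. g (0, snd z)) (\<lambda>_. 0)"
      using subst_germ_germ_of[OF hg, of "\<lambda>_. 0" snd] by (simp add: rx_def Y_def germ_of_eq_iff flip: germ_of_0)
    then have ev: "\<forall>\<^sub>F z in nhds (0 :: C2). g (0, snd z) = 0" by (simp add: germ_eq_def)
    \<comment> \<open>The quotient of germs is known only near the origin; the identity theorem
      extends the vanishing on x = 0 to the whole disc.\<close>
    have "g (0, t) = 0" if "t \<in> ball 0 R" for t
    proof -
      have "hol2 ?B (\<lambda>z. g (0, snd z))"
        by (rule hol2_compose[OF g(1)]) (use R in auto)
      from hol2_identity[OF this B(1) _ B(2) ev, of "(0, t)"]
      show ?thesis using that R by (auto intro: convex_Times)
    qed
    then obtain g' where g': "hol2 ?B g'" "\<forall>z\<in>?B. g z = fst z * g' z"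
      using hol2_divide_fst[OF g(1)] by blast
    then show ?case using g by (intro exI[of _ g']) auto
  qed
  then obtain G where G: "\<And>i. hol2 ?B (G i)" "\<And>i z. z \<in> ?B \<Longrightarrow> f' z = fst z ^ i * G i z" by metis
  have "f' (s, t) = 0" if st: "(s, t) \<in> ?B" for s t
  proof (rule ccontr)
    assume nz: "f' (s, t) \<noteq> 0"
    have st': "s \<in> ball 0 R" "t \<in> ball 0 R" using st by auto
    have "(\<lambda>s. f' (s, t)) holomorphic_on ball 0 R"
      by (rule hol2_holomorphic_on1[OF hf]) (use st' in auto)
    then obtain h n where h: "h holomorphic_on ball 0 R" "h 0 \<noteq> 0" "\<And>w. w \<in> ball 0 R \<Longrightarrow> f' (w, t) = w ^ n * h w"
      using holomorphic_factor_at_0[of "\<lambda>s. f' (s, t)" R s] st'(1) nz by metis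
    have Gh: "(\<lambda>w. G (Suc n) (w, t)) holomorphic_on ball 0 R"
      by (rule hol2_holomorphic_on1[OF G(1)]) (use st' in auto)
    have "h w = w * G (Suc n) (w, t)" if "w \<in> ball 0 R - {0}" for w
      using h(3)[of w] G(2)[of "(w, t)" "Suc n"] that st' by simp
    then have *: "h w - w * G (Suc n) (w, t) = 0" if "w \<in> ball 0 R - {0}" for w using that by simp
    have c: "continuous_on (ball 0 R) (\<lambda>w. h w - w * G (Suc n) (w, t))"
      by (intro continuous_intros holomorphic_on_imp_continuous_on h(1) Gh)
    have "h 0 - 0 * G (Suc n) (0, t) = 0"
    proof (rule tendsto_unique[of "at 0"])
      have "isCont (\<lambda>w. h w - w * G (Suc n) (w, t)) 0"
        using c R by (simp add: continuous_on_eq_continuous_at)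
      then show "((\<lambda>w. h w - w * G (Suc n) (w, t)) \<longlongrightarrow> h 0 - 0 * G (Suc n) (0, t)) (at 0)"
        by (simp add: isCont_def)
      have "\<forall>\<^sub>F w in at (0 :: complex). w \<in> ball 0 R - {0}" using R by (intro eventually_at_in_open) auto
      then have "\<forall>\<^sub>F w in at 0. h w - w * G (Suc n) (w, t) = 0" by eventually_elim (rule *)
      then show "((\<lambda>w. h w - w * G (Suc n) (w, t)) \<longlongrightarrow> 0) (at 0)" by (rule tendsto_eventually)
    qed simp
    then show False using h(2) by simp
  qed
  then have "germ_eq f' (\<lambda>_. 0)" by (intro germ_eqI[OF B]) auto
  then show ?thesis using f by (simp add: germ_of_eq_iff flip: germ_of_0)
qed

lemma X_order:
  assumes "f \<noteq> 0" obtains i g where "f = X ^ i * g" "rx g \<noteq> 0"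
proof -
  obtain i where i: "\<not> X ^ i dvd f" using X_power_dvd_imp_0 assms by blast
  define m where "m = (LEAST i. \<not> X ^ i dvd f)"
  have m: "\<not> X ^ m dvd f" unfolding m_def using i by (rule LeastI)
  then have "m \<noteq> 0" by (cases m) auto
  then obtain j where j: "m = Suc j" by (cases m) auto
  then have "X ^ j dvd f" using not_less_Least[of j "\<lambda>i. \<not> X ^ i dvd f"] by (auto simp: m_def[symmetric])
  then obtain g where g: "f = X ^ j * g" by (elim dvdE)
  have "rx g \<noteq> 0"
  proof
    assume "rx g = 0"
    then obtain k where "g = X * k" by (auto simp: X_dvd_iff[symmetric] elim: dvdE)
    then show False using m g j by (simp add: mult.assoc mult.left_commute)
  qed
  with g show thesis by (rule that)
qed

lemma xgerm_order:
  assumes "ry c = c" "c \<noteq> 0" obtains n u where "c = X ^ n * u" "ev0 u \<noteq> 0" "ry u = u"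
proof -
  obtain i g where g: "c = X ^ i * g" "rx g \<noteq> 0" using X_order[OF assms(2)] .
  have "X ^ i * ry g = X ^ i * g" using assms(1) g(1) by (metis ry_simps(5,8,11))
  then have r: "ry g = g" by simp
  then have "rx g = C (ev0 g)" by (metis rx_ry)
  then have "ev0 g \<noteq> 0" using g(2) by simp
  with g r show thesis using that by blast
qed

lemma rx_order:
  assumes "rx f \<noteq> 0" obtains n u where "rx f = Y ^ n * u" "ev0 u \<noteq> 0"
proof -
  have "ry (sw (rx f)) = sw (rx f)" by (simp add: ry_sw)
  then obtain n u where "sw (rx f) = X ^ n * u" "ev0 u \<noteq> 0" using xgerm_order assms by (metis sw_eq_iff(2))
  then have "rx f = Y ^ n * sw u" "ev0 (sw u) \<noteq> 0" using sw_sw[of "rx f"] by auto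
  then show thesis by (rule that)
qed

lemma Y_power_unit_eq:
  assumes "Y ^ n * u = Y ^ m * v" "ev0 u \<noteq> 0" "ev0 v \<noteq> (0 :: complex)" shows "n = m \<and> u = v"
proof -
  have "n = m" if h: "Y ^ n * u = Y ^ m * v" "ev0 u \<noteq> 0" "ev0 v \<noteq> (0 :: complex)" "n \<le> m" for n m u v
  proof (rule ccontr)
    assume "n \<noteq> m"
    then obtain k where "m = n + Suc k" using h(4) less_imp_Suc_add by fastforce
    then have "Y ^ n * u = Y ^ n * (Y ^ Suc k * v)" using h(1) by (simp add: power_add mult_ac)
    then have "u = Y ^ Suc k * v" by (subst (asm) mult_cancel_left) simp
    then show False using h(2) by simp
  qed
  then have "n = m" using assms by (metis nle_le)
  with assms show ?thesis by simp
qed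

lemma X_power_unit_eq:
  assumes "X ^ n * u = X ^ m * v" "ev0 u \<noteq> 0" "ev0 v \<noteq> (0 :: complex)" shows "n = m \<and> u = v"
proof -
  have "sw (X ^ n * u) = sw (X ^ m * v)" using assms(1) by (rule arg_cong)
  then have "Y ^ n * sw u = Y ^ m * sw v" by (simp only: sw_simps)
  from Y_power_unit_eq[OF this] assms(2,3) show ?thesis by simp
qed

lemma X_power_rx_eq:
  assumes "X ^ n * u = X ^ m * v" "rx u \<noteq> 0" "rx v \<noteq> 0" shows "n = m \<and> u = v"
proof -
  have "n = m" if h: "X ^ n * u = X ^ m * v" "rx u \<noteq> 0" "rx v \<noteq> 0" "n \<le> m" for n m u v
  proof (rule ccontr)
    assume "n \<noteq> m"
    then obtain k where "m = n + Suc k" using h(4) less_imp_Suc_add by fastforce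
    then have "X ^ n * u = X ^ n * (X ^ Suc k * v)" using h(1) by (simp add: power_add mult_ac)
    then have "u = X ^ Suc k * v" by (subst (asm) mult_cancel_left) simp
    then show False using h(2) by simp
  qed
  then have "n = m" using assms by (metis nle_le)
  with assms show ?thesis by simp
qed

text \<open>Intersection numbers with the axes \<open>x = 0\<close> and \<open>y = 0\<close>; meaningless if \<open>f\<close> vanishes on the axis.\<close>

definition ox :: "germ \<Rightarrow> nat" where "ox f = (THE n. \<exists>u. rx f = Y ^ n * u \<and> ev0 u \<noteq> 0)"
definition oy :: "germ \<Rightarrow> nat" where "oy f = ox (sw f)"

lemma ox_eqI: "rx f = Y ^ n * u \<Longrightarrow> ev0 u \<noteq> 0 \<Longrightarrow> ox f = n"
  unfolding ox_def by (rule the_equality) (use Y_power_unit_eq in metis)+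

lemma ox_ex: "rx f \<noteq> 0 \<Longrightarrow> \<exists>u. rx f = Y ^ ox f * u \<and> ev0 u \<noteq> 0"
  by (metis rx_order ox_eqI)

lemma oy_eqI: "ry f = X ^ n * u \<Longrightarrow> ev0 u \<noteq> 0 \<Longrightarrow> oy f = n"
  unfolding oy_def by (rule ox_eqI[of _ _ "sw u"]) (simp_all add: rx_sw)

lemma oy_ex: "ry f \<noteq> 0 \<Longrightarrow> \<exists>u. ry f = X ^ oy f * u \<and> ev0 u \<noteq> 0"
  using ox_ex[of "sw f"] unfolding oy_def
  by (metis rx_sw sw_eq_iff(2) sw_simps(5,9,10,11) sw_sw)

lemma ox_mult:
  assumes "rx f \<noteq> 0" "rx g \<noteq> 0" shows "ox (f * g) = ox f + ox g"
proof -
  obtain u v where "rx f = Y ^ ox f * u" "ev0 u \<noteq> 0" "rx g = Y ^ ox g * v" "ev0 v \<noteq> 0"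
    using assms ox_ex by metis
  then show ?thesis by (intro ox_eqI[of _ _ "u * v"]) (simp_all add: power_add mult_ac)
qed

lemma ox_unit: "ev0 f \<noteq> 0 \<Longrightarrow> ox f = 0"
  by (rule ox_eqI[of _ _ "rx f"]) auto

lemma oy_mult: "ry f \<noteq> 0 \<Longrightarrow> ry g \<noteq> 0 \<Longrightarrow> oy (f * g) = oy f + oy g"
  by (simp add: oy_def ox_mult rx_sw)

lemma oy_unit: "ev0 f \<noteq> 0 \<Longrightarrow> oy f = 0"
  by (simp add: oy_def ox_unit)

lemma ox_eq_0_iff: "rx f \<noteq> 0 \<Longrightarrow> ox f = 0 \<longleftrightarrow> ev0 f \<noteq> 0"
proof -
  assume "rx f \<noteq> 0"
  then obtain u where "rx f = Y ^ ox f * u" "ev0 u \<noteq> 0" using ox_ex by blast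
  then show ?thesis using ox_unit[of f] by (metis ev0_CXY(3) ev0_power ev0_simps(5) mult_1 mult_eq_0_iff power_0 rx_simps(10) power_0_left)
qed

lemma unit_rx_ry: "ev0 f \<noteq> 0 \<Longrightarrow> rx f \<noteq> 0 \<and> ry f \<noteq> 0"
  by (metis ev0_simps(1) rx_simps(10) ry_simps(10))

text \<open>The coefficients are numbered from the leading term: under a blow-up that keeps the
  degree, the k-th coefficient loses the factor \<open>X ^ k\<close>, and a curve descends to the
  plane by gaining this factor.\<close>

lemma germ_weierstrass:
  assumes "rx f \<noteq> 0"
  obtains U c where "ev0 U \<noteq> 0" "\<And>k :: nat. ry (c k) = c k" "c 0 = 1" "\<And>k. k \<ge> 1 \<Longrightarrow> ev0 (c k) = 0"
    "f = U * (\<Sum>k\<le>ox f. c k * Y ^ (ox f - k))"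
proof -
  obtain f' where f: "holomorphic_germ f'" "f = germ_of f'" by (rule germ_of_cases)
  obtain V where V: "open V" "0 \<in> V" "hol2 V f'" by (rule holomorphic_germ_open[OF f(1)])
  obtain R where R: "R > 0" "cball 0 R \<times> cball 0 R \<subseteq> V"
    using open_contains_polydisc[of V 0 0] V by (auto simp: zero_prod_def)
  let ?B = "\<lambda>R. ball 0 R \<times> ball 0 R :: C2 set"
  have B: "open (?B R)" "0 \<in> ?B R" if "R > 0" for R using that by (auto intro: open_Times simp: zero_prod_def)
  have hf: "hol2 (?B R) f'" by (rule hol2_subset[OF V(3)]) (use R in auto)
  have rxf: "rx f = germ_of (\<lambda>z. f' (0, snd z))"
    using f subst_germ_germ_of[OF f(1), of "\<lambda>_. 0" snd] by (simp add: rx_def Y_def germ_of_0)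
  have h0: "holomorphic_germ (\<lambda>z. f' (0, snd z))" using holomorphic_germ_compose[OF f(1), of "\<lambda>_. 0" snd] by simp
  have "\<exists>w\<in>ball 0 R. f' (0, w) \<noteq> 0"
  proof (rule ccontr)
    assume "\<not> ?thesis"
    then have "germ_eq (\<lambda>z. f' (0, snd z)) (\<lambda>_. 0)"
      by (intro germ_eqI[OF B[OF R(1)]]) auto
    then show False using assms h0 by (simp add: rxf germ_of_eq_iff flip: germ_of_0)
  qed
  then obtain w where w: "w \<in> ball 0 R" "f' (0, w) \<noteq> 0" by blast
  have "(\<lambda>t. f' (0, t)) holomorphic_on ball 0 R" using R by (intro hol2_holomorphic_on2[OF hf]) auto
  then obtain h n where h: "h holomorphic_on ball 0 R" "h 0 \<noteq> 0" "\<And>t. t \<in> ball 0 R \<Longrightarrow> f' (0, t) = t ^ n * h t"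
    using holomorphic_factor_at_0[of _ R w] w by metis
  from weierstrass_preparation_analytic[OF R(1) hf h]
  obtain r c U where rc: "0 < r" "\<forall>k :: nat. c k holomorphic_on ball 0 r" "\<forall>k\<ge>1. c k 0 = 0" "\<forall>s. c 0 s = 1"
    and U: "hol2 (?B r) U" "\<forall>z\<in>?B r. U z \<noteq> 0"
    and fW: "\<forall>s\<in>ball 0 r. \<forall>t\<in>ball 0 r. f' (s, t) = U (s, t) * (\<Sum>k\<le>n. c k s * t ^ (n - k))"
    by blast
  have hU: "holomorphic_germ U" by (rule holomorphic_germI[OF B[OF rc(1)] U(1)])
  have U0: "U 0 \<noteq> 0" by (rule bspec[OF U(2) B(2)[OF rc(1)]])
  have hc: "holomorphic_germ (\<lambda>z. c k (fst z))" for k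
    by (rule holomorphic_germI[OF B[OF rc(1)] hol2_fst_holomorphic[OF spec[OF rc(2)] open_ball]])
  have hs: "germ_of (\<lambda>z. snd z ^ m) = Y ^ m \<and> holomorphic_germ (\<lambda>z. snd z ^ m)" for m
    by (induction m) (auto simp: Y_def gm_1 germ_of_mult)
  have hsum: "germ_of (\<lambda>z. \<Sum>k\<in>A. c k (fst z) * snd z ^ (n - k)) = (\<Sum>k\<in>A. germ_of (\<lambda>z. c k (fst z)) * Y ^ (n - k)) \<and>
     holomorphic_germ (\<lambda>z. \<Sum>k\<in>A. c k (fst z) * snd z ^ (n - k))" if "finite A" for A
    using that
  proof (induction A)
    case (insert k A)
    have "germ_of (\<lambda>z. c k (fst z) * snd z ^ (n - k)) = germ_of (\<lambda>z. c k (fst z)) * Y ^ (n - k)"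
      using hs[of "n - k"] hc[of k] by (simp add: germ_of_mult)
    moreover have "holomorphic_germ (\<lambda>z. c k (fst z) * snd z ^ (n - k))" using hs hc by simp
    ultimately show ?case using insert by (simp add: germ_of_add)
  qed (simp add: germ_of_0)
  define S where "S z = (\<Sum>k\<le>n. c k (fst z) * snd z ^ (n - k))" for z :: C2
  have S: "germ_of S = (\<Sum>k\<le>n. germ_of (\<lambda>z. c k (fst z)) * Y ^ (n - k))" "holomorphic_germ S"
    using hsum[of "{..n}"] by (simp_all add: S_def[abs_def])
  have "germ_eq f' (\<lambda>z. U z * S z)"
    by (rule germ_eqI[OF B[OF rc(1)]]) (use fW in \<open>auto simp: S_def\<close>)
  then have "germ_of f' = germ_of (\<lambda>z. U z * S z)" using f(1) hU S(2) by (simp add: germ_of_eq_iff)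
  then have feq: "f = germ_of U * (\<Sum>k\<le>n. germ_of (\<lambda>z. c k (fst z)) * Y ^ (n - k))"
    using f(2) hU S by (simp add: germ_of_mult)
  have c0: "germ_of (\<lambda>z. c 0 (fst z)) = 1" using rc(4) by (simp add: gm_1)
  have ck: "ev0 (germ_of (\<lambda>z. c k (fst z))) = 0" if "k \<ge> 1" for k using rc(3) that hc[of k] by (simp add: ev0_germ_of zero_prod_def)
  have ryc: "ry (germ_of (\<lambda>z. c k (fst z))) = germ_of (\<lambda>z. c k (fst z))" for k
    using subst_germ_germ_of[OF hc[of k], of fst "\<lambda>_. 0"] by (simp add: ry_def X_def germ_of_0)
  have rxc: "rx (germ_of (\<lambda>z. c k (fst z))) = C (ev0 (germ_of (\<lambda>z. c k (fst z))))" for k using rx_ry[of "germ_of (\<lambda>z. c k (fst z))"] by (simp add: ryc)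
  have "{..n} = insert 0 {1..n}" by auto
  then have "rx (\<Sum>k\<le>n. germ_of (\<lambda>z. c k (fst z)) * Y ^ (n - k)) = Y ^ n"
    by (simp add: rxc ck c0 C_simps)
  then have "rx f = Y ^ n * rx (germ_of U)" by (simp add: feq mult.commute)
  then have n: "ox f = n" by (rule ox_eqI) (simp add: ev0_germ_of hU U0)
  show thesis
    by (rule that[of "germ_of U" "\<lambda>k. germ_of (\<lambda>z. c k (fst z))"]) (simp_all add: n ryc c0 ck feq[symmetric] ev0_germ_of hU U0)
qed

section \<open>Multiplicity and strict transforms\<close>

definition poly_at :: "complex poly \<Rightarrow> germ \<Rightarrow> germ" where
  "poly_at P g = fold_coeffs (\<lambda>a b. C a + g * b) P 0"

lemma poly_at_0 [simp]: "poly_at 0 g = 0" by (simp add: poly_at_def)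

lemma poly_at_pCons [simp]: "poly_at (pCons a p) g = C a + g * poly_at p g"
  by (cases "p = 0 \<and> a = 0") (auto simp: poly_at_def C_simps)

lemma poly_at_add: "poly_at (p + q) g = poly_at p g + poly_at q g"
  by (induction p q rule: poly_induct2) (auto simp: C_simps algebra_simps)

lemma poly_at_smult: "poly_at (smult a p) g = C a * poly_at p g"
  by (induction p) (auto simp: C_simps algebra_simps)

lemma poly_at_1 [simp]: "poly_at 1 g = 1" by (simp add: one_pCons C_simps)

lemma poly_at_mult: "poly_at (p * q) g = poly_at p g * poly_at q g"
  by (induction p) (auto simp: poly_at_add poly_at_smult C_simps algebra_simps)

lemma poly_at_power: "poly_at (p ^ n) g = poly_at p g ^ n"
  by (induction n) (auto simp: poly_at_mult)

lemma poly_at_monom: "poly_at (monom c n) g = C c * g ^ n"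
  by (induction n) (auto simp: monom_0 monom_Suc C_simps mult_ac)

lemma poly_at_sum: "poly_at (sum f A) g = (\<Sum>i\<in>A. poly_at (f i) g)"
  by (induction A rule: infinite_finite_induct) (auto simp: poly_at_add)

lemma ev0_poly_at [simp]: "ev0 (poly_at P g) = poly P (ev0 g)"
  by (induction P) auto

lemma poly_at_order:
  assumes "P \<noteq> 0" shows "\<exists>u. poly_at P (Y + C c) = Y ^ order c P * u \<and> ev0 u \<noteq> 0"
proof -
  obtain q where q: "P = [:- c, 1:] ^ order c P * q" "\<not> [:- c, 1:] dvd q" using order_decomp[OF assms] by blast
  have "poly_at [:- c, 1:] (Y + C c) = Y" by (simp add: C_simps)
  then have "poly_at ([:- c, 1:] ^ order c P * q) (Y + C c) = Y ^ order c P * poly_at q (Y + C c)"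
    by (simp only: poly_at_mult poly_at_power)
  moreover have "ev0 (poly_at q (Y + C c)) \<noteq> 0" using q(2) by (simp add: poly_eq_0_iff_dvd)
  ultimately show ?thesis using q(1) by metis
qed

lemma hadamard:
  assumes "ev0 f = 0" shows "\<exists>a b. f = X * a + Y * b"
proof -
  have "X dvd f - rx f" by (simp add: X_dvd_iff)
  moreover have "Y dvd rx f" using assms by (simp add: Y_dvd_iff C_simps)
  ultimately obtain a b where ab: "f - rx f = X * a" "rx f = Y * b" by (auto elim!: dvdE)
  have "f = X * a + Y * b" by (metis ab diff_add_cancel)
  then show ?thesis by blast
qed

lemma pull_Slope_shear: "pull (Slope c) f = pull (Slope 0) (subst_germ f X (Y + C c * X))"
  by (simp add: pull.simps subst_germ_subst_germ subst_germ_simps C_simps algebra_simps)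

lemma pull_eq_0_iff [simp]: "pull d f = 0 \<longleftrightarrow> f = 0"
proof -
  have V: "pull Vertical f \<noteq> 0" if nz: "f \<noteq> 0" for f
  proof -
    obtain i g where g: "f = X ^ i * g" "rx g \<noteq> 0" by (rule X_order[OF nz])
    then have "pull Vertical g \<noteq> 0" by (metis rx_pull(1) rx_simps(1))
    then show ?thesis using g by simp
  qed
  have "pull d f \<noteq> 0" if "f \<noteq> 0"
  proof (cases d)
    case (Slope c)
    have "subst_germ f X (Y + C c * X) \<noteq> 0"
    proof
      assume "subst_germ f X (Y + C c * X) = 0"
      then have "subst_germ (subst_germ f X (Y + C c * X)) X (Y - C c * X) = 0" by (simp add: subst_germ_simps)
      then show False using that by (simp add: subst_germ_subst_germ subst_germ_simps)
    qed
    then have "pull Vertical (sw (subst_germ f X (Y + C c * X))) \<noteq> 0" by (intro V) simp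
    then show ?thesis by (simp add: Slope pull_Slope_shear[of c f] pull_Vertical_sw)
  qed (use V that in auto)
  then show ?thesis by auto
qed

text \<open>\<open>e\<close> is the order of \<open>f\<close> at the origin and \<open>P t\<close> the value of its leading form at \<open>(1, t)\<close>, so that the
  zeros of \<open>P\<close>, together with \<open>Vertical\<close> if \<open>degree P < e\<close>, are the tangents of \<open>f\<close>.\<close>

definition order_form :: "germ \<Rightarrow> nat \<Rightarrow> complex poly \<Rightarrow> bool" where
  "order_form f e P \<longleftrightarrow> P \<noteq> 0 \<and> degree P \<le> e \<and>
     (\<forall>c. \<exists>g. pull (Slope c) f = X ^ e * g \<and> rx g = poly_at P (Y + C c)) \<and>
     (\<exists>g u. pull Vertical f = Y ^ e * g \<and> ry g = X ^ (e - degree P) * u \<and> ev0 u \<noteq> 0) \<and>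
     (rx f \<noteq> 0 \<longrightarrow> e \<le> ox f \<and> (ox f = e \<longrightarrow> degree P = e)) \<and>
     (ry f \<noteq> 0 \<longrightarrow> e \<le> oy f \<and> (oy f = e \<longrightarrow> poly P 0 \<noteq> 0))"

text \<open>If all coefficients vanished at the origin for every exponent, they could be expanded
  again and again, so \<open>f\<close> would lie in every power of the maximal ideal and its
  pull-back would be divisible by every power of \<open>X\<close>.\<close>

lemma order_expansion:
  assumes "f \<noteq> 0" shows "\<exists>e a. f = (\<Sum>j\<le>e. X ^ (e - j) * Y ^ j * a j) \<and> (\<exists>j\<le>e. ev0 (a j) \<noteq> 0)"
proof (rule ccontr)
  assume *: "\<not> ?thesis"
  have inm: "\<exists>a. f = (\<Sum>j\<le>e. X ^ (e - j) * Y ^ j * a j)" for e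
  proof (induction e)
    case 0
    show ?case by (intro exI[of _ "\<lambda>_. f"]) simp
  next
    case (Suc e)
    then obtain a where a: "f = (\<Sum>j\<le>e. X ^ (e - j) * Y ^ j * a j)" by blast
    then have "\<forall>j\<le>e. ev0 (a j) = 0" using * by blast
    then have "\<forall>j. \<exists>b c. j \<le> e \<longrightarrow> a j = X * b + Y * c" using hadamard by blast
    then obtain b c where bc: "\<And>j. j \<le> e \<Longrightarrow> a j = X * b j + Y * c j" by metis
    define B where "B j = (if j \<le> e then b j else 0)" for j
    define D where "D j = (case j of 0 \<Rightarrow> 0 | Suc i \<Rightarrow> c i)" for j
    have "(\<Sum>j\<le>Suc e. X ^ (Suc e - j) * Y ^ j * B j) = (\<Sum>j\<le>e. X ^ (e - j) * Y ^ j * (X * b j))"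
      by (simp add: B_def Suc_diff_le mult_ac)
    moreover have "(\<Sum>j\<le>Suc e. X ^ (Suc e - j) * Y ^ j * D j) = (\<Sum>j\<le>e. X ^ (e - j) * Y ^ j * (Y * c j))"
      by (subst sum.atMost_Suc_shift) (simp add: D_def mult_ac)
    ultimately have "(\<Sum>j\<le>Suc e. X ^ (Suc e - j) * Y ^ j * (B j + D j)) = (\<Sum>j\<le>e. X ^ (e - j) * Y ^ j * (X * b j + Y * c j))"
      by (simp only: distrib_left sum.distrib)
    also have "\<dots> = f" unfolding a by (intro sum.cong) (simp_all add: bc)
    finally show ?case by (intro exI[of _ "\<lambda>j. B j + D j"]) simp
  qed
  have "X ^ e dvd pull (Slope 0) f" for e
  proof -
    obtain a where a: "f = (\<Sum>j\<le>e. X ^ (e - j) * Y ^ j * a j)" using inm by blast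
    have *: "X ^ e dvd X ^ (e - j) * (X * (Y + C 0)) ^ j" if "j \<le> e" for j
      using that by (simp add: power_mult_distrib flip: mult.assoc power_add)
    have "pull (Slope 0) f = (\<Sum>j\<le>e. X ^ (e - j) * (X * (Y + C 0)) ^ j * pull (Slope 0) (a j))"
      unfolding a by (simp only: pull_simps pull_XY)
    then show ?thesis by (simp only:) (intro dvd_sum dvd_mult2 *, simp)
  qed
  then have "pull (Slope 0) f = 0" by (rule X_power_dvd_imp_0)
  then show False using assms by simp
qed

text \<open>The leading form has the coefficients \<open>ev0 (a j)\<close>, and \<open>P\<close> is
  this form at (1, t). The drop of its degree below \<open>e\<close> is the multiplicity of the
  vertical tangent.\<close>

lemma order_form_ex:
  assumes "f \<noteq> 0" shows "\<exists>e P. order_form f e P"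
proof -
  obtain e a where a: "f = (\<Sum>j\<le>e. X ^ (e - j) * Y ^ j * a j)" "\<exists>j\<le>e. ev0 (a j) \<noteq> 0"
    using order_expansion[OF assms] by blast
  define P where "P = (\<Sum>j\<le>e. monom (ev0 (a j)) j)"
  have cP: "coeff P j = (if j \<le> e then ev0 (a j) else 0)" for j
    unfolding P_def coeff_sum coeff_monom by (simp add: sum.delta)
  have P0: "P \<noteq> 0" using a(2) cP by (metis coeff_0)
  have dP: "degree P \<le> e" by (rule degree_le) (simp add: cP)
  have slope: "\<exists>g. pull (Slope c) f = X ^ e * g \<and> rx g = poly_at P (Y + C c)" for c
  proof (intro exI conjI)
    have "X ^ (e - j) * (X * (Y + C c)) ^ j = X ^ e * (Y + C c) ^ j" if "j \<le> e" for j
      using that by (simp add: power_mult_distrib flip: mult.assoc power_add)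
    then show "pull (Slope c) f = X ^ e * (\<Sum>j\<le>e. (Y + C c) ^ j * pull (Slope c) (a j))"
      unfolding a(1) by (simp add: sum_distrib_left mult.assoc[symmetric])
    show "rx (\<Sum>j\<le>e. (Y + C c) ^ j * pull (Slope c) (a j)) = poly_at P (Y + C c)"
      by (simp add: P_def poly_at_sum poly_at_monom mult.commute)
  qed
  have vert: "\<exists>g u. pull Vertical f = Y ^ e * g \<and> ry g = X ^ (e - degree P) * u \<and> ev0 u \<noteq> 0"
  proof (intro exI conjI)
    have "(X * Y) ^ (e - j) * Y ^ j = Y ^ e * X ^ (e - j)" if "j \<le> e" for j
    proof -
      have "Y ^ (e - j) * Y ^ j = Y ^ e" using that by (simp flip: power_add)
      then show ?thesis by (simp add: power_mult_distrib mult_ac)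
    qed
    then show "pull Vertical f = Y ^ e * (\<Sum>j\<le>e. X ^ (e - j) * pull Vertical (a j))"
      unfolding a(1) by (simp add: sum_distrib_left mult.assoc[symmetric])
    have "ry (\<Sum>j\<le>e. X ^ (e - j) * pull Vertical (a j)) = (\<Sum>j\<le>e. X ^ (e - j) * C (coeff P j))"
      by (simp add: cP)
    also have "\<dots> = (\<Sum>j\<le>degree P. X ^ (e - j) * C (coeff P j))"
      by (rule sum.mono_neutral_right) (use dP in \<open>auto simp: coeff_eq_0 C_simps\<close>)
    also have "\<dots> = (\<Sum>j\<le>degree P. X ^ (e - degree P) * (X ^ (degree P - j) * C (coeff P j)))"
      by (rule sum.cong) (use dP in \<open>auto simp flip: mult.assoc power_add\<close>)
    also have "\<dots> = X ^ (e - degree P) * (\<Sum>j\<le>degree P. X ^ (degree P - j) * C (coeff P j))"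
      by (simp add: sum_distrib_left)
    finally show "ry (\<Sum>j\<le>e. X ^ (e - j) * pull Vertical (a j)) =
      X ^ (e - degree P) * (\<Sum>j\<le>degree P. X ^ (degree P - j) * C (coeff P j))" .
    have "(\<Sum>j\<le>degree P. 0 ^ (degree P - j) * coeff P j) = (\<Sum>j\<le>degree P. if j = degree P then coeff P j else 0)"
      by (rule sum.cong) (auto simp: power_0_left)
    then show "ev0 (\<Sum>j\<le>degree P. X ^ (degree P - j) * C (coeff P j)) \<noteq> 0" using P0 by simp
  qed
  have rxf: "rx f = Y ^ e * rx (a e)"
  proof -
    have "rx f = (\<Sum>j\<le>e. if j = e then Y ^ e * rx (a e) else 0)"
      unfolding a(1) by (simp only: rx_simps, intro sum.cong) (auto simp: power_0_left)
    then show ?thesis by simp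
  qed
  have ryf: "ry f = X ^ e * ry (a 0)"
  proof -
    have "ry f = (\<Sum>j\<le>e. if j = 0 then X ^ e * ry (a 0) else 0)"
      unfolding a(1) by (simp only: ry_simps, intro sum.cong) (auto simp: power_0_left)
    then show ?thesis by simp
  qed
  have 1: "e \<le> ox f \<and> (ox f = e \<longrightarrow> degree P = e)" if "rx f \<noteq> 0"
  proof -
    have "rx (a e) \<noteq> 0" using that rxf by auto
    moreover have "ox (Y ^ e) = e" by (rule ox_eqI[of _ _ 1]) auto
    moreover have "ox f = ox (Y ^ e * a e)" by (simp add: ox_def rxf)
    ultimately have o: "ox f = e + ox (a e)" by (simp add: ox_mult)
    have "degree P = e" if "ox f = e"
    proof -
      have "coeff P e \<noteq> 0" using that o ox_eq_0_iff[OF \<open>rx (a e) \<noteq> 0\<close>] by (simp add: cP)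
      then show ?thesis using dP le_degree le_antisym by blast
    qed
    with o show ?thesis by simp
  qed
  have 2: "e \<le> oy f \<and> (oy f = e \<longrightarrow> poly P 0 \<noteq> 0)" if "ry f \<noteq> 0"
  proof -
    have "ry (a 0) \<noteq> 0" using that ryf by auto
    moreover have "oy (X ^ e) = e" by (rule oy_eqI[of _ _ 1]) auto
    moreover have "oy f = oy (X ^ e * a 0)" by (simp add: oy_def ox_def rx_sw ryf)
    ultimately have o: "oy f = e + oy (a 0)" by (simp add: oy_mult)
    have "poly P 0 \<noteq> 0" if "oy f = e"
      using that o ox_eq_0_iff[of "sw (a 0)"] \<open>ry (a 0) \<noteq> 0\<close> by (simp add: cP poly_0_coeff_0 oy_def rx_sw)
    with o show ?thesis by simp
  qed
  show ?thesis unfolding order_form_def using P0 dP slope vert 1 2 by blast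
qed

section \<open>Order, leading polynomial and strict transform\<close>

definition ord0_lead :: "germ \<Rightarrow> nat \<times> complex poly" where
  "ord0_lead f = (SOME p. order_form f (fst p) (snd p))"

definition ord0 :: "germ \<Rightarrow> nat" where "ord0 f = fst (ord0_lead f)"
definition lead_poly :: "germ \<Rightarrow> complex poly" where "lead_poly f = snd (ord0_lead f)"

lemma order_form_ord0: "f \<noteq> 0 \<Longrightarrow> order_form f (ord0 f) (lead_poly f)"
  unfolding ord0_def lead_poly_def ord0_lead_def by (rule someI_ex) (use order_form_ex in auto)

text \<open>In the chart of direction \<open>d\<close>, \<open>E d\<close> is the equation of the
  exceptional line, \<open>rE d\<close> the restriction to it, and \<open>oE d\<close> the
  intersection number with it.\<close>

fun E :: "direction \<Rightarrow> germ" where "E (Slope c) = X" | "E Vertical = Y"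
fun rE :: "direction \<Rightarrow> germ \<Rightarrow> germ" where "rE (Slope c) = rx" | "rE Vertical = ry"
fun oE :: "direction \<Rightarrow> germ \<Rightarrow> nat" where "oE (Slope c) = ox" | "oE Vertical = oy"

definition strict :: "direction \<Rightarrow> germ \<Rightarrow> germ" where
  "strict d f = (SOME g. pull d f = E d ^ ord0 f * g)"

lemma rE_simps [simp]: "rE d 0 = 0" "rE d 1 = 1" "rE d (f * g) = rE d f * rE d g" "rE d (f ^ n) = rE d f ^ n"
  "rE d (E d) = 0" "ev0 (rE d f) = ev0 f" "rE d (prod h A) = (\<Prod>i\<in>A. rE d (h i))" "rE d (pull d f) = C (ev0 f)"
  by (cases d; simp)+

lemma E_nonzero [simp]: "E d \<noteq> 0" "ev0 (E d) = 0" by (cases d; simp)+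

lemma E_power_eq:
  assumes "E d ^ n * u = E d ^ m * v" "rE d u \<noteq> 0" "rE d v \<noteq> 0" shows "n = m \<and> u = v"
proof (cases d)
  case (Slope c)
  then show ?thesis using X_power_rx_eq assms by simp
next
  case Vertical
  then have "sw (Y ^ n * u) = sw (Y ^ m * v)" using assms(1) by simp
  then have "X ^ n * sw u = X ^ m * sw v" by (simp only: sw_simps)
  from X_power_rx_eq[OF this] show ?thesis using assms Vertical by (simp add: rx_sw)
qed

lemma pull_strict: "f \<noteq> 0 \<Longrightarrow> pull d f = E d ^ ord0 f * strict d f"
proof -
  assume "f \<noteq> 0"
  from order_form_ord0[OF this] have "\<exists>g. pull d f = E d ^ ord0 f * g"
    unfolding order_form_def by (cases d) (simp, blast, simp, blast)
  then show ?thesis unfolding strict_def by (rule someI_ex)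
qed

lemma strict_Slope:
  assumes "f \<noteq> 0" shows "rx (strict (Slope c) f) = poly_at (lead_poly f) (Y + C c)"
proof -
  obtain g where g: "pull (Slope c) f = X ^ ord0 f * g" "rx g = poly_at (lead_poly f) (Y + C c)"
    using order_form_ord0[OF assms] unfolding order_form_def by blast
  have "X ^ ord0 f * strict (Slope c) f = X ^ ord0 f * g" using pull_strict[OF assms, of "Slope c"] g by simp
  then have "strict (Slope c) f = g" by simp
  then show ?thesis using g by simp
qed

lemma lead_poly_nonzero: "f \<noteq> 0 \<Longrightarrow> lead_poly f \<noteq> 0" and degree_lead: "f \<noteq> 0 \<Longrightarrow> degree (lead_poly f) \<le> ord0 f"
  using order_form_ord0 unfolding order_form_def by blast+

lemma ord0_le_ox: "rx f \<noteq> 0 \<Longrightarrow> ord0 f \<le> ox f" and ord0_eq_ox: "rx f \<noteq> 0 \<Longrightarrow> ox f = ord0 f \<Longrightarrow> degree (lead_poly f) = ord0 f"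
  and ord0_le_oy: "ry f \<noteq> 0 \<Longrightarrow> ord0 f \<le> oy f" and ord0_eq_oy: "ry f \<noteq> 0 \<Longrightarrow> oy f = ord0 f \<Longrightarrow> poly (lead_poly f) 0 \<noteq> 0"
  by (cases "f = 0"; use order_form_ord0[of f] in \<open>auto simp: order_form_def\<close>)+

text \<open>The intersection number with the exceptional line is the multiplicity of the tangent,
  hence at most the order of \<open>f\<close>. This bound drives the descent in the
  resolution.\<close>

lemma ox_strict_Slope:
  assumes "f \<noteq> 0" shows "rx (strict (Slope c) f) \<noteq> 0" "ox (strict (Slope c) f) = order c (lead_poly f)"
proof -
  obtain u where u: "poly_at (lead_poly f) (Y + C c) = Y ^ order c (lead_poly f) * u" "ev0 u \<noteq> 0"
    using poly_at_order[OF lead_poly_nonzero[OF assms]] by blast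
  then show "ox (strict (Slope c) f) = order c (lead_poly f)" by (intro ox_eqI[of _ _ u]) (simp_all add: strict_Slope[OF assms])
  show "rx (strict (Slope c) f) \<noteq> 0" using u by (auto simp: strict_Slope[OF assms])
qed

lemma oy_strict_Vertical:
  assumes "f \<noteq> 0" shows "ry (strict Vertical f) \<noteq> 0" "oy (strict Vertical f) = ord0 f - degree (lead_poly f)"
proof -
  obtain g u where g: "pull Vertical f = Y ^ ord0 f * g" "ry g = X ^ (ord0 f - degree (lead_poly f)) * u" "ev0 u \<noteq> 0"
    using order_form_ord0[OF assms] unfolding order_form_def by blast
  have "Y ^ ord0 f * strict Vertical f = Y ^ ord0 f * g" using pull_strict[OF assms, of Vertical] g by simp
  then have s: "strict Vertical f = g" by simp
  show "oy (strict Vertical f) = ord0 f - degree (lead_poly f)" using g by (intro oy_eqI[of _ _ u]) (simp_all add: s)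
  show "ry (strict Vertical f) \<noteq> 0" using g s by auto
qed

lemma rE_strict: "f \<noteq> 0 \<Longrightarrow> rE d (strict d f) \<noteq> 0"
  by (cases d) (simp_all add: ox_strict_Slope oy_strict_Vertical)

lemma strict_nonzero: "f \<noteq> 0 \<Longrightarrow> strict d f \<noteq> 0"
  using rE_strict[of f d] rE_simps(1)[of d] by (auto simp del: rE_simps)

text \<open>Any cofactor of a power of the exceptional equation that is not identically zero on the
  exceptional line is the strict transform. One chart suffices to find the order.\<close>

lemma strict_eqI:
  assumes "pull d f = E d ^ k * g" "rE d g \<noteq> 0" shows "ord0 f = k \<and> strict d f = g"
proof -
  have "g \<noteq> 0" using assms(2) by auto
  then have f: "f \<noteq> 0" using assms(1) by auto
  show ?thesis using E_power_eq[of d "ord0 f" "strict d f" k g] pull_strict[OF f] rE_strict[OF f] assms by metis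
qed

lemma strict_mult:
  assumes "f \<noteq> 0" "g \<noteq> 0" shows "ord0 (f * g) = ord0 f + ord0 g" "strict d (f * g) = strict d f * strict d g"
proof -
  have "pull d (f * g) = E d ^ (ord0 f + ord0 g) * (strict d f * strict d g)" for d
    using pull_strict[OF assms(1)] pull_strict[OF assms(2)] by (simp add: power_add mult_ac)
  from strict_eqI[OF this] rE_strict assms
  show "ord0 (f * g) = ord0 f + ord0 g" "strict d (f * g) = strict d f * strict d g" by auto
qed

lemma strict_unit: "ev0 f \<noteq> 0 \<Longrightarrow> ord0 f = 0" "ev0 f \<noteq> 0 \<Longrightarrow> strict d f = pull d f" "ev0 f \<noteq> 0 \<Longrightarrow> ev0 (strict d f) \<noteq> 0"
  using strict_eqI[of _ f 0 "pull _ f"] by auto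

lemma ord0_pos:
  assumes "f \<noteq> 0" "ev0 f = 0" shows "ord0 f > 0"
proof (rule ccontr)
  assume "\<not> ord0 f > 0"
  then have "rx (pull (Slope 0) f) \<noteq> 0" using pull_strict[OF assms(1), of "Slope 0"] ox_strict_Slope(1)[OF assms(1)] by simp
  then show False using assms(2) by (simp add: C_simps)
qed

lemma finite_nonunit_slopes: "f \<noteq> 0 \<Longrightarrow> finite {d. ev0 (strict d f) = 0}"
proof -
  assume f: "f \<noteq> 0"
  have "ev0 (strict (Slope c) f) = poly (lead_poly f) c" for c
    using arg_cong[OF strict_Slope[OF f, of c], of ev0] by simp
  then have "{d. ev0 (strict d f) = 0} \<subseteq> insert Vertical (Slope ` {c. poly (lead_poly f) c = 0})"
    by (intro subsetI; case_tac x) auto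
  then show ?thesis by (rule finite_subset) (use poly_roots_finite[OF lead_poly_nonzero[OF f]] in auto)
qed

lemma ev0_strict_Slope: "f \<noteq> 0 \<Longrightarrow> ev0 (strict (Slope c) f) = poly (lead_poly f) c"
  using arg_cong[OF strict_Slope[of f c], of ev0] by simp

section \<open>Embedded resolution of plane curves\<close>

text \<open>A pair of flags tells which of the axes \<open>x = 0\<close> and \<open>y = 0\<close> belong to the exceptional divisor.\<close>

fun axes_step :: "direction \<Rightarrow> bool \<times> bool \<Rightarrow> bool \<times> bool" where
  "axes_step (Slope c) (lx, ly) = (True, ly \<and> c = 0)"
| "axes_step Vertical (lx, ly) = (lx, True)"

text \<open>A power of the graph of a germ in x, up to a unit. The exponent may be 0, so units are
  included.\<close>

definition curve_x :: "germ \<Rightarrow> bool" where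
  "curve_x f \<longleftrightarrow> (\<exists>\<phi> k U. ry \<phi> = \<phi> \<and> ev0 \<phi> = 0 \<and> ev0 U \<noteq> 0 \<and> f = U * (Y - \<phi>) ^ k)"

text \<open>Normal crossings of \<open>f\<close> with the exceptional axes: away from the corners \<open>f\<close> may be a power of a smooth
  germ that is transverse to the exceptional axis; at corners \<open>f\<close> must be a unit.\<close>

definition nc :: "bool \<times> bool \<Rightarrow> germ \<Rightarrow> bool" where
  "nc l f \<longleftrightarrow> ev0 f \<noteq> 0 \<or> (l = (True, False) \<and> curve_x f) \<or> (l = (False, True) \<and> curve_x (sw f))"

text \<open>Membership is a well-founded tree of blow-ups. The finiteness premise restricts the work
  to finitely many directions at each point, so that the tree is a finite sequence of
  blow-ups.\<close>

inductive resolvable :: "bool \<times> bool \<Rightarrow> germ \<Rightarrow> bool" where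
  leaf: "nc l f \<Longrightarrow> resolvable l f"
| blow: "finite {d. \<not> nc (axes_step d l) (strict d f)} \<Longrightarrow> (\<And>d. resolvable (axes_step d l) (strict d f)) \<Longrightarrow> resolvable l f"

lemma res_blow: "f \<noteq> 0 \<Longrightarrow> (\<And>d. resolvable (axes_step d l) (strict d f)) \<Longrightarrow> resolvable l f"
proof (rule resolvable.blow)
  assume "f \<noteq> 0"
  from finite_nonunit_slopes[OF this] show "finite {d. \<not> nc (axes_step d l) (strict d f)}"
    by (rule rev_finite_subset) (auto simp: nc_def)
qed

text \<open>The Tschirnhausen form is the case \<open>b 1 = 0\<close>. If the axis \<open>y = 0\<close> is exceptional, \<open>\<phi> = 0\<close> is used instead.\<close>

definition tsch_form :: "germ \<Rightarrow> nat \<Rightarrow> germ \<Rightarrow> (nat \<Rightarrow> germ) \<Rightarrow> bool" where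
  "tsch_form f n \<phi> b \<longleftrightarrow> ry \<phi> = \<phi> \<and> ev0 \<phi> = 0 \<and> (\<forall>k. ry (b k) = b k) \<and> b 0 = 1 \<and> (\<forall>k\<in>{1..n}. ev0 (b k) = 0) \<and>
     (\<exists>U. ev0 U \<noteq> 0 \<and> f = U * (\<Sum>k\<le>n. b k * (Y - \<phi>) ^ (n - k)))"

section \<open>Tschirnhausen forms and maximal contact\<close>

lemma rx_xgerm: "ry c = c \<Longrightarrow> rx c = C (ev0 c)"
  by (metis rx_ry)

lemma ry_cancel_X: "ry (X ^ n * c) = X ^ n * c \<Longrightarrow> ry c = c"
  by simp

lemma pull_xgerm: "ry c = c \<Longrightarrow> pull (Slope a) c = c"
proof -
  have "pull (Slope a) (ry c) = ry c" by (simp add: ry_def pull.simps subst_germ_subst_germ subst_germ_simps)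
  then show "ry c = c \<Longrightarrow> pull (Slope a) c = c" by simp
qed

lemma poly_at_eq_0_iff: "poly_at P (Y + C c) = 0 \<longleftrightarrow> P = 0"
proof
  assume "poly_at P (Y + C c) = 0"
  then show "P = 0" using poly_at_order[of P c] by auto
qed simp

text \<open>On x = 0 the sum becomes a polynomial in a translate of y, which vanishes only together
  with all its coefficients; this splits off one factor \<open>X\<close> at a time.\<close>

lemma X_power_dvd_coeffs:
  assumes "X ^ m dvd (\<Sum>k\<le>n. d k * (Y + \<zeta>) ^ k)" "\<And>k. ry (d k) = d k" "ry \<zeta> = \<zeta>" "k \<le> n"
  shows "X ^ m dvd d k"
  using assms(1,2,4)
proof (induction m arbitrary: d k)
  case (Suc m)
  have "X dvd (\<Sum>k\<le>n. d k * (Y + \<zeta>) ^ k)" by (rule dvd_trans[OF _ Suc.prems(1)]) simp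
  then have "rx (\<Sum>k\<le>n. d k * (Y + \<zeta>) ^ k) = 0" by (simp only: X_dvd_iff)
  then have "poly_at (\<Sum>k\<le>n. monom (ev0 (d k)) k) (Y + C (ev0 \<zeta>)) = 0"
    by (simp add: poly_at_sum poly_at_monom rx_xgerm Suc.prems(2) assms(3))
  then have P: "(\<Sum>k\<le>n. monom (ev0 (d k)) k) = 0" by (simp add: poly_at_eq_0_iff)
  have ev: "ev0 (d k) = 0" if "k \<le> n" for k
  proof -
    have "ev0 (d k) = coeff (\<Sum>k\<le>n. monom (ev0 (d k)) k) k" using that by (simp add: coeff_sum sum.delta)
    then show ?thesis by (simp add: P)
  qed
  have "X dvd d k" if "k \<le> n" for k
    using ev[OF that] by (simp add: X_dvd_iff rx_xgerm Suc.prems(2) C_simps)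
  then have "\<forall>k. \<exists>q. k \<le> n \<longrightarrow> d k = X * q" by (auto elim!: dvdE)
  then obtain q where q: "\<And>k. k \<le> n \<Longrightarrow> d k = X * q k" by metis
  define q' where "q' k = (if k \<le> n then q k else 0)" for k
  have "X ^ Suc m dvd X * (\<Sum>k\<le>n. q' k * (Y + \<zeta>) ^ k)"
    using Suc.prems(1) by (simp add: q q'_def sum_distrib_left mult.assoc)
  then have "X ^ m dvd (\<Sum>k\<le>n. q' k * (Y + \<zeta>) ^ k)" by simp
  moreover have "ry (q' k) = q' k" for k
    using Suc.prems(2)[of k] q[of k] by (auto simp: q'_def)
  ultimately have "X ^ m dvd q' k" using Suc.IH[of q' k] Suc.prems(3) by blast
  then show ?case using q[OF Suc.prems(3)] Suc.prems(3) by (simp add: q'_def)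
qed simp

lemma coeff_linear_power_pred:
  fixes a :: complex
  assumes "n \<ge> 1" shows "coeff ([:a, 1:] ^ n) (n - 1) = of_nat n * a"
  using assms
proof (induction n rule: dec_induct)
  case (step m)
  have "coeff ([:a, 1:] ^ m) m = 1" using lead_coeff_power[of "[:a, 1:]" m] by (simp add: degree_linear_power)
  with step show ?case by (cases m) (auto simp: algebra_simps)
qed simp

lemma monic_order_eq:
  fixes Q :: "complex poly"
  assumes "degree Q = n" "lead_coeff Q = 1" "order c Q = n" shows "Q = [:- c, 1:] ^ n"
proof -
  have Q0: "Q \<noteq> 0" using assms(2) by auto
  obtain q where q: "Q = [:- c, 1:] ^ n * q" using order_1[of c Q] assms(3) by (auto elim!: dvdE)
  then have q0: "q \<noteq> 0" using Q0 by auto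
  have "degree Q = n + degree q" using q0 by (subst q, subst degree_mult_eq) (auto simp: degree_linear_power)
  then have "degree q = 0" using assms(1) by simp
  then obtain a where a: "q = [:a:]" by (meson degree_eq_zeroE)
  have "lead_coeff Q = lead_coeff ([:- c, 1:] ^ n * q)" using q by (rule arg_cong)
  also have "\<dots> = a" by (simp only: lead_coeff_mult lead_coeff_power) (simp add: a)
  finally have "lead_coeff Q = a" .
  with assms(2) a have "q = 1" by (simp add: one_pCons)
  with q show ?thesis by (simp only: mult_1_right)
qed

lemma tsch_form_rx:
  assumes "tsch_form f n \<phi> b" shows "rx f \<noteq> 0" "ox f = n"
proof -
  obtain U where U: "ev0 U \<noteq> 0" "f = U * (\<Sum>k\<le>n. b k * (Y - \<phi>) ^ (n - k))"
    using assms by (auto simp: tsch_form_def)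
  have b: "rx (b k) = C (ev0 (b k))" "rx \<phi> = 0" for k
    using assms by (auto simp: tsch_form_def rx_xgerm C_simps)
  have "(\<Sum>k\<le>n. rx (b k) * Y ^ (n - k)) = (\<Sum>k\<le>n. if k = 0 then Y ^ n else 0)"
    using assms by (intro sum.cong) (auto simp: tsch_form_def b C_simps)
  then have r: "rx f = Y ^ n * rx U" by (simp add: U b mult.commute)
  then show "ox f = n" by (rule ox_eqI) (simp add: U)
  have "rx U \<noteq> 0" using U(1) unit_rx_ry by blast
  then show "rx f \<noteq> 0" using r by simp
qed

text \<open>If blowing up does not lower the order on the exceptional line, then \<open>y = \<phi>(x)\<close> has maximal
  contact: its strict transform plays the same role, and the coefficients lose powers of \<open>x\<close>.\<close>

lemma tsch_form_persist:
  assumes f: "tsch_form f n \<phi> b" and n: "n \<ge> 1" and o: "ox (strict (Slope c) f) = n" and c: "b 1 = 0 \<or> \<phi> = 0 \<and> c = 0"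
  shows "\<exists>\<phi>' b'. tsch_form (strict (Slope c) f) n \<phi>' b' \<and> (\<forall>k\<le>n. b k = X ^ k * b' k) \<and> (\<phi> = 0 \<and> c = 0 \<longrightarrow> \<phi>' = 0)"
proof -
  obtain U where U: "ev0 U \<noteq> 0" "f = U * (\<Sum>k\<le>n. b k * (Y - \<phi>) ^ (n - k))"
    and b: "ry \<phi> = \<phi>" "ev0 \<phi> = 0" "\<And>k. ry (b k) = b k" "b 0 = 1" "\<And>k. k \<in> {1..n} \<Longrightarrow> ev0 (b k) = 0"
    using f by (auto simp: tsch_form_def)
  note rxf = tsch_form_rx[OF f]
  have f0: "f \<noteq> 0" using rxf by auto
  \<comment> \<open>The root multiplicity of c is at most the degree of the leading polynomial,
    which is at most the order, which is at most \<open>ox f\<close>. Both ends are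
    \<open>n\<close>, so everything is equal and \<open>f\<close> has a single tangent.\<close>
  have "ord0 f = n"
    using ord0_le_ox[OF rxf(1)] rxf(2) o ox_strict_Slope(2)[OF f0, of c] degree_lead[OF f0]
      order_degree[OF lead_poly_nonzero[OF f0], of c] by linarith
  then have pf: "pull (Slope c) f = X ^ n * strict (Slope c) f" using pull_strict[OF f0, of "Slope c"] by simp
  have "X dvd \<phi>" using b by (simp add: X_dvd_iff rx_xgerm C_simps)
  then obtain \<psi> where \<psi>: "\<phi> = X * \<psi>" by (elim dvdE)
  have ry\<psi>: "ry \<psi> = \<psi>" using b(1) ry_cancel_X[of 1 \<psi>] by (simp add: \<psi>)
  define \<zeta> where "\<zeta> = C c - \<psi>"
  have ry\<zeta>: "ry \<zeta> = \<zeta>" by (simp add: \<zeta>_def ry\<psi>)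
  define V where "V = pull (Slope c) U"
  have V: "ev0 V \<noteq> 0" using U by (simp add: V_def)
  have "pull (Slope c) (Y - \<phi>) = X * (Y + \<zeta>)"
    using pull_xgerm[OF b(1)] by (simp add: \<psi> \<zeta>_def algebra_simps)
  then have pf2: "pull (Slope c) f = V * (\<Sum>k\<le>n. b k * (X * (Y + \<zeta>)) ^ (n - k))"
    unfolding U(2) by (simp only: pull_simps V_def[symmetric] pull_xgerm[OF b(3)])
  obtain V' where V': "V * V' = 1" using V germ_unit_iff by (metis dvdE)
  define d where "d j = b (n - j) * X ^ j" for j
  have dsum: "(\<Sum>k\<le>n. b k * (X * (Y + \<zeta>)) ^ (n - k)) = (\<Sum>j\<le>n. d j * (Y + \<zeta>) ^ j)"
    by (rule sum.reindex_bij_witness[of _ "\<lambda>i. n - i" "\<lambda>i. n - i"]) (auto simp: d_def power_mult_distrib mult_ac)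
  have "(\<Sum>j\<le>n. d j * (Y + \<zeta>) ^ j) = X ^ n * (V' * strict (Slope c) f)"
  proof -
    have "(\<Sum>j\<le>n. d j * (Y + \<zeta>) ^ j) = (V * V') * (\<Sum>j\<le>n. d j * (Y + \<zeta>) ^ j)" using V' by simp
    also have "\<dots> = V' * pull (Slope c) f" by (simp add: pf2 dsum mult_ac)
    finally show ?thesis by (simp add: pf mult_ac)
  qed
  then have dvd: "X ^ n dvd (\<Sum>j\<le>n. d j * (Y + \<zeta>) ^ j)" by simp
  have dj: "X ^ n dvd d j" if "j \<le> n" for j
    by (rule X_power_dvd_coeffs[OF dvd _ ry\<zeta> that]) (simp add: d_def b(3))
  have "X ^ k * X ^ (n - k) dvd b k * X ^ (n - k)" if "k \<le> n" for k
    using dj[of "n - k"] that by (simp add: d_def flip: power_add)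
  then have "X ^ k dvd b k" if "k \<le> n" for k using that by simp
  then have "\<forall>k. \<exists>q. k \<le> n \<longrightarrow> b k = X ^ k * q" by (auto elim!: dvdE)
  then obtain q where q: "\<And>k. k \<le> n \<Longrightarrow> b k = X ^ k * q k" by metis
  define b' where "b' k = (if k \<le> n then q k else 0)" for k
  have bb': "\<And>k. k \<le> n \<Longrightarrow> b k = X ^ k * b' k" using q by (simp add: b'_def)
  have ryb': "ry (b' k) = b' k" for k
    using b(3)[of k] bb'[of k] by (cases "k \<le> n") (auto simp: b'_def)
  have b'0: "b' 0 = 1" using bb'[of 0] b(4) by simp
  have "X ^ n * strict (Slope c) f = X ^ n * (V * (\<Sum>k\<le>n. b' k * (Y + \<zeta>) ^ (n - k)))"
  proof -
    have "b k * (X * (Y + \<zeta>)) ^ (n - k) = X ^ n * (b' k * (Y + \<zeta>) ^ (n - k))" if "k \<le> n" for k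
    proof -
      have "X ^ k * X ^ (n - k) = X ^ n" using that by (simp flip: power_add)
      then show ?thesis using bb'[OF that] by (simp add: power_mult_distrib mult_ac)
    qed
    then have "pull (Slope c) f = V * (\<Sum>k\<le>n. X ^ n * (b' k * (Y + \<zeta>) ^ (n - k)))"
      unfolding pf2 by (intro arg_cong[where f = "\<lambda>s. V * s"] sum.cong) auto
    then show ?thesis by (simp add: pf sum_distrib_left mult_ac)
  qed
  then have fc: "strict (Slope c) f = V * (\<Sum>k\<le>n. b' k * (Y + \<zeta>) ^ (n - k))" by simp
  \<comment> \<open>The restriction of the new polynomial to the exceptional line. It has a root of
    multiplicity \<open>n\<close>, its full degree, so it is the n-th power of a linear
    factor.\<close>
  define Q where "Q = (\<Sum>k\<le>n. monom (ev0 (b' k)) (n - k))"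
  have cQ: "coeff Q j = (if j \<le> n then ev0 (b' (n - j)) else 0)" for j
  proof -
    have "coeff Q j = (\<Sum>k\<le>n. if n - k = j then ev0 (b' k) else 0)" by (simp add: Q_def coeff_sum)
    also have "\<dots> = (\<Sum>k\<le>n. if k = n - j \<and> j \<le> n then ev0 (b' k) else 0)" by (intro sum.cong) auto
    finally show ?thesis by (cases "j \<le> n") auto
  qed
  have dQ: "degree Q = n"
    by (rule antisym[OF degree_le le_degree]) (auto simp: cQ b'0)
  define \<gamma> where "\<gamma> = ev0 \<zeta>"
  have rfc: "rx (strict (Slope c) f) = rx V * poly_at Q (Y + C \<gamma>)"
    by (simp add: fc Q_def poly_at_sum poly_at_monom rx_xgerm ryb' ry\<zeta> \<gamma>_def)
  have Q0: "Q \<noteq> 0" using cQ[of n] b'0 by auto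
  obtain u where u: "poly_at Q (Y + C \<gamma>) = Y ^ order \<gamma> Q * u" "ev0 u \<noteq> 0" using poly_at_order[OF Q0] by blast
  have "ox (strict (Slope c) f) = order \<gamma> Q"
    by (rule ox_eqI[of _ _ "rx V * u"]) (simp_all add: rfc u V mult_ac)
  then have Qpow: "Q = [:- \<gamma>, 1:] ^ n"
    using o dQ cQ[of n] b'0 by (intro monic_order_eq) auto
  \<comment> \<open>In Tschirnhausen form the coefficient after the leading one vanishes, which
    forces the root to be 0: the strict transform of the graph passes through the new centre. In the
    other case \<phi> and c are 0 and this is immediate.\<close>
  have "\<gamma> = 0"
  proof (cases "b 1 = 0")
    case True
    then have "b' 1 = 0" using bb'[of 1] n by simp
    then have "coeff Q (n - 1) = 0" using n by (simp add: cQ)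
    then show ?thesis using coeff_linear_power_pred[OF n, of "- \<gamma>"] n Qpow by simp
  next
    case False
    then show ?thesis using c \<psi> by (auto simp: \<gamma>_def \<zeta>_def)
  qed
  then have "Q = monom 1 n" using Qpow by (simp add: monom_altdef)
  then have b'k: "ev0 (b' k) = 0" if "k \<in> {1..n}" for k
  proof -
    have "n - k \<noteq> n" using that by auto
    then show ?thesis using cQ[of "n - k"] that \<open>Q = monom 1 n\<close> by auto
  qed
  have "tsch_form (strict (Slope c) f) n (- \<zeta>) b'"
    unfolding tsch_form_def using ry\<zeta> \<open>\<gamma> = 0\<close> ryb' b'0 b'k fc V by (auto simp: \<gamma>_def)
  moreover have "- \<zeta> = 0" if "\<phi> = 0 \<and> c = 0" using that \<psi> by (auto simp: \<zeta>_def C_simps)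
  ultimately show ?thesis using bb' by blast
qed

lemma tsch_form_0_ex:
  assumes "rx f \<noteq> 0" shows "\<exists>b. tsch_form f (ox f) 0 b"
proof -
  obtain U c where "ev0 U \<noteq> 0" "\<And>k :: nat. ry (c k) = c k" "c 0 = 1" "\<And>k. k \<ge> 1 \<Longrightarrow> ev0 (c k) = 0"
    "f = U * (\<Sum>k\<le>ox f. c k * Y ^ (ox f - k))"
    using germ_weierstrass[OF assms] by blast
  then have "tsch_form f (ox f) 0 c" unfolding tsch_form_def by auto
  then show ?thesis by blast
qed

text \<open>Completing the n-th power: translating y by the mean of the roots removes the
  coefficient after the leading one.\<close>

lemma tsch_form_ex:
  assumes "rx f \<noteq> 0" "ox f = n" "n \<ge> 1" shows "\<exists>\<phi> b. tsch_form f n \<phi> b \<and> b 1 = 0"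
proof -
  obtain c U where U: "ev0 U \<noteq> 0" "f = U * (\<Sum>k\<le>n. c k * Y ^ (n - k))"
    and c: "\<And>k. ry (c k) = c k" "c 0 = 1" "\<And>k. k \<in> {1..n} \<Longrightarrow> ev0 (c k) = 0"
    using tsch_form_0_ex[OF assms(1)] assms(2) by (auto simp: tsch_form_def)
  define \<phi> where "\<phi> = C (- 1 / of_nat n) * c 1"
  have \<phi>: "ry \<phi> = \<phi>" "ev0 \<phi> = 0" using c assms(3) by (auto simp: \<phi>_def)
  have n\<phi>: "of_nat n * \<phi> = - c 1"
  proof -
    have on: "of_nat m = C (of_nat m)" for m by (induction m) (auto simp: C_simps)
    have "C (of_nat n) * C (- 1 / of_nat n) = C (- 1)" using assms(3) by (simp flip: C_simps)
    then have "C (of_nat n) * C (- 1 / of_nat n) = - 1" by (simp add: C_simps)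
    then show ?thesis by (simp add: \<phi>_def on flip: mult.assoc)
  qed
  define b where "b k = (\<Sum>i\<le>k. c i * (of_nat ((n - i) choose (k - i)) * \<phi> ^ (k - i)))" for k
  have on: "ry (of_nat m) = of_nat m" for m by (induction m) auto
  have "ry (b k) = b k" for k by (simp add: b_def c \<phi> on)
  moreover have "b 0 = 1" by (simp add: b_def c)
  moreover have "ev0 (b k) = 0" if "k \<in> {1..n}" for k
    unfolding b_def ev0_sum
  proof (rule sum.neutral, rule ballI)
    fix i assume "i \<in> {..k}"
    then show "ev0 (c i * (of_nat ((n - i) choose (k - i)) * \<phi> ^ (k - i))) = 0"
      using that c(3)[of i] \<phi>(2) by (cases "i = 0") auto
  qed
  moreover have "b 1 = 0" using n\<phi> assms(3) by (simp add: b_def c)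
  moreover have "(\<Sum>k\<le>n. c k * Y ^ (n - k)) = (\<Sum>k\<le>n. b k * (Y - \<phi>) ^ (n - k))"
  proof -
    let ?g = "\<lambda>i j. c i * (of_nat ((n - i) choose j) * \<phi> ^ j) * (Y - \<phi>) ^ (n - i - j)"
    have "c i * Y ^ (n - i) = (\<Sum>j\<le>n - i. ?g i j)" for i
    proof -
      have "Y ^ (n - i) = (\<phi> + (Y - \<phi>)) ^ (n - i)" by simp
      also have "\<dots> = (\<Sum>j\<le>n - i. of_nat ((n - i) choose j) * \<phi> ^ j * (Y - \<phi>) ^ (n - i - j))"
        by (rule binomial_ring)
      finally show ?thesis by (simp add: sum_distrib_left mult_ac)
    qed
    then have "(\<Sum>i\<le>n. c i * Y ^ (n - i)) = (\<Sum>i\<le>n. \<Sum>j\<le>n - i. ?g i j)" by simp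
    also have "\<dots> = (\<Sum>(i, j)\<in>{(i, j). i + j \<le> n}. ?g i j)"
      by (subst sum.Sigma) (auto intro!: sum.cong)
    also have "\<dots> = (\<Sum>k\<le>n. \<Sum>i\<le>k. ?g i (k - i))" by (rule sum.triangle_reindex_eq)
    also have "\<dots> = (\<Sum>k\<le>n. b k * (Y - \<phi>) ^ (n - k))"
      by (auto simp: b_def sum_distrib_right intro!: sum.cong)
    finally show ?thesis .
  qed
  ultimately have "tsch_form f n \<phi> b \<and> b 1 = 0" unfolding tsch_form_def using \<phi> U by auto
  then show ?thesis by blast
qed

section \<open>Intersection numbers under a blow-up\<close>

lemma rx_strict_Vertical: "rx f \<noteq> 0 \<Longrightarrow> rx (strict Vertical f) \<noteq> 0"
proof -
  assume rx: "rx f \<noteq> 0"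
  then have "f \<noteq> 0" by auto
  from arg_cong[OF pull_strict[OF this, of Vertical], of rx] rx show ?thesis by auto
qed

lemma ry_strict_Slope0: "ry f \<noteq> 0 \<Longrightarrow> ry (strict (Slope 0) f) \<noteq> 0"
proof -
  assume ry: "ry f \<noteq> 0"
  then have "f \<noteq> 0" by auto
  from arg_cong[OF pull_strict[OF this, of "Slope 0"], of ry] ry show ?thesis by auto
qed

text \<open>Exchanging the coordinates turns the vertical direction into slope 0, so facts about
  \<open>Vertical\<close> follow from facts about \<open>Slope 0\<close>.\<close>

lemma strict_Vertical_sw:
  assumes "f \<noteq> 0" shows "strict Vertical f = sw (strict (Slope 0) (sw f))"
proof -
  have f': "sw f \<noteq> 0" using assms by simp
  have "pull Vertical (sw (sw f)) = sw (pull (Slope 0) (sw f))" by (rule pull_Vertical_sw)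
  then have "pull Vertical f = E Vertical ^ ord0 (sw f) * sw (strict (Slope 0) (sw f))"
    by (simp add: pull_strict[OF f'])
  moreover have "rE Vertical (sw (strict (Slope 0) (sw f))) \<noteq> 0"
    using ox_strict_Slope(1)[OF f'] by (simp add: ry_sw)
  ultimately show ?thesis using strict_eqI by blast
qed

text \<open>The descent in the vertical direction is strict: either \<open>ox f\<close> already
  exceeds the order, or they agree, and then x = 0 is not a tangent and the strict transform misses
  this point.\<close>

lemma ox_strict_le: "rx f \<noteq> 0 \<Longrightarrow> ox (strict (Slope c) f) \<le> ox f"
  and oy_strict_Vertical_less: "rx f \<noteq> 0 \<Longrightarrow> ox f \<ge> 1 \<Longrightarrow> oy (strict Vertical f) < ox f"
  and ox_strict_le_oy: "ry f \<noteq> 0 \<Longrightarrow> ox (strict (Slope c) f) \<le> oy f"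
  and oy_strict_Vertical_le: "ry f \<noteq> 0 \<Longrightarrow> oy (strict Vertical f) \<le> oy f"
proof -
  have *: "ox (strict (Slope c) f) \<le> ord0 f" "oy (strict Vertical f) = ord0 f - degree (lead_poly f)" if "f \<noteq> 0" for c
    using ox_strict_Slope(2)[OF that, of c] order_degree[OF lead_poly_nonzero[OF that], of c] degree_lead[OF that]
      oy_strict_Vertical(2)[OF that] by linarith+
  show "rx f \<noteq> 0 \<Longrightarrow> ox (strict (Slope c) f) \<le> ox f"
    using *(1)[of c] ord0_le_ox[of f] by (cases "f = 0") auto
  show "ry f \<noteq> 0 \<Longrightarrow> ox (strict (Slope c) f) \<le> oy f"
    using *(1)[of c] ord0_le_oy[of f] by (cases "f = 0") auto
  show "ry f \<noteq> 0 \<Longrightarrow> oy (strict Vertical f) \<le> oy f"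
    using *(2) ord0_le_oy[of f] by (cases "f = 0") auto
  show "rx f \<noteq> 0 \<Longrightarrow> ox f \<ge> 1 \<Longrightarrow> oy (strict Vertical f) < ox f"
    using *(2) ord0_le_ox[of f] ord0_eq_ox[of f] by (cases "f = 0"; cases "ox f = ord0 f") auto
qed

text \<open>The inner termination measure: while the order on the exceptional line stays
  \<open>n\<close>, the x-order of a fixed nonzero coefficient drops by k > 0 at every step.\<close>

lemma order_drop:
  assumes "tsch_form f n \<phi> b" "b k \<noteq> 0" "b k = X ^ i * v" "ev0 v \<noteq> 0" "k \<in> {1..n}" "b k = X ^ k * b' k" "ry (b' k) = b' k"
  obtains j w where "j < i" "b' k = X ^ j * w" "ev0 w \<noteq> 0" "b' k \<noteq> 0"
proof -
  have "b' k \<noteq> 0" using assms(2,6) by auto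
  then obtain j w where w: "b' k = X ^ j * w" "ev0 w \<noteq> 0" using xgerm_order[OF assms(7)] by metis
  have "X ^ i * v = X ^ (k + j) * w" using assms(3,6) w by (simp add: power_add mult.assoc)
  then have "i = k + j" using X_power_unit_eq assms(4) w(2) by blast
  then have "j < i" using assms(5) by simp
  then show thesis using w \<open>b' k \<noteq> 0\<close> that by blast
qed

text \<open>The outer induction is on the intersection number \<open>n\<close> and enters as
  \<open>IHX\<close> and \<open>IHY\<close>; the inner one is on the x-order of a nonzero
  coefficient of the Tschirnhausen form. If only the leading coefficient is nonzero,
  \<open>f\<close> is a power of a graph and has normal crossings.\<close>

lemma res_x_unflagged:
  assumes IHX: "\<And>g ly. rx g \<noteq> 0 \<Longrightarrow> ox g < n \<Longrightarrow> (ly \<Longrightarrow> ry g \<noteq> 0) \<Longrightarrow> resolvable (True, ly) g"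
    and IHY: "\<And>g lx. ry g \<noteq> 0 \<Longrightarrow> oy g < n \<Longrightarrow> (lx \<Longrightarrow> rx g \<noteq> 0) \<Longrightarrow> resolvable (lx, True) g"
    and n: "n \<ge> 1" and f: "rx f \<noteq> 0" "ox f = n"
  shows "resolvable (True, False) f"
proof -
  have main: "resolvable (True, False) f" if "tsch_form f n \<phi> b" "b 1 = 0" "k \<in> {1..n}" "b k \<noteq> 0" "b k = X ^ i * v" "ev0 v \<noteq> 0"
    for i k f \<phi> b v
    using that
  proof (induction i arbitrary: f \<phi> b v rule: less_induct)
    case (less i)
    note rf = tsch_form_rx[OF less.prems(1)]
    have f0: "f \<noteq> 0" using rf by auto
    show ?case
    proof (rule res_blow[OF f0])
      fix d
      show "resolvable (axes_step d (True, False)) (strict d f)"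
      proof (cases d)
        case Vertical
        have "resolvable (True, True) (strict Vertical f)"
          using IHY[of "strict Vertical f" True] oy_strict_Vertical(1)[OF f0] oy_strict_Vertical_less[OF rf(1)]
            rx_strict_Vertical[OF rf(1)] rf(2) n by simp
        then show ?thesis using Vertical by simp
      next
        case (Slope c)
        show ?thesis
        proof (cases "ox (strict (Slope c) f) = n")
          case True
          obtain \<phi>' b' where p: "tsch_form (strict (Slope c) f) n \<phi>' b'" "\<forall>k\<le>n. b k = X ^ k * b' k"
            using tsch_form_persist[OF less.prems(1) n True] less.prems(2) by blast
          have b1: "b' 1 = 0" using p(2) n less.prems(2) by (metis X_nonzero mult_eq_0_iff power_eq_0_iff)
          have "ry (b' k) = b' k" "b k = X ^ k * b' k" using p less.prems(3) by (auto simp: tsch_form_def)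
          then obtain j w where "j < i" "b' k = X ^ j * w" "ev0 w \<noteq> 0" "b' k \<noteq> 0"
            using order_drop[OF less.prems(1,4,5,6,3), of b'] by blast
          then have "resolvable (True, False) (strict (Slope c) f)"
            using less.IH[OF _ p(1) b1 less.prems(3)] by blast
          then show ?thesis using Slope by simp
        next
          case False
          then have "ox (strict (Slope c) f) < n" using ox_strict_le[OF rf(1), of c] rf(2) by simp
          then show ?thesis using IHX[of "strict (Slope c) f" False] ox_strict_Slope(1)[OF f0] Slope by simp
        qed
      qed
    qed
  qed
  obtain \<phi> b where t: "tsch_form f n \<phi> b" "b 1 = 0" using tsch_form_ex[OF f n] by blast
  show ?thesis
  proof (cases "\<exists>k\<in>{1..n}. b k \<noteq> 0")
    case True
    then obtain k where k: "k \<in> {1..n}" "b k \<noteq> 0" by blast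
    have "ry (b k) = b k" using t(1) by (simp add: tsch_form_def)
    then obtain i v where "b k = X ^ i * v" "ev0 v \<noteq> 0" using xgerm_order[OF _ k(2)] by metis
    then show ?thesis using main t k by blast
  next
    case False
    obtain U where U: "ev0 U \<noteq> 0" "f = U * (\<Sum>k\<le>n. b k * (Y - \<phi>) ^ (n - k))" and b: "ry \<phi> = \<phi>" "ev0 \<phi> = 0" "b 0 = 1"
      using t(1) by (auto simp: tsch_form_def)
    have "(\<Sum>k\<le>n. b k * (Y - \<phi>) ^ (n - k)) = (\<Sum>k\<le>n. if k = 0 then (Y - \<phi>) ^ n else 0)"
      using False b(3) by (intro sum.cong) auto
    then have "f = U * (Y - \<phi>) ^ n" using U(2) by simp
    then have "curve_x f" unfolding curve_x_def using U(1) b(1,2) by blast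
    then show ?thesis by (intro resolvable.leaf) (simp add: nc_def)
  qed
qed

text \<open>The axis y = 0 is exceptional and takes over the role of the contact curve, so \<phi> =
  0 replaces the Tschirnhausen condition. Nonzero slopes leave this axis and fall under the
  unflagged case.\<close>

lemma res_x_flagged:
  assumes IHX: "\<And>g ly. rx g \<noteq> 0 \<Longrightarrow> ox g < n \<Longrightarrow> (ly \<Longrightarrow> ry g \<noteq> 0) \<Longrightarrow> resolvable (True, ly) g"
    and IHY: "\<And>g lx. ry g \<noteq> 0 \<Longrightarrow> oy g < n \<Longrightarrow> (lx \<Longrightarrow> rx g \<noteq> 0) \<Longrightarrow> resolvable (lx, True) g"
    and n: "n \<ge> 1" and f: "rx f \<noteq> 0" "ox f = n" "ry f \<noteq> 0"
  shows "resolvable (True, True) f"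
proof -
  have main: "resolvable (True, True) f" if "tsch_form f n 0 b" "ry f \<noteq> 0" "k \<in> {1..n}" "b k \<noteq> 0" "b k = X ^ i * v" "ev0 v \<noteq> 0"
    for i k f b v
    using that
  proof (induction i arbitrary: f b v rule: less_induct)
    case (less i)
    note rf = tsch_form_rx[OF less.prems(1)]
    have f0: "f \<noteq> 0" using rf by auto
    show ?case
    proof (rule res_blow[OF f0])
      fix d
      show "resolvable (axes_step d (True, True)) (strict d f)"
      proof (cases d)
        case Vertical
        have "resolvable (True, True) (strict Vertical f)"
          using IHY[of "strict Vertical f" True] oy_strict_Vertical(1)[OF f0] oy_strict_Vertical_less[OF rf(1)]
            rx_strict_Vertical[OF rf(1)] rf(2) n by simp
        then show ?thesis using Vertical by simp
      next
        case (Slope c)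
        show ?thesis
        proof (cases "ox (strict (Slope c) f) = n")
          case True
          show ?thesis
          proof (cases "c = 0")
            case c: True
            obtain b' where p: "tsch_form (strict (Slope c) f) n 0 b'" "\<forall>k\<le>n. b k = X ^ k * b' k"
              using tsch_form_persist[OF less.prems(1) n True] c by auto
            have "ry (b' k) = b' k" "b k = X ^ k * b' k" using p less.prems(3) by (auto simp: tsch_form_def)
            then obtain j w where "j < i" "b' k = X ^ j * w" "ev0 w \<noteq> 0" "b' k \<noteq> 0"
              using order_drop[OF less.prems(1,4,5,6,3), of b'] by blast
            then have "resolvable (True, True) (strict (Slope c) f)"
              using less.IH[OF _ p(1) _ less.prems(3)] ry_strict_Slope0[OF less.prems(2)] c by blast
            then show ?thesis using Slope c by simp
          next
            case c: False
            have "resolvable (True, False) (strict (Slope c) f)"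
              by (rule res_x_unflagged[OF IHX IHY n]) (use ox_strict_Slope(1)[OF f0] True in auto)
            then show ?thesis using Slope c by simp
          qed
        next
          case False
          then have o: "ox (strict (Slope c) f) < n" using ox_strict_le[OF rf(1), of c] rf(2) by simp
          have "resolvable (True, c = 0) (strict (Slope c) f)"
            by (rule IHX) (use o ox_strict_Slope(1)[OF f0] ry_strict_Slope0[OF less.prems(2)] in auto)
          then show ?thesis using Slope by simp
        qed
      qed
    qed
  qed
  obtain b where t: "tsch_form f n 0 b" using tsch_form_0_ex[OF f(1)] f(2) by blast
  \<comment> \<open>Otherwise \<open>f\<close> would vanish on the exceptional axis y = 0.\<close>
  have "\<exists>k\<in>{1..n}. b k \<noteq> 0"
  proof (rule ccontr)
    assume F: "\<not> ?thesis"
    obtain U where U: "ev0 U \<noteq> 0" "f = U * (\<Sum>k\<le>n. b k * (Y - 0) ^ (n - k))" and b: "b 0 = 1"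
      using t(1) by (auto simp: tsch_form_def)
    have "(\<Sum>k\<le>n. b k * (Y - 0) ^ (n - k)) = (\<Sum>k\<le>n. if k = 0 then Y ^ n else 0)"
      using F b by (intro sum.cong) auto
    then have "ry f = 0" using U(2) n by simp
    then show False using f(3) by simp
  qed
  then obtain k where k: "k \<in> {1..n}" "b k \<noteq> 0" by blast
  have "ry (b k) = b k" using t(1) by (simp add: tsch_form_def)
  then obtain i v where "b k = X ^ i * v" "ev0 v \<noteq> 0" using xgerm_order[OF _ k(2)] by metis
  then show ?thesis using main t k f(3) by blast
qed

text \<open>The measure is the order along y = 0. Every slope leads to a problem along the new axis
  x = 0 of order at most \<open>n\<close>, which is why \<open>IHX\<close> includes the value n;
  only the vertical direction can continue with the same measure.\<close>

lemma res_y: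
  assumes IHX: "\<And>g ly. rx g \<noteq> 0 \<Longrightarrow> ox g \<le> n \<Longrightarrow> (ly \<Longrightarrow> ry g \<noteq> 0) \<Longrightarrow> resolvable (True, ly) g"
    and IHY: "\<And>g lx. ry g \<noteq> 0 \<Longrightarrow> oy g < n \<Longrightarrow> (lx \<Longrightarrow> rx g \<noteq> 0) \<Longrightarrow> resolvable (lx, True) g"
    and n: "n \<ge> 1" and f: "ry f \<noteq> 0" "oy f = n" "lx \<Longrightarrow> rx f \<noteq> 0"
  shows "resolvable (lx, True) f"
proof -
  have main: "resolvable (lx, True) f" if "tsch_form (sw f) n \<phi> b" "b 1 = 0 \<or> \<phi> = 0" "lx \<Longrightarrow> rx f \<noteq> 0" "k \<in> {1..n}" "b k \<noteq> 0" "b k = X ^ i * v" "ev0 v \<noteq> 0"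
    for i k f \<phi> b v
    using that
  proof (induction i arbitrary: f \<phi> b v rule: less_induct)
    case (less i)
    note rsf = tsch_form_rx[OF less.prems(1)]
    have rf: "ry f \<noteq> 0" "oy f = n" using rsf by (auto simp: rx_sw oy_def)
    have f0: "f \<noteq> 0" using rf by auto
    show ?case
    proof (rule res_blow[OF f0])
      fix d
      show "resolvable (axes_step d (lx, True)) (strict d f)"
      proof (cases d)
        case (Slope c)
        have "resolvable (True, c = 0) (strict (Slope c) f)"
          by (rule IHX) (use ox_strict_Slope(1)[OF f0] ry_strict_Slope0[OF rf(1)] ox_strict_le_oy[OF rf(1), of c] rf(2) in auto)
        then show ?thesis using Slope by simp
      next
        case Vertical
        have lx: "lx \<Longrightarrow> rx (strict Vertical f) \<noteq> 0" using rx_strict_Vertical less.prems(3) by blast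
        have "resolvable (lx, True) (strict Vertical f)"
        proof (cases "oy (strict Vertical f) = n")
          case True
          have sv: "sw (strict Vertical f) = strict (Slope 0) (sw f)" by (simp add: strict_Vertical_sw[OF f0])
          have o: "ox (strict (Slope 0) (sw f)) = n" using True by (simp add: oy_def sv)
          obtain \<phi>' b' where p: "tsch_form (strict (Slope 0) (sw f)) n \<phi>' b'" "\<forall>k\<le>n. b k = X ^ k * b' k" "\<phi> = 0 \<longrightarrow> \<phi>' = 0"
            using tsch_form_persist[OF less.prems(1) n o] less.prems(2) by blast
          have b1: "b' 1 = 0 \<or> \<phi>' = 0" using p(2,3) n less.prems(2) by (metis X_nonzero mult_eq_0_iff power_eq_0_iff)
          have "ry (b' k) = b' k" "b k = X ^ k * b' k" using p less.prems(4) by (auto simp: tsch_form_def)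
          then obtain j w where "j < i" "b' k = X ^ j * w" "ev0 w \<noteq> 0" "b' k \<noteq> 0"
            using order_drop[OF less.prems(1,5,6,7,4), of b'] by blast
          then show ?thesis
            using less.IH[of j "strict Vertical f" \<phi>' b' w] p(1) b1 lx less.prems(4) by (simp add: sv)
        next
          case False
          then have "oy (strict Vertical f) < n" using oy_strict_Vertical_le[OF rf(1)] rf(2) by simp
          then show ?thesis using IHY[of "strict Vertical f" lx] oy_strict_Vertical(1)[OF f0] lx by simp
        qed
        then show ?thesis using Vertical by simp
      qed
    qed
  qed
  have sf: "rx (sw f) \<noteq> 0" "ox (sw f) = n" using f by (auto simp: rx_sw oy_def)
  obtain \<phi> b where t: "tsch_form (sw f) n \<phi> b" "b 1 = 0 \<or> \<phi> = 0" "lx \<Longrightarrow> \<phi> = 0" "\<not> lx \<Longrightarrow> b 1 = 0"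
    using tsch_form_ex[OF sf n] tsch_form_0_ex[OF sf(1)] sf(2) by metis
  show ?thesis
  proof (cases "\<exists>k\<in>{1..n}. b k \<noteq> 0")
    case True
    then obtain k where k: "k \<in> {1..n}" "b k \<noteq> 0" by blast
    have "ry (b k) = b k" using t(1) by (simp add: tsch_form_def)
    then obtain i v where "b k = X ^ i * v" "ev0 v \<noteq> 0" using xgerm_order[OF _ k(2)] by metis
    then show ?thesis using main[OF t(1,2) f(3) k] by blast
  next
    case False
    obtain U where U: "ev0 U \<noteq> 0" "sw f = U * (\<Sum>k\<le>n. b k * (Y - \<phi>) ^ (n - k))" and b: "ry \<phi> = \<phi>" "ev0 \<phi> = 0" "b 0 = 1"
      using t(1) by (auto simp: tsch_form_def)
    have "(\<Sum>k\<le>n. b k * (Y - \<phi>) ^ (n - k)) = (\<Sum>k\<le>n. if k = 0 then (Y - \<phi>) ^ n else 0)"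
      using False b(3) by (intro sum.cong) auto
    then have fU: "sw f = U * (Y - \<phi>) ^ n" using U(2) by simp
    show ?thesis
    proof (cases lx)
      case True
      then have "ry (sw f) = 0" using fU t(3) n by simp
      then show ?thesis using f(3) True by (simp add: ry_sw)
    next
      case False
      have "curve_x (sw f)" unfolding curve_x_def using U(1) b(1,2) fU by blast
      then show ?thesis using False by (intro resolvable.leaf) (simp add: nc_def)
    qed
  qed
qed

text \<open>A simultaneous induction in which, at each \<open>n\<close>, the case of x = 0 is
  settled before that of y = 0, which uses it at the same n.\<close>

lemma res_xy:
  "(\<forall>f ly. rx f \<noteq> 0 \<longrightarrow> ox f = n \<longrightarrow> (ly \<longrightarrow> ry f \<noteq> 0) \<longrightarrow> resolvable (True, ly) f) \<and>
   (\<forall>f lx. ry f \<noteq> 0 \<longrightarrow> oy f = n \<longrightarrow> (lx \<longrightarrow> rx f \<noteq> 0) \<longrightarrow> resolvable (lx, True) f)"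
proof (induction n rule: less_induct)
  case (less n)
  show ?case
  proof (cases "n = 0")
    case True
    have "ev0 f \<noteq> 0" if "rx f \<noteq> 0" "ox f = 0" for f using ox_eq_0_iff that by blast
    moreover have "ev0 f \<noteq> 0" if "ry f \<noteq> 0" "oy f = 0" for f using ox_eq_0_iff[of "sw f"] that by (simp add: oy_def rx_sw)
    ultimately show ?thesis using True by (auto intro!: resolvable.leaf simp: nc_def)
  next
    case False
    then have n: "n \<ge> 1" by simp
    have X: "\<And>g ly. rx g \<noteq> 0 \<Longrightarrow> ox g < n \<Longrightarrow> (ly \<Longrightarrow> ry g \<noteq> 0) \<Longrightarrow> resolvable (True, ly) g"
      and Y: "\<And>g lx. ry g \<noteq> 0 \<Longrightarrow> oy g < n \<Longrightarrow> (lx \<Longrightarrow> rx g \<noteq> 0) \<Longrightarrow> resolvable (lx, True) g"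
      using less by blast+
    have Xn: "resolvable (True, ly) f" if "rx f \<noteq> 0" "ox f = n" "ly \<Longrightarrow> ry f \<noteq> 0" for f ly
      using res_x_unflagged[OF X Y n, of f] res_x_flagged[OF X Y n, of f] that by (cases ly) auto
    then have X': "\<And>g ly. rx g \<noteq> 0 \<Longrightarrow> ox g \<le> n \<Longrightarrow> (ly \<Longrightarrow> ry g \<noteq> 0) \<Longrightarrow> resolvable (True, ly) g"
      using X le_neq_implies_less by metis
    have "resolvable (lx, True) f" if "ry f \<noteq> 0" "oy f = n" "lx \<Longrightarrow> rx f \<noteq> 0" for f lx
      using res_y[OF X' Y n that(1,2)] that(3) by blast
    with Xn show ?thesis by blast
  qed
qed

lemma embedded_resolution: "f \<noteq> 0 \<Longrightarrow> resolvable (False, False) f"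
  and embedded_resolution_x: "rx f \<noteq> 0 \<Longrightarrow> resolvable (True, False) f"
proof -
  show X: "rx f \<noteq> 0 \<Longrightarrow> resolvable (True, False) f" for f using res_xy by blast
  assume f: "f \<noteq> 0"
  show "resolvable (False, False) f"
  proof (rule res_blow[OF f])
    fix d
    show "resolvable (axes_step d (False, False)) (strict d f)"
    proof (cases d)
      case (Slope c)
      then show ?thesis using X ox_strict_Slope(1)[OF f] by simp
    next
      case Vertical
      have "resolvable (False, True) (strict Vertical f)" using res_xy oy_strict_Vertical(1)[OF f] by blast
      then show ?thesis using Vertical by simp
    qed
  qed
qed

section \<open>Infinitely near points\<close>

fun pull_at :: "point \<Rightarrow> germ \<Rightarrow> germ" where
  "pull_at [] f = f"
| "pull_at (d # r) f = pull_at r (pull d f)"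

fun strict_at :: "point \<Rightarrow> germ \<Rightarrow> germ" where
  "strict_at [] f = f"
| "strict_at (d # r) f = strict_at r (strict d f)"

fun exc_axes_from :: "bool \<times> bool \<Rightarrow> point \<Rightarrow> bool \<times> bool" where
  "exc_axes_from l [] = l"
| "exc_axes_from l (d # r) = exc_axes_from (axes_step d l) r"

text \<open>For a slope the new line is x = 0 and the old axis y = 0 passes through the new point
  only at slope 0; in the vertical direction the new line is y = 0 and the old axis x = 0 passes
  through.\<close>

fun next_labels :: "point \<Rightarrow> point option \<times> point option \<Rightarrow> direction \<Rightarrow> point option \<times> point option" where
  "next_labels q l (Slope c) = (Some q, if c = 0 then snd l else None)"
| "next_labels q l Vertical = (fst l, Some q)"

text \<open>The labels at a point depend on its last direction and on the labels before it, hence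
  the recursion on the reversed list.\<close>

fun labels_rev :: "point \<Rightarrow> point option \<times> point option" where
  "labels_rev [] = (None, None)"
| "labels_rev (d # r) = next_labels (rev r) (labels_rev r) d"

text \<open>\<open>labels p\<close> holds the components along the axes \<open>x = 0\<close> and \<open>y = 0\<close> of the coordinates at \<open>p\<close>.\<close>

definition labels :: "point \<Rightarrow> point option \<times> point option" where
  "labels p = labels_rev (rev p)"

definition exc_axes :: "point \<Rightarrow> bool \<times> bool" where
  "exc_axes p = (fst (labels p) \<noteq> None, snd (labels p) \<noteq> None)"

lemma labels_Nil [simp]: "labels [] = (None, None)" and lab_snoc [simp]: "labels (p @ [d]) = next_labels p (labels p) d"
  by (simp_all add: labels_def)

lemma exc_axes_Nil [simp]: "exc_axes [] = (False, False)" and flags_snoc [simp]: "exc_axes (p @ [d]) = axes_step d (exc_axes p)"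
  by (cases d; simp add: exc_axes_def)+

lemma exc_axes_append: "exc_axes (p @ r) = exc_axes_from (exc_axes p) r"
proof (induction r arbitrary: p)
  case (Cons d r)
  then show ?case using Cons[of "p @ [d]"] by simp
qed simp

lemma pull_at_append: "pull_at (p @ r) f = pull_at r (pull_at p f)"
  by (induction p arbitrary: f) auto

lemma strict_at_append: "strict_at (p @ r) f = strict_at r (strict_at p f)"
  by (induction p arbitrary: f) auto

lemma pull_at_simps [simp]: "pull_at p 0 = 0" "pull_at p 1 = 1" "pull_at p (f + g) = pull_at p f + pull_at p g"
  "pull_at p (f - g) = pull_at p f - pull_at p g" "pull_at p (f * g) = pull_at p f * pull_at p g" "pull_at p (- f) = - pull_at p f"
  "pull_at p (C c) = C c" "ev0 (pull_at p f) = ev0 f" "pull_at p (f ^ n) = pull_at p f ^ n"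
  by (induction p arbitrary: f g) auto

lemma pull_at_eq_0_iff [simp]: "pull_at p f = 0 \<longleftrightarrow> f = 0"
  by (induction p arbitrary: f) auto

lemma strict_at_nonzero: "f \<noteq> 0 \<Longrightarrow> strict_at p f \<noteq> 0"
  by (induction p arbitrary: f) (auto simp: strict_nonzero)

section \<open>Trees of centres and their leaves\<close>

lemma blowup_seq_prefix: "is_blowup_seq T \<Longrightarrow> p @ r \<in> T \<Longrightarrow> p \<in> T"
proof (induction r rule: rev_induct)
  case (snoc a r)
  then show ?case unfolding is_blowup_seq_iff by (metis append.assoc)
qed simp

lemma blowup_seq_Nil: "is_blowup_seq T \<Longrightarrow> T \<noteq> {} \<Longrightarrow> [] \<in> T"
  using blowup_seq_prefix[of T "[]"] by auto

lemma fibre_notin: "p \<in> fibre T \<Longrightarrow> p \<notin> T"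
  by (auto simp: fibre_def split: if_splits)

lemma fibre_snoc_iff: "T \<noteq> {} \<Longrightarrow> p @ [d] \<in> fibre T \<longleftrightarrow> p \<in> T \<and> p @ [d] \<notin> T"
  by (auto simp: fibre_def)

lemma fibre_cases:
  assumes "p \<in> fibre T" "T \<noteq> {}" obtains q d where "p = q @ [d]" "q \<in> T" "p \<notin> T"
  using assms by (auto simp: fibre_def)

lemma fibre_prefix:
  assumes "is_blowup_seq T" "q @ r \<in> fibre T" "r \<noteq> []" shows "q \<in> T"
proof -
  have "T \<noteq> {}" using assms(2,3) by (auto simp: fibre_def)
  then obtain p d where p: "q @ r = p @ [d]" "p \<in> T" using fibre_cases[OF assms(2)] by metis
  obtain r' where "r = r' @ [d]" using p(1) assms(3) by (metis append_butlast_last_id last_appendR last_snoc)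
  then have "p = q @ r'" using p(1) by simp
  then show ?thesis using p(2) blowup_seq_prefix[OF assms(1)] by blast
qed

lemma fibre_incomparable:
  assumes "is_blowup_seq T" "p \<in> fibre T" "p @ r \<in> fibre T" shows "r = []"
  using fibre_prefix[OF assms(1,3)] fibre_notin[OF assms(2)] by blast

lemma prefix_in_fibre:
  assumes "is_blowup_seq T" "p \<notin> T" shows "\<exists>q r. p = q @ r \<and> q \<in> fibre T"
  using assms(2)
proof (induction p rule: rev_induct)
  case Nil
  then have "T = {}" using blowup_seq_Nil[OF assms(1)] by blast
  then show ?case by (simp add: fibre_def)
next
  case (snoc a p)
  show ?case
  proof (cases "p \<in> T")
    case True
    then have "p @ [a] \<in> fibre T" using snoc.prems by (auto simp: fibre_def)
    then show ?thesis by (intro exI[of _ "p @ [a]"] exI[of _ "[]"]) simp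
  next
    case False
    then show ?thesis using snoc.IH by (metis append.assoc)
  qed
qed

section \<open>Stability of normal crossings under further blow-ups\<close>

lemma nc_unit_mult: "nc l f \<Longrightarrow> ev0 U \<noteq> 0 \<Longrightarrow> nc l (U * f)"
proof -
  have *: "curve_x (U * f)" if h: "curve_x f" "ev0 U \<noteq> 0" for U f
  proof -
    obtain \<phi> k V where V: "ry \<phi> = \<phi>" "ev0 \<phi> = 0" "ev0 V \<noteq> 0" "f = V * (Y - \<phi>) ^ k"
      using h(1) unfolding curve_x_def by blast
    have "ev0 (U * V) \<noteq> 0" "U * f = (U * V) * (Y - \<phi>) ^ k" using V h(2) by (auto simp: mult.assoc)
    with V show ?thesis unfolding curve_x_def by blast
  qed
  show "nc l f \<Longrightarrow> ev0 U \<noteq> 0 \<Longrightarrow> nc l (U * f)"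
    using *[of f U] *[of "sw f" "sw U"] by (auto simp: nc_def)
qed

lemma curve_x_rx: "curve_x f \<Longrightarrow> rx f \<noteq> 0"
proof -
  assume "curve_x f"
  then obtain \<phi> k U where U: "ry \<phi> = \<phi>" "ev0 \<phi> = 0" "ev0 U \<noteq> 0" "f = U * (Y - \<phi>) ^ k"
    unfolding curve_x_def by blast
  then have "rx f = rx U * Y ^ k" by (simp add: rx_xgerm C_simps)
  then show ?thesis using U unit_rx_ry by auto
qed

text \<open>A Weierstrass polynomial of degree 1 is \<open>Y\<close> minus a germ in x: the implicit
  function theorem.\<close>

lemma smooth_curve_x: "rx f \<noteq> 0 \<Longrightarrow> ox f = 1 \<Longrightarrow> curve_x (f ^ k)"
proof -
  assume f: "rx f \<noteq> 0" "ox f = 1"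
  obtain U c where c: "ev0 U \<noteq> 0" "\<And>k :: nat. ry (c k) = c k" "c 0 = 1" "\<And>k. k \<ge> 1 \<Longrightarrow> ev0 (c k) = 0"
    "f = U * (\<Sum>k\<le>ox f. c k * Y ^ (ox f - k))" using germ_weierstrass[OF f(1)] by blast
  then have "f = U * (Y - (- c 1))" using f(2) by (simp add: add.commute)
  then have "f ^ k = U ^ k * (Y - (- c 1)) ^ k" by (simp add: power_mult_distrib)
  moreover have "ry (- c 1) = - c 1" "ev0 (- c 1) = 0" "ev0 (U ^ k) \<noteq> 0" using c by auto
  ultimately show ?thesis unfolding curve_x_def by blast
qed

text \<open>With \<phi> = X \<psi> the strict transform of the graph is the graph of \<psi> - c,
  which meets the exceptional line only at the slope \<open>ev0 \<psi>\<close>.\<close>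

lemma curve_x_strict:
  assumes "curve_x f" shows "curve_x (strict (Slope c) f)" "ev0 (strict Vertical f) \<noteq> 0"
proof -
  obtain \<phi> k U where U: "ry \<phi> = \<phi>" "ev0 \<phi> = 0" "ev0 U \<noteq> 0" "f = U * (Y - \<phi>) ^ k"
    using assms unfolding curve_x_def by blast
  have "X dvd \<phi>" using U by (simp add: X_dvd_iff rx_xgerm C_simps)
  then obtain \<psi> where \<psi>: "\<phi> = X * \<psi>" by (elim dvdE)
  have ry\<psi>: "ry \<psi> = \<psi>" using U(1) ry_cancel_X[of 1 \<psi>] by (simp add: \<psi>)
  have pS: "pull (Slope c) f = X ^ k * (pull (Slope c) U * (Y + (C c - \<psi>)) ^ k)"
  proof -
    have "pull (Slope c) (Y - \<phi>) = X * (Y + (C c - \<psi>))"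
      using pull_xgerm[OF U(1)] by (simp add: \<psi> algebra_simps)
    then show ?thesis by (simp add: U(4) power_mult_distrib mult_ac del: pull_XY pull_simps(3,4))
  qed
  have r: "rx (Y + (C c - \<psi>)) = Y + C (c - ev0 \<psi>)" by (simp add: rx_xgerm[OF ry\<psi>] C_simps)
  have "Y + C a \<noteq> 0" for a using poly_at_eq_0_iff[of "[:0, 1:]" a] by (simp add: C_simps)
  then have "rx (Y + (C c - \<psi>)) \<noteq> 0" unfolding r .
  moreover have "rx (pull (Slope c) U) \<noteq> 0" using U(3) unit_rx_ry[of "pull (Slope c) U"] by simp
  ultimately have "rx (pull (Slope c) U * (Y + (C c - \<psi>)) ^ k) \<noteq> 0"
    by (simp only: rx_simps mult_eq_0_iff power_eq_0_iff simp_thms)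
  then have s: "strict (Slope c) f = pull (Slope c) U * (Y + (C c - \<psi>)) ^ k"
    using strict_eqI[of "Slope c" f k "pull (Slope c) U * (Y + (C c - \<psi>)) ^ k"] pS by simp
  show "curve_x (strict (Slope c) f)"
  proof (cases "ev0 \<psi> = c")
    case True
    have "ry (\<psi> - C c) = \<psi> - C c" "ev0 (\<psi> - C c) = 0" using ry\<psi> True by auto
    moreover have "Y + (C c - \<psi>) = Y - (\<psi> - C c)" by simp
    ultimately show ?thesis unfolding s curve_x_def using U(3) by (metis pull_simps(8))
  next
    case False
    then have "ev0 (strict (Slope c) f) \<noteq> 0" using U(3) by (simp add: s)
    then show ?thesis unfolding curve_x_def
      by (intro exI[of _ 0] exI[of _ "0 :: nat"] exI[of _ "strict (Slope c) f"]) simp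
  qed
  have "pull Vertical f = Y ^ k * (pull Vertical U * (1 - X * pull Vertical \<psi>) ^ k)"
  proof -
    have "pull Vertical (Y - \<phi>) = Y * (1 - X * pull Vertical \<psi>)" by (simp add: \<psi> algebra_simps)
    then show ?thesis by (simp add: U(4) power_mult_distrib mult_ac del: pull_XY pull_simps(3,4))
  qed
  moreover have ev: "ev0 (pull Vertical U * (1 - X * pull Vertical \<psi>) ^ k) \<noteq> 0" using U(3) by simp
  ultimately have "strict Vertical f = pull Vertical U * (1 - X * pull Vertical \<psi>) ^ k"
    using strict_eqI[of Vertical f k "pull Vertical U * (1 - X * pull Vertical \<psi>) ^ k"] unit_rx_ry[OF ev] by simp
  then show "ev0 (strict Vertical f) \<noteq> 0" using ev by simp
qed

text \<open>The curve is transverse to the exceptional axis y = 0, so its strict transform avoids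
  slope 0, the point where this axis meets the new line.\<close>

lemma curve_y_strict:
  assumes "curve_x (sw f)"
  shows "curve_x (sw (strict Vertical f))" "ev0 (strict (Slope 0) f) \<noteq> 0" "curve_x (strict (Slope c) f)"
proof -
  have sf: "sw f \<noteq> 0" using curve_x_rx[OF assms] by auto
  then have f0: "f \<noteq> 0" by auto
  show "curve_x (sw (strict Vertical f))"
    using curve_x_strict(1)[OF assms, of 0] by (simp add: strict_Vertical_sw[OF f0])
  have "ev0 (strict Vertical (sw f)) \<noteq> 0" by (rule curve_x_strict(2)[OF assms])
  then show "ev0 (strict (Slope 0) f) \<noteq> 0" by (simp add: strict_Vertical_sw[OF sf])
  obtain \<phi> k U where U: "ry \<phi> = \<phi>" "ev0 \<phi> = 0" "ev0 U \<noteq> 0" "sw f = U * (Y - \<phi>) ^ k"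
    using assms unfolding curve_x_def by blast
  have "X dvd \<phi>" using U by (simp add: X_dvd_iff rx_xgerm C_simps)
  then obtain \<psi> where \<psi>: "\<phi> = X * \<psi>" by (elim dvdE)
  have ry\<psi>: "ry \<psi> = \<psi>" using U(1) ry_cancel_X[of 1 \<psi>] by (simp add: \<psi>)
  have f: "f = sw U * (X - Y * sw \<psi>) ^ k" using arg_cong[OF U(4), of sw] by (simp add: \<psi>)
  define g where "g = 1 - (Y + C c) * pull (Slope c) (sw \<psi>)"
  have pf: "pull (Slope c) f = X ^ k * (pull (Slope c) (sw U) * g ^ k)"
  proof -
    have "pull (Slope c) (X - Y * sw \<psi>) = X * g" by (simp add: g_def algebra_simps)
    then show ?thesis by (simp add: f power_mult_distrib mult_ac del: pull_XY pull_simps(3,4))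
  qed
  have rg: "rx g = C (- ev0 \<psi>) * Y + C (1 - c * ev0 \<psi>)" by (simp add: g_def C_simps algebra_simps)
  have rg': "rx g = poly_at [:1 - c * ev0 \<psi>, - ev0 \<psi>:] (Y + C 0)" by (simp add: rg C_simps mult.commute)
  have "[:1 - c * ev0 \<psi>, - ev0 \<psi>:] \<noteq> 0" by auto
  then have rg0: "rx g \<noteq> 0" unfolding rg' poly_at_eq_0_iff .
  have "rx (pull (Slope c) (sw U) * g ^ k) \<noteq> 0" using rg0 U(3) by simp
  then have s: "strict (Slope c) f = pull (Slope c) (sw U) * g ^ k"
    using strict_eqI[of "Slope c" f k "pull (Slope c) (sw U) * g ^ k"] pf by simp
  have "curve_x (g ^ k)"
  proof (cases "1 - c * ev0 \<psi> = 0")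
    case True
    then have "ev0 \<psi> \<noteq> 0" by auto
    moreover have "rx g = Y ^ 1 * C (- ev0 \<psi>)" using True rg by (simp add: C_simps mult.commute)
    ultimately have "ox g = 1" by (intro ox_eqI[of _ _ "C (- ev0 \<psi>)"]) auto
    then show ?thesis using smooth_curve_x rg0 by blast
  next
    case False
    then have "ev0 (g ^ k) \<noteq> 0" by (simp add: g_def)
    then show ?thesis unfolding curve_x_def
      by (intro exI[of _ 0] exI[of _ "0 :: nat"] exI[of _ "g ^ k"]) simp
  qed
  then obtain \<phi>' k' V where "ry \<phi>' = \<phi>'" "ev0 \<phi>' = 0" "ev0 V \<noteq> 0" "g ^ k = V * (Y - \<phi>') ^ k'"
    unfolding curve_x_def by blast
  then show "curve_x (strict (Slope c) f)"
    unfolding curve_x_def s using U(3)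
    by (intro exI[of _ \<phi>'] exI[of _ k'] exI[of _ "pull (Slope c) (sw U) * V"]) (simp add: mult.assoc)
qed

text \<open>This permits enlarging a tree after the branches have been resolved, as is done to make
  room for the components in \<open>Q\<close>.\<close>

lemma nc_strict:
  assumes "nc l f" "fst l \<or> snd l" shows "nc (axes_step d l) (strict d f)"
proof (cases "ev0 f = 0")
  case False
  then show ?thesis by (simp add: nc_def strict_unit)
next
  case True
  then have "(l = (True, False) \<and> curve_x f) \<or> (l = (False, True) \<and> curve_x (sw f))"
    using assms(1) by (simp add: nc_def)
  then show ?thesis
  proof
    assume "l = (True, False) \<and> curve_x f"
    then show ?thesis using curve_x_strict[of f] by (cases d) (auto simp: nc_def)
  next
    assume *: "l = (False, True) \<and> curve_x (sw f)"
    show ?thesis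
    proof (cases d)
      case (Slope c)
      then show ?thesis using * curve_y_strict(2,3)[of f] by (cases "c = 0") (auto simp: nc_def)
    next
      case Vertical
      then show ?thesis using * curve_y_strict(1)[of f] by (auto simp: nc_def)
    qed
  qed
qed

lemma exc_axes_some: "p \<noteq> [] \<Longrightarrow> fst (exc_axes p) \<or> snd (exc_axes p)"
  by (cases p rule: rev_cases; cases "last p") (auto simp: exc_axes_def)

lemma nc_strict_at: "nc l f \<Longrightarrow> fst l \<or> snd l \<Longrightarrow> nc (exc_axes_from l r) (strict_at r f)"
proof (induction r arbitrary: l f)
  case (Cons d r)
  have "fst (axes_step d l) \<or> snd (axes_step d l)" by (cases d; cases l) auto
  then show ?case using Cons.IH nc_strict Cons.prems by simp
qed simp

lemma fibre_insert_Cons: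
  assumes S: "finite S" and T: "\<And>d. d \<in> S \<Longrightarrow> is_blowup_seq (T d)" "\<And>d. d \<notin> S \<Longrightarrow> T d = {}"
  shows "is_blowup_seq (insert [] (\<Union>d\<in>S. (#) d ` T d))" (is "is_blowup_seq ?T")
    and "fibre (insert [] (\<Union>d\<in>S. (#) d ` T d)) \<subseteq> {d # r | d r. r \<in> fibre (T d)}"
proof -
  have mem: "d # r \<in> ?T \<longleftrightarrow> r \<in> T d" for d r using T(2) by auto
  have bT: "is_blowup_seq (T d)" for d using T by (cases "d \<in> S") (auto simp: is_blowup_seq_iff)
  show "is_blowup_seq ?T"
    unfolding is_blowup_seq_iff
  proof (intro conjI allI impI)
    show "finite ?T" using S T(1) by (auto simp: is_blowup_seq_iff)
    fix p a assume pa: "p @ [a] \<in> ?T"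
    show "p \<in> ?T"
    proof (cases p)
      case (Cons d r)
      then have "r @ [a] \<in> T d" using pa mem[of d "r @ [a]"] by simp
      then have "r \<in> T d" using bT[of d] by (auto simp: is_blowup_seq_iff)
      then show ?thesis unfolding Cons mem .
    qed simp
  qed
  show "fibre ?T \<subseteq> {d # r | d r. r \<in> fibre (T d)}"
  proof
    fix p assume "p \<in> fibre ?T"
    then obtain q a where q: "p = q @ [a]" "q \<in> ?T" "p \<notin> ?T" by (rule fibre_cases) auto
    show "p \<in> {d # r | d r. r \<in> fibre (T d)}"
    proof (cases q)
      case Nil
      then have "[] \<notin> T a" using q mem[of a "[]"] by simp
      then have "T a = {}" using blowup_seq_Nil[OF bT] by blast
      then show ?thesis using q Nil by (simp add: fibre_def)
    next
      case (Cons d r)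
      then have "r \<in> T d" "r @ [a] \<notin> T d" using q mem[of d r] mem[of d "r @ [a]"] by auto
      then have "r @ [a] \<in> fibre (T d)" by (auto simp: fibre_def)
      then show ?thesis using q Cons by simp
    qed
  qed
qed

text \<open>The last clause makes the subtree empty in all but finitely many directions, so that the
  subtrees over a centre glue to a finite tree.\<close>

lemma res_tree:
  assumes "resolvable l f"
  shows "\<exists>T. is_blowup_seq T \<and> (\<forall>r\<in>fibre T. nc (exc_axes_from l r) (strict_at r f)) \<and> (nc l f \<longrightarrow> T = {})"
  using assms
proof (induction rule: resolvable.induct)
  case (leaf l f)
  then show ?case by (intro exI[of _ "{}"]) (simp add: is_blowup_seq_iff fibre_def)
next
  case (blow l f)
  show ?case
  proof (cases "nc l f")
    case True
    then show ?thesis by (intro exI[of _ "{}"]) (simp add: is_blowup_seq_iff fibre_def)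
  next
    case False
    let ?S = "{d. \<not> nc (axes_step d l) (strict d f)}"
    obtain T where T: "\<And>d. is_blowup_seq (T d)" "\<And>d r. r \<in> fibre (T d) \<Longrightarrow> nc (exc_axes_from (axes_step d l) r) (strict_at r (strict d f))"
      "\<And>d. nc (axes_step d l) (strict d f) \<Longrightarrow> T d = {}"
      using blow.IH by metis
    have sub: "fibre (insert [] (\<Union>d\<in>?S. (#) d ` T d)) \<subseteq> {d # r | d r. r \<in> fibre (T d)}"
      by (rule fibre_insert_Cons(2)[OF blow.hyps(1)]) (use T in auto)
    have "is_blowup_seq (insert [] (\<Union>d\<in>?S. (#) d ` T d))"
      by (rule fibre_insert_Cons(1)[OF blow.hyps(1)]) (use T in auto)
    moreover have "nc (exc_axes_from l p) (strict_at p f)" if "p \<in> fibre (insert [] (\<Union>d\<in>?S. (#) d ` T d))" for p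
      using subsetD[OF sub that] T(2) by auto
    ultimately show ?thesis using False by blast
  qed
qed

section \<open>Descent of curves from the blown-up surface to the plane\<close>

lemma germ_inverse:
  assumes "ev0 U \<noteq> 0" obtains V where "ev0 V \<noteq> 0" "U * V = 1"
proof -
  obtain V where V: "1 = U * V" using assms germ_unit_iff by (metis dvdE)
  then have "ev0 U * ev0 V = 1" by (metis ev0_simps(2,5))
  then have "ev0 V \<noteq> 0" by (metis mult_zero_right zero_neq_one)
  then show thesis by (rule that) (rule V[symmetric])
qed

text \<open>The Weierstrass polynomial of the curve at slope \<open>a\<close> is homogenized: the
  coefficient \<open>c k\<close> gains \<open>X ^ k\<close>, and \<open>Y\<close> becomes y - a x.
  All coefficients but the leading one vanish at the origin, so the resulting curve has no tangent
  other than a and becomes a unit in every other direction.\<close>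

lemma push_Slope:
  assumes "rx \<phi> \<noteq> 0"
  shows "\<exists>\<psi>. \<forall>d. \<exists>U. ev0 U \<noteq> 0 \<and> pull d \<psi> = E d ^ ox \<phi> * U * (if d = Slope a then \<phi> else 1)"
proof -
  define n where "n = ox \<phi>"
  obtain U c where U: "ev0 U \<noteq> 0" and c: "\<And>k :: nat. ry (c k) = c k" "c 0 = 1" "\<And>k. k \<ge> 1 \<Longrightarrow> ev0 (c k) = 0"
    and \<phi>: "\<phi> = U * (\<Sum>k\<le>n. c k * Y ^ (n - k))" using germ_weierstrass[OF assms] unfolding n_def by blast
  obtain V where V: "ev0 V \<noteq> 0" "U * V = 1" by (rule germ_inverse[OF U])
  define \<psi> where "\<psi> = (\<Sum>k\<le>n. c k * X ^ k * (Y - C a * X) ^ (n - k))"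
  have slope: "pull (Slope b) \<psi> = X ^ n * (\<Sum>k\<le>n. c k * (Y + C (b - a)) ^ (n - k))" for b
  proof -
    have "c k * X ^ k * (X * (Y + C b) - C a * X) ^ (n - k) = X ^ n * (c k * (Y + C (b - a)) ^ (n - k))" if "k \<le> n" for k
    proof -
      have "X * (Y + C b) - C a * X = X * (Y + C (b - a))" by (simp add: C_simps algebra_simps)
      moreover have "X ^ k * X ^ (n - k) = X ^ n" using that by (simp flip: power_add)
      ultimately show ?thesis by (simp only: power_mult_distrib) (simp add: mult_ac)
    qed
    then have "(\<Sum>k\<le>n. c k * X ^ k * (X * (Y + C b) - C a * X) ^ (n - k)) = (\<Sum>k\<le>n. X ^ n * (c k * (Y + C (b - a)) ^ (n - k)))"
      by (intro sum.cong) auto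
    then show ?thesis unfolding \<psi>_def pull_simps pull_XY pull_xgerm[OF c(1)] sum_distrib_left .
  qed
  have vert: "pull Vertical \<psi> = Y ^ n * (\<Sum>k\<le>n. pull Vertical (c k) * X ^ k * (1 - C a * X) ^ (n - k))"
  proof -
    have "pull Vertical (c k) * (X * Y) ^ k * (Y - C a * (X * Y)) ^ (n - k) = Y ^ n * (pull Vertical (c k) * X ^ k * (1 - C a * X) ^ (n - k))"
      if "k \<le> n" for k
    proof -
      have "Y - C a * (X * Y) = Y * (1 - C a * X)" by (simp add: algebra_simps)
      moreover have "Y ^ k * Y ^ (n - k) = Y ^ n" using that by (simp flip: power_add)
      ultimately show ?thesis by (simp only: power_mult_distrib) (simp add: mult_ac)
    qed
    then have "(\<Sum>k\<le>n. pull Vertical (c k) * (X * Y) ^ k * (Y - C a * (X * Y)) ^ (n - k)) = (\<Sum>k\<le>n. Y ^ n * (pull Vertical (c k) * X ^ k * (1 - C a * X) ^ (n - k)))"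
      by (intro sum.cong) auto
    then show ?thesis unfolding \<psi>_def pull_simps pull_XY sum_distrib_left .
  qed
  have evc: "(\<Sum>k\<le>n. ev0 (c k) * h k) = h 0" for h :: "nat \<Rightarrow> complex"
  proof -
    have "(\<Sum>k\<le>n. ev0 (c k) * h k) = (\<Sum>k\<le>n. if k = 0 then h 0 else 0)" using c by (intro sum.cong) auto
    then show ?thesis by simp
  qed
  have "\<exists>U. ev0 U \<noteq> 0 \<and> pull d \<psi> = E d ^ n * U * (if d = Slope a then \<phi> else 1)" for d
  proof (cases d)
    case (Slope b)
    show ?thesis
    proof (cases "b = a")
      case True
      have "(\<Sum>k\<le>n. c k * Y ^ (n - k)) = V * \<phi>" using V(2) by (simp add: \<phi> mult.assoc[symmetric] mult.commute)
      then show ?thesis using V(1) True Slope slope[of b] by (intro exI[of _ V]) (simp add: C_simps mult.assoc)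
    next
      case False
      then show ?thesis using slope[of b] Slope
        by (intro exI[of _ "\<Sum>k\<le>n. c k * (Y + C (b - a)) ^ (n - k)"]) (simp add: evc)
    qed
  next
    case Vertical
    have "ev0 (\<Sum>k\<le>n. pull Vertical (c k) * X ^ k * (1 - C a * X) ^ (n - k)) = 1"
      using evc[of "\<lambda>k. 0 ^ k"] by simp
    then show ?thesis using vert Vertical
      by (intro exI[of _ "\<Sum>k\<le>n. pull Vertical (c k) * X ^ k * (1 - C a * X) ^ (n - k)"]) simp
  qed
  then show ?thesis unfolding n_def by blast
qed

lemma push_Vertical:
  assumes "ry \<phi> \<noteq> 0"
  shows "\<exists>\<psi>. \<forall>d. \<exists>U. ev0 U \<noteq> 0 \<and> pull d \<psi> = E d ^ oy \<phi> * U * (if d = Vertical then \<phi> else 1)"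
proof -
  define n where "n = oy \<phi>"
  have "rx (sw \<phi>) \<noteq> 0" using assms by (simp add: rx_sw)
  from germ_weierstrass[OF this]
  obtain U c where U: "ev0 U \<noteq> 0" and c: "\<And>k :: nat. ry (c k) = c k" "c 0 = 1" "\<And>k. k \<ge> 1 \<Longrightarrow> ev0 (c k) = 0"
    and \<phi>: "sw \<phi> = U * (\<Sum>k\<le>n. c k * Y ^ (n - k))" unfolding n_def oy_def by blast
  obtain V where V: "ev0 V \<noteq> 0" "U * V = 1" by (rule germ_inverse[OF U])
  define \<psi> where "\<psi> = (\<Sum>k\<le>n. sw (c k) * Y ^ k * X ^ (n - k))"
  have slope: "pull (Slope b) \<psi> = X ^ n * (\<Sum>k\<le>n. pull (Slope b) (sw (c k)) * (Y + C b) ^ k)" for b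
  proof -
    have "h * (X * (Y + C b)) ^ k * X ^ (n - k) = X ^ n * (h * (Y + C b) ^ k)" if "k \<le> n" for k h
    proof -
      have "X ^ k * X ^ (n - k) = X ^ n" using that by (simp flip: power_add)
      then show ?thesis by (simp only: power_mult_distrib) (simp add: mult_ac)
    qed
    then have "(\<Sum>k\<le>n. pull (Slope b) (sw (c k)) * (X * (Y + C b)) ^ k * X ^ (n - k)) = (\<Sum>k\<le>n. X ^ n * (pull (Slope b) (sw (c k)) * (Y + C b) ^ k))"
      by (intro sum.cong) auto
    then show ?thesis unfolding \<psi>_def pull_simps pull_XY sum_distrib_left .
  qed
  have vert: "pull Vertical \<psi> = Y ^ n * (\<Sum>k\<le>n. sw (c k) * X ^ (n - k))"
  proof -
    have "h * Y ^ k * (X * Y) ^ (n - k) = Y ^ n * (h * X ^ (n - k))" if "k \<le> n" for k h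
    proof -
      have "Y ^ k * Y ^ (n - k) = Y ^ n" using that by (simp flip: power_add)
      then show ?thesis by (simp only: power_mult_distrib) (simp add: mult_ac)
    qed
    then have "(\<Sum>k\<le>n. sw (c k) * Y ^ k * (X * Y) ^ (n - k)) = (\<Sum>k\<le>n. Y ^ n * (sw (c k) * X ^ (n - k)))"
      by (intro sum.cong) auto
    moreover have "pull Vertical (sw (c k)) = sw (c k)" for k using pull_xgerm[OF c(1)[of k], of 0] by (simp add: pull_Vertical_sw)
    ultimately show ?thesis unfolding \<psi>_def pull_simps pull_XY sum_distrib_left by simp
  qed
  have evc: "(\<Sum>k\<le>n. ev0 (c k) * h k) = h 0" for h :: "nat \<Rightarrow> complex"
  proof -
    have "(\<Sum>k\<le>n. ev0 (c k) * h k) = (\<Sum>k\<le>n. if k = 0 then h 0 else 0)" using c by (intro sum.cong) auto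
    then show ?thesis by simp
  qed
  have "\<exists>U. ev0 U \<noteq> 0 \<and> pull d \<psi> = E d ^ n * U * (if d = Vertical then \<phi> else 1)" for d
  proof (cases d)
    case (Slope b)
    then show ?thesis using slope[of b]
      by (intro exI[of _ "\<Sum>k\<le>n. pull (Slope b) (sw (c k)) * (Y + C b) ^ k"]) (simp add: evc)
  next
    case Vertical
    have "\<phi> = sw U * (\<Sum>k\<le>n. sw (c k) * X ^ (n - k))" using arg_cong[OF \<phi>, of sw] by simp
    moreover have "sw U * sw V = 1" using arg_cong[OF V(2), of sw] by simp
    ultimately have "(\<Sum>k\<le>n. sw (c k) * X ^ (n - k)) = sw V * \<phi>" by (simp add: mult.assoc[symmetric] mult.commute)
    then show ?thesis using V(1) Vertical vert by (intro exI[of _ "sw V"]) (simp add: mult.assoc)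
  qed
  then show ?thesis unfolding n_def by blast
qed

text \<open>The exponent of \<open>E d\<close> is the same in all directions, being the order of the
  product at the centre. It is the total intersection number of the family with the exceptional
  line.\<close>

lemma push_family:
  assumes "finite D" "\<And>d. d \<in> D \<Longrightarrow> rE d (\<phi> d) \<noteq> 0"
  shows "\<exists>\<psi>. \<forall>d. \<exists>U. ev0 U \<noteq> 0 \<and> pull d \<psi> = E d ^ (\<Sum>d\<in>D. oE d (\<phi> d)) * U * (if d \<in> D then \<phi> d else 1)"
  using assms
proof (induction D)
  case empty
  show ?case by (intro exI[of _ 1] allI exI[of _ 1]) simp
next
  case (insert d0 D)
  have "\<exists>\<psi>. \<forall>d. \<exists>U. ev0 U \<noteq> 0 \<and> pull d \<psi> = E d ^ (\<Sum>d\<in>D. oE d (\<phi> d)) * U * (if d \<in> D then \<phi> d else 1)"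
    by (rule insert.IH) (use insert.prems in blast)
  then obtain \<psi> U where \<psi>: "\<And>d. ev0 (U d) \<noteq> 0" "\<And>d. pull d \<psi> = E d ^ (\<Sum>d\<in>D. oE d (\<phi> d)) * U d * (if d \<in> D then \<phi> d else 1)"
    by metis
  have nz: "rE d0 (\<phi> d0) \<noteq> 0" using insert.prems by blast
  have "\<exists>\<psi>. \<forall>d. \<exists>U. ev0 U \<noteq> 0 \<and> pull d \<psi> = E d ^ oE d0 (\<phi> d0) * U * (if d = d0 then \<phi> d0 else 1)"
  proof (cases d0)
    case (Slope a)
    show ?thesis using push_Slope[of "\<phi> d0" a] nz unfolding Slope by simp
  next
    case Vertical
    show ?thesis using push_Vertical[of "\<phi> d0"] nz unfolding Vertical by simp
  qed
  then obtain \<psi>' U' where \<psi>': "\<And>d. ev0 (U' d) \<noteq> 0" "\<And>d. pull d \<psi>' = E d ^ oE d0 (\<phi> d0) * U' d * (if d = d0 then \<phi> d0 else 1)"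
    by metis
  show ?case
  proof (rule exI[of _ "\<psi> * \<psi>'"], rule allI)
    fix d
    have "pull d (\<psi> * \<psi>') = E d ^ (\<Sum>d\<in>insert d0 D. oE d (\<phi> d)) * (U d * U' d) * (if d \<in> insert d0 D then \<phi> d else 1)"
      using insert.hyps \<psi>(2)[of d] \<psi>'(2)[of d] by (auto simp: power_add mult_ac)
    then show "\<exists>U. ev0 U \<noteq> 0 \<and> pull d (\<psi> * \<psi>') = E d ^ (\<Sum>d\<in>insert d0 D. oE d (\<phi> d)) * U * (if d \<in> insert d0 D then \<phi> d else 1)"
      using \<psi>(1)[of d] \<psi>'(1)[of d] by (intro exI[of _ "U d * U' d"]) simp
  qed
qed

section \<open>Prescribing the zeros and poles of a fraction\<close>

text \<open>\<open>Q\<close> is the set of prescribed dicritical components: the exponent of an exceptional axis in \<open>N / D\<close>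
  vanishes exactly on these, and axes that are not exceptional carry no exponent.\<close>

definition adm1 :: "point set \<Rightarrow> point option \<Rightarrow> nat \<Rightarrow> bool" where
  "adm1 Q o' a \<longleftrightarrow> (case o' of None \<Rightarrow> a = 0 | Some q \<Rightarrow> (a = 0 \<longleftrightarrow> q \<in> Q))"

definition adm :: "point set \<Rightarrow> point \<Rightarrow> nat \<Rightarrow> nat \<Rightarrow> bool" where
  "adm Q p a b \<longleftrightarrow> adm1 Q (fst (labels p)) a \<and> adm1 Q (snd (labels p)) b"

definition exc_mono :: "bool \<times> bool \<Rightarrow> germ \<Rightarrow> bool" where
  "exc_mono l w \<longleftrightarrow> (\<exists>i j U. ev0 U \<noteq> 0 \<and> w = X ^ i * Y ^ j * U \<and> (fst l \<or> i = 0) \<and> (snd l \<or> j = 0))"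

text \<open>Up to an exceptional monomial, the fraction is an admissible monomial times a normal crossings germ, or
  the inverse of such a germ.\<close>

definition leaf_ok :: "point set \<Rightarrow> point \<Rightarrow> germ \<Rightarrow> germ \<Rightarrow> bool" where
  "leaf_ok Q p N D \<longleftrightarrow> (\<exists>a b M. adm Q p a b \<and> nc (exc_axes p) M \<and>
     ((N = D * (X ^ a * Y ^ b * M) \<and> exc_mono (exc_axes p) D) \<or> (a = 0 \<and> b = 0 \<and> D = N * M \<and> exc_mono (exc_axes p) N)))"

text \<open>The three zeros on the exceptional line of \<open>t\<close> force every reduction to blow up \<open>t\<close>.\<close>

definition three_zeros :: "point set \<Rightarrow> point set \<Rightarrow> point \<Rightarrow> germ \<Rightarrow> germ \<Rightarrow> bool" where
  "three_zeros T Q t N D \<longleftrightarrow> (\<exists>S. card S = 3 \<and> (\<forall>c\<in>S. t @ [Slope c] \<in> fibre T \<and>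
     (\<exists>a k U. (a = 0 \<longleftrightarrow> t \<in> Q) \<and> k \<ge> (1::nat) \<and> ev0 U \<noteq> 0 \<and>
        pull (Slope c) N = pull (Slope c) D * (X ^ a * Y ^ k * U))))"

definition tree_ok :: "point set \<Rightarrow> point set \<Rightarrow> point \<Rightarrow> germ \<Rightarrow> germ \<Rightarrow> bool" where
  "tree_ok T Q p N D \<longleftrightarrow> (\<forall>r. p @ r \<in> fibre T \<longrightarrow> leaf_ok Q (p @ r) (pull_at r N) (pull_at r D)) \<and>
     (\<forall>r. p @ r \<in> T \<longrightarrow> three_zeros T Q (p @ r) (pull_at r N) (pull_at r D))"

section \<open>Calculus of exceptional monomials and admissible trees\<close>

lemma exc_mono_mult: assumes "exc_mono l w" "exc_mono l w'" shows "exc_mono l (w * w')"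
proof -
  obtain i j U where 1: "ev0 U \<noteq> 0" "w = X ^ i * Y ^ j * U" "fst l \<or> i = 0" "snd l \<or> j = 0"
    using assms(1) unfolding exc_mono_def by blast
  obtain i' j' U' where 2: "ev0 U' \<noteq> 0" "w' = X ^ i' * Y ^ j' * U'" "fst l \<or> i' = 0" "snd l \<or> j' = 0"
    using assms(2) unfolding exc_mono_def by blast
  have "w * w' = X ^ (i + i') * Y ^ (j + j') * (U * U')" by (simp add: 1 2 power_add mult_ac)
  moreover have "ev0 (U * U') \<noteq> 0" using 1 2 by simp
  ultimately show ?thesis unfolding exc_mono_def using 1 2 by (metis add_0)
qed

lemma exc_mono_unit: "ev0 U \<noteq> 0 \<Longrightarrow> exc_mono l U"
  unfolding exc_mono_def by (intro exI[of _ 0] exI[of _ "0::nat"] exI[of _ U]) simp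

lemma exc_mono_E: "exc_mono (axes_step d l) (E d ^ n)"
proof (cases d)
  case (Slope c)
  show ?thesis unfolding exc_mono_def Slope by (cases l) (intro exI[of _ n] exI[of _ "0::nat"] exI[of _ 1]; simp)
next
  case Vertical
  show ?thesis unfolding exc_mono_def Vertical
    by (cases l) (rule exI[of _ "0::nat"], rule exI[of _ n], rule exI[of _ 1]; simp)
qed

lemma pull_monomial: "\<exists>V. ev0 V \<noteq> 0 \<and> pull (Slope c) (X ^ i * Y ^ j) = X ^ (i + j) * Y ^ (if c = 0 then j else 0) * V"
  "pull Vertical (X ^ i * Y ^ j) = X ^ i * Y ^ (i + j)"
proof -
  show "\<exists>V. ev0 V \<noteq> 0 \<and> pull (Slope c) (X ^ i * Y ^ j) = X ^ (i + j) * Y ^ (if c = 0 then j else 0) * V"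
  proof (cases "c = 0")
    case True
    then show ?thesis by (intro exI[of _ 1]) (simp add: C_simps power_mult_distrib power_add mult_ac)
  next
    case False
    then show ?thesis by (intro exI[of _ "(Y + C c) ^ j"]) (simp add: power_mult_distrib power_add mult_ac)
  qed
  show "pull Vertical (X ^ i * Y ^ j) = X ^ i * Y ^ (i + j)"
    by (simp add: power_mult_distrib power_add mult_ac)
qed

lemma exc_mono_pull: assumes "exc_mono l w" shows "exc_mono (axes_step d l) (pull d w)"
proof -
  obtain i j U where 1: "ev0 U \<noteq> 0" "w = X ^ i * Y ^ j * U" "fst l \<or> i = 0" "snd l \<or> j = 0"
    using assms unfolding exc_mono_def by blast
  show ?thesis
  proof (cases d)
    case (Slope c)
    obtain V where V: "ev0 V \<noteq> 0" "pull (Slope c) (X ^ i * Y ^ j) = X ^ (i + j) * Y ^ (if c = 0 then j else 0) * V"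
      using pull_monomial(1) by blast
    have "pull d w = X ^ (i + j) * Y ^ (if c = 0 then j else 0) * (V * pull d U)"
      unfolding 1(2) Slope pull_simps(5)[of _ _ U] V(2) by (simp add: mult_ac)
    moreover have "ev0 (V * pull d U) \<noteq> 0" using V 1 by simp
    moreover have "fst (axes_step d l)" "snd (axes_step d l) \<or> (if c = 0 then j else 0) = 0" using 1 Slope by (cases l; auto)+
    ultimately show ?thesis unfolding exc_mono_def by blast
  next
    case Vertical
    have "pull d w = X ^ i * Y ^ (i + j) * pull d U"
      unfolding 1(2) Vertical pull_simps(5)[of _ _ U] pull_monomial(2) ..
    moreover have "fst (axes_step d l) \<or> i = 0" "snd (axes_step d l)" using 1 Vertical by (cases l; auto)+
    ultimately show ?thesis unfolding exc_mono_def using 1(1) by (metis pull_simps(8))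
  qed
qed

lemma exc_mono_pull_at: "exc_mono l w \<Longrightarrow> exc_mono (exc_axes_from l r) (pull_at r w)"
  by (induction r arbitrary: l w) (simp_all add: exc_mono_pull)

lemma exc_mono_nonzero: "exc_mono l w \<Longrightarrow> w \<noteq> 0"
  unfolding exc_mono_def by auto

text \<open>Pulling back a numerator and a denominator produces units and a common exceptional
  monomial; these change the fraction only by a unit.\<close>

lemma leaf_ok_cong:
  assumes "leaf_ok Q p N D" "exc_mono (exc_axes p) w" "ev0 V1 \<noteq> 0" "ev0 V2 \<noteq> 0"
  shows "leaf_ok Q p (V1 * w * N) (V2 * w * D)"
proof -
  obtain a b M where M: "adm Q p a b" "nc (exc_axes p) M" and
    c: "(N = D * (X ^ a * Y ^ b * M) \<and> exc_mono (exc_axes p) D) \<or> (a = 0 \<and> b = 0 \<and> D = N * M \<and> exc_mono (exc_axes p) N)"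
    using assms(1) unfolding leaf_ok_def by blast
  obtain W1 where W1: "ev0 W1 \<noteq> 0" "V1 * W1 = 1" by (rule germ_inverse[OF assms(3)])
  obtain W2 where W2: "ev0 W2 \<noteq> 0" "V2 * W2 = 1" by (rule germ_inverse[OF assms(4)])
  from c show ?thesis
  proof
    assume c: "N = D * (X ^ a * Y ^ b * M) \<and> exc_mono (exc_axes p) D"
    have "V1 * w * N = (V2 * W2) * (V1 * w * (D * (X ^ a * Y ^ b * M)))" using c W2(2) by simp
    also have "\<dots> = V2 * w * D * (X ^ a * Y ^ b * ((V1 * W2) * M))" by (simp only: mult_ac)
    finally have "V1 * w * N = V2 * w * D * (X ^ a * Y ^ b * ((V1 * W2) * M))" .
    moreover have "nc (exc_axes p) ((V1 * W2) * M)" by (rule nc_unit_mult[OF M(2)]) (use assms W2 in simp)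
    moreover have "exc_mono (exc_axes p) (V2 * w * D)" using c assms by (metis exc_mono_mult exc_mono_unit)
    ultimately show ?thesis unfolding leaf_ok_def using M(1) by blast
  next
    assume c: "a = 0 \<and> b = 0 \<and> D = N * M \<and> exc_mono (exc_axes p) N"
    have "V2 * w * D = (V1 * W1) * (V2 * w * (N * M))" using c W1(2) by simp
    also have "\<dots> = V1 * w * N * ((V2 * W1) * M)" by (simp only: mult_ac)
    finally have "V2 * w * D = V1 * w * N * ((V2 * W1) * M)" .
    moreover have "nc (exc_axes p) ((V2 * W1) * M)" by (rule nc_unit_mult[OF M(2)]) (use assms W1 in simp)
    moreover have "exc_mono (exc_axes p) (V1 * w * N)" using c assms by (metis exc_mono_mult exc_mono_unit)
    ultimately show ?thesis unfolding leaf_ok_def using M(1) c by blast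
  qed
qed

lemma three_zeros_cong:
  assumes "three_zeros T Q t N D" "ev0 V1 \<noteq> 0" "ev0 V2 \<noteq> 0"
  shows "three_zeros T Q t (V1 * w * N) (V2 * w * D)"
proof -
  obtain S where S: "card S = 3" and SS: "\<forall>c\<in>S. t @ [Slope c] \<in> fibre T \<and>
     (\<exists>a k U. (a = 0 \<longleftrightarrow> t \<in> Q) \<and> k \<ge> (1::nat) \<and> ev0 U \<noteq> 0 \<and>
        pull (Slope c) N = pull (Slope c) D * (X ^ a * Y ^ k * U))"
    using assms(1) unfolding three_zeros_def by (elim exE conjE)
  obtain W2 where W2: "ev0 W2 \<noteq> 0" "V2 * W2 = 1" by (rule germ_inverse[OF assms(3)])
  have "\<exists>a k U. (a = 0 \<longleftrightarrow> t \<in> Q) \<and> k \<ge> (1::nat) \<and> ev0 U \<noteq> 0 \<and>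
        pull (Slope c) (V1 * w * N) = pull (Slope c) (V2 * w * D) * (X ^ a * Y ^ k * U)" if c: "c \<in> S" for c
  proof -
    obtain a k U where U: "a = 0 \<longleftrightarrow> t \<in> Q" "k \<ge> (1::nat)" "ev0 U \<noteq> 0"
        "pull (Slope c) N = pull (Slope c) D * (X ^ a * Y ^ k * U)" using bspec[OF SS c] by (elim exE conjE)
    have "pull (Slope c) V2 * pull (Slope c) W2 = 1" using arg_cong[OF W2(2), of "pull (Slope c)"] by (simp del: pull.simps)
    then have "pull (Slope c) (V1 * w * N) = (pull (Slope c) V2 * pull (Slope c) W2) * (pull (Slope c) V1 * pull (Slope c) w * (pull (Slope c) D * (X ^ a * Y ^ k * U)))"
      unfolding pull_simps U(4) by (simp only: mult_1_left)
    also have "\<dots> = pull (Slope c) (V2 * w * D) * (X ^ a * Y ^ k * (pull (Slope c) V1 * pull (Slope c) W2 * U))"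
      by (simp only: pull_simps mult_ac)
    finally show ?thesis using U assms W2(1)
      by (intro exI[of _ a] exI[of _ k] exI[of _ "pull (Slope c) V1 * pull (Slope c) W2 * U"]) (simp del: pull.simps)
  qed
  then show ?thesis unfolding three_zeros_def using S SS by (intro exI[of _ S]) simp
qed

lemma tree_ok_cong:
  assumes "tree_ok T Q p N D" "exc_mono (exc_axes p) w" "ev0 V1 \<noteq> 0" "ev0 V2 \<noteq> 0"
  shows "tree_ok T Q p (V1 * w * N) (V2 * w * D)"
proof -
  have "exc_mono (exc_axes (p @ r)) (pull_at r w)" for r
    using exc_mono_pull_at[OF assms(2)] by (simp add: exc_axes_append)
  then show ?thesis using assms leaf_ok_cong three_zeros_cong unfolding tree_ok_def by simp
qed

lemma tree_ok_node:
  assumes "p \<in> T" "\<And>d. tree_ok T Q (p @ [d]) (pull d N) (pull d D)" "three_zeros T Q p N D"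
  shows "tree_ok T Q p N D"
  unfolding tree_ok_def
proof (intro conjI allI impI)
  fix r assume r: "p @ r \<in> fibre T"
  have "r \<noteq> []" using r fibre_notin assms(1) by auto
  then obtain d r' where "r = d # r'" by (cases r) auto
  then show "leaf_ok Q (p @ r) (pull_at r N) (pull_at r D)" using assms(2)[of d] r unfolding tree_ok_def by simp
next
  fix r assume r: "p @ r \<in> T"
  show "three_zeros T Q (p @ r) (pull_at r N) (pull_at r D)"
  proof (cases r)
    case Nil
    then show ?thesis using assms(3) by simp
  next
    case (Cons d r')
    then show ?thesis using assms(2)[of d] r unfolding tree_ok_def by simp
  qed
qed

lemma tree_ok_leaf:
  assumes "is_blowup_seq T" "p \<in> fibre T" "leaf_ok Q p N D" shows "tree_ok T Q p N D"
  unfolding tree_ok_def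
proof (intro conjI allI impI)
  fix r assume "p @ r \<in> fibre T"
  then have "r = []" using fibre_incomparable[OF assms(1,2)] by blast
  then show "leaf_ok Q (p @ r) (pull_at r N) (pull_at r D)" using assms(3) by simp
next
  fix r assume "p @ r \<in> T"
  then have "p \<in> T" by (rule blowup_seq_prefix[OF assms(1)])
  then show "three_zeros T Q (p @ r) (pull_at r N) (pull_at r D)" using fibre_notin[OF assms(2)] by blast
qed

text \<open>The axis x = 0 of the parent reappears in the vertical chart and y = 0 at slope 0, so
  the orders along both axes can be read off from two children.\<close>

lemma push_order:
  assumes f: "\<And>d. \<exists>U. ev0 U \<noteq> 0 \<and> pull d f = E d ^ n * U * \<psi> d"
  shows "rx (\<psi> Vertical) \<noteq> 0 \<Longrightarrow> rx f \<noteq> 0 \<and> ox f = n + ox (\<psi> Vertical)"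
    and "ry (\<psi> (Slope 0)) \<noteq> 0 \<Longrightarrow> ry f \<noteq> 0 \<and> oy f = n + oy (\<psi> (Slope 0))"
proof -
  assume nz: "rx (\<psi> Vertical) \<noteq> 0"
  obtain U where U: "ev0 U \<noteq> 0" "pull Vertical f = Y ^ n * U * \<psi> Vertical" using f[of Vertical] by auto
  obtain u where u: "rx (\<psi> Vertical) = Y ^ ox (\<psi> Vertical) * u" "ev0 u \<noteq> 0" using ox_ex[OF nz] by blast
  have "rx f = rx (Y ^ n * U * \<psi> Vertical)" using rx_pull(1)[of f] U(2) by simp
  then have e: "rx f = Y ^ (n + ox (\<psi> Vertical)) * (rx U * u)" by (simp add: u(1) power_add mult_ac)
  have v: "ev0 (rx U * u) \<noteq> 0" using U u by simp
  have "rx U * u \<noteq> 0" using v by (metis ev0_simps(1))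
  then have "rx f \<noteq> 0" unfolding e by (simp del: mult_eq_0_iff add: no_zero_divisors)
  then show "rx f \<noteq> 0 \<and> ox f = n + ox (\<psi> Vertical)" using ox_eqI[OF e v] by blast
next
  assume nz: "ry (\<psi> (Slope 0)) \<noteq> 0"
  obtain U where U: "ev0 U \<noteq> 0" "pull (Slope 0) f = X ^ n * U * \<psi> (Slope 0)" using f[of "Slope 0"] by auto
  obtain u where u: "ry (\<psi> (Slope 0)) = X ^ oy (\<psi> (Slope 0)) * u" "ev0 u \<noteq> 0" using oy_ex[OF nz] by blast
  have "ry f = ry (X ^ n * U * \<psi> (Slope 0))" using ry_pull(2)[of f] U(2) by simp
  then have e: "ry f = X ^ (n + oy (\<psi> (Slope 0))) * (ry U * u)" by (simp add: u(1) power_add mult_ac)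
  have v: "ev0 (ry U * u) \<noteq> 0" using U u by simp
  have "ry U * u \<noteq> 0" using v by (metis ev0_simps(1))
  then have "ry f \<noteq> 0" unfolding e by (simp del: mult_eq_0_iff add: no_zero_divisors)
  then show "ry f \<noteq> 0 \<and> oy f = n + oy (\<psi> (Slope 0))" using oy_eqI[OF e v] by blast
qed

text \<open>The bounds \<open>A\<close> and \<open>B\<close> do not depend on the exponents \<open>a\<close> and \<open>b\<close>. This makes the recursion work:
  the orders of \<open>f\<close> and \<open>g\<close> at the parent determine the exponent of the new component, which
  enters the problem at the children.\<close>

definition solvable :: "point set \<Rightarrow> point set \<Rightarrow> germ \<Rightarrow> point \<Rightarrow> int \<Rightarrow> int \<Rightarrow> bool" where
  "solvable T Q F p A B \<longleftrightarrow> (\<forall>a b. adm Q p a b \<longrightarrow> (\<exists>f g. rx f \<noteq> 0 \<and> ry f \<noteq> 0 \<and> rx g \<noteq> 0 \<and> ry g \<noteq> 0 \<and>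
     int (ox f) - int (ox g) \<le> A \<and> int (oy f) - int (oy g) \<le> B \<and> tree_ok T Q p (X ^ a * Y ^ b * strict_at p F * f) g))"

text \<open>\<open>m\<close> is the exponent of the new line; of the old axes only one passing
  through the chosen direction keeps its exponent.\<close>

fun child_exp :: "direction \<Rightarrow> nat \<Rightarrow> nat \<Rightarrow> nat \<Rightarrow> nat \<times> nat" where
  "child_exp (Slope c) m a b = (m, if c = 0 then b else 0)"
| "child_exp Vertical m a b = (a, m)"

definition xy :: "nat \<times> nat \<Rightarrow> germ" where "xy e = X ^ fst e * Y ^ snd e"

lemma adm_child: "adm Q p a b \<Longrightarrow> (m = 0 \<longleftrightarrow> p \<in> Q) \<Longrightarrow> adm Q (p @ [d]) (fst (child_exp d m a b)) (snd (child_exp d m a b))"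
  by (cases d) (auto simp: adm_def adm1_def)

lemma pull_xy: "\<exists>V. ev0 V \<noteq> 0 \<and> E d ^ m * pull d (X ^ a * Y ^ b) = E d ^ (a + b) * V * xy (child_exp d m a b)"
proof (cases d)
  case (Slope c)
  obtain V where V: "ev0 V \<noteq> 0" "pull (Slope c) (X ^ a * Y ^ b) = X ^ (a + b) * Y ^ (if c = 0 then b else 0) * V"
    using pull_monomial(1) by blast
  show ?thesis unfolding Slope V(2) by (intro exI[of _ V]) (use V(1) in \<open>simp add: xy_def mult_ac\<close>)
next
  case Vertical
  show ?thesis unfolding Vertical pull_monomial(2) by (intro exI[of _ 1]) (simp add: xy_def mult_ac)
qed

text \<open>The equation between exponents says that the order of the numerator at the centre is the
  wanted exponent \<open>m\<close> on the new line plus the order \<open>ng\<close> of the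
  denominator. Up to the common factor \<open>E d ^ ng\<close> the problem at the child then has the
  same shape as at the parent.\<close>

lemma pull_step:
  assumes "F \<noteq> 0" and f: "\<exists>U. ev0 U \<noteq> 0 \<and> pull d f = E d ^ nf * U * \<psi>" and n: "a + b + ord0 F + nf = m + ng"
  shows "\<exists>V. ev0 V \<noteq> 0 \<and> pull d (X ^ a * Y ^ b * F * f) = V * E d ^ ng * (xy (child_exp d m a b) * strict d F * \<psi>)"
proof -
  obtain U where U: "ev0 U \<noteq> 0" "pull d f = E d ^ nf * U * \<psi>" using f by blast
  obtain V where V: "ev0 V \<noteq> 0" "E d ^ m * pull d (X ^ a * Y ^ b) = E d ^ (a + b) * V * xy (child_exp d m a b)"
    using pull_xy by blast
  have e: "pull d (w * F * f) = pull d w * pull d F * pull d f" for w by (simp only: pull_simps(5))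
  have "E d ^ m * pull d (X ^ a * Y ^ b * F * f) = (E d ^ m * pull d (X ^ a * Y ^ b)) * (E d ^ ord0 F * strict d F) * (E d ^ nf * U * \<psi>)"
    unfolding e U(2) pull_strict[OF assms(1)] by (simp only: mult_ac)
  also have "\<dots> = E d ^ (a + b + ord0 F + nf) * ((V * U) * (xy (child_exp d m a b) * strict d F * \<psi>))"
    unfolding V(2) power_add by (simp only: mult_ac)
  also have "\<dots> = E d ^ m * ((V * U) * E d ^ ng * (xy (child_exp d m a b) * strict d F * \<psi>))"
    unfolding n power_add by (simp only: mult_ac)
  finally have "pull d (X ^ a * Y ^ b * F * f) = (V * U) * E d ^ ng * (xy (child_exp d m a b) * strict d F * \<psi>)"
    using mult_cancel_left[of "E d ^ m"] by simp
  moreover have "ev0 (V * U) \<noteq> 0" using U V by simp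
  ultimately show ?thesis by blast
qed

text \<open>\<open>K\<close> bounds the excess of the orders at the children, so off \<open>Q\<close> the exponent \<open>K\<close> is attained by adding
  zeros only, along curves through \<open>c1\<close>, \<open>c2\<close>, \<open>c3\<close>. On \<open>Q\<close> the exponent must be \<open>0\<close>, and the excess is
  compensated by poles along a curve through \<open>c0\<close>.\<close>

lemma solvable_step:
  assumes T: "is_blowup_seq T" "p \<in> T" and F: "F \<noteq> 0"
    and nc: "\<And>r. r \<in> fibre T \<Longrightarrow> nc (exc_axes r) (strict_at r F)"
    and IH: "\<And>d. p @ [d] \<in> T \<Longrightarrow> \<exists>A B. solvable T Q F (p @ [d]) A B"
  shows "\<exists>A B. solvable T Q F p A B"
proof -
  let ?SD = "{d. p @ [d] \<in> T}"
  have "(\<lambda>d. p @ [d]) ` ?SD \<subseteq> T" by auto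
  then have "finite ((\<lambda>d. p @ [d]) ` ?SD)" using T(1) finite_subset by (auto simp: is_blowup_seq_iff)
  then have finSD: "finite ?SD" by (rule finite_imageD) (simp add: inj_on_def)
  have "\<forall>d. \<exists>A B. p @ [d] \<in> T \<longrightarrow> solvable T Q F (p @ [d]) A B" using IH by blast
  then obtain A B where AB: "\<And>d. p @ [d] \<in> T \<Longrightarrow> solvable T Q F (p @ [d]) (A d) (B d)" by metis
  \<comment> \<open>A child enters the order at the parent through its intersection with the new
    line, which is x = 0 for a slope and y = 0 for the vertical direction.\<close>
  define EB where "EB d = (case d of Slope _ \<Rightarrow> A d | Vertical \<Rightarrow> B d)" for d
  define G where "G = strict_at p F"
  have G: "G \<noteq> 0" unfolding G_def by (rule strict_at_nonzero[OF F])
  have sG: "strict d G = strict_at (p @ [d]) F" for d by (simp add: G_def strict_at_append)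
  \<comment> \<open>The summand 3 leaves a multiplicity of at least 3 for the zeros added off
    \<open>Q\<close>, one for each of \<open>c1\<close>, \<open>c2\<close>,
    \<open>c3\<close>.\<close>
  define K where "K = nat (max 0 (\<Sum>d\<in>?SD. EB d)) + 3"
  \<comment> \<open>By \<open>push_order\<close> the order along an axis is the order at the centre
    plus that of the child on the same axis. A leaf contributes 0, hence the maximum.\<close>
  define A' where "A' = int K + max 0 (A Vertical)"
  define B' where "B' = int K + max 0 (B (Slope 0))"
  \<comment> \<open>The slopes avoid 0, the directions blown up and the tangents of
    \<open>G\<close>, so the points there are leaves with a single exceptional axis at which
    \<open>G\<close> becomes a unit.\<close>
  obtain Z where Z: "card Z = (4::nat)" "finite Z" "Z \<subseteq> {c. c \<noteq> 0 \<and> Slope c \<notin> ?SD \<and> ev0 (strict (Slope c) G) \<noteq> 0}"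
  proof -
    have i: "inj Slope" by (rule injI) simp
    have "finite (Slope -` ?SD)" by (rule finite_vimageI[OF finSD i])
    moreover have "finite (Slope -` {d. ev0 (strict d G) = 0})" by (rule finite_vimageI[OF finite_nonunit_slopes[OF G] i])
    ultimately have "finite (insert 0 (Slope -` ?SD \<union> Slope -` {d. ev0 (strict d G) = 0}))" by simp
    then have "infinite (UNIV - insert 0 (Slope -` ?SD \<union> Slope -` {d. ev0 (strict d G) = 0}))"
      by (rule Diff_infinite_finite) (rule infinite_UNIV_char_0)
    then obtain Z where "Z \<subseteq> UNIV - insert 0 (Slope -` ?SD \<union> Slope -` {d. ev0 (strict d G) = 0})" "finite Z" "card Z = 4"
      using infinite_arbitrarily_large by metis
    then show thesis by (intro that[of Z]) auto
  qed
  have "\<exists>c0 c1 c2 c3. Z = {c0, c1, c2, c3} \<and> distinct [c0, c1, c2, c3]"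
  proof -
    obtain zs where zs: "set zs = Z" "distinct zs" using finite_distinct_list[OF Z(2)] by blast
    then have "length zs = 4" using Z(1) distinct_card by fastforce
    then obtain c0 c1 c2 c3 where "zs = [c0, c1, c2, c3]" by (auto simp: numeral_eq_Suc length_Suc_conv)
    then show ?thesis using zs by auto
  qed
  then obtain c0 c1 c2 c3 where c: "Z = {c0, c1, c2, c3}" "distinct [c0, c1, c2, c3]" by blast
  have cZ: "c \<noteq> 0" "p @ [Slope c] \<notin> T" "ev0 (strict (Slope c) G) \<noteq> 0" if "c \<in> {c0, c1, c2, c3}" for c
    using Z(3) that c(1) by auto
  have Tne: "T \<noteq> {}" using T(2) by blast
  have "\<exists>f g. rx f \<noteq> 0 \<and> ry f \<noteq> 0 \<and> rx g \<noteq> 0 \<and> ry g \<noteq> 0 \<and>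
     int (ox f) - int (ox g) \<le> A' \<and> int (oy f) - int (oy g) \<le> B' \<and> tree_ok T Q p (X ^ a * Y ^ b * strict_at p F * f) g"
    if adm1: "adm Q p a b" for a b
  proof -
    \<comment> \<open>The wanted excess of zeros over poles at \<open>p\<close>: on \<open>Q\<close>
      it cancels the order already present, so that the exponent \<open>m\<close> of the new line is
      0; elsewhere it is \<open>K\<close> and \<open>m\<close> is positive.\<close>
    define e where "e = (if p \<in> Q then - int (a + b + ord0 G) else int K)"
    define m where "m = nat (int (a + b + ord0 G) + e)"
    have m0: "m = 0 \<longleftrightarrow> p \<in> Q" unfolding m_def e_def K_def by auto
    have m: "int m = int (a + b + ord0 G) + e" unfolding m_def e_def by auto
    have "\<exists>f g. p @ [d] \<in> T \<longrightarrow> rx f \<noteq> 0 \<and> ry f \<noteq> 0 \<and> rx g \<noteq> 0 \<and> ry g \<noteq> 0 \<and>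
        int (ox f) - int (ox g) \<le> A d \<and> int (oy f) - int (oy g) \<le> B d \<and>
        tree_ok T Q (p @ [d]) (xy (child_exp d m a b) * strict d G * f) g" for d
      using AB[of d] adm_child[OF adm1 m0, of d] unfolding solvable_def sG xy_def by blast
    then obtain fd gd where fgd: "\<And>d. p @ [d] \<in> T \<Longrightarrow> rx (fd d) \<noteq> 0 \<and> ry (fd d) \<noteq> 0 \<and> rx (gd d) \<noteq> 0 \<and> ry (gd d) \<noteq> 0 \<and>
        int (ox (fd d)) - int (ox (gd d)) \<le> A d \<and> int (oy (fd d)) - int (oy (gd d)) \<le> B d \<and>
        tree_ok T Q (p @ [d]) (xy (child_exp d m a b) * strict d G * fd d) (gd d)" by metis
    define s where "s = (\<Sum>d\<in>?SD. int (oE d (fd d)) - int (oE d (gd d)))"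
    have "s \<le> (\<Sum>d\<in>?SD. EB d)" unfolding s_def
    proof (rule sum_mono)
      fix d assume "d \<in> ?SD"
      then show "int (oE d (fd d)) - int (oE d (gd d)) \<le> EB d" using fgd[of d] by (cases d) (auto simp: EB_def)
    qed
    then have sK: "s + 3 \<le> int K" unfolding K_def by linarith
    \<comment> \<open>The zero at \<open>c1\<close> takes the multiplicity that is missing after
      simple zeros at \<open>c2\<close> and \<open>c3\<close>, but at least 1. The pole at
      \<open>c0\<close> removes the surplus \<open>n0\<close>, which is 0 off
      \<open>Q\<close>.\<close>
    define j where "j = nat (max 1 (e - s - 2))"
    define n0 where "n0 = nat (int j + 2 - (e - s))"
    have j1: "j \<ge> 1" unfolding j_def by simp
    have n0: "int n0 = int j + 2 - (e - s)" unfolding n0_def j_def by linarith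
    have n0Q: "n0 = 0" if "p \<notin> Q" using that sK unfolding n0_def j_def e_def by simp
    define kk where "kk c = (if c = c1 then j else 1)" for c
    define \<phi>f where "\<phi>f d = (if p @ [d] \<in> T then fd d else case d of Slope c \<Rightarrow> Y ^ kk c | Vertical \<Rightarrow> 1)" for d
    define \<phi>g where "\<phi>g d = (if p @ [d] \<in> T then gd d else Y ^ n0)" for d
    let ?Z3 = "Slope ` {c1, c2, c3}"
    let ?Df = "?SD \<union> ?Z3" and ?Dg = "insert (Slope c0) ?SD"
    have rEf: "rE d (\<phi>f d) \<noteq> 0" if "d \<in> ?Df" for d using that fgd[of d] by (cases d) (auto simp: \<phi>f_def)
    have rEg: "rE d (\<phi>g d) \<noteq> 0" if "d \<in> ?Dg" for d using that fgd[of d] by (cases d) (auto simp: \<phi>g_def)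
    define \<psi>f where "\<psi>f d = (if d \<in> ?Df then \<phi>f d else 1)" for d
    define \<psi>g where "\<psi>g d = (if d \<in> ?Dg then \<phi>g d else 1)" for d
    define nf where "nf = (\<Sum>d\<in>?Df. oE d (\<phi>f d))"
    define ng where "ng = (\<Sum>d\<in>?Dg. oE d (\<phi>g d))"
    have "\<exists>f. \<forall>d. \<exists>U. ev0 U \<noteq> 0 \<and> pull d f = E d ^ nf * U * \<psi>f d"
      unfolding nf_def \<psi>f_def by (rule push_family) (use finSD rEf in auto)
    then obtain f where f: "\<And>d. \<exists>U. ev0 U \<noteq> 0 \<and> pull d f = E d ^ nf * U * \<psi>f d" by blast
    have "\<exists>g. \<forall>d. \<exists>U. ev0 U \<noteq> 0 \<and> pull d g = E d ^ ng * U * \<psi>g d"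
      unfolding ng_def \<psi>g_def by (rule push_family) (use finSD rEg in auto)
    then obtain g where g: "\<And>d. \<exists>U. ev0 U \<noteq> 0 \<and> pull d g = E d ^ ng * U * \<psi>g d" by blast
    have oxY: "ox (Y ^ n) = n" for n by (rule ox_eqI[of _ _ 1]) auto
    have nf: "nf = (\<Sum>d\<in>?SD. oE d (fd d)) + (j + 2)"
    proof -
      have "?SD \<inter> ?Z3 = {}" using cZ by auto
      then have "nf = (\<Sum>d\<in>?SD. oE d (\<phi>f d)) + (\<Sum>d\<in>?Z3. oE d (\<phi>f d))"
        unfolding nf_def using finSD by (intro sum.union_disjoint) auto
      moreover have "(\<Sum>d\<in>?SD. oE d (\<phi>f d)) = (\<Sum>d\<in>?SD. oE d (fd d))" by (rule sum.cong) (auto simp: \<phi>f_def)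
      moreover have "(\<Sum>d\<in>?Z3. oE d (\<phi>f d)) = (\<Sum>c\<in>{c1, c2, c3}. kk c)"
        by (subst sum.reindex) (auto simp: inj_on_def \<phi>f_def cZ oxY intro!: sum.cong)
      moreover have "(\<Sum>c\<in>{c1, c2, c3}. kk c) = j + 2" using c(2) by (auto simp: kk_def)
      ultimately show ?thesis by simp
    qed
    have ng: "ng = (\<Sum>d\<in>?SD. oE d (gd d)) + n0"
    proof -
      have "Slope c0 \<notin> ?SD" using cZ by auto
      then have "ng = oE (Slope c0) (\<phi>g (Slope c0)) + (\<Sum>d\<in>?SD. oE d (\<phi>g d))"
        unfolding ng_def using finSD by simp
      moreover have "(\<Sum>d\<in>?SD. oE d (\<phi>g d)) = (\<Sum>d\<in>?SD. oE d (gd d))" by (rule sum.cong) (auto simp: \<phi>g_def)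
      moreover have "oE (Slope c0) (\<phi>g (Slope c0)) = n0" using cZ[of c0] by (simp add: \<phi>g_def oxY)
      ultimately show ?thesis by simp
    qed
    have e: "int nf - int ng = e" unfolding nf ng using n0 by (simp add: s_def sum_subtractf)
    have mng: "a + b + ord0 G + nf = m + ng" using e m by linarith
    have vf: "\<psi>f Vertical = (if p @ [Vertical] \<in> T then fd Vertical else 1)" "\<psi>g Vertical = (if p @ [Vertical] \<in> T then gd Vertical else 1)"
      by (auto simp: \<psi>f_def \<psi>g_def \<phi>f_def \<phi>g_def)
    have sf: "\<psi>f (Slope 0) = (if p @ [Slope 0] \<in> T then fd (Slope 0) else 1)" "\<psi>g (Slope 0) = (if p @ [Slope 0] \<in> T then gd (Slope 0) else 1)"
      using cZ by (auto simp: \<psi>f_def \<psi>g_def \<phi>f_def \<phi>g_def)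
    have x: "rx f \<noteq> 0 \<and> ox f = nf + ox (\<psi>f Vertical)" "rx g \<noteq> 0 \<and> ox g = ng + ox (\<psi>g Vertical)"
      by (rule push_order(1)[OF f] push_order(1)[OF g]; use fgd[of Vertical] in \<open>auto simp: vf\<close>)+
    have y: "ry f \<noteq> 0 \<and> oy f = nf + oy (\<psi>f (Slope 0))" "ry g \<noteq> 0 \<and> oy g = ng + oy (\<psi>g (Slope 0))"
      by (rule push_order(2)[OF f] push_order(2)[OF g]; use fgd[of "Slope 0"] in \<open>auto simp: sf\<close>)+
    have eK: "e \<le> int K" unfolding e_def by auto
    have A': "int (ox f) - int (ox g) \<le> A'"
      using x e eK fgd[of Vertical] unfolding A'_def vf by (auto simp: ox_unit split: if_splits)
    have B': "int (oy f) - int (oy g) \<le> B'"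
      using y e eK fgd[of "Slope 0"] unfolding B'_def sf by (auto simp: oy_unit split: if_splits)
    let ?N = "X ^ a * Y ^ b * G * f"
    have pN: "\<exists>V. ev0 V \<noteq> 0 \<and> pull d ?N = V * E d ^ ng * (xy (child_exp d m a b) * strict d G * \<psi>f d)" for d
      by (rule pull_step[OF G f mng])
    have pg: "\<exists>V. ev0 V \<noteq> 0 \<and> pull d g = V * E d ^ ng * \<psi>g d" for d
      using g[of d] by (metis mult.commute)
    have okd: "tree_ok T Q (p @ [d]) (pull d ?N) (pull d g)" for d
    proof -
      obtain V1 where V1: "ev0 V1 \<noteq> 0" "pull d ?N = V1 * E d ^ ng * (xy (child_exp d m a b) * strict d G * \<psi>f d)" using pN by blast
      obtain V2 where V2: "ev0 V2 \<noteq> 0" "pull d g = V2 * E d ^ ng * \<psi>g d" using pg by blast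
      have "tree_ok T Q (p @ [d]) (xy (child_exp d m a b) * strict d G * \<psi>f d) (\<psi>g d)"
      proof (cases "p @ [d] \<in> T")
        case True
        then have "\<psi>f d = fd d" "\<psi>g d = gd d" by (auto simp: \<psi>f_def \<psi>g_def \<phi>f_def \<phi>g_def)
        then show ?thesis using fgd[OF True] by simp
      next
        case False
        then have fib: "p @ [d] \<in> fibre T" using T(2) Tne by (simp add: fibre_snoc_iff)
        have adm': "adm Q (p @ [d]) (fst (child_exp d m a b)) (snd (child_exp d m a b))" by (rule adm_child[OF adm1 m0])
        have ncG: "nc (exc_axes (p @ [d])) (strict d G)" using nc[OF fib] by (simp add: sG)
        have "leaf_ok Q (p @ [d]) (xy (child_exp d m a b) * strict d G * \<psi>f d) (\<psi>g d)"
        \<comment> \<open>The only leaf over \<open>p\<close> with a pole on a curve. It occurs on a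
          line in \<open>Q\<close>, where the exponent is 0, so here the inverse fraction takes the
          required form.\<close>
        proof (cases "d = Slope c0 \<and> n0 \<noteq> 0")
          case True
          then have d: "d = Slope c0" by blast
          have "m = 0" using True n0Q m0 by blast
          then have "xy (child_exp d m a b) = 1" using cZ(1)[of c0] by (simp add: d xy_def)
          moreover have "\<psi>f d = 1" using c(2) cZ(2)[of c0] by (auto simp: \<psi>f_def d)
          moreover have "\<psi>g d = Y ^ n0" using cZ(2)[of c0] by (auto simp: \<psi>g_def \<phi>g_def d)
          moreover have u: "ev0 (strict d G) \<noteq> 0" using cZ(3)[of c0] by (simp add: d)
          moreover obtain W where W: "ev0 W \<noteq> 0" "strict d G * W = 1" by (rule germ_inverse[OF u])
          moreover have "nc (exc_axes (p @ [d])) (W * Y ^ n0)"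
          proof -
            have "exc_axes (p @ [d]) = (True, False)" using cZ(1)[of c0] by (cases "exc_axes p") (simp add: d)
            moreover have "curve_x (Y ^ n0)" by (rule smooth_curve_x) (use oxY[of 1] in auto)
            ultimately have "nc (exc_axes (p @ [d])) (Y ^ n0)" by (simp add: nc_def)
            then show ?thesis using nc_unit_mult W(1) by blast
          qed
          moreover have "Y ^ n0 = strict d G * (W * Y ^ n0)" using W(2) by (simp add: mult.assoc[symmetric])
          moreover have "exc_mono (exc_axes (p @ [d])) (strict d G)" using exc_mono_unit u by blast
          moreover have "adm Q (p @ [d]) 0 0" using adm' \<open>m = 0\<close> cZ(1)[of c0] by (simp add: d)
          ultimately show ?thesis unfolding leaf_ok_def by (metis mult_1_left mult_1_right)
        next
          case no0: False
          have g1: "\<psi>g d = 1" using no0 False by (auto simp: \<psi>g_def \<phi>g_def)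
          have "nc (exc_axes (p @ [d])) (strict d G * \<psi>f d)"
          proof (cases "d \<in> ?Z3")
            case True
            then obtain c where c: "c \<in> {c1, c2, c3}" "d = Slope c" by blast
            have "exc_axes (p @ [d]) = (True, False)" using cZ(1)[of c] c by (cases "exc_axes p") auto
            moreover have "curve_x (Y ^ kk c)" by (rule smooth_curve_x) (use oxY[of 1] in auto)
            ultimately have "nc (exc_axes (p @ [d])) (Y ^ kk c)" by (simp add: nc_def)
            moreover have "\<psi>f d = Y ^ kk c" using True False c by (simp add: \<psi>f_def \<phi>f_def)
            moreover have "ev0 (strict d G) \<noteq> 0" using cZ(3)[of c] c by auto
            ultimately show ?thesis using nc_unit_mult by metis
          next
            case F3: False
            then have "\<psi>f d = 1" using False by (simp add: \<psi>f_def)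
            then show ?thesis using ncG by simp
          qed
          then show ?thesis unfolding leaf_ok_def g1 using adm' exc_mono_unit[of 1]
            by (intro exI[of _ "fst (child_exp d m a b)"] exI[of _ "snd (child_exp d m a b)"] exI[of _ "strict d G * \<psi>f d"])
               (simp add: xy_def mult.assoc)
        qed
        then show ?thesis by (rule tree_ok_leaf[OF T(1) fib])
      qed
      then show ?thesis unfolding V1(2) V2(2)
        by (rule tree_ok_cong) (use V1(1) V2(1) exc_mono_E in \<open>simp_all del: E.simps\<close>)
    qed
    have thr: "three_zeros T Q p ?N g"
      unfolding three_zeros_def
    proof (intro exI[of _ "{c1, c2, c3}"] conjI ballI)
      show "card {c1, c2, c3} = 3" using c(2) by simp
      fix c assume c': "c \<in> {c1, c2, c3}"
      then have cz: "c \<noteq> 0" "p @ [Slope c] \<notin> T" "ev0 (strict (Slope c) G) \<noteq> 0" using cZ[of c] by auto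
      show "p @ [Slope c] \<in> fibre T" using cz T(2) Tne by (simp add: fibre_snoc_iff)
      obtain V1 where V1: "ev0 V1 \<noteq> 0" "pull (Slope c) ?N = V1 * E (Slope c) ^ ng * (xy (child_exp (Slope c) m a b) * strict (Slope c) G * \<psi>f (Slope c))" using pN by blast
      obtain V2 where V2: "ev0 V2 \<noteq> 0" "pull (Slope c) g = V2 * E (Slope c) ^ ng * \<psi>g (Slope c)" using pg by blast
      have "c \<noteq> c0" using c' c(2) by auto
      then have g1: "\<psi>g (Slope c) = 1" using cz by (simp add: \<psi>g_def)
      have f1: "\<psi>f (Slope c) = Y ^ kk c" using cz c' by (auto simp: \<psi>f_def \<phi>f_def)
      have x1: "xy (child_exp (Slope c) m a b) = X ^ m" using cz by (simp add: xy_def)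
      obtain W where W: "ev0 W \<noteq> 0" "V2 * W = 1" by (rule germ_inverse[OF V2(1)])
      have "pull (Slope c) ?N = (V2 * W) * (V1 * E (Slope c) ^ ng * (X ^ m * strict (Slope c) G * Y ^ kk c))"
        unfolding V1(2) x1 f1 W(2) by simp
      also have "\<dots> = pull (Slope c) g * (X ^ m * Y ^ kk c * (W * V1 * strict (Slope c) G))"
        unfolding V2(2) g1 by (simp only: mult_ac mult_1_left mult_1_right)
      finally have "pull (Slope c) ?N = pull (Slope c) g * (X ^ m * Y ^ kk c * (W * V1 * strict (Slope c) G))" .
      moreover have "ev0 (W * V1 * strict (Slope c) G) \<noteq> 0" using W V1 cz by simp
      moreover have "kk c \<ge> 1" using j1 by (simp add: kk_def)
      ultimately show "\<exists>a k U. (a = 0 \<longleftrightarrow> p \<in> Q) \<and> k \<ge> (1::nat) \<and> ev0 U \<noteq> 0 \<and>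
        pull (Slope c) ?N = pull (Slope c) g * (X ^ a * Y ^ k * U)" using m0 by (intro exI[of _ m] exI[of _ "kk c"] exI[of _ "W * V1 * strict (Slope c) G"]) (simp del: pull.simps pull_simps)
    qed
    have "tree_ok T Q p ?N g" by (rule tree_ok_node[OF T(2) okd thr])
    then show ?thesis using x y A' B' unfolding G_def by blast
  qed
  then have "solvable T Q F p A' B'" unfolding solvable_def by blast
  then show ?thesis by blast
qed

lemma solvable_all:
  assumes T: "is_blowup_seq T" and F: "F \<noteq> 0"
    and nc: "\<And>r. r \<in> fibre T \<Longrightarrow> nc (exc_axes r) (strict_at r F)" and p: "p \<in> T"
  shows "\<exists>A B. solvable T Q F p A B"
  using p
proof (induction "card {r. p @ r \<in> T}" arbitrary: p rule: less_induct)
  case less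
  have fin: "finite {r. p @ r \<in> T}"
  proof -
    have "finite ((@) p -` T)" by (rule finite_vimageI) (use T in \<open>auto simp: is_blowup_seq_iff inj_on_def\<close>)
    then show ?thesis by (simp add: vimage_def)
  qed
  show ?case
  proof (rule solvable_step[OF T less.prems F nc])
    fix d assume d: "p @ [d] \<in> T"
    have "(#) d ` {r. (p @ [d]) @ r \<in> T} \<subset> {r. p @ r \<in> T}"
    proof
      show "(#) d ` {r. (p @ [d]) @ r \<in> T} \<subseteq> {r. p @ r \<in> T}" by auto
      show "(#) d ` {r. (p @ [d]) @ r \<in> T} \<noteq> {r. p @ r \<in> T}" using less.prems by auto
    qed
    then have "card ((#) d ` {r. (p @ [d]) @ r \<in> T}) < card {r. p @ r \<in> T}" by (rule psubset_card_mono[OF fin])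
    moreover have "card ((#) d ` {r. (p @ [d]) @ r \<in> T}) = card {r. (p @ [d]) @ r \<in> T}" by (rule card_image) simp
    ultimately show "\<exists>A B. solvable T Q F (p @ [d]) A B" using less.hyps d by simp
  qed auto
qed

lemma fraction_tree:
  assumes T: "is_blowup_seq T" "[] \<in> T" and F: "F \<noteq> 0"
    and nc: "\<And>r. r \<in> fibre T \<Longrightarrow> nc (exc_axes r) (strict_at r F)"
  obtains f D where "f \<noteq> 0" "D \<noteq> 0" "tree_ok T Q [] (F * f) D"
proof -
  obtain A B where "solvable T Q F [] A B" using solvable_all[OF T(1) F nc T(2)] by blast
  moreover have "adm Q [] 0 0" by (simp add: adm_def adm1_def)
  ultimately obtain f g where fg: "rx f \<noteq> 0" "rx g \<noteq> 0" "tree_ok T Q [] (X ^ 0 * Y ^ 0 * strict_at [] F * f) g"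
    unfolding solvable_def by blast
  show thesis by (rule that[of f g]) (use fg in auto)
qed

section \<open>Making all leaves monomial\<close>

lemma strict_at_unit: "ev0 f \<noteq> 0 \<Longrightarrow> ev0 (strict_at r f) \<noteq> 0"
  by (induction r arbitrary: f) (auto simp: strict_unit)

lemma nc_fibre_mono':
  assumes "is_blowup_seq T" "T \<subseteq> T'"
    and nc: "\<And>p. p \<in> fibre T \<Longrightarrow> nc (exc_axes p) (strict_at p F)" and p: "p \<in> fibre T'"
  shows "nc (exc_axes p) (strict_at p F)"
proof -
  have "p \<notin> T" using fibre_notin[OF p] assms(2) by blast
  then obtain q r where q: "p = q @ r" "q \<in> fibre T" using prefix_in_fibre[OF assms(1)] by blast
  show ?thesis
  proof (cases "q = []")
    case True
    then have "ev0 F \<noteq> 0" using nc[OF q(2)] by (simp add: nc_def)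
    then show ?thesis using strict_at_unit by (simp add: nc_def)
  next
    case False
    then show ?thesis using nc_strict_at[OF nc[OF q(2)] exc_axes_some] q(1) by (simp add: exc_axes_append strict_at_append)
  qed
qed

text \<open>\<open>z = x - \<zeta>(y)\<close> and \<open>w = y - \<phi>(x)\<close> are local coordinates in which \<open>H\<close> is a monomial.\<close>

definition mono_form :: "point set \<Rightarrow> point \<Rightarrow> germ \<Rightarrow> bool" where
  "mono_form Q p H \<longleftrightarrow> (\<exists>\<zeta> \<phi> i k U. rx \<zeta> = \<zeta> \<and> ry \<phi> = \<phi> \<and> ev0 \<zeta> = 0 \<and> ev0 \<phi> = 0 \<and> ev0 U \<noteq> 0 \<and> (i > 0 \<or> k > 0) \<and>
     H = (X - \<zeta>) ^ i * (Y - \<phi>) ^ k * U \<and>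
     (\<forall>q. fst (labels p) = Some q \<longrightarrow> \<zeta> = 0 \<and> (i = 0 \<longleftrightarrow> q \<in> Q)) \<and>
     (\<forall>q. snd (labels p) = Some q \<longrightarrow> \<phi> = 0 \<and> (k = 0 \<longleftrightarrow> q \<in> Q)))"

text \<open>The levels of a fraction do not change under Moebius transformations, which bring it to the form \<open>H\<close>.\<close>

definition mono_leaf :: "point set \<Rightarrow> point \<Rightarrow> germ \<Rightarrow> germ \<Rightarrow> bool" where
  "mono_leaf Q p N D \<longleftrightarrow> (\<exists>\<alpha> \<beta> \<gamma> \<delta> H. \<alpha> * \<delta> - \<beta> * \<gamma> \<noteq> 0 \<and> mono_form Q p H \<and> exc_mono (exc_axes p) (C \<gamma> * N + C \<delta> * D) \<and>
     C \<alpha> * N + C \<beta> * D = (C \<gamma> * N + C \<delta> * D) * H)"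

text \<open>If \<open>M\<close> is not a unit, normal crossings leave exactly one exceptional axis.
  The curve of \<open>M\<close> then serves as the other coordinate axis, which carries no exponent
  of its own.\<close>

lemma mono_formI:
  assumes adm1: "adm Q p a b" and nc: "nc (exc_axes p) M" and nu: "\<not> (a = 0 \<and> b = 0 \<and> ev0 M \<noteq> 0)"
  shows "mono_form Q p (X ^ a * Y ^ b * M)"
proof -
  have labels: "(fst (labels p) = Some q \<longrightarrow> (a = 0 \<longleftrightarrow> q \<in> Q)) \<and> (snd (labels p) = Some q \<longrightarrow> (b = 0 \<longleftrightarrow> q \<in> Q))" for q
    using adm1 by (auto simp: adm_def adm1_def)
  consider (u) "ev0 M \<noteq> 0" | (x) "ev0 M = 0" "exc_axes p = (True, False)" "curve_x M" | (y) "ev0 M = 0" "exc_axes p = (False, True)" "curve_x (sw M)"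
    using nc unfolding nc_def by blast
  then show ?thesis
  proof cases
    case u
    then show ?thesis unfolding mono_form_def using nu labels
      by (intro exI[of _ 0] exI[of _ a] exI[of _ b] exI[of _ M]) auto
  next
    case x
    then obtain \<phi> k U where U: "ry \<phi> = \<phi>" "ev0 \<phi> = 0" "ev0 U \<noteq> 0" "M = U * (Y - \<phi>) ^ k"
      unfolding curve_x_def by blast
    have k: "k \<noteq> 0" using x(1) U(3,4) by auto
    have l: "snd (labels p) = None" using x(2) by (auto simp: exc_axes_def)
    then have "b = 0" using adm1 by (simp add: adm_def adm1_def)
    then have "X ^ a * Y ^ b * M = (X - 0) ^ a * (Y - \<phi>) ^ k * U" using U(4) by (simp add: mult_ac)
    then show ?thesis unfolding mono_form_def using U k labels l
      by (intro exI[of _ 0] exI[of _ \<phi>] exI[of _ a] exI[of _ k] exI[of _ U]) simp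
  next
    case y
    then obtain \<phi> k U where U: "ry \<phi> = \<phi>" "ev0 \<phi> = 0" "ev0 U \<noteq> 0" "sw M = U * (Y - \<phi>) ^ k"
      unfolding curve_x_def by blast
    have M: "M = sw U * (X - sw \<phi>) ^ k" using arg_cong[OF U(4), of sw] by simp
    have k: "k \<noteq> 0" using y(1) U(3) M by auto
    have l: "fst (labels p) = None" using y(2) by (auto simp: exc_axes_def)
    then have "a = 0" using adm1 by (simp add: adm_def adm1_def)
    then have "X ^ a * Y ^ b * M = (X - sw \<phi>) ^ k * (Y - 0) ^ b * sw U" using M by (simp add: mult_ac)
    moreover have "rx (sw \<phi>) = sw \<phi>" using U(1) by (simp add: rx_sw)
    ultimately show ?thesis unfolding mono_form_def using U k labels l
      by (intro exI[of _ "sw \<phi>"] exI[of _ 0] exI[of _ k] exI[of _ b] exI[of _ "sw U"]) simp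
  qed
qed

text \<open>The leaves left over have a finite nonzero value of the fraction, and by admissibility
  all components through them lie in \<open>Q\<close>.\<close>

lemma leaf_ok_cases:
  assumes "leaf_ok Q p N D"
  obtains (mono_leaf) "mono_leaf Q p N D"
    | (unit) M where "adm Q p 0 0" "ev0 M \<noteq> 0" "N = D * M" "exc_mono (exc_axes p) D"
proof -
  obtain a b M where M: "adm Q p a b" "nc (exc_axes p) M" and
    c: "(N = D * (X ^ a * Y ^ b * M) \<and> exc_mono (exc_axes p) D) \<or> (a = 0 \<and> b = 0 \<and> D = N * M \<and> exc_mono (exc_axes p) N)"
    using assms unfolding leaf_ok_def by blast
  show thesis
  proof (cases "a = 0 \<and> b = 0 \<and> ev0 M \<noteq> 0")
    case True
    obtain W where W: "ev0 W \<noteq> 0" "M * W = 1" by (rule germ_inverse) (use True in blast)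
    from c show ?thesis
    proof
      assume "N = D * (X ^ a * Y ^ b * M) \<and> exc_mono (exc_axes p) D"
      then show ?thesis using True M(1) by (intro unit[of M]) simp_all
    next
      assume d: "a = 0 \<and> b = 0 \<and> D = N * M \<and> exc_mono (exc_axes p) N"
      then have "N = D * W" using W(2) by (simp add: mult.assoc)
      moreover have "exc_mono (exc_axes p) D" using d True by (metis exc_mono_mult exc_mono_unit)
      ultimately show ?thesis using True M(1) W(1) by (intro unit[of W]) simp_all
    qed
  next
    case False
    then have h: "mono_form Q p (X ^ a * Y ^ b * M)" by (rule mono_formI[OF M])
    from c have "mono_leaf Q p N D"
    proof
      assume "N = D * (X ^ a * Y ^ b * M) \<and> exc_mono (exc_axes p) D"
      then show ?thesis unfolding mono_leaf_def using h
        by (intro exI[of _ 1] exI[of _ 0] exI[of _ 0] exI[of _ 1] exI[of _ "X ^ a * Y ^ b * M"]) (simp add: C_simps)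
    next
      assume d: "a = 0 \<and> b = 0 \<and> D = N * M \<and> exc_mono (exc_axes p) N"
      then have "mono_form Q p M" using h by simp
      then show ?thesis unfolding mono_leaf_def using d
        by (intro exI[of _ 0] exI[of _ 1] exI[of _ 1] exI[of _ 0] exI[of _ M]) (simp add: C_simps)
    qed
    then show ?thesis by (rule mono_leaf)
  qed
qed

text \<open>Since \<open>H\<close> vanishes at \<open>p\<close>, every later exceptional line gets a
  positive exponent, as admissibility demands of components outside \<open>Q\<close>.\<close>

lemma pull_at_strict_at_exceptional:
  assumes H: "H \<noteq> 0" "ev0 H = 0" and p: "\<And>r. p @ r \<notin> Q" "adm Q p 0 0"
  shows "\<exists>a b V. ev0 V \<noteq> 0 \<and> adm Q (p @ r) a b \<and> (r = [] \<or> a + b > 0) \<and> pull_at r H = V * (X ^ a * Y ^ b * strict_at r H)"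
proof (induction r rule: rev_induct)
  case Nil
  show ?case using p(2) by (intro exI[of _ 0] exI[of _ 1]) simp
next
  case (snoc d r)
  then obtain a b V where V: "ev0 V \<noteq> 0" "adm Q (p @ r) a b" "r = [] \<or> a + b > 0" "pull_at r H = V * (X ^ a * Y ^ b * strict_at r H)"
    by blast
  let ?S = "strict_at r H"
  have S: "?S \<noteq> 0" by (rule strict_at_nonzero[OF H(1)])
  define m where "m = a + b + ord0 ?S"
  have m: "m > 0"
  proof (cases "r = []")
    case True
    then show ?thesis using ord0_pos[OF H] by (simp add: m_def)
  qed (use V(3) m_def in simp)
  have e: "\<exists>U. ev0 U \<noteq> 0 \<and> pull d 1 = E d ^ 0 * U * 1" by (intro exI[of _ 1]) simp
  obtain W where W: "ev0 W \<noteq> 0" "pull d (X ^ a * Y ^ b * ?S * 1) = W * E d ^ 0 * (xy (child_exp d m a b) * strict d ?S * 1)"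
    using pull_step[OF S e, of a b m 0] by (auto simp: m_def)
  have "pull_at (r @ [d]) H = pull d V * pull d (X ^ a * Y ^ b * ?S)" by (simp add: pull_at_append V(4))
  also have "\<dots> = pull d V * W * (xy (child_exp d m a b) * strict d ?S)" using W(2) by (simp add: mult.assoc)
  finally have "pull_at (r @ [d]) H = pull d V * W * (xy (child_exp d m a b) * strict_at (r @ [d]) H)" by (simp add: strict_at_append)
  moreover have "adm Q ((p @ r) @ [d]) (fst (child_exp d m a b)) (snd (child_exp d m a b))"
    by (rule adm_child[OF V(2)]) (use m p(1) in simp)
  moreover have "fst (child_exp d m a b) + snd (child_exp d m a b) > 0" using m by (cases d) auto
  moreover have "ev0 (pull d V * W) \<noteq> 0" using V(1) W(1) by simp
  ultimately show ?case unfolding xy_def append_assoc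
    by - (rule exI[of _ "fst (child_exp d m a b)"], rule exI[of _ "snd (child_exp d m a b)"], rule exI[of _ "pull d V * W"], simp)
qed

text \<open>Subtracting the value v at the point is a Moebius transformation that makes the fraction
  vanish there; resolving its zero set then gives monomials.\<close>

lemma mono_leaf_resolved:
  assumes M: "adm Q p 0 0" "N = D * M" "exc_mono (exc_axes p) D" and p: "\<And>r. p @ r \<notin> Q"
    and H: "H = M - C v" "H \<noteq> 0" "ev0 H = 0" and nc: "nc (exc_axes (p @ r)) (strict_at r H)"
  shows "mono_leaf Q (p @ r) (pull_at r N) (pull_at r D)"
proof -
  obtain a b V where V: "ev0 V \<noteq> 0" "adm Q (p @ r) a b" "r = [] \<or> a + b > 0" "pull_at r H = V * (X ^ a * Y ^ b * strict_at r H)"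
    using pull_at_strict_at_exceptional[OF H(2,3) p M(1)] by blast
  have "mono_form Q (p @ r) (X ^ a * Y ^ b * (V * strict_at r H))"
  proof (rule mono_formI[OF V(2) nc_unit_mult[OF nc V(1)]])
    show "\<not> (a = 0 \<and> b = 0 \<and> ev0 (V * strict_at r H) \<noteq> 0)" using V(3) H(3) by auto
  qed
  moreover have "X ^ a * Y ^ b * (V * strict_at r H) = pull_at r H" unfolding V(4) by (simp only: mult_ac)
  ultimately have h: "mono_form Q (p @ r) (pull_at r H)" by simp
  have "exc_mono (exc_axes (p @ r)) (pull_at r D)" using exc_mono_pull_at[OF M(3)] by (simp add: exc_axes_append)
  moreover have "pull_at r N - C v * pull_at r D = pull_at r D * pull_at r H" unfolding H(1) M(2) by (simp add: algebra_simps)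
  ultimately show ?thesis unfolding mono_leaf_def using h
    by (intro exI[of _ 1] exI[of _ "- v"] exI[of _ 0] exI[of _ 1] exI[of _ "pull_at r H"]) (simp add: C_simps)
qed

text \<open>Comparison of leading coefficients shows that nonzero polynomials with vanishing
  Wronskian have equal degrees. Subtracting the multiple of \<open>R\<close> that kills the leading
  term of \<open>P\<close> keeps the Wronskian 0 but lowers the degree, so the difference is
  0.\<close>

lemma pderiv_ratio_constant:
  fixes P R :: "complex poly"
  assumes R: "R \<noteq> 0" and W: "pderiv P * R = P * pderiv R"
  shows "\<exists>v. P = smult v R"
proof -
  define v where "v = lead_coeff P / lead_coeff R"
  have "P - smult v R = 0"
  proof (rule ccontr)
    let ?S = "P - smult v R"
    assume S: "?S \<noteq> 0"
    have WS: "pderiv ?S * R = ?S * pderiv R" using W by (simp add: pderiv_diff pderiv_smult algebra_simps)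
    have dd: "degree A = degree B" if h: "A \<noteq> 0" "B \<noteq> 0" "pderiv A * B = A * pderiv B" for A B :: "complex poly"
    proof -
      have c: "coeff (pderiv A * B) (degree A + degree B - 1) = of_nat (degree A) * lead_coeff A * lead_coeff B"
        if "degree A + degree B > 0" for A B :: "complex poly"
      proof (cases "degree A = 0")
        case True
        then have "pderiv A = 0" by (simp add: pderiv_eq_0_iff)
        then show ?thesis using True by simp
      next
        case False
        then have "coeff (pderiv A * B) (degree (pderiv A) + degree B) = lead_coeff (pderiv A) * lead_coeff B"
          by (intro coeff_mult_degree_sum)
        moreover have "degree (pderiv A) + degree B = degree A + degree B - 1" using False by (simp add: degree_pderiv)
        moreover have "lead_coeff (pderiv A) = of_nat (degree A) * lead_coeff A"
          using False by (simp add: degree_pderiv coeff_pderiv)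
        ultimately show ?thesis by simp
      qed
      show ?thesis
      proof (cases "degree A + degree B > 0")
        case True
        have "of_nat (degree A) * lead_coeff A * lead_coeff B = of_nat (degree B) * lead_coeff B * lead_coeff A"
        proof -
          have "degree B + degree A > 0" using True by linarith
          then have "coeff (pderiv B * A) (degree B + degree A - 1) = of_nat (degree B) * lead_coeff B * lead_coeff A" by (rule c)
          moreover have "pderiv B * A = pderiv A * B" using h(3) by (simp add: mult.commute)
          ultimately show ?thesis using c[OF True] by (simp only: add.commute)
        qed
        then have "of_nat (degree A) * (lead_coeff A * lead_coeff B) = of_nat (degree B) * (lead_coeff A * lead_coeff B)"
          by (simp only: mult_ac)
        moreover have "lead_coeff A * lead_coeff B \<noteq> 0" using h(1,2) by simp
        ultimately have "(of_nat (degree A) :: complex) = of_nat (degree B)" using mult_right_cancel by blast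
        then show ?thesis by simp
      qed simp
    qed
    have P: "P \<noteq> 0" using S by (auto simp: v_def)
    have "degree P = degree R" by (rule dd[OF P R W])
    moreover have "degree ?S = degree R" by (rule dd[OF S R WS])
    moreover have "coeff ?S (degree R) = 0" using calculation R by (simp add: v_def)
    ultimately show False using S by (metis leading_coeff_0_iff)
  qed
  then show ?thesis by (intro exI[of _ v]) simp
qed

text \<open>Wronskian criterion: if the lowest forms of \<open>A\<close> and \<open>B\<close> have a nonconstant quotient, then \<open>A / B\<close> has only
  finitely many critical points on the exceptional line.\<close>

lemma critical_slope:
  assumes A: "A \<noteq> 0" and B: "B \<noteq> 0" and M: "ev0 M \<noteq> 0" and e: "pull (Slope c) A = pull (Slope c) B * M"
    and nr: "\<And>v. lead_poly A \<noteq> smult v (lead_poly B)"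
  shows "rx (M - C (ev0 M)) \<noteq> 0"
    and "poly (pderiv (lead_poly A) * lead_poly B - lead_poly A * pderiv (lead_poly B)) c \<noteq> 0 \<Longrightarrow> ox (M - C (ev0 M)) = 1"
proof -
  let ?P = "lead_poly A" and ?R = "lead_poly B" and ?H = "M - C (ev0 M)"
  define v where "v = ev0 M"
  have "rx (strict (Slope c) A) \<noteq> 0" using rE_strict[OF A, of "Slope c"] by simp
  moreover have "rx (strict (Slope c) B * M) \<noteq> 0" using rE_strict[OF B, of "Slope c"] unit_rx_ry[OF M] by simp
  moreover have "X ^ ord0 A * strict (Slope c) A = X ^ ord0 B * (strict (Slope c) B * M)"
    using e pull_strict[OF A, of "Slope c"] pull_strict[OF B, of "Slope c"] by (simp add: mult.assoc)
  ultimately have "strict (Slope c) A = strict (Slope c) B * M" using X_power_rx_eq by blast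
  then have "poly_at ?P (Y + C c) = poly_at ?R (Y + C c) * rx M" using strict_Slope[OF A, of c] strict_Slope[OF B, of c] by simp
  then have eH: "poly_at (?P - smult v ?R) (Y + C c) = poly_at ?R (Y + C c) * rx ?H"
    using poly_at_add[of "?P - smult v ?R" "smult v ?R" "Y + C c"] by (simp add: poly_at_smult v_def algebra_simps)
  have S: "?P - smult v ?R \<noteq> 0" using nr[of v] by simp
  then have "poly_at (?P - smult v ?R) (Y + C c) \<noteq> 0" unfolding poly_at_eq_0_iff .
  then show nz: "rx ?H \<noteq> 0" using eH by auto
  assume W: "poly (pderiv ?P * ?R - ?P * pderiv ?R) c \<noteq> 0"
  let ?S = "?P - smult v ?R"
  \<comment> \<open>Subtracting a multiple of the denominator does not change the Wronskian.\<close>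
  have WS: "poly (pderiv ?P * ?R - ?P * pderiv ?R) c = poly (pderiv ?S) c * poly ?R c - poly ?S c * poly (pderiv ?R) c"
    by (simp add: pderiv_diff pderiv_smult algebra_simps)
  have "poly ?S c = 0" using arg_cong[OF eH, of ev0] by simp
  then have R: "poly ?R c \<noteq> 0" "poly (pderiv ?S) c \<noteq> 0" using W WS by auto
  obtain u where u: "poly_at ?S (Y + C c) = Y ^ order c ?S * u" "ev0 u \<noteq> 0" using poly_at_order[OF S] by blast
  have "order c ?S = 1"
  proof -
    have "order c ?S \<noteq> 0" using \<open>poly ?S c = 0\<close> S order_root[of ?S c] by blast
    moreover have "\<not> order c ?S \<ge> 2"
    proof
      assume "order c ?S \<ge> 2"
      then have "[:- c, 1:] ^ 2 dvd ?S" by (metis order_divides)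
      then obtain k where k: "?S = [:- c, 1:] ^ 2 * k" by (elim dvdE)
      define L where "L = [:- c, 1:]"
      have "pderiv ?S = L * pderiv (L * k) + L * k * pderiv L"
        unfolding k L_def[symmetric] power2_eq_square mult.assoc by (subst pderiv_mult) (simp only: mult_ac)
      moreover have "poly L c = 0" by (simp add: L_def)
      ultimately have "poly (pderiv ?S) c = 0" by simp
      then show False using R(2) by simp
    qed
    ultimately show ?thesis by linarith
  qed
  moreover have evR: "ev0 (poly_at ?R (Y + C c)) \<noteq> 0" using R(1) by simp
  moreover obtain W where W: "ev0 W \<noteq> 0" "poly_at ?R (Y + C c) * W = 1" by (rule germ_inverse[OF evR])
  ultimately have "rx ?H = Y ^ 1 * (u * W)" using eH u by (metis mult.assoc mult.commute mult.right_neutral)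
  then show "ox ?H = 1" by (rule ox_eqI) (use u W in simp)
qed

text \<open>At a zero on the line the quotient of the leading polynomials vanishes, so a constant
  quotient would be 0, although the leading polynomial of \<open>A\<close> is not.\<close>

lemma three_zeros_nonconstant:
  assumes "three_zeros T Q t A B" "A \<noteq> 0" "B \<noteq> 0" "t \<in> Q" shows "lead_poly A \<noteq> smult v (lead_poly B)"
proof
  assume l: "lead_poly A = smult v (lead_poly B)"
  obtain S where S: "card S = 3" and SS: "\<forall>c\<in>S. t @ [Slope c] \<in> fibre T \<and>
     (\<exists>a k U. (a = 0 \<longleftrightarrow> t \<in> Q) \<and> k \<ge> (1::nat) \<and> ev0 U \<noteq> 0 \<and>
        pull (Slope c) A = pull (Slope c) B * (X ^ a * Y ^ k * U))"
    using assms(1) unfolding three_zeros_def by (elim exE conjE)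
  have "S \<noteq> {}" using S by auto
  then obtain c where c: "c \<in> S" by blast
  obtain a k U where U: "a = 0 \<longleftrightarrow> t \<in> Q" "k \<ge> (1::nat)" "ev0 U \<noteq> 0"
        "pull (Slope c) A = pull (Slope c) B * (X ^ a * Y ^ k * U)" using bspec[OF SS c] by (elim exE conjE)
  have a: "a = 0" using U(1) assms(4) by simp
  have "rx (strict (Slope c) A) \<noteq> 0" using rE_strict[OF assms(2), of "Slope c"] by simp
  moreover have "rx (strict (Slope c) B * (Y ^ k * U)) \<noteq> 0" using rE_strict[OF assms(3), of "Slope c"] unit_rx_ry[OF U(3)] by simp
  moreover have "X ^ ord0 A * strict (Slope c) A = X ^ ord0 B * (strict (Slope c) B * (Y ^ k * U))"
    using U(4) a pull_strict[OF assms(2), of "Slope c"] pull_strict[OF assms(3), of "Slope c"] by (simp add: mult.assoc)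
  ultimately have "strict (Slope c) A = strict (Slope c) B * (Y ^ k * U)" using X_power_rx_eq by blast
  then have "poly_at (lead_poly A) (Y + C c) = poly_at (lead_poly B) (Y + C c) * (Y ^ k * rx U)"
    using strict_Slope[OF assms(2), of c] strict_Slope[OF assms(3), of c] by simp
  then have "poly_at (lead_poly B) (Y + C c) * C v = poly_at (lead_poly B) (Y + C c) * (Y ^ k * rx U)" unfolding l poly_at_smult by (simp only: mult.commute)
  moreover have "poly_at (lead_poly B) (Y + C c) \<noteq> 0" unfolding poly_at_eq_0_iff by (rule lead_poly_nonzero[OF assms(3)])
  ultimately have "C v = Y ^ k * rx U" using mult_left_cancel by blast
  then have "v = ev0 (Y ^ k * rx U)" by (metis ev0_CXY(1))
  then have "v = 0" using U(2) by simp
  then show False using l lead_poly_nonzero[OF assms(2)] by simp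
qed

section \<open>Grafting trees onto leaves\<close>

lemma graft:
  assumes T: "is_blowup_seq T" "T \<noteq> {}" and TT: "\<And>p. is_blowup_seq (TT p)" "finite {p \<in> fibre T. TT p \<noteq> {}}"
  defines "T' \<equiv> T \<union> {p @ r | p r. p \<in> fibre T \<and> r \<in> TT p}"
  shows "is_blowup_seq T'" "s \<in> fibre T' \<Longrightarrow> \<exists>p r. s = p @ r \<and> p \<in> fibre T \<and> r \<in> fibre (TT p)"
proof -
  have T'eq: "T' = T \<union> (\<Union>p\<in>{p \<in> fibre T. TT p \<noteq> {}}. (@) p ` TT p)" unfolding T'_def by auto
  have mem: "p @ r \<in> T' \<longleftrightarrow> r \<in> TT p" if p: "p \<in> fibre T" for p r
  proof
    assume "p @ r \<in> T'"
    then consider "p @ r \<in> T" | p' r' where "p @ r = p' @ r'" "p' \<in> fibre T" "r' \<in> TT p'" unfolding T'_def by blast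
    then show "r \<in> TT p"
    proof cases
      case 1
      then show ?thesis using blowup_seq_prefix[OF T(1)] fibre_notin[OF p] by blast
    next
      case 2
      from 2(1) consider u where "p' = p @ u" "r = u @ r'" | u where "p = p' @ u" "u @ r = r'"
        by (auto simp: append_eq_append_conv2)
      then show ?thesis
      proof cases
        case (1 u)
        then have "u = []" using fibre_incomparable[OF T(1) p, of u] 2(2) by simp
        then show ?thesis using 1 2 by simp
      next
        case (2 u)
        then have "u = []" using fibre_incomparable[OF T(1), of p' u] p \<open>p' \<in> fibre T\<close> by simp
        then show ?thesis using 2 \<open>r' \<in> TT p'\<close> by simp
      qed
    qed
  next
    assume "r \<in> TT p"
    then show "p @ r \<in> T'" using p unfolding T'_def by blast
  qed
  show "is_blowup_seq T'"
    unfolding is_blowup_seq_iff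
  proof (intro conjI allI impI)
    show "finite T'" unfolding T'eq using T TT by (auto simp: is_blowup_seq_iff)
    fix s a assume sa: "s @ [a] \<in> T'"
    show "s \<in> T'"
    proof (cases "s @ [a] \<in> T")
      case True
      then show ?thesis using T(1) unfolding T'_def is_blowup_seq_iff by blast
    next
      case False
      then obtain p r where pr: "s @ [a] = p @ r" "p \<in> fibre T" "r \<in> TT p" using sa unfolding T'_def by blast
      show ?thesis
      proof (cases r rule: rev_cases)
        case Nil
        then have "s \<in> T" using pr(1,2) T(2) by (auto simp: fibre_def)
        then show ?thesis unfolding T'_def by blast
      next
        case (snoc r' b)
        then have "r' \<in> TT p" using pr(3) TT(1)[of p] by (auto simp: is_blowup_seq_iff)
        moreover have "s = p @ r'" using pr(1) snoc by simp
        ultimately show ?thesis using mem[OF pr(2)] by simp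
      qed
    qed
  qed
  assume s: "s \<in> fibre T'"
  have "s \<notin> T" using fibre_notin[OF s] unfolding T'_def by blast
  then obtain p r where p: "s = p @ r" "p \<in> fibre T" using prefix_in_fibre[OF T(1)] by blast
  have "r \<in> fibre (TT p)"
  proof (cases r rule: rev_cases)
    case Nil
    then have "[] \<notin> TT p" using fibre_notin[OF s] mem[OF p(2), of "[]"] p(1) by simp
    then have "TT p = {}" using blowup_seq_Nil[OF TT(1)] by blast
    then show ?thesis using Nil by (simp add: fibre_def)
  next
    case (snoc r' b)
    have "T' \<noteq> {}" using T(2) unfolding T'_def by blast
    then have "p @ r' \<in> T'" "p @ r' @ [b] \<notin> T'" using s p snoc fibre_snoc_iff[of T' "p @ r'" b] by auto
    then show ?thesis using mem[OF p(2)] snoc by (auto simp: fibre_def)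
  qed
  then show "\<exists>p r. s = p @ r \<and> p \<in> fibre T \<and> r \<in> fibre (TT p)" using p by blast
qed

lemma resolved_fraction:
  assumes F: "F \<noteq> 0" and T0: "is_blowup_seq T0" "Q \<subseteq> T0"
  obtains N D T T2 where "N \<noteq> 0" "D \<noteq> 0" "F dvd N" "is_blowup_seq T" "[] \<in> T" "Q \<subseteq> T" "is_blowup_seq T2" "T \<subseteq> T2"
    "\<And>t. t \<in> T \<Longrightarrow> three_zeros T Q t (pull_at t N) (pull_at t D)" "\<And>p. p \<in> fibre T2 \<Longrightarrow> mono_leaf Q p (pull_at p N) (pull_at p D)"
proof -
  obtain TF where TF: "is_blowup_seq TF" "\<forall>r\<in>fibre TF. nc (exc_axes_from (False, False) r) (strict_at r F)"
    using res_tree[OF embedded_resolution[OF F]] by blast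
  define T1 where "T1 = insert [] (TF \<union> T0)"
  have T1: "finite T1" "\<And>p a. p @ [a] \<in> T1 \<Longrightarrow> p \<in> T1" using TF(1) T0(1) unfolding T1_def is_blowup_seq_iff by auto
  \<comment> \<open>Blowing up slope 0 and the vertical direction at every point of
    \<open>T1\<close> ensures that a leaf directly on the line of a point in \<open>Q\<close> has
    nonzero slope, hence a single exceptional axis. If two components meet at a leaf, the later one
    is therefore not in \<open>Q\<close>.\<close>
  define T where "T = T1 \<union> ((\<lambda>q. q @ [Slope 0]) ` T1 \<union> (\<lambda>q. q @ [Vertical]) ` T1)"
  have T: "is_blowup_seq T" unfolding is_blowup_seq_iff T_def using T1 by auto
  have QT1: "Q \<subseteq> T1" using T0(2) unfolding T1_def by blast
  have nT: "[] \<in> T" "Q \<subseteq> T" "TF \<subseteq> T" using QT1 unfolding T_def T1_def by auto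
  have nc: "nc (exc_axes r) (strict_at r F)" if "r \<in> fibre T" for r
    by (rule nc_fibre_mono'[OF TF(1) nT(3) _ that]) (use TF(2) exc_axes_append[of "[]"] in auto)
  obtain f D where fD: "f \<noteq> 0" "D \<noteq> 0" "tree_ok T Q [] (F * f) D" using fraction_tree[OF T nT(1) F nc] by blast
  define N where "N = F * f"
  have N0: "N \<noteq> 0" unfolding N_def using F fD(1) by simp
  have leaf_ok: "leaf_ok Q p (pull_at p N) (pull_at p D)" if "p \<in> fibre T" for p using fD(3) that unfolding tree_ok_def N_def by auto
  have thr: "three_zeros T Q t (pull_at t N) (pull_at t D)" if "t \<in> T" for t using fD(3) that unfolding tree_ok_def N_def by auto
  \<comment> \<open>The Wronskian of numerator and denominator on the line over q; outside its roots
    the restricted fraction has no critical point at a finite slope.\<close>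
  define W where "W q = (let P = lead_poly (pull_at q N); R = lead_poly (pull_at q D) in pderiv P * R - P * pderiv R)" for q
  define crit where "crit = {q @ [Slope c] | q c. q \<in> Q \<and> poly (W q) c = 0}"
  have nr: "lead_poly (pull_at q N) \<noteq> smult v (lead_poly (pull_at q D))" if "q \<in> Q" for q v
    by (rule three_zeros_nonconstant[OF thr]) (use that nT N0 fD(2) in auto)
  have W0: "W q \<noteq> 0" if "q \<in> Q" for q
  proof
    assume "W q = 0"
    then have "pderiv (lead_poly (pull_at q N)) * lead_poly (pull_at q D) = lead_poly (pull_at q N) * pderiv (lead_poly (pull_at q D))"
      unfolding W_def Let_def by simp
    then have "\<exists>v. lead_poly (pull_at q N) = smult v (lead_poly (pull_at q D))"
      by (rule pderiv_ratio_constant[rotated]) (use lead_poly_nonzero fD(2) in simp)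
    then show False using nr[OF that] by blast
  qed
  have fincrit: "finite crit"
  proof -
    have "crit = (\<Union>q\<in>Q. (\<lambda>c. q @ [Slope c]) ` {c. poly (W q) c = 0})" unfolding crit_def by blast
    moreover have "finite Q" using QT1 T1(1) finite_subset by blast
    ultimately show ?thesis using poly_roots_finite[OF W0] by auto
  qed
  \<comment> \<open>A leaf that is not yet monomial has exponent 0 and so lies on the line of a
    point in \<open>Q\<close>. Away from the critical points the fraction minus its value is already
    a smooth curve transverse to the line, so only finitely many leaves need further
    blow-ups.\<close>
  have leaf: "\<exists>M. adm Q p 0 0 \<and> pull_at p N = pull_at p D * M \<and> exc_mono (exc_axes p) (pull_at p D) \<and>
      rx (M - C (ev0 M)) \<noteq> 0 \<and> exc_axes p = (True, False) \<and> (p \<notin> crit \<longrightarrow> nc (True, False) (M - C (ev0 M)))"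
    if p: "p \<in> fibre T" and nl: "\<not> mono_leaf Q p (pull_at p N) (pull_at p D)" for p
  proof -
    from leaf_ok_cases[OF leaf_ok[OF p]] nl obtain M where M: "adm Q p 0 0" "ev0 M \<noteq> 0" "pull_at p N = pull_at p D * M" "exc_mono (exc_axes p) (pull_at p D)"
      by metis
    obtain t d where td: "p = t @ [d]" "t \<in> T" "p \<notin> T" using fibre_cases[OF p] nT(1) by blast
    have tQ: "t \<in> Q" using M(1) td(1) by (cases d) (auto simp: adm_def adm1_def)
    have "d \<noteq> Slope 0" "d \<noteq> Vertical" using tQ QT1 td(1,3) unfolding T_def by auto
    then obtain c where c: "d = Slope c" "c \<noteq> 0" by (cases d) auto
    have fl: "exc_axes p = (True, False)" using c td(1) by (cases "exc_axes t") simp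
    have e: "pull (Slope c) (pull_at t N) = pull (Slope c) (pull_at t D) * M" using M(3) td(1) c(1) by (simp add: pull_at_append)
    have nz: "pull_at t N \<noteq> 0" "pull_at t D \<noteq> 0" using N0 fD(2) by auto
    note cs = critical_slope[OF nz M(2) e nr[OF tQ]]
    have "nc (True, False) (M - C (ev0 M))" if "p \<notin> crit"
    proof -
      have "poly (W t) c \<noteq> 0" using that tQ td(1) c(1) unfolding crit_def by auto
      then have "ox (M - C (ev0 M)) = 1" by (intro cs(2)) (simp add: W_def Let_def)
      then have "curve_x ((M - C (ev0 M)) ^ 1)" by (rule smooth_curve_x[OF cs(1)])
      then show ?thesis by (simp add: nc_def)
    qed
    then show ?thesis using M cs(1) fl by blast
  qed
  have "\<exists>TT. is_blowup_seq TT \<and> (TT = {} \<or> p \<in> crit) \<and> (\<forall>r\<in>fibre TT. mono_leaf Q (p @ r) (pull_at r (pull_at p N)) (pull_at r (pull_at p D)))"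
    if p: "p \<in> fibre T" for p
  proof (cases "mono_leaf Q p (pull_at p N) (pull_at p D)")
    case True
    then show ?thesis by (intro exI[of _ "{}"]) (simp add: is_blowup_seq_iff fibre_def)
  next
    case False
    obtain M where M: "adm Q p 0 0" "pull_at p N = pull_at p D * M" "exc_mono (exc_axes p) (pull_at p D)"
      "rx (M - C (ev0 M)) \<noteq> 0" "exc_axes p = (True, False)" "p \<notin> crit \<longrightarrow> nc (True, False) (M - C (ev0 M))"
      using leaf[OF p False] by blast
    let ?H = "M - C (ev0 M)"
    have H0: "?H \<noteq> 0" "ev0 ?H = 0" using M(4) rx_simps(1) by (metis, simp)
    obtain TT where TT: "is_blowup_seq TT" "\<forall>r\<in>fibre TT. nc (exc_axes_from (True, False) r) (strict_at r ?H)" "nc (True, False) ?H \<longrightarrow> TT = {}"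
      using res_tree[OF embedded_resolution_x[OF M(4)]] by blast
    have pQ: "p @ r \<notin> Q" for r
      using fibre_notin[OF p] nT(2) blowup_seq_prefix[OF T, of p r] by blast
    have "mono_leaf Q (p @ r) (pull_at r (pull_at p N)) (pull_at r (pull_at p D))" if "r \<in> fibre TT" for r
      by (rule mono_leaf_resolved[OF M(1-3) pQ HOL.refl H0]) (use TT(2) that M(5) in \<open>simp add: exc_axes_append\<close>)
    then show ?thesis using TT M(6) by blast
  qed
  then have "\<forall>p. \<exists>TT. p \<in> fibre T \<longrightarrow> is_blowup_seq TT \<and> (TT = {} \<or> p \<in> crit) \<and> (\<forall>r\<in>fibre TT. mono_leaf Q (p @ r) (pull_at r (pull_at p N)) (pull_at r (pull_at p D)))"
    by blast
  then obtain TT0 where TT0: "\<And>p. p \<in> fibre T \<Longrightarrow> is_blowup_seq (TT0 p) \<and> (TT0 p = {} \<or> p \<in> crit) \<and> (\<forall>r\<in>fibre (TT0 p). mono_leaf Q (p @ r) (pull_at r (pull_at p N)) (pull_at r (pull_at p D)))"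
    by metis
  define TT where "TT p = (if p \<in> fibre T then TT0 p else {})" for p
  have bTT: "is_blowup_seq (TT p)" for p using TT0[of p] unfolding TT_def by (simp add: is_blowup_seq_iff)
  have fTT: "finite {p \<in> fibre T. TT p \<noteq> {}}" by (rule finite_subset[OF _ fincrit]) (use TT0 TT_def in auto)
  have neT: "T \<noteq> {}" using nT(1) by blast
  let ?T2 = "T \<union> {p @ r | p r. p \<in> fibre T \<and> r \<in> TT p}"
  note gr = graft[of T TT, OF T neT bTT fTT]
  show thesis
  proof (rule that[of N D T ?T2])
    show "F dvd N" unfolding N_def by simp
    fix p assume "p \<in> fibre ?T2"
    then obtain p' r where p: "p = p' @ r" "p' \<in> fibre T" "r \<in> fibre (TT p')" using gr(2) by blast
    then show "mono_leaf Q p (pull_at p N) (pull_at p D)" using TT0[OF p(2)] by (simp add: TT_def pull_at_append)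
  qed (use N0 fD(2) T nT thr gr(1) in auto)
qed

section \<open>Strict transforms of 1-forms\<close>

definition cop :: "germ \<Rightarrow> germ \<Rightarrow> bool" where
  "cop A B \<longleftrightarrow> (\<forall>d. d dvd A \<longrightarrow> d dvd B \<longrightarrow> ev0 d \<noteq> 0)"

lemma cop_commute: "cop A B \<longleftrightarrow> cop B A"
  unfolding cop_def by blast

text \<open>Dividing out a common nonunit lowers the order at the origin, so a coprime pair is
  reached after finitely many steps.\<close>

lemma gcd_extract:
  assumes "A \<noteq> 0 \<or> B \<noteq> 0" shows "\<exists>k A' B'. k \<noteq> 0 \<and> A = k * A' \<and> B = k * B' \<and> cop A' B'"
  using assms
proof (induction "if A \<noteq> 0 then ord0 A else ord0 B" arbitrary: A B rule: less_induct)
  case less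
  show ?case
  proof (cases "cop A B")
    case True
    then show ?thesis by (intro exI[of _ 1] exI[of _ A] exI[of _ B]) simp
  next
    case False
    then obtain d A1 B1 where d: "A = d * A1" "B = d * B1" "ev0 d = 0" unfolding cop_def by (auto elim!: dvdE)
    have d0: "d \<noteq> 0" using less.prems d by auto
    have nz: "A1 \<noteq> 0 \<or> B1 \<noteq> 0" using less.prems d by auto
    have "ord0 d > 0" by (rule ord0_pos[OF d0 d(3)])
    then have "(if A1 \<noteq> 0 then ord0 A1 else ord0 B1) < (if A \<noteq> 0 then ord0 A else ord0 B)"
      using d d0 nz strict_mult(1)[OF d0] by auto
    then obtain k A' B' where "k \<noteq> 0" "A1 = k * A'" "B1 = k * B'" "cop A' B'" using less.hyps nz by metis
    then show ?thesis using d d0 by (intro exI[of _ "d * k"] exI[of _ A'] exI[of _ B']) (simp add: mult.assoc)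
  qed
qed

section \<open>Derivatives of germs and pull-back of 1-forms\<close>

lemma dXY_minus: "dX (- f) = - dX f" "dY (- f) = - dY f"
proof -
  have e: "- f = C (- 1) * f" by (simp add: C_simps)
  show "dX (- f) = - dX f" "dY (- f) = - dY f" unfolding e dXY_mult dXY_const by (simp_all add: C_simps)
qed

lemma dXY_diff: "dX (f - g) = dX f - dX g" "dY (f - g) = dY f - dY g"
  using dXY_add[of f "- g"] by (simp_all add: dXY_minus)

lemma dXY_01 [simp]: "dX 0 = 0" "dY 0 = 0" "dX 1 = 0" "dY 1 = 0"
  using dXY_const(1,2)[of 0] dXY_const(1,2)[of 1] by (simp_all add: C_simps)

lemma ev0_of_nat [simp]: "ev0 (of_nat n) = of_nat n"
  by (induction n) auto

lemma dXY_power_Suc: "dX (f ^ Suc n) = f ^ n * (of_nat (Suc n) * dX f) \<and> dY (f ^ Suc n) = f ^ n * (of_nat (Suc n) * dY f)"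
proof (induction n)
  case (Suc n)
  have "dX (f ^ Suc (Suc n)) = f * dX (f ^ Suc n) + dX f * f ^ Suc n" "dY (f ^ Suc (Suc n)) = f * dY (f ^ Suc n) + dY f * f ^ Suc n"
    unfolding power_Suc[of f "Suc n"] dXY_mult by (rule HOL.refl)+
  then show ?case unfolding conjunct1[OF Suc.IH] conjunct2[OF Suc.IH] by (simp add: algebra_simps)
qed simp

lemma dY_xgerm: "ry \<phi> = \<phi> \<Longrightarrow> dY \<phi> = 0"
proof -
  assume "ry \<phi> = \<phi>"
  then have "dY \<phi> = dY (subst_germ \<phi> X 0)" unfolding ry_def by simp
  then show ?thesis by (simp add: dXY_subst_germ)
qed

lemma dX_ygerm: "rx \<phi> = \<phi> \<Longrightarrow> dX \<phi> = 0"
proof -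
  assume "rx \<phi> = \<phi>"
  then have "dX \<phi> = dX (subst_germ \<phi> 0 Y)" unfolding rx_def by simp
  then show ?thesis by (simp add: dXY_subst_germ)
qed

fun blow_form :: "direction \<Rightarrow> germ \<times> germ \<Rightarrow> germ \<times> germ" where
  "blow_form (Slope c) (A, B) = (pull (Slope c) A + pull (Slope c) B * (Y + C c), X * pull (Slope c) B)"
| "blow_form Vertical (A, B) = (Y * pull Vertical A, X * pull Vertical A + pull Vertical B)"

fun chart_form :: "point \<Rightarrow> germ \<times> germ \<Rightarrow> germ \<times> germ" where
  "chart_form [] w = w"
| "chart_form (d # r) w = chart_form r (blow_form d w)"

definition scale :: "germ \<Rightarrow> germ \<times> germ \<Rightarrow> germ \<times> germ" where "scale k w = (k * fst w, k * snd w)"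

text \<open>The coefficients of D dN - N dD, which is D^2 times the differential of the fraction and
  commutes with pull-backs.\<close>

definition level_pair :: "germ \<Rightarrow> germ \<Rightarrow> germ \<times> germ" where
  "level_pair N D = (D * dX N - N * dX D, D * dY N - N * dY D)"

definition transf :: "germ \<times> germ \<Rightarrow> point \<Rightarrow> germ \<Rightarrow> germ \<Rightarrow> bool" where
  "transf w p A B \<longleftrightarrow> cop A B \<and> (\<exists>k. k \<noteq> 0 \<and> chart_form p w = scale k (A, B))"

lemma chart_form_append: "chart_form (p @ r) w = chart_form r (chart_form p w)"
  by (induction p arbitrary: w) auto

lemma blow_form_scale: "blow_form d (scale k w) = scale (pull d k) (blow_form d w)"
  by (cases d; cases w) (simp_all add: scale_def algebra_simps del: pull.simps)

lemma chart_form_scale: "chart_form p (scale k w) = scale (pull_at p k) (chart_form p w)"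
  by (induction p arbitrary: k w) (simp_all add: blow_form_scale)

lemma blow_form_eq_0: "blow_form d w = (0, 0) \<longleftrightarrow> w = (0, 0)"
proof (cases d)
  case (Slope c)
  then show ?thesis by (cases w) (auto simp del: pull.simps)
next
  case Vertical
  then show ?thesis by (cases w) (auto simp del: pull.simps)
qed

lemma chart_form_eq_0: "chart_form p w = (0, 0) \<longleftrightarrow> w = (0, 0)"
  by (induction p arbitrary: w) (simp_all add: blow_form_eq_0)

lemma transf_ex: "w \<noteq> (0, 0) \<Longrightarrow> \<exists>A B. transf w p A B"
proof -
  assume "w \<noteq> (0, 0)"
  then have "fst (chart_form p w) \<noteq> 0 \<or> snd (chart_form p w) \<noteq> 0" using chart_form_eq_0[of p w] by (metis prod.collapse)
  from gcd_extract[OF this] show ?thesis unfolding transf_def scale_def by (metis fst_conv prod.collapse snd_conv)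
qed

lemma dXY_pull:
  "dX (pull (Slope c) f) = pull (Slope c) (dX f) + pull (Slope c) (dY f) * (Y + C c)"
  "dY (pull (Slope c) f) = X * pull (Slope c) (dY f)"
  "dX (pull Vertical f) = Y * pull Vertical (dX f)"
  "dY (pull Vertical f) = X * pull Vertical (dX f) + pull Vertical (dY f)"
  by (simp_all add: pull.simps dXY_subst_germ dXY_mult dXY_add mult_ac)

lemma blow_form_level_pair: "blow_form d (level_pair N D) = level_pair (pull d N) (pull d D)"
  by (cases d) (simp_all add: level_pair_def dXY_pull algebra_simps del: pull.simps)

lemma chart_form_level_pair: "chart_form p (level_pair N D) = level_pair (pull_at p N) (pull_at p D)"
  by (induction p arbitrary: N D) (simp_all add: blow_form_level_pair)

text \<open>A Moebius transformation of the fraction multiplies the form by its determinant, so the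
  foliation stays the same.\<close>

lemma level_pair_linear: "level_pair (C \<alpha> * N + C \<beta> * D) (C \<gamma> * N + C \<delta> * D) = scale (C (\<alpha> * \<delta> - \<beta> * \<gamma>)) (level_pair N D)"
  unfolding level_pair_def scale_def by (simp add: dXY_mult dXY_add C_simps algebra_simps)

lemma level_pair_mult: "level_pair (D * H) D = scale (D * D) (dX H, dY H)"
  unfolding level_pair_def scale_def by (simp add: dXY_mult algebra_simps)

text \<open>Both pairs are proportional to the same pulled back level form, hence to each other; the
  conclusion states this without denominators.\<close>

lemma transf_par:
  assumes level_pair: "level_pair N D = scale g w" and g: "g \<noteq> 0" and s: "s \<noteq> 0" and
    \<eta>: "scale s0 (level_pair (pull_at p N) (pull_at p D)) = scale s (\<eta>1, \<eta>2)" "s0 \<noteq> 0" and transf: "transf w p A B"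
  shows "A * \<eta>2 = B * \<eta>1"
proof -
  obtain k where k: "k \<noteq> 0" "chart_form p w = scale k (A, B)" using transf unfolding transf_def by blast
  have "scale s (\<eta>1, \<eta>2) = scale s0 (scale (pull_at p g) (scale k (A, B)))"
    using \<eta>(1) level_pair k by (metis chart_form_level_pair chart_form_scale)
  then have 1: "s * \<eta>1 = s0 * pull_at p g * k * A" and 2: "s * \<eta>2 = s0 * pull_at p g * k * B"
    by (simp_all add: scale_def mult.assoc)
  have "s * (A * \<eta>2) = A * (s * \<eta>2)" by (simp only: mult_ac)
  also have "\<dots> = B * (s * \<eta>1)" unfolding 1 2 by (simp only: mult_ac)
  also have "\<dots> = s * (B * \<eta>1)" by (simp only: mult_ac)
  finally show ?thesis using s mult_left_cancel by blast
qed

text \<open>If \<open>\<eta>2\<close> is a unit, then \<open>B\<close> divides \<open>A\<close>, so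
  coprimality makes \<open>B\<close> a unit and with it the factor of proportionality.\<close>

lemma par_regular:
  assumes cop: "cop A B" and par: "A * \<eta>2 = B * \<eta>1" and reg: "ev0 \<eta>1 \<noteq> 0 \<or> ev0 \<eta>2 \<noteq> 0"
  shows "\<exists>u. ev0 u \<noteq> 0 \<and> A = u * \<eta>1 \<and> B = u * \<eta>2"
proof -
  have *: "\<exists>u. ev0 u \<noteq> 0 \<and> A = u * \<eta>1 \<and> B = u * \<eta>2"
    if h: "cop A B" "A * \<eta>2 = B * \<eta>1" "ev0 \<eta>2 \<noteq> 0" for A B \<eta>1 \<eta>2
  proof -
    obtain V where V: "ev0 V \<noteq> 0" "\<eta>2 * V = 1" by (rule germ_inverse[OF h(3)])
    have "A = (A * \<eta>2) * V" using V(2) by (simp add: mult.assoc)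
    then have A: "A = B * V * \<eta>1" unfolding h(2) by (simp only: mult_ac)
    then have "B dvd A" by (metis dvd_triv_left mult.assoc)
    then have B: "ev0 B \<noteq> 0" using h(1)[unfolded cop_def, rule_format, of B] by simp
    have "B = B * (\<eta>2 * V)" unfolding V(2) by simp
    then have "B = B * V * \<eta>2" by (simp only: mult_ac)
    moreover have "ev0 (B * V) \<noteq> 0" using B V(1) by simp
    ultimately show ?thesis using A by (intro exI[of _ "B * V"] conjI)
  qed
  show ?thesis
  proof (cases "ev0 \<eta>2 = 0")
    case True
    then have "ev0 \<eta>1 \<noteq> 0" using reg by simp
    from *[OF cop_commute[THEN iffD1, OF cop] par[symmetric] this] show ?thesis by (elim exE conjE) (intro exI conjI)
  next
    case False
    show ?thesis by (rule *[OF cop par False])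
  qed
qed

text \<open>At a crossing neither coefficient need be a unit. Adding \<open>m * \<eta>2\<close> to
  \<open>\<eta>1\<close> brings the pair to the form (w P, z R) with units P and R, and w can be
  cancelled because it divides a multiple of z only through the other factor.\<close>

lemma par_crossing:
  assumes cop: "cop A B" and par: "A * \<eta>2 = B * \<eta>1"
    and 1: "\<eta>1 + m * \<eta>2 = w * P" "ev0 P \<noteq> 0" and 2: "\<eta>2 = z * R"
    and wz: "\<And>f. w dvd z * f \<Longrightarrow> w dvd f" "w \<noteq> 0" and R: "ev0 R \<noteq> 0"
  shows "\<exists>u. ev0 u \<noteq> 0 \<and> A = u * \<eta>1 \<and> B = u * \<eta>2"
proof -
  define a where "a = A + m * B"
  have e: "a * (z * R) = B * (w * P)" unfolding a_def 1(1)[symmetric] 2[symmetric] using par by (simp add: algebra_simps)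
  obtain V where V: "ev0 V \<noteq> 0" "P * V = 1" by (rule germ_inverse[OF 1(2)])
  obtain W where W: "ev0 W \<noteq> 0" "R * W = 1" by (rule germ_inverse[OF R])
  have "z * a = (a * (z * R)) * W" using W(2) by (simp add: mult_ac)
  also have "\<dots> = w * (B * P * W)" unfolding e by (simp only: mult_ac)
  finally have "w dvd z * a" by simp
  then have "w dvd a" by (rule wz(1))
  then obtain q where q: "a = w * q" by (elim dvdE)
  have "w * (q * z * R) = w * (B * P)" using e unfolding q by (simp only: mult_ac)
  then have qz: "q * z * R = B * P" using wz(2) mult_left_cancel by blast
  have "B = (B * P) * V" using V(2) by (simp add: mult.assoc)
  then have B: "B = (q * V) * \<eta>2" unfolding qz[symmetric] 2 by (simp only: mult_ac)
  have "(q * V) * (\<eta>1 + m * \<eta>2) = q * w * (P * V)" unfolding 1(1) by (simp only: mult_ac)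
  then have "(q * V) * \<eta>1 + m * ((q * V) * \<eta>2) = a" unfolding V(2) q by (simp add: algebra_simps)
  then have A: "A = (q * V) * \<eta>1" unfolding B[symmetric] a_def by (simp add: algebra_simps)
  have "q dvd A" "q dvd B" using A B by (metis dvd_triv_left mult.assoc)+
  then have "ev0 q \<noteq> 0" using cop[unfolded cop_def, rule_format, of q] by simp
  then have "ev0 (q * V) \<noteq> 0" using V(1) by simp
  then show ?thesis using A B by (intro exI[of _ "q * V"] conjI)
qed

text \<open>The shear that adds \<phi>(x) to y carries the graph to the axis y = 0, where
  divisibility is restriction to the axis.\<close>

lemma dvd_graph_x:
  assumes \<phi>: "ry \<phi> = \<phi>" "ev0 \<phi> = 0" shows "(Y - \<phi>) dvd f \<longleftrightarrow> subst_germ f X \<phi> = 0"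
proof
  assume "(Y - \<phi>) dvd f"
  then obtain g where "f = (Y - \<phi>) * g" by (elim dvdE)
  moreover have "subst_germ \<phi> X \<phi> = \<phi>"
  proof -
    have "subst_germ \<phi> X \<phi> = subst_germ (ry \<phi>) X \<phi>" using \<phi> by simp
    also have "\<dots> = ry \<phi>" unfolding ry_def using \<phi>(2) by (simp add: subst_germ_subst_germ subst_germ_simps)
    finally show ?thesis using \<phi> by simp
  qed
  ultimately show "subst_germ f X \<phi> = 0" using \<phi> by (simp add: subst_germ_simps)
next
  assume f: "subst_germ f X \<phi> = 0"
  have r: "subst_germ \<phi> X g = \<phi>" if "ev0 g = 0" for g
  proof -
    have "subst_germ \<phi> X g = subst_germ (ry \<phi>) X g" using \<phi> by simp
    also have "\<dots> = ry \<phi>" unfolding ry_def using that by (simp add: subst_germ_subst_germ subst_germ_simps)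
    finally show ?thesis using \<phi> by simp
  qed
  have "ry (subst_germ f X (Y + \<phi>)) = subst_germ f X \<phi>"
    unfolding ry_def using \<phi>(2) r[of 0] by (simp add: subst_germ_subst_germ subst_germ_simps)
  then have "Y dvd subst_germ f X (Y + \<phi>)" using f Y_dvd_iff by simp
  then obtain g where g: "subst_germ f X (Y + \<phi>) = Y * g" by (elim dvdE)
  have "subst_germ (subst_germ f X (Y + \<phi>)) X (Y - \<phi>) = f"
    using \<phi>(2) r[of "Y - \<phi>"] by (simp add: subst_germ_subst_germ subst_germ_simps)
  then have "f = (Y - \<phi>) * subst_germ g X (Y - \<phi>)" unfolding g using \<phi>(2) by (simp add: subst_germ_simps)
  then show "(Y - \<phi>) dvd f" by simp
qed

section \<open>Simple singularities and the form at monomial leaves\<close>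

definition lin_matrix :: "germ \<Rightarrow> germ \<Rightarrow> complex^2^2" where
  "lin_matrix A B = vector [vector [ev0 (dX B), ev0 (dY B)], vector [- ev0 (dX A), - ev0 (dY A)]]"

definition simple_pair :: "germ \<Rightarrow> germ \<Rightarrow> bool" where
  "simple_pair A B \<longleftrightarrow> ev0 A = 0 \<and> ev0 B = 0 \<and> \<not> nilpotent_matrix (lin_matrix A B) \<and>
     (\<forall>l m. (\<forall>t. det (mat t - lin_matrix A B) = (t - l) * (t - m)) \<longrightarrow> \<not> (\<exists>r::rat. r > 0 \<and> l = of_rat r * m))"

lemma det_lin_matrix: "det (mat t - lin_matrix A B) = (t - ev0 (dX B)) * (t + ev0 (dY A)) + ev0 (dY B) * ev0 (dX A)"
  by (simp add: det_2 lin_matrix_def mat_def algebra_simps)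

text \<open>Trace and determinant are those of the eigenvalues k u and - i u, whose ratio is a
  negative rational. If l = r m with r > 0, the identity r (l + m)^2 = (1 + r)^2 l m would make a
  positive rational vanish.\<close>

lemma simple_pairI:
  assumes ev: "ev0 A = 0" "ev0 B = 0" and u: "u \<noteq> 0" and ik: "i \<ge> (1::nat)" "k \<ge> (1::nat)"
    and transf: "ev0 (dX B) - ev0 (dY A) = of_nat k * u - of_nat i * u"
    and dt: "ev0 (dY B) * ev0 (dX A) - ev0 (dX B) * ev0 (dY A) = - (of_nat k * u * (of_nat i * u))"
  shows "simple_pair A B"
  unfolding simple_pair_def
proof (intro conjI allI impI ev)
  have "det (lin_matrix A B) = ev0 (dY B) * ev0 (dX A) - ev0 (dX B) * ev0 (dY A)"
    by (simp add: det_2 lin_matrix_def algebra_simps)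
  then have d0: "det (lin_matrix A B) \<noteq> 0" unfolding dt using u ik by simp
  have "det (((\<lambda>M. lin_matrix A B ** M) ^^ n) (mat 1)) \<noteq> 0" for n
    by (induction n) (use d0 in \<open>simp_all add: det_mul\<close>)
  moreover have "det (0 :: complex^2^2) = 0" by (simp add: det_2)
  ultimately have "((\<lambda>M. lin_matrix A B ** M) ^^ n) (mat 1) \<noteq> 0" for n by metis
  then show "\<not> nilpotent_matrix (lin_matrix A B)" unfolding nilpotent_matrix_def by blast
  fix l m assume lm: "\<forall>t. det (mat t - lin_matrix A B) = (t - l) * (t - m)"
  have e: "(t - ev0 (dX B)) * (t + ev0 (dY A)) + ev0 (dY B) * ev0 (dX A) = (t - l) * (t - m)" for t
    using lm unfolding det_lin_matrix by blast
  have p: "l * m = - (of_nat k * u * (of_nat i * u))" using e[of 0] dt by (simp add: algebra_simps)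
  have "l + m = ev0 (dX B) - ev0 (dY A)" using e[of 1] e[of 0] by (simp add: algebra_simps)
  then have s: "l + m = of_nat k * u - of_nat i * u" using transf by simp
  show "\<not> (\<exists>r::rat. r > 0 \<and> l = of_rat r * m)"
  proof
    assume "\<exists>r::rat. r > 0 \<and> l = of_rat r * m"
    then obtain r :: rat where r: "r > 0" "l = of_rat r * m" by blast
    let ?r = "of_rat r :: complex"
    have "?r * ((l + m) * (l + m)) = (1 + ?r) * (1 + ?r) * (l * m)" unfolding r(2) by (simp add: algebra_simps)
    then have "?r * ((of_nat k - of_nat i) * (of_nat k - of_nat i)) * (u * u) = - ((1 + ?r) * (1 + ?r) * (of_nat k * of_nat i)) * (u * u)"
      unfolding s p by (simp add: algebra_simps)
    then have "?r * ((of_nat k - of_nat i) * (of_nat k - of_nat i)) = - ((1 + ?r) * (1 + ?r) * (of_nat k * of_nat i))"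
      by (rule mult_right_cancel[THEN iffD1, rotated]) (use u in simp)
    then have "of_rat (r * ((of_nat k - of_nat i) * (of_nat k - of_nat i)) + (1 + r) * (1 + r) * (of_nat k * of_nat i)) = (0 :: complex)"
      by (simp add: of_rat_add of_rat_mult of_rat_diff)
    then have "r * ((of_nat k - of_nat i) * (of_nat k - of_nat i)) + (1 + r) * (1 + r) * (of_nat k * of_nat i) = 0"
      by (simp only: of_rat_eq_0_iff)
    moreover have "r * ((of_nat k - of_nat i) * (of_nat k - of_nat i)) \<ge> 0" using r(1) by simp
    moreover have "(1 + r) * (1 + r) * (of_nat k * of_nat i) > 0" using r(1) ik by simp
    ultimately show False by linarith
  qed
qed

lemma dXY_of_nat [simp]: "dX (of_nat n) = 0" "dY (of_nat n) = 0"
  by (induction n) (simp_all add: dXY_add)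

lemma sw_dvd: "sw a dvd sw b \<longleftrightarrow> a dvd b"
proof
  assume "sw a dvd sw b"
  then obtain g where "sw b = sw a * g" by (elim dvdE)
  then have "b = a * sw g" by (metis sw_simps(5) sw_sw)
  then show "a dvd b" by simp
next
  assume "a dvd b"
  then show "sw a dvd sw b" by (elim dvdE) simp
qed

text \<open>The first condition says that \<open>(\<eta>1, \<eta>2)\<close> generates the saturation of the form.\<close>

definition leaf_pair :: "point set \<Rightarrow> point \<Rightarrow> germ \<Rightarrow> germ \<Rightarrow> bool" where
  "leaf_pair Q p \<eta>1 \<eta>2 \<longleftrightarrow>
     (\<forall>A B. cop A B \<longrightarrow> A * \<eta>2 = B * \<eta>1 \<longrightarrow> (\<exists>u. ev0 u \<noteq> 0 \<and> A = u * \<eta>1 \<and> B = u * \<eta>2)) \<and>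
     (ev0 \<eta>1 \<noteq> 0 \<or> ev0 \<eta>2 \<noteq> 0 \<or> simple_pair \<eta>1 \<eta>2) \<and>
     (\<forall>q. fst (labels p) = Some q \<longrightarrow> (if q \<in> Q then ev0 \<eta>2 \<noteq> 0 else rx \<eta>2 = 0 \<and> rx \<eta>1 \<noteq> 0)) \<and>
     (\<forall>q. snd (labels p) = Some q \<longrightarrow> (if q \<in> Q then ev0 \<eta>1 \<noteq> 0 else ry \<eta>1 = 0 \<and> ry \<eta>2 \<noteq> 0)) \<and>
     (\<forall>q q'. fst (labels p) = Some q \<longrightarrow> snd (labels p) = Some q' \<longrightarrow> q \<in> Q \<longrightarrow> q' \<notin> Q)"

text \<open>The vector (1, \<phi>') is tangent to the graph w = 0, and this graph is invariant.
  Hence \<open>\<eta>1 + dX \<phi> * \<eta>2\<close>, the form evaluated on this vector, is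
  divisible by w.\<close>

lemma crossing_unique:
  assumes z: "z = X - \<zeta>" "rx \<zeta> = \<zeta>" "ev0 \<zeta> = 0" and w: "w = Y - \<phi>" "ry \<phi> = \<phi>" "ev0 \<phi> = 0"
    and U: "ev0 (ca * U) \<noteq> 0" "ev0 (cb * U) \<noteq> 0" and \<zeta>: "\<zeta> = 0"
    and \<eta>1: "\<eta>1 = ca * U * w - cb * U * z * dX \<phi> + z * w * dX U"
    and \<eta>2: "\<eta>2 = cb * U * z - ca * U * w * dY \<zeta> + z * w * dY U"
    and AB: "cop A B" "A * \<eta>2 = B * \<eta>1"
  shows "\<exists>u. ev0 u \<noteq> 0 \<and> A = u * \<eta>1 \<and> B = u * \<eta>2"
proof (rule par_crossing[OF AB, of "dX \<phi>" w "ca * U + z * (dX U + dX \<phi> * dY U)" z "cb * U + w * dY U"])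
  show "\<eta>1 + dX \<phi> * \<eta>2 = w * (ca * U + z * (dX U + dX \<phi> * dY U))" "\<eta>2 = z * (cb * U + w * dY U)"
    unfolding \<eta>1 \<eta>2 \<zeta> by (simp_all add: algebra_simps)
  have "ev0 z = 0" "ev0 w = 0" using z w by simp_all
  then show "ev0 (ca * U + z * (dX U + dX \<phi> * dY U)) \<noteq> 0" "ev0 (cb * U + w * dY U) \<noteq> 0" using U by simp_all
  have "rx w = Y" unfolding w(1) using rx_xgerm[OF w(2)] w(3) by (simp add: C_simps)
  then show "w \<noteq> 0" by auto
  fix f assume "w dvd z * f"
  then have "subst_germ (z * f) X \<phi> = 0" unfolding w(1) dvd_graph_x[OF w(2,3)] .
  then have "X * subst_germ f X \<phi> = 0" using w(3) z(1) \<zeta> by (simp add: subst_germ_simps)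
  then show "w dvd f" unfolding w(1) dvd_graph_x[OF w(2,3)] by simp
qed

lemma sw_dXY: "dX (sw f) = sw (dY f)" "dY (sw f) = sw (dX f)"
  unfolding sw_def by (simp_all add: dXY_subst_germ)

lemma cop_sw: "cop (sw A) (sw B) \<longleftrightarrow> cop A B"
proof -
  have *: "cop (sw A) (sw B)" if "cop A B" for A B
    unfolding cop_def
  proof (intro allI impI)
    fix d assume "d dvd sw A" "d dvd sw B"
    then have "sw d dvd A" "sw d dvd B" using sw_dvd[of "sw d"] by simp_all
    then have "ev0 (sw d) \<noteq> 0" using that unfolding cop_def by blast
    then show "ev0 d \<noteq> 0" by simp
  qed
  show ?thesis using *[of A B] *[of "sw A" "sw B"] by auto
qed

lemma crossing_unique':
  assumes z: "z = X - \<zeta>" "rx \<zeta> = \<zeta>" "ev0 \<zeta> = 0" and w: "w = Y - \<phi>" "ry \<phi> = \<phi>" "ev0 \<phi> = 0"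
    and U: "ev0 (ca * U) \<noteq> 0" "ev0 (cb * U) \<noteq> 0" and \<zeta>: "\<zeta> = 0 \<or> \<phi> = 0"
    and \<eta>1: "\<eta>1 = ca * U * w - cb * U * z * dX \<phi> + z * w * dX U"
    and \<eta>2: "\<eta>2 = cb * U * z - ca * U * w * dY \<zeta> + z * w * dY U"
    and AB: "cop A B" "A * \<eta>2 = B * \<eta>1"
  shows "\<exists>u. ev0 u \<noteq> 0 \<and> A = u * \<eta>1 \<and> B = u * \<eta>2"
  using \<zeta>
proof
  assume "\<zeta> = 0"
  then show ?thesis using crossing_unique[OF z w U _ \<eta>1 \<eta>2 AB] by blast
next
  assume \<phi>: "\<phi> = 0"
  have "\<exists>u. ev0 u \<noteq> 0 \<and> sw B = u * sw \<eta>2 \<and> sw A = u * sw \<eta>1"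
  proof (rule crossing_unique[of "sw w" "sw \<phi>" "sw z" "sw \<zeta>" "sw cb" "sw U" "sw ca"])
    show "sw w = X - sw \<phi>" "sw z = Y - sw \<zeta>" by (simp_all add: z(1) w(1))
    show "rx (sw \<phi>) = sw \<phi>" "ry (sw \<zeta>) = sw \<zeta>" using z(2) w(2) by (simp_all add: rx_sw ry_sw)
    show "ev0 (sw \<phi>) = 0" "ev0 (sw \<zeta>) = 0" "ev0 (sw cb * sw U) \<noteq> 0" "ev0 (sw ca * sw U) \<noteq> 0" "sw \<phi> = 0"
      using z w U \<phi> by simp_all
    show "sw \<eta>2 = sw cb * sw U * sw z - sw ca * sw U * sw w * dX (sw \<zeta>) + sw w * sw z * dX (sw U)"
      unfolding \<eta>2 sw_dXY by (simp add: mult_ac)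
    show "sw \<eta>1 = sw ca * sw U * sw w - sw cb * sw U * sw z * dY (sw \<phi>) + sw w * sw z * dY (sw U)"
      unfolding \<eta>1 sw_dXY by (simp add: mult_ac)
    show "cop (sw B) (sw A)" using AB(1) cop_sw cop_commute by blast
    show "sw B * sw \<eta>1 = sw A * sw \<eta>2" using arg_cong[OF AB(2), of sw] by simp
  qed
  then obtain u where u: "ev0 u \<noteq> 0" "sw B = u * sw \<eta>2" "sw A = u * sw \<eta>1" by (elim exE conjE)
  have "A = sw u * \<eta>1" "B = sw u * \<eta>2" using arg_cong[OF u(3), of sw] arg_cong[OF u(2), of sw] by simp_all
  then show ?thesis using u(1) by (intro exI[of _ "sw u"] conjI) simp_all
qed

text \<open>With both exponents positive the pair is z w U times the logarithmic form i dz/z + k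
  dw/w + dU/U, and \<open>s\<close> is z^(i-1) w^(k-1); this is a crossing with negative rational
  eigenvalue ratio. With one exponent 0 the foliation is regular.\<close>

lemma leaf_form:
  assumes h: "mono_form Q p H" and p: "p \<noteq> []"
  shows "\<exists>s \<eta>1 \<eta>2. s \<noteq> 0 \<and> dX H = s * \<eta>1 \<and> dY H = s * \<eta>2 \<and> leaf_pair Q p \<eta>1 \<eta>2"
proof -
  obtain \<zeta> \<phi> i k U where \<zeta>: "rx \<zeta> = \<zeta>" "ev0 \<zeta> = 0" and \<phi>: "ry \<phi> = \<phi>" "ev0 \<phi> = 0" and U: "ev0 U \<noteq> 0" and ik: "i > 0 \<or> k > 0"
    and H: "H = (X - \<zeta>) ^ i * (Y - \<phi>) ^ k * U" and
     lx: "\<And>q. fst (labels p) = Some q \<Longrightarrow> \<zeta> = 0 \<and> (i = 0 \<longleftrightarrow> q \<in> Q)" and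
     ly: "\<And>q. snd (labels p) = Some q \<Longrightarrow> \<phi> = 0 \<and> (k = 0 \<longleftrightarrow> q \<in> Q)"
    using h unfolding mono_form_def by blast
  define z where "z = X - \<zeta>"
  define w where "w = Y - \<phi>"
  have zw0: "ev0 z = 0" "ev0 w = 0" using \<zeta> \<phi> by (simp_all add: z_def w_def)
  have rw: "rx w = Y" unfolding w_def using rx_xgerm[OF \<phi>(1)] \<phi>(2) by (simp add: C_simps)
  have rz: "ry z = X"
    using rx_xgerm[of "sw \<zeta>"] \<zeta> unfolding z_def by (simp add: ry_sw C_simps rx_sw)
  have zw: "z \<noteq> 0" "w \<noteq> 0" using rw rz by auto
  have d: "dX z = 1" "dY z = - dY \<zeta>" "dX w = - dX \<phi>" "dY w = 1"
    using dX_ygerm[OF \<zeta>(1)] dY_xgerm[OF \<phi>(1)] by (simp_all add: z_def w_def dXY_diff)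
  have c0: "ev0 (of_nat (Suc n) * U) \<noteq> 0" for n using U by (simp del: of_nat_Suc)
  have two: "\<forall>q q'. fst (labels p) = Some q \<longrightarrow> snd (labels p) = Some q' \<longrightarrow> q \<in> Q \<longrightarrow> q' \<notin> Q"
    using lx ly ik by blast
  consider (y) n where "i = 0" "k = Suc n" | (x) n where "k = 0" "i = Suc n" | (xy) a b where "i = Suc a" "k = Suc b"
    using ik by (metis not0_implies_Suc not_gr_zero)
  then show ?thesis
  proof cases
    case y
    define \<eta>1 where "\<eta>1 = w * dX U - of_nat (Suc n) * U * dX \<phi>"
    define \<eta>2 where "\<eta>2 = w * dY U + of_nat (Suc n) * U"
    have Hw: "H = w ^ Suc n * U" unfolding H y z_def w_def by simp
    have "dX H = w ^ n * \<eta>1" "dY H = w ^ n * \<eta>2"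
      unfolding Hw dXY_mult conjunct1[OF dXY_power_Suc] conjunct2[OF dXY_power_Suc] d \<eta>1_def \<eta>2_def
      by (simp_all add: algebra_simps del: of_nat_Suc)
    moreover have e2: "ev0 \<eta>2 \<noteq> 0" using c0[of n] zw0 by (simp add: \<eta>2_def del: of_nat_Suc)
    moreover have "ry \<eta>1 = 0" if "\<phi> = 0" using that by (simp add: \<eta>1_def w_def del: of_nat_Suc)
    moreover have "\<forall>A B. cop A B \<longrightarrow> A * \<eta>2 = B * \<eta>1 \<longrightarrow> (\<exists>u. ev0 u \<noteq> 0 \<and> A = u * \<eta>1 \<and> B = u * \<eta>2)"
      using par_regular[OF _ _ disjI2[OF e2]] by blast
    ultimately have "w ^ n \<noteq> 0 \<and> dX H = w ^ n * \<eta>1 \<and> dY H = w ^ n * \<eta>2 \<and> leaf_pair Q p \<eta>1 \<eta>2"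
      unfolding leaf_pair_def using zw lx ly y two unit_rx_ry[OF e2] by auto
    then show ?thesis by blast
  next
    case x
    define \<eta>1 where "\<eta>1 = z * dX U + of_nat (Suc n) * U"
    define \<eta>2 where "\<eta>2 = z * dY U - of_nat (Suc n) * U * dY \<zeta>"
    have Hz: "H = z ^ Suc n * U" unfolding H x z_def w_def by simp
    have "dX H = z ^ n * \<eta>1" "dY H = z ^ n * \<eta>2"
      unfolding Hz dXY_mult conjunct1[OF dXY_power_Suc] conjunct2[OF dXY_power_Suc] d \<eta>1_def \<eta>2_def
      by (simp_all add: algebra_simps del: of_nat_Suc)
    moreover have e1: "ev0 \<eta>1 \<noteq> 0" using c0[of n] zw0 by (simp add: \<eta>1_def del: of_nat_Suc)
    moreover have "rx \<eta>2 = 0" if "\<zeta> = 0" using that by (simp add: \<eta>2_def z_def del: of_nat_Suc)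
    moreover have "\<forall>A B. cop A B \<longrightarrow> A * \<eta>2 = B * \<eta>1 \<longrightarrow> (\<exists>u. ev0 u \<noteq> 0 \<and> A = u * \<eta>1 \<and> B = u * \<eta>2)"
      using par_regular[OF _ _ disjI1[OF e1]] by blast
    ultimately have "z ^ n \<noteq> 0 \<and> dX H = z ^ n * \<eta>1 \<and> dY H = z ^ n * \<eta>2 \<and> leaf_pair Q p \<eta>1 \<eta>2"
      unfolding leaf_pair_def using zw lx ly x two unit_rx_ry[OF e1] by auto
    then show ?thesis by blast
  next
    case xy
    define ca cb :: germ where "ca = of_nat (Suc a)" and "cb = of_nat (Suc b)"
    have cd: "dX ca = 0" "dY ca = 0" "dX cb = 0" "dY cb = 0" unfolding ca_def cb_def by (simp_all only: dXY_of_nat)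
    have ce: "ev0 ca = of_nat (Suc a)" "ev0 cb = of_nat (Suc b)" unfolding ca_def cb_def by (simp_all only: ev0_of_nat)
    define \<eta>1 where "\<eta>1 = ca * U * w - cb * U * z * dX \<phi> + z * w * dX U"
    define \<eta>2 where "\<eta>2 = cb * U * z - ca * U * w * dY \<zeta> + z * w * dY U"
    have Hzw: "H = z ^ Suc a * w ^ Suc b * U" unfolding H xy z_def w_def by simp
    have dH: "dX H = z ^ a * w ^ b * \<eta>1" "dY H = z ^ a * w ^ b * \<eta>2"
      unfolding Hzw dXY_mult conjunct1[OF dXY_power_Suc] conjunct2[OF dXY_power_Suc] d \<eta>1_def \<eta>2_def ca_def[symmetric] cb_def[symmetric]
      by (simp_all add: algebra_simps)
    have l: "fst (labels p) \<noteq> None \<or> snd (labels p) \<noteq> None" using exc_axes_some[OF p] by (simp add: exc_axes_def)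
    then have zf: "\<zeta> = 0 \<or> \<phi> = 0" using lx ly by blast
    have Uc: "ev0 (ca * U) \<noteq> 0" "ev0 (cb * U) \<noteq> 0" unfolding ca_def cb_def by (rule c0)+
    have uniq: "\<forall>A B. cop A B \<longrightarrow> A * \<eta>2 = B * \<eta>1 \<longrightarrow> (\<exists>u. ev0 u \<noteq> 0 \<and> A = u * \<eta>1 \<and> B = u * \<eta>2)"
      using crossing_unique'[OF z_def \<zeta> w_def \<phi> Uc zf \<eta>1_def \<eta>2_def] by blast
    have "rx \<eta>2 = 0 \<and> rx \<eta>1 \<noteq> 0" if "\<zeta> = 0"
    proof -
      have "rx z = 0" using that by (simp add: z_def)
      then have "rx \<eta>2 = 0" "rx \<eta>1 = rx (ca * U) * Y" using that by (simp_all add: \<eta>1_def \<eta>2_def rw)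
      then show ?thesis using unit_rx_ry[OF Uc(1)] by simp
    qed
    moreover have "ry \<eta>1 = 0 \<and> ry \<eta>2 \<noteq> 0" if "\<phi> = 0"
    proof -
      have "ry w = 0" using that by (simp add: w_def)
      then have "ry \<eta>1 = 0" "ry \<eta>2 = ry (cb * U) * X" using that by (simp_all add: \<eta>1_def \<eta>2_def rz)
      then show ?thesis using unit_rx_ry[OF Uc(2)] by simp
    qed
    moreover have "simple_pair \<eta>1 \<eta>2"
    proof (rule simple_pairI[OF _ _ U, of _ _ "Suc a" "Suc b"])
      show "ev0 \<eta>1 = 0" "ev0 \<eta>2 = 0" by (simp_all add: \<eta>1_def \<eta>2_def zw0)
      \<comment> \<open>One of the two curves is an exceptional axis, so one of the two derivatives
        is 0 and the linear part is triangular.\<close>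
      have fg: "ev0 (dX \<phi>) * ev0 (dY \<zeta>) = 0" using zf by auto
      have v: "ev0 (dX \<eta>2) = ev0 cb * ev0 U" "ev0 (dY \<eta>1) = ev0 ca * ev0 U"
        "ev0 (dY \<eta>2) = - ev0 (dY \<zeta>) * (ev0 ca + ev0 cb) * ev0 U" "ev0 (dX \<eta>1) = - ev0 (dX \<phi>) * (ev0 ca + ev0 cb) * ev0 U"
        unfolding \<eta>1_def \<eta>2_def using fg by (auto simp: dXY_mult dXY_add dXY_diff cd d zw0 algebra_simps)
      show "ev0 (dX \<eta>2) - ev0 (dY \<eta>1) = of_nat (Suc b) * ev0 U - of_nat (Suc a) * ev0 U" unfolding v ce ..
      show "ev0 (dY \<eta>2) * ev0 (dX \<eta>1) - ev0 (dX \<eta>2) * ev0 (dY \<eta>1) = - (of_nat (Suc b) * ev0 U * (of_nat (Suc a) * ev0 U))"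
        unfolding v ce using fg by auto
    qed simp_all
    ultimately have "z ^ a * w ^ b \<noteq> 0 \<and> dX H = z ^ a * w ^ b * \<eta>1 \<and> dY H = z ^ a * w ^ b * \<eta>2 \<and> leaf_pair Q p \<eta>1 \<eta>2"
      unfolding leaf_pair_def using zw lx ly xy two uniq dH by auto
    then show ?thesis by blast
  qed
qed

text \<open>\<open>F\<close> is the contraction of the form with the radial vector field; the
  coefficients of the pull-back are its pull-back divided by \<open>X\<close>, and \<open>X\<close>
  times the pull-back of \<open>B0\<close>. Off the roots of the two leading polynomials both are
  powers of X times units, and cancelling the smaller power leaves a regular form.\<close>

lemma generic_slope:
  assumes "w \<noteq> (0, 0)"
  shows "finite {c. \<not> (\<exists>g A B. g \<noteq> 0 \<and> blow_form (Slope c) w = scale g (A, B) \<and> (ev0 A \<noteq> 0 \<or> ev0 B \<noteq> 0))}" (is "finite ?S")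
proof -
  obtain A0 B0 where w: "w = (A0, B0)" by (cases w)
  define F where "F = X * A0 + Y * B0"
  have XF: "pull (Slope c) F = X * (pull (Slope c) A0 + pull (Slope c) B0 * (Y + C c))" for c
    by (simp add: F_def algebra_simps)
  have F0: "ev0 F = 0" by (simp add: F_def)
  have AB0: "A0 \<noteq> 0 \<or> B0 \<noteq> 0" using assms w by simp
  show ?thesis
  proof (cases "F = 0 \<or> B0 = 0")
    case True
    have ne: "c \<notin> ?S" for c
    proof (cases "F = 0")
      case True
      then have f1: "pull (Slope c) A0 + pull (Slope c) B0 * (Y + C c) = 0" using XF[of c] by simp
      have "B0 \<noteq> 0"
      proof
        assume "B0 = 0"
        then have "X * A0 = 0" using True by (simp add: F_def)
        then show False using AB0 \<open>B0 = 0\<close> by simp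
      qed
      moreover have "blow_form (Slope c) w = scale (X * pull (Slope c) B0) (0, 1)" using f1 by (simp add: w scale_def)
      ultimately have "X * pull (Slope c) B0 \<noteq> 0 \<and> blow_form (Slope c) w = scale (X * pull (Slope c) B0) (0, 1) \<and> (ev0 0 \<noteq> 0 \<or> ev0 1 \<noteq> 0)" by simp
      then show ?thesis by blast
    next
      case False
      then have "B0 = 0" "A0 \<noteq> 0" using True AB0 by auto
      then have "pull (Slope c) A0 \<noteq> 0 \<and> blow_form (Slope c) w = scale (pull (Slope c) A0) (1, 0) \<and> (ev0 1 \<noteq> 0 \<or> ev0 0 \<noteq> 0)"
        by (simp add: w scale_def)
      then show ?thesis by blast
    qed
    have "?S = {}" by (rule equals0I) (rule notE[OF ne])
    then show ?thesis by simp
  next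
    case False
    then have nz: "F \<noteq> 0" "B0 \<noteq> 0" by auto
    obtain m where m: "ord0 F = Suc m" using ord0_pos[OF nz(1) F0] by (metis gr0_implies_Suc)
    have "?S \<subseteq> {c. poly (lead_poly F) c = 0} \<union> {c. poly (lead_poly B0) c = 0}"
    proof
      fix c assume c: "c \<in> ?S"
      show "c \<in> {c. poly (lead_poly F) c = 0} \<union> {c. poly (lead_poly B0) c = 0}"
      proof (rule ccontr)
        assume "c \<notin> {c. poly (lead_poly F) c = 0} \<union> {c. poly (lead_poly B0) c = 0}"
        then have u: "ev0 (strict (Slope c) F) \<noteq> 0" "ev0 (strict (Slope c) B0) \<noteq> 0" by (simp_all add: ev0_strict_Slope nz)
        let ?S1 = "strict (Slope c) F" and ?S2 = "strict (Slope c) B0"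
        have "X * (pull (Slope c) A0 + pull (Slope c) B0 * (Y + C c)) = X * (X ^ m * ?S1)"
          using pull_strict[OF nz(1), of "Slope c"] unfolding XF m by (simp add: mult.assoc)
        then have f1: "pull (Slope c) A0 + pull (Slope c) B0 * (Y + C c) = X ^ m * ?S1" using mult_left_cancel[OF X_nonzero] by blast
        have f2: "X * pull (Slope c) B0 = X ^ Suc (ord0 B0) * ?S2" using pull_strict[OF nz(2), of "Slope c"] by (simp add: mult.assoc)
        have blow_form: "blow_form (Slope c) w = (X ^ m * ?S1, X ^ Suc (ord0 B0) * ?S2)" unfolding w blow_form.simps f1 f2 ..
        have "\<exists>g A B. g \<noteq> 0 \<and> blow_form (Slope c) w = scale g (A, B) \<and> (ev0 A \<noteq> 0 \<or> ev0 B \<noteq> 0)"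
        proof (cases "m \<le> Suc (ord0 B0)")
          case True
          then obtain j where "Suc (ord0 B0) = m + j" using le_Suc_ex by blast
          then have "blow_form (Slope c) w = scale (X ^ m) (?S1, X ^ j * ?S2)" unfolding blow_form scale_def by (simp add: power_add mult.assoc del: power_Suc)
          then have "X ^ m \<noteq> 0 \<and> blow_form (Slope c) w = scale (X ^ m) (?S1, X ^ j * ?S2) \<and> (ev0 ?S1 \<noteq> 0 \<or> ev0 (X ^ j * ?S2) \<noteq> 0)" using u by simp
          then show ?thesis by blast
        next
          case False
          then obtain j where mj: "m = Suc (ord0 B0) + j" using le_Suc_ex nat_le_linear by blast
          have "blow_form (Slope c) w = scale (X ^ Suc (ord0 B0)) (X ^ j * ?S1, ?S2)"
            unfolding blow_form scale_def mj power_add by (simp only: mult.assoc fst_conv snd_conv)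
          then have "X ^ Suc (ord0 B0) \<noteq> 0 \<and> blow_form (Slope c) w = scale (X ^ Suc (ord0 B0)) (X ^ j * ?S1, ?S2) \<and> (ev0 (X ^ j * ?S1) \<noteq> 0 \<or> ev0 ?S2 \<noteq> 0)" using u by simp
          then show ?thesis by blast
        qed
        then show False using c by blast
      qed
    qed
    then show ?thesis by (rule finite_subset) (simp add: poly_roots_finite lead_poly_nonzero nz)
  qed
qed

text \<open>If the pair is regular or simple, then the exceptional line of its blow-up is invariant and carries at most
  two singular slopes.\<close>

lemma simple_slopes:
  assumes "ev0 A \<noteq> 0 \<or> ev0 B \<noteq> 0 \<or> simple_pair A B"
  shows "\<exists>P. P \<noteq> 0 \<and> degree P \<le> 2 \<and> (\<forall>c. poly P c \<noteq> 0 \<longrightarrow>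
    (\<exists>g A' B'. g \<noteq> 0 \<and> blow_form (Slope c) (A, B) = scale g (A', X * B') \<and> ev0 A' \<noteq> 0))"
proof (cases "ev0 A = 0 \<and> ev0 B = 0")
  case False
  let ?P = "[:ev0 A, ev0 B:]"
  have "\<exists>g A' B'. g \<noteq> 0 \<and> blow_form (Slope c) (A, B) = scale g (A', X * B') \<and> ev0 A' \<noteq> 0" if "poly ?P c \<noteq> 0" for c
    using that by (intro exI[of _ 1] exI[of _ "pull (Slope c) A + pull (Slope c) B * (Y + C c)"] exI[of _ "pull (Slope c) B"])
      (simp add: scale_def mult.commute)
  moreover have "?P \<noteq> 0" "degree ?P \<le> 2" using False by auto
  ultimately show ?thesis by blast
next
  case True
  then have s: "simple_pair A B" using assms by blast
  obtain a1 a2 where a: "A = X * a1 + Y * a2" using hadamard True by blast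
  obtain b1 b2 where b: "B = X * b1 + Y * b2" using hadamard True by blast
  have dA: "ev0 (dX A) = ev0 a1" "ev0 (dY A) = ev0 a2" by (simp_all add: a dXY_add dXY_mult)
  have dB: "ev0 (dX B) = ev0 b1" "ev0 (dY B) = ev0 b2" by (simp_all add: b dXY_add dXY_mult)
  \<comment> \<open>The quadratic part of x A + y B at (1, t). It vanishes identically only if the
    linear part is a multiple of the identity, where the eigenvalue ratio 1 contradicts
    simplicity.\<close>
  let ?P = "[:ev0 a1, ev0 a2 + ev0 b1, ev0 b2:]"
  have "?P \<noteq> 0"
  proof
    assume "?P = 0"
    then have 0: "ev0 a1 = 0" "ev0 a2 = - ev0 b1" "ev0 b2 = 0" by (simp_all add: eq_neg_iff_add_eq_0)
    then have "\<forall>t. det (mat t - lin_matrix A B) = (t - ev0 b1) * (t - ev0 b1)" unfolding det_lin_matrix dA dB by simp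
    then have "\<not> (\<exists>r::rat. r > 0 \<and> ev0 b1 = of_rat r * ev0 b1)" using s unfolding simple_pair_def by blast
    then show False by (metis mult_1 of_rat_1 zero_less_one)
  qed
  moreover have "degree ?P \<le> 2" by simp
  moreover have "\<exists>g A' B'. g \<noteq> 0 \<and> blow_form (Slope c) (A, B) = scale g (A', X * B') \<and> ev0 A' \<noteq> 0" if "poly ?P c \<noteq> 0" for c
  proof -
    let ?p = "pull (Slope c)" and ?t = "Y + C c"
    have "blow_form (Slope c) (A, B) = scale X (?p a1 + ?t * ?p a2 + ?t * (?p b1 + ?t * ?p b2), X * (?p b1 + ?t * ?p b2))"
      by (simp add: a b scale_def algebra_simps)
    moreover have "ev0 (?p a1 + ?t * ?p a2 + ?t * (?p b1 + ?t * ?p b2)) \<noteq> 0" using that by (simp add: algebra_simps)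
    ultimately show ?thesis using X_nonzero by blast
  qed
  ultimately show ?thesis by blast
qed

text \<open>At one of the three slopes the transform would be regular with the exceptional line as
  its leaf. The fraction has a zero along y = 0 there: if its order on the line is 0, it is not
  constant on that leaf; if positive, y = 0 is a second invariant curve through a regular
  point.\<close>

lemma three_zeros_not_simple:
  assumes thr: "three_zeros T Q t N D" and D: "D \<noteq> 0" and level_pair: "level_pair N D = scale g (A, B)" "g \<noteq> 0"
  shows "\<not> (ev0 A \<noteq> 0 \<or> ev0 B \<noteq> 0 \<or> simple_pair A B)"
proof
  assume "ev0 A \<noteq> 0 \<or> ev0 B \<noteq> 0 \<or> simple_pair A B"
  from simple_slopes[OF this] obtain P where P: "P \<noteq> 0" "degree P \<le> 2"
    and Pc: "\<And>c. poly P c \<noteq> 0 \<Longrightarrow> \<exists>g A' B'. g \<noteq> 0 \<and> blow_form (Slope c) (A, B) = scale g (A', X * B') \<and> ev0 A' \<noteq> 0" by blast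
  obtain S where S: "card S = 3" and SS: "\<forall>c\<in>S. t @ [Slope c] \<in> fibre T \<and>
     (\<exists>a k U. (a = 0 \<longleftrightarrow> t \<in> Q) \<and> k \<ge> (1::nat) \<and> ev0 U \<noteq> 0 \<and>
        pull (Slope c) N = pull (Slope c) D * (X ^ a * Y ^ k * U))"
    using thr unfolding three_zeros_def by (elim exE conjE)
  have "card {c. poly P c = 0} \<le> 2" using card_poly_roots_bound[OF P(1)] P(2) by linarith
  then have "\<not> S \<subseteq> {c. poly P c = 0}" using S card_mono[OF poly_roots_finite[OF P(1)], of S] by linarith
  then obtain c where c: "c \<in> S" "poly P c \<noteq> 0" by blast
  obtain a k U where U: "k \<ge> (1::nat)" "ev0 U \<noteq> 0"
        "pull (Slope c) N = pull (Slope c) D * (X ^ a * Y ^ k * U)" using bspec[OF SS c(1)] by (elim exE conjE)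
  obtain g' A' B' where g': "g' \<noteq> 0" "blow_form (Slope c) (A, B) = scale g' (A', X * B')" "ev0 A' \<noteq> 0" using Pc[OF c(2)] by blast
  define H where "H = X ^ a * Y ^ k * U"
  let ?D = "pull (Slope c) D" and ?g = "pull (Slope c) g"
  have "scale (?D * ?D) (dX H, dY H) = level_pair (pull (Slope c) N) ?D" unfolding U(3) H_def[symmetric] by (rule level_pair_mult[symmetric])
  also have "\<dots> = scale ?g (scale g' (A', X * B'))" unfolding blow_form_level_pair[symmetric] level_pair(1) blow_form_scale g'(2) ..
  finally have 1: "?D * ?D * dX H = ?g * g' * A'" and 2: "?D * ?D * dY H = ?g * g' * (X * B')" by (simp_all add: scale_def mult.assoc)
  have "(?D * ?D) * (?g * g') * (A' * dY H) = (?g * g' * A') * (?D * ?D * dY H)" by (simp only: mult_ac)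
  also have "\<dots> = (?D * ?D) * (?g * g') * (X * B' * dX H)" unfolding 1[symmetric] 2 by (simp only: mult_ac)
  finally have e: "A' * dY H = X * B' * dX H"
    using D level_pair(2) g'(1) mult_left_cancel[of "(?D * ?D) * (?g * g')"] by simp
  obtain n where n: "k = Suc n" using U(1) by (cases k) auto
  have c0: "ev0 (of_nat (Suc n) * U) \<noteq> 0" for n using U(2) by (simp del: of_nat_Suc)
  define u2 where "u2 = of_nat (Suc n) * U + Y * dY U"
  have u2: "ev0 u2 \<noteq> 0" using c0[of n] by (simp add: u2_def del: of_nat_Suc)
  show False
  proof (cases a)
    case 0
    have H: "H = Y ^ Suc n * U" unfolding H_def 0 n by simp
    have "dY H = Y ^ n * u2" unfolding H dXY_mult conjunct2[OF dXY_power_Suc] u2_def by (simp add: algebra_simps del: of_nat_Suc)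
    then have "rx (A' * (Y ^ n * u2)) = 0" using arg_cong[OF e, of rx] by simp
    then show False using unit_rx_ry[OF u2] unit_rx_ry[OF g'(3)] by simp
  next
    case (Suc m)
    have H: "H = X ^ Suc m * (Y ^ Suc n * U)" unfolding H_def Suc n by (simp only: mult.assoc)
    define u1 where "u1 = of_nat (Suc m) * U + X * dX U"
    have dy: "dY H = X ^ m * Y ^ n * (X * u2)"
      unfolding H dXY_mult conjunct2[OF dXY_power_Suc] u2_def by (simp add: algebra_simps del: of_nat_Suc)
    have dx: "dX H = X ^ m * Y ^ n * (Y * u1)"
      unfolding H dXY_mult conjunct1[OF dXY_power_Suc] u1_def by (simp add: algebra_simps del: of_nat_Suc)
    have "X ^ m * Y ^ n * (A' * (X * u2)) = X ^ m * Y ^ n * (X * B' * (Y * u1))"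
      using e unfolding dy dx by (simp only: mult_ac)
    then have "A' * (X * u2) = X * B' * (Y * u1)" using mult_left_cancel[of "X ^ m * Y ^ n"] by simp
    from arg_cong[OF this, of ry] show False using unit_rx_ry[OF u2] unit_rx_ry[OF g'(3)] by simp
  qed
qed

section \<open>Components, transforms and singularities in terms of germs\<close>

text \<open>The strict transform of x = 0 passes through no direction but the vertical one, so a
  component along this axis is traced by repeating that direction.\<close>

lemma fst_labels_iff: "fst (labels p) = Some q \<longleftrightarrow> (\<exists>c n. p = q @ Slope c # replicate n Vertical)"
proof (induction p rule: rev_induct)
  case (snoc d p)
  show ?case
  proof (cases d)
    case (Slope c)
    have "p @ [Slope c] = q @ Slope c' # replicate n Vertical \<longleftrightarrow> n = 0 \<and> c' = c \<and> p = q" for c' n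
      by (cases n) (auto simp: replicate_append_same[symmetric] simp del: replicate_append_same)
    then show ?thesis using Slope by auto
  next
    case Vertical
    have 1: "q @ Slope c' # replicate (Suc n) Vertical = (q @ Slope c' # replicate n Vertical) @ [Vertical]" for c' n
      by (simp add: replicate_append_same)
    have 2: "p @ [Vertical] = q @ Slope c' # replicate n Vertical \<longleftrightarrow> (\<exists>m. n = Suc m \<and> p = q @ Slope c' # replicate m Vertical)" for c' n
      by (cases n) (auto simp only: 1, auto)
    show ?thesis unfolding Vertical 2 using snoc.IH by auto
  qed
qed simp

lemma snd_labels_iff: "snd (labels p) = Some q \<longleftrightarrow> (\<exists>n. p = q @ Vertical # replicate n (Slope 0))"
proof (induction p rule: rev_induct)
  case (snoc d p)
  have 1: "q @ Vertical # replicate (Suc n) (Slope 0) = (q @ Vertical # replicate n (Slope 0)) @ [Slope 0]" for n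
    by (simp add: replicate_append_same)
  have 2: "p @ [d] = q @ Vertical # replicate n (Slope 0) \<longleftrightarrow>
      (n = 0 \<and> d = Vertical \<and> p = q) \<or> (\<exists>m. n = Suc m \<and> d = Slope 0 \<and> p = q @ Vertical # replicate m (Slope 0))" for n
    by (cases n) (auto simp only: 1, auto)
  show ?case unfolding 2 using snoc.IH by (cases d) auto
qed simp

section \<open>Components as coordinate axes\<close>

lemma vertical_line_eq:
  "{w. chart r w \<noteq> 0 \<and> fst (chart r w) = 0} = (if set r \<subseteq> {Vertical} then {0} \<times> (- {0}) else {})"
proof (induction r)
  case Nil
  show ?case by (auto simp: zero_prod_def)
next
  case (Cons b r)
  show ?case
  proof (cases b)
    case (Slope c)
    have "blow b z = 0" if "fst (blow b z) = 0" for z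
      using that by (cases z) (auto simp: Slope zero_prod_def)
    then have "{w. chart (b # r) w \<noteq> 0 \<and> fst (chart (b # r) w) = 0} = {}"
      unfolding chart.simps o_def by blast
    then show ?thesis by (simp add: Slope)
  next
    case Vertical
    have "blow b z \<noteq> 0 \<and> fst (blow b z) = 0 \<longleftrightarrow> z \<noteq> 0 \<and> fst z = 0" for z
      by (cases z) (auto simp: Vertical zero_prod_def)
    then show ?thesis using Cons Vertical by simp
  qed
qed

lemma horizontal_line_eq:
  "if set r \<subseteq> {Slope 0} then {w. chart r w \<noteq> 0 \<and> snd (chart r w) = 0} = (- {0}) \<times> {0}
   else 0 \<notin> closure {w. chart r w \<noteq> 0 \<and> snd (chart r w) = 0}"
proof (induction r)
  case Nil
  show ?case by (auto simp: zero_prod_def)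
next
  case (Cons b r)
  consider "b = Slope 0" | c where "b = Slope c" "c \<noteq> 0" | "b = Vertical" by (cases b) auto
  then show ?case
  proof cases
    case 1
    have "blow b z \<noteq> 0 \<and> snd (blow b z) = 0 \<longleftrightarrow> z \<noteq> 0 \<and> snd z = 0" for z
      by (cases z) (auto simp: 1 zero_prod_def)
    then have e: "{w. chart (b # r) w \<noteq> 0 \<and> snd (chart (b # r) w) = 0} = {w. chart r w \<noteq> 0 \<and> snd (chart r w) = 0}" by simp
    show ?thesis unfolding e using Cons 1 by auto
  next
    case 2
    have "closure {w. chart (b # r) w \<noteq> 0 \<and> snd (chart (b # r) w) = 0} \<subseteq> {w. snd (chart r w) = - c}"
    proof (rule closure_minimal)
      show "closed {w. snd (chart r w) = - c}" by (intro closed_Collect_eq continuous_intros continuous_chart)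
      have "snd z = - c" if "blow b z \<noteq> 0" "snd (blow b z) = 0" for z
        using that by (cases z) (auto simp: 2 zero_prod_def eq_neg_iff_add_eq_0)
      then show "{w. chart (b # r) w \<noteq> 0 \<and> snd (chart (b # r) w) = 0} \<subseteq> {w. snd (chart r w) = - c}"
        unfolding chart.simps o_def by blast
    qed
    moreover have "0 \<notin> {w. snd (chart r w) = - c}" using 2 by (simp add: chart_0)
    ultimately show ?thesis using 2 by auto
  next
    case 3
    have "blow b z = 0" if "snd (blow b z) = 0" for z
      using that by (cases z) (auto simp: 3 zero_prod_def)
    then have e: "{w. chart (b # r) w \<noteq> 0 \<and> snd (chart (b # r) w) = 0} = {}"
      unfolding chart.simps o_def by blast
    show ?thesis unfolding e using 3 by simp
  qed
qed

lemma component_at_append: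
  "component_at q (q @ a # r) = closure {w. chart r w \<noteq> 0 \<and> blow a (chart r w) = 0}"
  by (auto simp: component_at_def)

lemma closure_punctured: "closure (- {0 :: complex}) = UNIV"
  by (simp add: closure_complement)

lemma blow_zero: "blow (Slope c) z = 0 \<longleftrightarrow> fst z = 0" "blow Vertical z = 0 \<longleftrightarrow> snd z = 0"
  by (cases z; auto simp: zero_prod_def)+

lemma component_at_x: "fst (labels p) = Some q \<Longrightarrow> component_at q p = {0} \<times> UNIV"
proof -
  assume "fst (labels p) = Some q"
  then obtain c n where p: "p = q @ Slope c # replicate n Vertical" unfolding fst_labels_iff by blast
  have "set (replicate n Vertical) \<subseteq> {Vertical}" by auto
  then have "{w. chart (replicate n Vertical) w \<noteq> 0 \<and> fst (chart (replicate n Vertical) w) = 0} = {0} \<times> (- {0})"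
    unfolding vertical_line_eq by (rule if_P)
  then show ?thesis unfolding p component_at_append blow_zero by (simp add: closure_Times closure_punctured)
qed

lemma component_at_y: "snd (labels p) = Some q \<Longrightarrow> component_at q p = UNIV \<times> {0}"
proof -
  assume "snd (labels p) = Some q"
  then obtain n where p: "p = q @ Vertical # replicate n (Slope 0)" unfolding snd_labels_iff by blast
  have "set (replicate n (Slope 0)) \<subseteq> {Slope 0}" by auto
  then have "{w. chart (replicate n (Slope 0)) w \<noteq> 0 \<and> snd (chart (replicate n (Slope 0)) w) = 0} = (- {0}) \<times> {0}"
    using horizontal_line_eq[of "replicate n (Slope 0)"] by simp
  then show ?thesis unfolding p component_at_append blow_zero by (simp add: closure_Times closure_punctured)
qed

lemma on_component_iff: "on_component q p \<longleftrightarrow> fst (labels p) = Some q \<or> snd (labels p) = Some q"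
proof
  assume on: "on_component q p"
  then obtain a r where p: "p = q @ a # r" by (auto simp: on_component_def component_at_def)
  have cl: "0 \<in> closure {w. chart r w \<noteq> 0 \<and> blow a (chart r w) = 0}"
    using on unfolding on_component_def p component_at_append .
  show "fst (labels p) = Some q \<or> snd (labels p) = Some q"
  proof (cases a)
    case (Slope c)
    then have "set r \<subseteq> {Vertical}" using cl unfolding Slope blow_zero vertical_line_eq by (auto split: if_splits)
    then have "r = replicate (length r) Vertical" by (metis replicate_length_same singletonD subsetD)
    then show ?thesis unfolding fst_labels_iff p Slope by blast
  next
    case Vertical
    then have "set r \<subseteq> {Slope 0}" using cl horizontal_line_eq[of r] unfolding Vertical blow_zero by (auto split: if_splits)
    then have "r = replicate (length r) (Slope 0)" by (metis replicate_length_same singletonD subsetD)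
    then show ?thesis unfolding snd_labels_iff p Vertical by blast
  qed
next
  assume "fst (labels p) = Some q \<or> snd (labels p) = Some q"
  then show "on_component q p" unfolding on_component_def
    by (auto simp: component_at_x component_at_y zero_prod_def)
qed

lemma on_component_prefix: "on_component q p \<Longrightarrow> \<exists>r. r \<noteq> [] \<and> p = q @ r"
  by (auto simp: on_component_def component_at_def)

section \<open>Translation from functions to germs\<close>

lemma germ_of_blow: "holomorphic_germ f \<Longrightarrow> holomorphic_germ (f \<circ> blow d) \<and> germ_of (f \<circ> blow d) = pull d (germ_of f)"
proof (cases d)
  case (Slope c)
  assume f: "holomorphic_germ f"
  have e: "f \<circ> blow d = (\<lambda>z. f (fst z, fst z * (snd z + c)))" unfolding Slope by (auto simp: fun_eq_iff)
  have p: "germ_of (\<lambda>z. fst z * (snd z + c)) = X * (Y + C c)" unfolding X_def Y_def C_def by (simp add: germ_of_mult germ_of_add)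
  have "pull d (germ_of f) = subst_germ (germ_of f) (germ_of fst) (germ_of (\<lambda>z. fst z * (snd z + c)))" unfolding Slope pull.simps p X_def[symmetric] ..
  also have "\<dots> = germ_of (f \<circ> blow d)" unfolding e by (rule subst_germ_germ_of) (use f in simp_all)
  finally show ?thesis using holomorphic_germ_compose[OF f, of fst "\<lambda>z. fst z * (snd z + c)"] unfolding e by simp
next
  case Vertical
  assume f: "holomorphic_germ f"
  have e: "f \<circ> blow d = (\<lambda>z. f (fst z * snd z, snd z))" unfolding Vertical by (auto simp: fun_eq_iff)
  have p: "germ_of (\<lambda>z. fst z * snd z) = X * Y" unfolding X_def Y_def by (simp add: germ_of_mult)
  have "pull d (germ_of f) = subst_germ (germ_of f) (germ_of (\<lambda>z. fst z * snd z)) (germ_of snd)" unfolding Vertical pull.simps p Y_def[symmetric] ..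
  also have "\<dots> = germ_of (f \<circ> blow d)" unfolding e by (rule subst_germ_germ_of) (use f in simp_all)
  finally show ?thesis using holomorphic_germ_compose[OF f, of "\<lambda>z. fst z * snd z" snd] unfolding e by simp
qed

lemma germ_of_chart: "holomorphic_germ f \<Longrightarrow> holomorphic_germ (f \<circ> chart p) \<and> germ_of (f \<circ> chart p) = pull_at p (germ_of f)"
proof (induction p arbitrary: f)
  case (Cons d r)
  have "f \<circ> chart (d # r) = (f \<circ> blow d) \<circ> chart r" by (simp add: comp_assoc)
  then show ?case using germ_of_blow[OF Cons.prems, of d] Cons.IH[of "f \<circ> blow d"] by (simp only: pull_at.simps)
qed simp

lemma chart_form_formula:
  "chart_form p (A, B) = (pull_at p A * dX (pull_at p X) + pull_at p B * dX (pull_at p Y), pull_at p A * dY (pull_at p X) + pull_at p B * dY (pull_at p Y))"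
proof (induction p arbitrary: A B)
  case (Cons d r)
  show ?case
  proof (cases d)
    case (Slope c)
    show ?thesis unfolding Slope chart_form.simps blow_form.simps Cons.IH by (simp add: dXY_mult dXY_add algebra_simps)
  next
    case Vertical
    show ?thesis unfolding Vertical chart_form.simps blow_form.simps Cons.IH by (simp add: dXY_mult dXY_add algebra_simps)
  qed
qed simp

lemma germ_dvd_iff:
  assumes "holomorphic_germ d" "holomorphic_germ f" shows "germ_dvd d f \<longleftrightarrow> germ_of d dvd germ_of f"
proof
  assume "germ_dvd d f"
  then obtain k where k: "holomorphic_germ k" "germ_eq f (\<lambda>z. d z * k z)" unfolding germ_dvd_def by blast
  then have "germ_of f = germ_of (\<lambda>z. d z * k z)" using germ_of_eq_iff[OF assms(2) holomorphic_germ_mult[OF assms(1) k(1)]] by simp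
  then have "germ_of f = germ_of d * germ_of k" unfolding germ_of_mult[OF assms(1) k(1)] .
  then show "germ_of d dvd germ_of f" by simp
next
  assume "germ_of d dvd germ_of f"
  then obtain K where K: "germ_of f = germ_of d * K" by (elim dvdE)
  obtain k where k: "holomorphic_germ k" "K = germ_of k" by (rule germ_of_cases)
  have "germ_of f = germ_of (\<lambda>z. d z * k z)" unfolding germ_of_mult[OF assms(1) k(1)] K k(2) ..
  then have "germ_eq f (\<lambda>z. d z * k z)" using germ_of_eq_iff[OF assms(2) holomorphic_germ_mult[OF assms(1) k(1)]] by simp
  then show "germ_dvd d f" unfolding germ_dvd_def using k(1) by blast
qed

lemma coprime_germs_iff:
  assumes "holomorphic_germ f" "holomorphic_germ g" shows "coprime_germs f g \<longleftrightarrow> cop (germ_of f) (germ_of g)"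
proof
  assume h: "coprime_germs f g"
  show "cop (germ_of f) (germ_of g)" unfolding cop_def
  proof (intro allI impI)
    fix d assume d: "d dvd germ_of f" "d dvd germ_of g"
    obtain d' where d': "holomorphic_germ d'" "d = germ_of d'" by (rule germ_of_cases)
    have "germ_dvd d' f" "germ_dvd d' g" using d germ_dvd_iff[OF d'(1)] assms unfolding d'(2) by simp_all
    then have "d' 0 \<noteq> 0" using h d'(1) unfolding coprime_germs_def by simp
    then show "ev0 d \<noteq> 0" unfolding d'(2) ev0_germ_of[OF d'(1)] .
  qed
next
  assume h: "cop (germ_of f) (germ_of g)"
  show "coprime_germs f g" unfolding coprime_germs_def
  proof (intro allI impI; elim conjE)
    fix d assume d: "holomorphic_germ d" "germ_dvd d f" "germ_dvd d g"
    have "germ_of d dvd germ_of f" "germ_of d dvd germ_of g" using d germ_dvd_iff[OF d(1)] assms by simp_all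
    then have "ev0 (germ_of d) \<noteq> 0" using h unfolding cop_def by simp
    then show "d 0 \<noteq> 0" unfolding ev0_germ_of[OF d(1)] .
  qed
qed

definition form_germs :: "oneform \<Rightarrow> germ \<times> germ" where "form_germs \<omega> = (germ_of (fst \<omega>), germ_of (snd \<omega>))"

definition hol_form :: "oneform \<Rightarrow> bool" where
  "hol_form \<omega> \<longleftrightarrow> holomorphic_germ (fst \<omega>) \<and> holomorphic_germ (snd \<omega>)"

lemma defines_foliation_iff:
  assumes "hol_form \<omega>"
  shows "defines_foliation \<eta> \<omega> \<longleftrightarrow> hol_form \<eta> \<and> cop (germ_of (fst \<eta>)) (germ_of (snd \<eta>)) \<and> (\<exists>k. k \<noteq> 0 \<and> form_germs \<omega> = scale k (form_germs \<eta>))"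
proof -
  have e: "(holomorphic_germ k \<and> \<not> germ_eq k (\<lambda>_. 0) \<and> germ_eq (fst \<omega>) (\<lambda>z. k z * fst \<eta> z) \<and> germ_eq (snd \<omega>) (\<lambda>z. k z * snd \<eta> z)) \<longleftrightarrow>
    (holomorphic_germ k \<and> germ_of k \<noteq> 0 \<and> form_germs \<omega> = scale (germ_of k) (form_germs \<eta>))" if "hol_form \<eta>" for k
    using that assms germ_of_eq_iff[of k "\<lambda>_. 0"] germ_of_eq_iff[of "fst \<omega>" "\<lambda>z. k z * fst \<eta> z"] germ_of_eq_iff[of "snd \<omega>" "\<lambda>z. k z * snd \<eta> z"]
    by (auto simp: hol_form_def form_germs_def scale_def germ_of_0 germ_of_mult)
  show ?thesis
  proof
    assume "defines_foliation \<eta> \<omega>"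
    then show "hol_form \<eta> \<and> cop (germ_of (fst \<eta>)) (germ_of (snd \<eta>)) \<and> (\<exists>k. k \<noteq> 0 \<and> form_germs \<omega> = scale k (form_germs \<eta>))"
      unfolding defines_foliation_def using e coprime_germs_iff hol_form_def by blast
  next
    assume h: "hol_form \<eta> \<and> cop (germ_of (fst \<eta>)) (germ_of (snd \<eta>)) \<and> (\<exists>k. k \<noteq> 0 \<and> form_germs \<omega> = scale k (form_germs \<eta>))"
    then obtain K where K: "K \<noteq> 0" "form_germs \<omega> = scale K (form_germs \<eta>)" by blast
    obtain k where "holomorphic_germ k" "K = germ_of k" by (rule germ_of_cases)
    then show "defines_foliation \<eta> \<omega>"
      unfolding defines_foliation_def using h K e[of k] coprime_germs_iff[of "fst \<eta>" "snd \<eta>"] by (auto simp: hol_form_def)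
  qed
qed

lemma form_germs_pullback: assumes "hol_form \<omega>" shows "hol_form (pullback (chart p) \<omega>) \<and> form_germs (pullback (chart p) \<omega>) = chart_form p (form_germs \<omega>)"
proof -
  have c: "holomorphic_germ (fst \<circ> chart p)" "germ_of (fst \<circ> chart p) = pull_at p X" "holomorphic_germ (snd \<circ> chart p)" "germ_of (snd \<circ> chart p) = pull_at p Y"
    using germ_of_chart[of fst p] germ_of_chart[of snd p] by (simp_all add: X_def Y_def)
  have f: "holomorphic_germ (fst \<omega> \<circ> chart p)" "germ_of (fst \<omega> \<circ> chart p) = pull_at p (germ_of (fst \<omega>))"
    "holomorphic_germ (snd \<omega> \<circ> chart p)" "germ_of (snd \<omega> \<circ> chart p) = pull_at p (germ_of (snd \<omega>))"
    using assms germ_of_chart by (auto simp: hol_form_def)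
  have e: "pullback (chart p) \<omega> =
    (\<lambda>z. (fst \<omega> \<circ> chart p) z * pd1 (fst \<circ> chart p) z + (snd \<omega> \<circ> chart p) z * pd1 (snd \<circ> chart p) z,
     \<lambda>z. (fst \<omega> \<circ> chart p) z * pd2 (fst \<circ> chart p) z + (snd \<omega> \<circ> chart p) z * pd2 (snd \<circ> chart p) z)"
    by (simp add: pullback_def)
  have h: "holomorphic_germ (pd1 (fst \<circ> chart p))" "holomorphic_germ (pd1 (snd \<circ> chart p))"
    "holomorphic_germ (pd2 (fst \<circ> chart p))" "holomorphic_germ (pd2 (snd \<circ> chart p))" using c by simp_all
  have m: "holomorphic_germ (\<lambda>z. a z * b z + a' z * b' z) \<and> germ_of (\<lambda>z. a z * b z + a' z * b' z) = germ_of a * germ_of b + germ_of a' * germ_of b'"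
    if "holomorphic_germ a" "holomorphic_germ b" "holomorphic_germ a'" "holomorphic_germ b'" for a b a' b'
    using that by (simp add: germ_of_add germ_of_mult)
  show ?thesis unfolding e hol_form_def form_germs_def fst_conv snd_conv chart_form_formula
    using m[OF f(1) h(1) f(3) h(2)] m[OF f(1) h(3) f(3) h(4)] by (simp add: f c dXY_germ_of[symmetric])
qed

lemma transform_at_iff:
  assumes "hol_form \<omega>" shows "transform_at \<omega> p \<eta> \<longleftrightarrow> hol_form \<eta> \<and> transf (form_germs \<omega>) p (germ_of (fst \<eta>)) (germ_of (snd \<eta>))"
  unfolding transform_at_def transf_def using form_germs_pullback[OF assms, of p] by (auto simp: defines_foliation_iff form_germs_def)

lemma transform_exI:
  assumes "hol_form \<omega>" "transf (form_germs \<omega>) p A B" shows "\<exists>\<eta>. transform_at \<omega> p \<eta> \<and> germ_of (fst \<eta>) = A \<and> germ_of (snd \<eta>) = B"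
proof -
  obtain a where a: "holomorphic_germ a" "A = germ_of a" by (rule germ_of_cases)
  obtain b where b: "holomorphic_germ b" "B = germ_of b" by (rule germ_of_cases)
  show ?thesis using assms a b by (intro exI[of _ "(a, b)"]) (simp add: transform_at_iff hol_form_def)
qed

lemma singular_at_iff: "hol_form \<omega> \<Longrightarrow> singular_at \<omega> p \<longleftrightarrow> (\<exists>A B. transf (form_germs \<omega>) p A B \<and> ev0 A = 0 \<and> ev0 B = 0)"
  unfolding singular_at_def
proof (intro iffI; elim exE conjE)
  fix \<eta> assume "hol_form \<omega>" "transform_at \<omega> p \<eta>" "fst \<eta> 0 = 0" "snd \<eta> 0 = 0"
  then show "\<exists>A B. transf (form_germs \<omega>) p A B \<and> ev0 A = 0 \<and> ev0 B = 0"
    by (intro exI[of _ "germ_of (fst \<eta>)"] exI[of _ "germ_of (snd \<eta>)"]) (simp add: transform_at_iff hol_form_def ev0_germ_of)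
next
  fix A B assume h: "hol_form \<omega>" "transf (form_germs \<omega>) p A B" "ev0 A = 0" "ev0 B = 0"
  from transform_exI[OF h(1,2)] obtain \<eta> where \<eta>: "transform_at \<omega> p \<eta>" "germ_of (fst \<eta>) = A" "germ_of (snd \<eta>) = B" by blast
  then have "fst \<eta> 0 = 0" "snd \<eta> 0 = 0" using h ev0_germ_of[of "fst \<eta>"] ev0_germ_of[of "snd \<eta>"] by (auto simp: transform_at_iff hol_form_def)
  then show "\<exists>\<eta>. transform_at \<omega> p \<eta> \<and> fst \<eta> 0 = 0 \<and> snd \<eta> 0 = 0" using \<eta>(1) by blast
qed

lemma linear_part_germ_of: "hol_form \<eta> \<Longrightarrow> linear_part \<eta> = lin_matrix (germ_of (fst \<eta>)) (germ_of (snd \<eta>))"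
  unfolding linear_part_def lin_matrix_def by (simp add: hol_form_def dXY_germ_of ev0_germ_of)

lemma simple_singularity_at_iff:
  "hol_form \<omega> \<Longrightarrow> simple_singularity_at \<omega> p \<longleftrightarrow> (\<exists>A B. transf (form_germs \<omega>) p A B \<and> simple_pair A B)"
proof
  assume h: "hol_form \<omega>"
  { assume "simple_singularity_at \<omega> p"
    then obtain \<eta> where \<eta>: "transform_at \<omega> p \<eta>" "fst \<eta> 0 = 0" "snd \<eta> 0 = 0" "\<not> nilpotent_matrix (linear_part \<eta>)"
      "\<forall>l m. (\<forall>t. det (mat t - linear_part \<eta>) = (t - l) * (t - m)) \<longrightarrow> \<not> (\<exists>r::rat. r > 0 \<and> l = of_rat r * m)"
      unfolding simple_singularity_at_def by (elim exE conjE)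
    have t: "hol_form \<eta>" "transf (form_germs \<omega>) p (germ_of (fst \<eta>)) (germ_of (snd \<eta>))" using \<eta>(1) h by (simp_all add: transform_at_iff)
    have "simple_pair (germ_of (fst \<eta>)) (germ_of (snd \<eta>))" unfolding simple_pair_def linear_part_germ_of[OF t(1), symmetric]
      using \<eta>(2-5) t(1) by (simp add: ev0_germ_of hol_form_def)
    then show "\<exists>A B. transf (form_germs \<omega>) p A B \<and> simple_pair A B" using t by blast }
  { assume "\<exists>A B. transf (form_germs \<omega>) p A B \<and> simple_pair A B"
    then obtain A B where AB: "transf (form_germs \<omega>) p A B" "simple_pair A B" by blast
    from transform_exI[OF h AB(1)] obtain \<eta> where \<eta>: "transform_at \<omega> p \<eta>" "germ_of (fst \<eta>) = A" "germ_of (snd \<eta>) = B" by blast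
    then have t: "hol_form \<eta>" using h by (simp add: transform_at_iff)
    then have "fst \<eta> 0 = ev0 A" "snd \<eta> 0 = ev0 B" "linear_part \<eta> = lin_matrix A B"
      using \<eta> ev0_germ_of[of "fst \<eta>"] ev0_germ_of[of "snd \<eta>"] linear_part_germ_of[OF t] by (auto simp: hol_form_def)
    then show "simple_singularity_at \<omega> p" unfolding simple_singularity_at_def
      using \<eta>(1) AB(2)[unfolded simple_pair_def] by (intro exI[of _ \<eta>]) simp }
qed

section \<open>Invariance and transversality along a component\<close>

lemma rx_eq_0D:
  assumes "holomorphic_germ f" "rx (germ_of f) = 0" shows "\<forall>\<^sub>F z in nhds 0. fst z = 0 \<longrightarrow> f z = 0"
proof -
  have "Y = germ_of (\<lambda>z. snd z)" by (simp add: Y_def)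
  then have "rx (germ_of f) = germ_of (\<lambda>z. f (0, snd z))"
    unfolding rx_def using subst_germ_germ_of[OF assms(1), of "\<lambda>_. 0" "\<lambda>z. snd z"] by (simp add: germ_of_0)
  then have "germ_of (\<lambda>z. f (0, snd z)) = germ_of (\<lambda>_. 0)" using assms(2) by (simp add: germ_of_0)
  moreover have "holomorphic_germ (\<lambda>z. f (0, snd z))" using holomorphic_germ_compose[OF assms(1), of "\<lambda>_. 0" snd] by simp
  ultimately have "\<forall>\<^sub>F z in nhds (0::C2). f (0, snd z) = 0" using germ_of_eq_iff by (simp add: germ_eq_def)
  then show ?thesis by (rule eventually_mono) auto
qed

lemma ry_eq_0D:
  assumes "holomorphic_germ f" "ry (germ_of f) = 0" shows "\<forall>\<^sub>F z in nhds 0. snd z = 0 \<longrightarrow> f z = 0"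
proof -
  have "X = germ_of (\<lambda>z. fst z)" by (simp add: X_def)
  then have "ry (germ_of f) = germ_of (\<lambda>z. f (fst z, 0))"
    unfolding ry_def using subst_germ_germ_of[OF assms(1), of "\<lambda>z. fst z" "\<lambda>_. 0"] by (simp add: germ_of_0)
  then have "germ_of (\<lambda>z. f (fst z, 0)) = germ_of (\<lambda>_. 0)" using assms(2) by (simp add: germ_of_0)
  moreover have "holomorphic_germ (\<lambda>z. f (fst z, 0))" using holomorphic_germ_compose[OF assms(1), of fst "\<lambda>_. 0"] by simp
  ultimately have "\<forall>\<^sub>F z in nhds (0::C2). f (fst z, 0) = 0" using germ_of_eq_iff by (simp add: germ_eq_def)
  then show ?thesis by (rule eventually_mono) auto
qed

lemma invariant_atI:
  assumes "hol_form \<omega>" "transf (form_germs \<omega>) p A B"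
    and "(fst (labels p) = Some q \<and> rx B = 0) \<or> (snd (labels p) = Some q \<and> ry A = 0)"
  shows "invariant_at \<omega> q p"
proof -
  from transform_exI[OF assms(1,2)] obtain \<eta> where \<eta>: "transform_at \<omega> p \<eta>" "germ_of (fst \<eta>) = A" "germ_of (snd \<eta>) = B" by blast
  then have t: "holomorphic_germ (fst \<eta>)" "holomorphic_germ (snd \<eta>)" using assms(1) by (simp_all add: transform_at_iff hol_form_def)
  show ?thesis unfolding invariant_at_def
  proof (intro exI[of _ \<eta>] conjI \<eta>(1))
    from assms(3) show "\<forall>\<^sub>F z in nhds 0. z \<in> component_at q p \<longrightarrow> (\<forall>w\<in>component_at q p. form_eval \<eta> z w = 0)"
    proof
      assume h: "fst (labels p) = Some q \<and> rx B = 0"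
      then have "\<forall>\<^sub>F z in nhds 0. fst z = 0 \<longrightarrow> snd \<eta> z = 0" using rx_eq_0D[OF t(2)] \<eta>(3) by simp
      then show ?thesis by (rule eventually_mono) (use h in \<open>auto simp: component_at_x form_eval_def\<close>)
    next
      assume h: "snd (labels p) = Some q \<and> ry A = 0"
      then have "\<forall>\<^sub>F z in nhds 0. snd z = 0 \<longrightarrow> fst \<eta> z = 0" using ry_eq_0D[OF t(1)] \<eta>(2) by simp
      then show ?thesis by (rule eventually_mono) (use h in \<open>auto simp: component_at_y form_eval_def\<close>)
    qed
  qed
qed

text \<open>For every choice of the transform, its value at the point does not annihilate the vector
  along the component; this one evaluation rules out all three properties.\<close>

lemma transverse_at:
  assumes "hol_form \<omega>"
    and "(fst (labels p) = Some q \<and> (\<forall>A B. transf (form_germs \<omega>) p A B \<longrightarrow> ev0 B \<noteq> 0)) \<or> (snd (labels p) = Some q \<and> (\<forall>A B. transf (form_germs \<omega>) p A B \<longrightarrow> ev0 A \<noteq> 0))"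
  shows "\<not> invariant_at \<omega> q p" "\<not> tangent_at \<omega> q p" "\<not> singular_at \<omega> p"
proof -
  have t: "transf (form_germs \<omega>) p (germ_of (fst \<eta>)) (germ_of (snd \<eta>)) \<and> fst \<eta> 0 = ev0 (germ_of (fst \<eta>)) \<and> snd \<eta> 0 = ev0 (germ_of (snd \<eta>))" if "transform_at \<omega> p \<eta>" for \<eta>
    using that assms(1) by (simp add: transform_at_iff hol_form_def ev0_germ_of)
  have k: "\<exists>w\<in>component_at q p. form_eval \<eta> 0 w \<noteq> 0" if "transform_at \<omega> p \<eta>" for \<eta>
    using assms(2)
  proof
    assume h: "fst (labels p) = Some q \<and> (\<forall>A B. transf (form_germs \<omega>) p A B \<longrightarrow> ev0 B \<noteq> 0)"
    then have "snd \<eta> 0 \<noteq> 0" using t[OF that] by metis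
    then show ?thesis using h by (intro bexI[of _ "(0, 1)"]) (auto simp: component_at_x form_eval_def)
  next
    assume h: "snd (labels p) = Some q \<and> (\<forall>A B. transf (form_germs \<omega>) p A B \<longrightarrow> ev0 A \<noteq> 0)"
    then have "fst \<eta> 0 \<noteq> 0" using t[OF that] by metis
    then show ?thesis using h by (intro bexI[of _ "(1, 0)"]) (auto simp: component_at_y form_eval_def)
  qed
  have "0 \<in> component_at q p" using assms(2) by (auto simp: component_at_x component_at_y zero_prod_def)
  then show "\<not> invariant_at \<omega> q p" unfolding invariant_at_def using k eventually_nhds_x_imp_x by blast
  show "\<not> tangent_at \<omega> q p" unfolding tangent_at_def using k by blast
  show "\<not> singular_at \<omega> p" unfolding singular_at_iff[OF assms(1)] using assms(2) by blast
qed

section \<open>The minimal reduction\<close>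

text \<open>A tangent always exists: a nonconstant leading polynomial has a root by the fundamental
  theorem of algebra, and for a constant one the tangent is vertical.\<close>

lemma nonunit_child:
  assumes f: "f \<noteq> 0" "ev0 f = 0" shows "\<exists>d. ev0 (strict d f) = 0"
proof (cases "degree (lead_poly f) = 0")
  case True
  then have "oy (strict Vertical f) > 0" using oy_strict_Vertical(2)[OF f(1)] ord0_pos[OF f] by simp
  then show ?thesis using oy_unit by (metis less_irrefl)
next
  case False
  then obtain c where "poly (lead_poly f) c = 0" using fundamental_theorem_of_algebra constant_degree by metis
  then show ?thesis using ev0_strict_Slope[OF f(1)] by metis
qed

text \<open>Among the centres through which the strict transform passes, one of maximal length has a
  next point that is no longer blown up.\<close>

lemma nonunit_leaf:
  assumes f: "f \<noteq> 0" "ev0 f = 0" and T: "is_blowup_seq T" "[] \<in> T"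
  shows "\<exists>p\<in>fibre T. ev0 (strict_at p f) = 0"
proof -
  let ?S = "{p \<in> T. ev0 (strict_at p f) = 0}"
  have fin: "finite ?S" using T(1) by (simp add: is_blowup_seq_iff)
  have "[] \<in> ?S" using f T by simp
  then have "Max (length ` ?S) \<in> length ` ?S" using fin by (intro Max_in) auto
  then obtain p where p: "p \<in> ?S" "length p = Max (length ` ?S)" by auto
  obtain d where d: "ev0 (strict d (strict_at p f)) = 0" using nonunit_child[OF strict_at_nonzero[OF f(1)]] p(1) by blast
  then have e: "ev0 (strict_at (p @ [d]) f) = 0" by (simp add: strict_at_append)
  have "p @ [d] \<notin> T"
  proof
    assume "p @ [d] \<in> T"
    then have "p @ [d] \<in> ?S" using e by blast
    then have "length (p @ [d]) \<le> Max (length ` ?S)" using fin by (intro Max_ge) blast+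
    then show False using p(2) by simp
  qed
  then have "p @ [d] \<in> fibre T" using p(1) T(2) by (auto simp: fibre_def)
  then show ?thesis using e by blast
qed

lemma pull_at_strict_at: "f \<noteq> 0 \<Longrightarrow> \<exists>m. exc_mono (exc_axes p) m \<and> pull_at p f = m * strict_at p f"
proof (induction p rule: rev_induct)
  case Nil
  show ?case by (intro exI[of _ 1]) (simp add: exc_mono_unit)
next
  case (snoc d p)
  then obtain m where m: "exc_mono (exc_axes p) m" "pull_at p f = m * strict_at p f" by blast
  let ?s = "strict_at p f"
  have "pull_at (p @ [d]) f = pull d m * E d ^ ord0 ?s * strict_at (p @ [d]) f"
    using m(2) pull_strict[OF strict_at_nonzero[OF snoc.prems, of p], of d] by (simp add: pull_at_append strict_at_append mult.assoc)
  moreover have "exc_mono (exc_axes (p @ [d])) (pull d m * E d ^ ord0 ?s)"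
    unfolding flags_snoc by (rule exc_mono_mult[OF exc_mono_pull[OF m(1)] exc_mono_E])
  ultimately show ?case by blast
qed

lemma strict_at_pure: "f \<noteq> 0 \<Longrightarrow> (fst (exc_axes p) \<longrightarrow> rx (strict_at p f) \<noteq> 0) \<and> (snd (exc_axes p) \<longrightarrow> ry (strict_at p f) \<noteq> 0)"
proof (induction p rule: rev_induct)
  case (snoc d p)
  let ?s = "strict_at p f"
  have s: "?s \<noteq> 0" by (rule strict_at_nonzero[OF snoc.prems])
  show ?case
  proof (cases d)
    case (Slope c)
    have "rx (strict d ?s) \<noteq> 0" using rE_strict[OF s, of d] Slope by simp
    moreover have "ry (strict d ?s) \<noteq> 0" if "snd (exc_axes p)" "c = 0"
      using ry_strict_Slope0 snoc that Slope by simp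
    ultimately show ?thesis by (cases "exc_axes p") (auto simp: Slope strict_at_append)
  next
    case Vertical
    have "ry (strict d ?s) \<noteq> 0" using rE_strict[OF s, of d] Vertical by simp
    moreover have "rx (strict d ?s) \<noteq> 0" if "fst (exc_axes p)"
      using rx_strict_Vertical snoc that Vertical by simp
    ultimately show ?thesis by (cases "exc_axes p") (auto simp: Vertical strict_at_append)
  qed
qed simp

text \<open>The coordinates are prime, so a divisor that is not identically zero on the exceptional
  axes can be stripped of them and divides the unit factor.\<close>

lemma dvd_exc_mono_unit:
  assumes "s dvd m" "exc_mono l m" "fst l \<longrightarrow> rx s \<noteq> 0" "snd l \<longrightarrow> ry s \<noteq> 0" shows "ev0 s \<noteq> 0"
proof -
  obtain i j U where m: "ev0 U \<noteq> 0" "m = X ^ i * Y ^ j * U" "fst l \<or> i = 0" "snd l \<or> j = 0"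
    using assms(2) unfolding exc_mono_def by blast
  have y: "ev0 s \<noteq> 0" if "s dvd Y ^ j * U" "j = 0 \<or> ry s \<noteq> 0" for j
    using that
  proof (induction j)
    case 0
    then obtain g where "U = s * g" by (auto elim: dvdE)
    then show ?case using m(1) by auto
  next
    case (Suc j)
    then obtain g where g: "Y * (Y ^ j * U) = s * g" by (auto elim: dvdE simp: mult.assoc)
    have "ry s * ry g = 0" using arg_cong[OF g, of ry] by simp
    then have "Y dvd g" using Suc.prems by (simp add: Y_dvd_iff)
    then obtain g' where "g = Y * g'" by (elim dvdE)
    then have "Y * (Y ^ j * U) = Y * (s * g')" using g by (simp only: mult_ac)
    then have "Y ^ j * U = s * g'" using mult_left_cancel[OF Y_nonzero] by blast
    then have "s dvd Y ^ j * U" by simp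
    then show ?case using Suc by simp
  qed
  have x: "ev0 s \<noteq> 0" if "s dvd X ^ i * (Y ^ j * U)" "i = 0 \<or> rx s \<noteq> 0" for i
    using that
  proof (induction i)
    case 0
    then show ?case using y[of j] m(4) assms(4) by auto
  next
    case (Suc i)
    then obtain g where g: "X * (X ^ i * (Y ^ j * U)) = s * g" by (auto elim: dvdE simp: mult.assoc)
    have "rx s * rx g = 0" using arg_cong[OF g, of rx] by simp
    then have "X dvd g" using Suc.prems by (simp add: X_dvd_iff)
    then obtain g' where "g = X * g'" by (elim dvdE)
    then have "X * (X ^ i * (Y ^ j * U)) = X * (s * g')" using g by (simp only: mult_ac)
    then have "X ^ i * (Y ^ j * U) = s * g'" using mult_left_cancel[OF X_nonzero] by blast
    then have "s dvd X ^ i * (Y ^ j * U)" by simp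
    then show ?case using Suc by simp
  qed
  show ?thesis using x[of i] assms(1,3) m(2,3) by (auto simp: mult.assoc)
qed

text \<open>Moving along a component in its own direction multiplies the restricted coefficients
  only by powers of the coordinate, so invariance can be tested at a leaf further up.\<close>

lemma rx_chart_form_Vertical:
  "rx (fst (chart_form (replicate n Vertical) (A, B))) = Y ^ n * rx A \<and> rx (snd (chart_form (replicate n Vertical) (A, B))) = rx B"
  by (induction n arbitrary: A B) (simp_all add: mult_ac)

lemma ry_chart_form_Slope:
  "ry (fst (chart_form (replicate n (Slope 0)) (A, B))) = ry A \<and> ry (snd (chart_form (replicate n (Slope 0)) (A, B))) = X ^ n * ry B"
  by (induction n arbitrary: A B) (simp_all add: C_simps mult_ac)

lemma replicate_in_fibre:
  assumes "is_blowup_seq T" "p \<in> T" shows "\<exists>n. p @ replicate n d \<in> fibre T"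
proof -
  have "inj (\<lambda>n. p @ replicate n d)" by (rule injI) (metis length_replicate same_append_eq)
  then have "\<not> range (\<lambda>n. p @ replicate n d) \<subseteq> T"
    using assms(1) finite_subset infinite_UNIV_nat finite_imageD unfolding is_blowup_seq_iff by blast
  then obtain m where m: "p @ replicate m d \<notin> T" by blast
  define n where "n = (LEAST n. p @ replicate n d \<notin> T)"
  have n: "p @ replicate n d \<notin> T" unfolding n_def by (rule LeastI[of _ m]) (rule m)
  then obtain k where k: "n = Suc k" using assms(2) by (cases n) auto
  have "p @ replicate k d \<in> T" using not_less_Least[of k "\<lambda>n. p @ replicate n d \<notin> T"] k unfolding n_def by auto
  moreover have "p @ replicate n d = (p @ replicate k d) @ [d]" unfolding k by (simp add: replicate_append_same)
  ultimately have "p @ replicate n d \<in> fibre T" using n fibre_snoc_iff[of T "p @ replicate k d" d] by auto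
  then show ?thesis by blast
qed

text \<open>The points of \<open>T\<close> carry the three zeros, and the leaves of the larger tree
  \<open>T2\<close> are monomial; the minimal reduction will lie between the two.\<close>

locale resolved =
  fixes N D :: germ and T T2 :: blowup_seq and Q :: "point set" and g :: germ and \<omega> :: oneform
  assumes N0: "N \<noteq> 0" and D0: "D \<noteq> 0" and T: "is_blowup_seq T" "[] \<in> T" "Q \<subseteq> T" and T2: "is_blowup_seq T2" "T \<subseteq> T2"
    and three_zeros: "\<And>t. t \<in> T \<Longrightarrow> three_zeros T Q t (pull_at t N) (pull_at t D)"
    and mono_leaf: "\<And>p. p \<in> fibre T2 \<Longrightarrow> mono_leaf Q p (pull_at p N) (pull_at p D)"
    and hol: "hol_form \<omega>" and level_pair: "level_pair N D = scale g (form_germs \<omega>)" and g: "g \<noteq> 0" and w: "form_germs \<omega> \<noteq> (0, 0)"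
begin

lemma Nil_T2: "[] \<in> T2" using T T2 by blast

text \<open>The Moebius transformation and the exceptional monomial only rescale the level form, so
  every saturated transform agrees with the pair of \<open>leaf_form\<close> up to a unit.\<close>

lemma leaf:
  assumes p: "p \<in> fibre T2"
  shows "\<exists>\<eta>1 \<eta>2. leaf_pair Q p \<eta>1 \<eta>2 \<and> transf (form_germs \<omega>) p \<eta>1 \<eta>2 \<and> (\<forall>A B. transf (form_germs \<omega>) p A B \<longrightarrow> (\<exists>u. ev0 u \<noteq> 0 \<and> A = u * \<eta>1 \<and> B = u * \<eta>2))"
proof -
  have p0: "p \<noteq> []" using fibre_notin[OF p] Nil_T2 by blast
  obtain \<alpha> \<beta> \<gamma> \<delta> H where det: "\<alpha> * \<delta> - \<beta> * \<gamma> \<noteq> 0" and H: "mono_form Q p H" and em: "exc_mono (exc_axes p) (C \<gamma> * pull_at p N + C \<delta> * pull_at p D)"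
    and e: "C \<alpha> * pull_at p N + C \<beta> * pull_at p D = (C \<gamma> * pull_at p N + C \<delta> * pull_at p D) * H"
    using mono_leaf[OF p] unfolding mono_leaf_def by blast
  let ?D = "C \<gamma> * pull_at p N + C \<delta> * pull_at p D"
  obtain s \<eta>1 \<eta>2 where s: "s \<noteq> 0" "dX H = s * \<eta>1" "dY H = s * \<eta>2" "leaf_pair Q p \<eta>1 \<eta>2" using leaf_form[OF H p0] by blast
  have "scale (C (\<alpha> * \<delta> - \<beta> * \<gamma>)) (level_pair (pull_at p N) (pull_at p D)) = level_pair (?D * H) ?D" unfolding level_pair_linear[symmetric] e ..
  also have "\<dots> = scale (?D * ?D * s) (\<eta>1, \<eta>2)" unfolding level_pair_mult s(2,3) scale_def by (simp add: mult.assoc)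
  finally have scale: "scale (C (\<alpha> * \<delta> - \<beta> * \<gamma>)) (level_pair (pull_at p N) (pull_at p D)) = scale (?D * ?D * s) (\<eta>1, \<eta>2)" .
  have s0: "?D * ?D * s \<noteq> 0" using s(1) exc_mono_nonzero[OF em] by simp
  have u: "\<exists>u. ev0 u \<noteq> 0 \<and> A = u * \<eta>1 \<and> B = u * \<eta>2" if t: "transf (form_germs \<omega>) p A B" for A B
  proof -
    have "A * \<eta>2 = B * \<eta>1" by (rule transf_par[OF level_pair g s0 scale _ t]) (use det in simp)
    moreover have "cop A B" using t unfolding transf_def by blast
    ultimately show ?thesis using s(4) unfolding leaf_pair_def by blast
  qed
  obtain A B where t: "transf (form_germs \<omega>) p A B" using transf_ex[OF w] by blast
  obtain u where u': "ev0 u \<noteq> 0" "A = u * \<eta>1" "B = u * \<eta>2" using u[OF t] by blast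
  obtain k where k: "cop A B" "k \<noteq> 0" "chart_form p (form_germs \<omega>) = scale k (A, B)" using t unfolding transf_def by blast
  have "chart_form p (form_germs \<omega>) = scale (k * u) (\<eta>1, \<eta>2)" unfolding k(3) u'(2,3) scale_def by (simp add: mult.assoc)
  moreover have "k * u \<noteq> 0" using k(2) u'(1) by auto
  moreover have "cop \<eta>1 \<eta>2" using k(1) unfolding u'(2,3) cop_def by simp
  ultimately have "transf (form_germs \<omega>) p \<eta>1 \<eta>2" unfolding transf_def by blast
  then show ?thesis using s(4) u by blast
qed

text \<open>What must not happen at a point of the fibre of a reduction. The members of
  \<open>Q\<close> stand in for the dicritical components, which keeps the property independent of a
  tree.\<close>

definition bad :: "point \<Rightarrow> bool" where
  "bad p \<longleftrightarrow> (singular_at \<omega> p \<and> \<not> simple_singularity_at \<omega> p) \<or>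
     (\<exists>q\<in>Q. on_component q p \<and> (singular_at \<omega> p \<or> tangent_at \<omega> q p)) \<or>
     (\<exists>q\<in>Q. \<exists>q'\<in>Q. q \<noteq> q' \<and> on_component q p \<and> on_component q' p)"

lemma leaf_transverse:
  assumes p: "p \<in> fibre T2" and q: "q \<in> Q" "on_component q p"
  shows "\<not> invariant_at \<omega> q p" "\<not> tangent_at \<omega> q p" "\<not> singular_at \<omega> p"
proof -
  obtain \<eta>1 \<eta>2 where \<eta>: "leaf_pair Q p \<eta>1 \<eta>2" "\<And>A B. transf (form_germs \<omega>) p A B \<Longrightarrow> \<exists>u. ev0 u \<noteq> 0 \<and> A = u * \<eta>1 \<and> B = u * \<eta>2"
    using leaf[OF p] by blast
  have "(fst (labels p) = Some q \<and> ev0 \<eta>2 \<noteq> 0) \<or> (snd (labels p) = Some q \<and> ev0 \<eta>1 \<noteq> 0)"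
    using \<eta>(1) q unfolding leaf_pair_def on_component_iff by auto
  moreover have "ev0 B \<noteq> 0" if "ev0 \<eta>2 \<noteq> 0" "transf (form_germs \<omega>) p A B" for A B using \<eta>(2)[OF that(2)] that(1) by auto
  moreover have "ev0 A \<noteq> 0" if "ev0 \<eta>1 \<noteq> 0" "transf (form_germs \<omega>) p A B" for A B using \<eta>(2)[OF that(2)] that(1) by auto
  ultimately have h: "(fst (labels p) = Some q \<and> (\<forall>A B. transf (form_germs \<omega>) p A B \<longrightarrow> ev0 B \<noteq> 0)) \<or> (snd (labels p) = Some q \<and> (\<forall>A B. transf (form_germs \<omega>) p A B \<longrightarrow> ev0 A \<noteq> 0))"
    by blast
  show "\<not> invariant_at \<omega> q p" "\<not> tangent_at \<omega> q p" "\<not> singular_at \<omega> p" by (rule transverse_at[OF hol h])+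
qed

lemma leaf_not_bad: assumes p: "p \<in> fibre T2" shows "\<not> bad p"
proof -
  obtain \<eta>1 \<eta>2 where \<eta>: "leaf_pair Q p \<eta>1 \<eta>2" "transf (form_germs \<omega>) p \<eta>1 \<eta>2" "\<And>A B. transf (form_germs \<omega>) p A B \<Longrightarrow> \<exists>u. ev0 u \<noteq> 0 \<and> A = u * \<eta>1 \<and> B = u * \<eta>2"
    using leaf[OF p] by blast
  have "simple_singularity_at \<omega> p" if s: "singular_at \<omega> p"
  proof -
    obtain A B where AB: "transf (form_germs \<omega>) p A B" "ev0 A = 0" "ev0 B = 0" using s unfolding singular_at_iff[OF hol] by blast
    obtain u where "ev0 u \<noteq> 0" "A = u * \<eta>1" "B = u * \<eta>2" using \<eta>(3)[OF AB(1)] by blast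
    then have "ev0 \<eta>1 = 0" "ev0 \<eta>2 = 0" using AB by auto
    then have "simple_pair \<eta>1 \<eta>2" using \<eta>(1) unfolding leaf_pair_def by blast
    then show ?thesis unfolding simple_singularity_at_iff[OF hol] using \<eta>(2) by blast
  qed
  moreover have "\<not> (\<exists>q\<in>Q. \<exists>q'\<in>Q. q \<noteq> q' \<and> on_component q p \<and> on_component q' p)"
    using \<eta>(1) unfolding leaf_pair_def on_component_iff by (metis option.inject)
  moreover have "\<not> (\<exists>q\<in>Q. on_component q p \<and> (singular_at \<omega> p \<or> tangent_at \<omega> q p))"
    using leaf_transverse(2)[OF p] leaf_transverse(3)[OF p] by blast
  ultimately show ?thesis unfolding bad_def by simp
qed

text \<open>Centres in \<open>T2\<close> are included since the minimal reduction may stop before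
  the leaves of \<open>T2\<close>. The component is followed to such a leaf, and invariance there is
  transferred back.\<close>

lemma invariant_exceptional:
  assumes p: "p \<in> T2 \<or> p \<in> fibre T2" and q: "q \<notin> Q" "on_component q p"
  shows "invariant_at \<omega> q p"
proof -
  have up: "\<exists>n. p @ replicate n d \<in> fibre T2" for d
    using p
  proof
    assume "p \<in> T2"
    then show ?thesis by (rule replicate_in_fibre[OF T2(1)])
  next
    assume "p \<in> fibre T2"
    then show ?thesis by (intro exI[of _ 0]) simp
  qed
  obtain A B where t: "transf (form_germs \<omega>) p A B" using transf_ex[OF w] by blast
  obtain k where k: "k \<noteq> 0" "chart_form p (form_germs \<omega>) = scale k (A, B)" using t unfolding transf_def by blast
  have par: "fst (chart_form r (A, B)) * \<eta>2 = snd (chart_form r (A, B)) * \<eta>1" if h: "transf (form_germs \<omega>) (p @ r) \<eta>1 \<eta>2" for r \<eta>1 \<eta>2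
  proof -
    obtain k' where k': "k' \<noteq> 0" "chart_form (p @ r) (form_germs \<omega>) = scale k' (\<eta>1, \<eta>2)" using h unfolding transf_def by blast
    have "scale (pull_at r k) (chart_form r (A, B)) = scale k' (\<eta>1, \<eta>2)" using k'(2) unfolding chart_form_append k(2) chart_form_scale .
    then have 1: "pull_at r k * fst (chart_form r (A, B)) = k' * \<eta>1" and 2: "pull_at r k * snd (chart_form r (A, B)) = k' * \<eta>2" by (simp_all add: scale_def)
    have "(pull_at r k * k') * (fst (chart_form r (A, B)) * \<eta>2) = (pull_at r k * fst (chart_form r (A, B))) * (k' * \<eta>2)" by (simp only: mult_ac)
    also have "\<dots> = (pull_at r k * k') * (snd (chart_form r (A, B)) * \<eta>1)" unfolding 1 2[symmetric] by (simp only: mult_ac)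
    finally show ?thesis using mult_left_cancel[of "pull_at r k * k'"] k(1) k'(1) by simp
  qed
  from q(2) have "(fst (labels p) = Some q \<and> rx B = 0) \<or> (snd (labels p) = Some q \<and> ry A = 0)"
    unfolding on_component_iff
  proof
    assume l: "fst (labels p) = Some q"
    obtain n where n: "p @ replicate n Vertical \<in> fibre T2" using up by blast
    obtain \<eta>1 \<eta>2 where \<eta>: "leaf_pair Q (p @ replicate n Vertical) \<eta>1 \<eta>2" "transf (form_germs \<omega>) (p @ replicate n Vertical) \<eta>1 \<eta>2" using leaf[OF n] by blast
    have "fst (labels (p @ replicate n Vertical)) = Some q"
      using l unfolding fst_labels_iff by (metis append.assoc append_Cons replicate_add)
    then have "rx \<eta>2 = 0 \<and> rx \<eta>1 \<noteq> 0" using \<eta>(1) q(1) unfolding leaf_pair_def by metis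
    then have "rx B = 0" using arg_cong[OF par[OF \<eta>(2)], of rx] rx_chart_form_Vertical[of n A B] by simp
    then show ?thesis using l by blast
  next
    assume l: "snd (labels p) = Some q"
    obtain n where n: "p @ replicate n (Slope 0) \<in> fibre T2" using up by blast
    obtain \<eta>1 \<eta>2 where \<eta>: "leaf_pair Q (p @ replicate n (Slope 0)) \<eta>1 \<eta>2" "transf (form_germs \<omega>) (p @ replicate n (Slope 0)) \<eta>1 \<eta>2" using leaf[OF n] by blast
    have "snd (labels (p @ replicate n (Slope 0))) = Some q"
      using l unfolding snd_labels_iff by (metis append.assoc append_Cons replicate_add)
    then have "ry \<eta>1 = 0 \<and> ry \<eta>2 \<noteq> 0" using \<eta>(1) q(1) unfolding leaf_pair_def by metis
    then have "ry A = 0" using arg_cong[OF par[OF \<eta>(2)], of ry] ry_chart_form_Slope[of n A B] by simp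
    then show ?thesis using l by blast
  qed
  then show ?thesis by (rule invariant_atI[OF hol t])
qed

text \<open>At a point that is not bad the foliation is regular or simple, which the three zeros on
  its line exclude.\<close>

lemma bad_T: assumes t: "t \<in> T" shows "bad t"
proof (rule ccontr)
  assume "\<not> bad t"
  then have n: "singular_at \<omega> t \<longrightarrow> simple_singularity_at \<omega> t" unfolding bad_def by blast
  have "\<exists>A B. transf (form_germs \<omega>) t A B \<and> (ev0 A \<noteq> 0 \<or> ev0 B \<noteq> 0 \<or> simple_pair A B)"
  proof (cases "singular_at \<omega> t")
    case True
    then show ?thesis using n unfolding simple_singularity_at_iff[OF hol] by blast
  next
    case False
    then show ?thesis using transf_ex[OF w, of t] unfolding singular_at_iff[OF hol] by blast
  qed
  then obtain A B where AB: "transf (form_germs \<omega>) t A B" "ev0 A \<noteq> 0 \<or> ev0 B \<noteq> 0 \<or> simple_pair A B" by blast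
  obtain k where k: "k \<noteq> 0" "chart_form t (form_germs \<omega>) = scale k (A, B)" using AB(1) unfolding transf_def by blast
  have "level_pair (pull_at t N) (pull_at t D) = scale (pull_at t g) (scale k (A, B))" unfolding chart_form_level_pair[symmetric] level_pair chart_form_scale k(2) ..
  then have "level_pair (pull_at t N) (pull_at t D) = scale (pull_at t g * k) (A, B)" by (simp add: scale_def mult.assoc)
  moreover have "pull_at t g * k \<noteq> 0" using g k(1) by simp
  moreover have "pull_at t D \<noteq> 0" using D0 by simp
  ultimately show False using three_zeros_not_simple[OF three_zeros[OF t]] AB(2) by blast
qed

definition Tmin :: blowup_seq where
  "Tmin = {p \<in> T2. \<forall>r s. p = r @ s \<longrightarrow> bad r}"

lemma Tmin: "is_blowup_seq Tmin" "T \<subseteq> Tmin" "Tmin \<subseteq> T2"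
proof -
  show "Tmin \<subseteq> T2" unfolding Tmin_def by blast
  then have "finite Tmin" using T2(1) finite_subset unfolding is_blowup_seq_iff by blast
  moreover have "p \<in> Tmin" if "p @ [a] \<in> Tmin" for p a
    using that T2(1) unfolding Tmin_def is_blowup_seq_iff by auto
  ultimately show "is_blowup_seq Tmin" unfolding is_blowup_seq_iff by blast
  show "T \<subseteq> Tmin"
  proof
    fix t assume t: "t \<in> T"
    then show "t \<in> Tmin" unfolding Tmin_def using T2(2) bad_T blowup_seq_prefix[OF T(1)] by blast
  qed
qed

lemma fibre_Tmin: assumes "p \<in> fibre Tmin" shows "\<not> bad p" "p \<in> T2 \<or> p \<in> fibre T2"
proof -
  have "[] \<in> Tmin" using Tmin(2) T(2) by blast
  then obtain t d where t: "p = t @ [d]" "t \<in> Tmin" "p \<notin> Tmin" using fibre_cases[OF assms] by blast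
  have tT2: "t \<in> T2" using t(2) Tmin(3) by blast
  show *: "p \<in> T2 \<or> p \<in> fibre T2" using tT2 t(1) by (auto simp: fibre_def)
  show "\<not> bad p"
  proof (cases "p \<in> T2")
    case True
    show ?thesis
    proof
      assume b: "bad p"
      have "bad r" if "p = r @ s" for r s
      proof (cases s rule: rev_cases)
        case Nil
        then show ?thesis using b that by simp
      next
        case (snoc s' a)
        then have "t = r @ s'" using that t(1) by simp
        then show ?thesis using t(2) unfolding Tmin_def by blast
      qed
      then show False using True t(3) unfolding Tmin_def by blast
    qed
  next
    case False
    then show ?thesis using * leaf_not_bad by blast
  qed
qed

text \<open>A slope used by neither tree gives a point in both fibres. Invariance at a point does
  not depend on the tree, so its failure at the leaf of \<open>T2\<close> carries over.\<close>

lemma dicritical_Q: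
  assumes "is_blowup_seq T'" "q \<in> T'" "q \<in> Q" shows "dicritical \<omega> T' q"
proof -
  have "finite (T' \<union> T2)" using assms(1) T2(1) by (simp add: is_blowup_seq_iff)
  then have "finite ((\<lambda>c. q @ [Slope c]) -` (T' \<union> T2))" by (rule finite_vimageI) (simp add: inj_on_def)
  then obtain c where c: "q @ [Slope c] \<notin> T' \<union> T2" using ex_new_if_finite[OF infinite_UNIV_char_0] by (metis vimageI2)
  have q2: "q \<in> T2" using assms(3) T T2 by blast
  have f: "q @ [Slope c] \<in> fibre T'" "q @ [Slope c] \<in> fibre T2" using c q2 assms(2) by (auto simp: fibre_def)
  have on: "on_component q (q @ [Slope c])" by (simp add: on_component_iff)
  show ?thesis unfolding dicritical_def using f on leaf_transverse(1)[OF f(2) assms(3) on] assms(2) by blast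
qed

lemma dicritical_Tmin: "{q. dicritical \<omega> Tmin q} = Q"
proof (intro equalityI subsetI)
  fix q assume "q \<in> {q. dicritical \<omega> Tmin q}"
  then obtain p where p: "p \<in> fibre Tmin" "on_component q p" "\<not> invariant_at \<omega> q p" unfolding dicritical_def by blast
  then show "q \<in> Q" using invariant_exceptional[OF fibre_Tmin(2)[OF p(1)]] by blast
next
  fix q assume "q \<in> Q"
  then show "q \<in> {q. dicritical \<omega> Tmin q}" using dicritical_Q[OF Tmin(1)] T(3) Tmin(2) by blast
qed

lemma finite_singular: "finite {p \<in> fibre Tmin. singular_at \<omega> p}"
proof -
  define G where "G t = {c. \<not> (\<exists>g A B. g \<noteq> 0 \<and> blow_form (Slope c) (chart_form t (form_germs \<omega>)) = scale g (A, B) \<and> (ev0 A \<noteq> 0 \<or> ev0 B \<noteq> 0))}" for t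
  have fG: "finite (G t)" for t unfolding G_def by (rule generic_slope) (use w chart_form_eq_0 in blast)
  have nS: "\<not> singular_at \<omega> (t @ [Slope c])" if c: "c \<notin> G t" for t c
  proof
    assume "singular_at \<omega> (t @ [Slope c])"
    then obtain A B where AB: "transf (form_germs \<omega>) (t @ [Slope c]) A B" "ev0 A = 0" "ev0 B = 0" unfolding singular_at_iff[OF hol] by blast
    obtain k where k: "cop A B" "k \<noteq> 0" "chart_form (t @ [Slope c]) (form_germs \<omega>) = scale k (A, B)" using AB(1) unfolding transf_def by blast
    obtain g A' B' where g': "g \<noteq> 0" "blow_form (Slope c) (chart_form t (form_germs \<omega>)) = scale g (A', B')" "ev0 A' \<noteq> 0 \<or> ev0 B' \<noteq> 0"
      using c unfolding G_def by blast
    have "scale k (A, B) = scale g (A', B')" using k(3) g'(2) by (simp add: chart_form_append)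
    then have 1: "k * A = g * A'" and 2: "k * B = g * B'" by (simp_all add: scale_def)
    have "(k * g) * (A * B') = (k * A) * (g * B')" by (simp only: mult_ac)
    also have "\<dots> = (k * g) * (B * A')" unfolding 1 2[symmetric] by (simp only: mult_ac)
    finally have "A * B' = B * A'" using mult_left_cancel[of "k * g"] k(2) g'(1) by simp
    from par_regular[OF k(1) this g'(3)] obtain u where "ev0 u \<noteq> 0" "A = u * A'" "B = u * B'" by blast
    then show False using AB(2,3) g'(3) by simp
  qed
  have "{p \<in> fibre Tmin. singular_at \<omega> p} \<subseteq> (\<Union>t\<in>Tmin. insert (t @ [Vertical]) ((\<lambda>c. t @ [Slope c]) ` G t))"
  proof
    fix p assume p: "p \<in> {p \<in> fibre Tmin. singular_at \<omega> p}"
    have "[] \<in> Tmin" using Tmin(2) T(2) by blast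
    then obtain t d where t: "p = t @ [d]" "t \<in> Tmin" using fibre_cases[of p Tmin] p by blast
    have "p \<in> insert (t @ [Vertical]) ((\<lambda>c. t @ [Slope c]) ` G t)"
      using nS[of _ t] p t(1) by (cases d) auto
    then show "p \<in> (\<Union>t\<in>Tmin. insert (t @ [Vertical]) ((\<lambda>c. t @ [Slope c]) ` G t))" using t(2) by blast
  qed
  moreover have "finite (\<Union>t\<in>Tmin. insert (t @ [Vertical]) ((\<lambda>c. t @ [Slope c]) ` G t))"
    using Tmin(1) fG by (simp add: is_blowup_seq_iff)
  ultimately show ?thesis by (rule finite_subset)
qed

lemma reduces_Tmin: "reduces \<omega> Tmin"
  unfolding reduces_def
proof (intro conjI allI impI ballI)
  show "is_blowup_seq Tmin" by (rule Tmin)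
  show "finite {p \<in> fibre Tmin. singular_at \<omega> p}" by (rule finite_singular)
next
  fix p assume "p \<in> fibre Tmin" "singular_at \<omega> p"
  then show "simple_singularity_at \<omega> p" using fibre_Tmin(1) unfolding bad_def by blast
next
  fix q p assume h: "dicritical \<omega> Tmin q \<and> p \<in> fibre Tmin \<and> on_component q p"
  then have "q \<in> Q" using dicritical_Tmin by blast
  then show "\<not> singular_at \<omega> p" "\<not> tangent_at \<omega> q p" using fibre_Tmin(1) h unfolding bad_def by blast+
next
  fix q q' assume h: "dicritical \<omega> Tmin q \<and> dicritical \<omega> Tmin q' \<and> q \<noteq> q'"
  then have "q \<in> Q" "q' \<in> Q" using dicritical_Tmin by blast+
  then show "\<not> components_meet Tmin q q'" unfolding components_meet_def using fibre_Tmin(1) h unfolding bad_def by blast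
qed

lemma minimal_Tmin: "minimal_reduction \<omega> Tmin"
  unfolding minimal_reduction_def
proof (intro conjI allI impI reduces_Tmin)
  fix T' assume r: "reduces \<omega> T'"
  have T': "is_blowup_seq T'"
    and r1: "\<forall>p\<in>fibre T'. singular_at \<omega> p \<longrightarrow> simple_singularity_at \<omega> p"
    and r2: "\<forall>q p. dicritical \<omega> T' q \<and> p \<in> fibre T' \<and> on_component q p \<longrightarrow> \<not> singular_at \<omega> p \<and> \<not> tangent_at \<omega> q p"
    and r3: "\<forall>q q'. dicritical \<omega> T' q \<and> dicritical \<omega> T' q' \<and> q \<noteq> q' \<longrightarrow> \<not> components_meet T' q q'"
    using r unfolding reduces_def by - (elim conjE, assumption)+
  have "Tmin \<subseteq> T'"
  proof
    fix p assume p: "p \<in> Tmin"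
    show "p \<in> T'"
    proof (rule ccontr)
      assume "p \<notin> T'"
      then obtain s u where s: "p = s @ u" "s \<in> fibre T'" using prefix_in_fibre[OF T'] by blast
      have b: "bad s" using p s(1) unfolding Tmin_def by blast
      \<comment> \<open>A component through \<open>s\<close> has its label in \<open>T'\<close>, so
        the members of \<open>Q\<close> through \<open>s\<close> are dicritical for
        \<open>T'\<close> as well, and badness of \<open>s\<close> contradicts the
        reduction.\<close>
      have dic: "dicritical \<omega> T' q" if "q \<in> Q" "on_component q s" for q
      proof -
        obtain v where "v \<noteq> []" "s = q @ v" using on_component_prefix[OF \<open>on_component q s\<close>] by blast
        then have "q \<in> T'" using fibre_prefix[OF T'] s(2) by blast
        then show ?thesis using dicritical_Q[OF T'] that(1) by blast
      qed
      have 1: "singular_at \<omega> s \<longrightarrow> simple_singularity_at \<omega> s" by (rule bspec[OF r1 s(2)])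
      have 2: "\<not> singular_at \<omega> s \<and> \<not> tangent_at \<omega> q s" if "q \<in> Q" "on_component q s" for q
        using r2 s(2) dic[OF that] that(2) by simp
      have 3: "\<not> (on_component q s \<and> on_component q' s)" if "q \<in> Q" "q' \<in> Q" "q \<noteq> q'" for q q'
      proof
        assume h: "on_component q s \<and> on_component q' s"
        then have "dicritical \<omega> T' q" "dicritical \<omega> T' q'" using dic that by blast+
        then have "\<not> components_meet T' q q'" using r3 that(3) by simp
        then show False using h s(2) unfolding components_meet_def by blast
      qed
      from b[unfolded bad_def] show False
      proof (elim disjE)
        assume "singular_at \<omega> s \<and> \<not> simple_singularity_at \<omega> s"
        then show False using 1 by simp
      next
        assume "\<exists>q\<in>Q. on_component q s \<and> (singular_at \<omega> s \<or> tangent_at \<omega> q s)"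
        then show False using 2 by auto
      next
        assume "\<exists>q\<in>Q. \<exists>q'\<in>Q. q \<noteq> q' \<and> on_component q s \<and> on_component q' s"
        then show False using 3 by auto
      qed
    qed
  qed
  then show "continues Tmin T'" using continues_iff[OF Tmin(1)] T' by blast
qed

text \<open>The class of a component depends only on its label, so the minimal tree and the given
  one define the same family.\<close>

lemma indeterminacy:
  assumes h: "level_foliation h \<omega>" and T0: "is_blowup_seq T0" "Q \<subseteq> T0"
  shows "indeterminacy_structure h (inf_class_union T0 Q)"
proof -
  have "inf_class Tmin q = inf_class T0 q" if "q \<in> Q" for q
  proof -
    have "q \<in> Tmin" "q \<in> T0" using that T(3) Tmin(2) T0(2) by blast+
    then show ?thesis using inf_class_iff[OF Tmin(1)] inf_class_iff[OF T0(1)] by simp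
  qed
  then have "inf_class_union Tmin Q = inf_class_union T0 Q" unfolding inf_class_union_def by (simp cong: ball_cong bex_cong)
  then show ?thesis unfolding indeterminacy_structure_def
    by (intro exI[of _ \<omega>] exI[of _ Tmin] conjI h minimal_Tmin) (simp add: dicritical_Tmin)
qed

end

text \<open>Following a direction in which the strict transform of a common divisor is not a unit leads to a leaf.
  There the common divisor would divide an exceptional monomial.\<close>

lemma coprime_resolved:
  assumes N: "N \<noteq> 0" and T2: "is_blowup_seq T2" "[] \<in> T2" and mono_leaf: "\<And>p. p \<in> fibre T2 \<Longrightarrow> mono_leaf Q p (pull_at p N) (pull_at p D)"
  shows "cop N D"
  unfolding cop_def
proof (intro allI impI notI)
  fix d assume d: "d dvd N" "d dvd D" "ev0 d = 0"
  have d0: "d \<noteq> 0" using N d(1) by auto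
  obtain p where p: "p \<in> fibre T2" "ev0 (strict_at p d) = 0" using nonunit_leaf[OF d0 d(3) T2] by blast
  obtain m where m: "pull_at p d = m * strict_at p d" using pull_at_strict_at[OF d0] by blast
  have dv: "strict_at p d dvd pull_at p f" if "d dvd f" for f
  proof -
    obtain f' where "f = d * f'" using \<open>d dvd f\<close> by (elim dvdE)
    then show ?thesis using m by simp
  qed
  have "strict_at p d dvd pull_at p N" "strict_at p d dvd pull_at p D" by (rule dv, fact d)+
  moreover obtain \<gamma> \<delta> where "exc_mono (exc_axes p) (C \<gamma> * pull_at p N + C \<delta> * pull_at p D)" using mono_leaf[OF p(1)] unfolding mono_leaf_def by blast
  ultimately have "ev0 (strict_at p d) \<noteq> 0" using dvd_exc_mono_unit strict_at_pure[OF d0] by (metis dvd_add dvd_mult)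
  then show False using p(2) by simp
qed

text \<open>A single leaf is enough, found by always taking the vertical direction: there the
  fraction is a Moebius image of a monomial, whose differential is not 0.\<close>

lemma level_pair_resolved_nonzero:
  assumes T2: "is_blowup_seq T2" "[] \<in> T2" and mono_leaf: "\<And>p. p \<in> fibre T2 \<Longrightarrow> mono_leaf Q p (pull_at p N) (pull_at p D)"
  shows "level_pair N D \<noteq> (0, 0)"
proof
  assume "level_pair N D = (0, 0)"
  then have z: "level_pair (pull_at p N) (pull_at p D) = (0, 0)" for p using chart_form_eq_0 chart_form_level_pair by metis
  obtain n where p: "replicate n Vertical \<in> fibre T2" using replicate_in_fibre[OF T2] by auto
  let ?p = "replicate n Vertical"
  have p0: "?p \<noteq> []" using fibre_notin[OF p] T2(2) by metis
  obtain \<alpha> \<beta> \<gamma> \<delta> H where det: "\<alpha> * \<delta> - \<beta> * \<gamma> \<noteq> 0" and H: "mono_form Q ?p H" and em: "exc_mono (exc_axes ?p) (C \<gamma> * pull_at ?p N + C \<delta> * pull_at ?p D)"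
    and e: "C \<alpha> * pull_at ?p N + C \<beta> * pull_at ?p D = (C \<gamma> * pull_at ?p N + C \<delta> * pull_at ?p D) * H"
    using mono_leaf[OF p] unfolding mono_leaf_def by blast
  let ?D = "C \<gamma> * pull_at ?p N + C \<delta> * pull_at ?p D"
  obtain s \<eta>1 \<eta>2 where s: "s \<noteq> 0" "dX H = s * \<eta>1" "dY H = s * \<eta>2" "leaf_pair Q ?p \<eta>1 \<eta>2" using leaf_form[OF H p0] by blast
  have "scale (?D * ?D) (dX H, dY H) = level_pair (?D * H) ?D" by (rule level_pair_mult[symmetric])
  also have "\<dots> = (0, 0)" unfolding e[symmetric] level_pair_linear z by (simp add: scale_def)
  finally have "\<eta>1 = 0" "\<eta>2 = 0" using s(1-3) exc_mono_nonzero[OF em] by (simp_all add: scale_def)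
  then have "fst (labels ?p) \<noteq> Some q \<and> snd (labels ?p) \<noteq> Some q" for q
    using s(4) unfolding leaf_pair_def by (cases "q \<in> Q") auto
  then show False using exc_axes_some[OF p0] unfolding exc_axes_def by (metis fst_conv not_None_eq snd_conv)
qed

lemma level_form_germ_of:
  assumes "holomorphic_germ n" "holomorphic_germ d" shows "hol_form (level_form (n, d)) \<and> form_germs (level_form (n, d)) = level_pair (germ_of n) (germ_of d)"
  using assms unfolding hol_form_def form_germs_def level_pair_def level_form_def by (simp add: germ_of_diff germ_of_mult dXY_germ_of)

theorem theorem2:
  fixes \<kappa> :: "(blowup_seq \<times> point set) set" and S :: "C2 set set"
  assumes "infinitesimal_class \<kappa>"
    and "finite S" and "\<forall>C\<in>S. branch C"
  shows "\<exists>h. meromorphic_germ h \<and> indeterminacy_structure h \<kappa> \<and>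
             S \<subseteq> zero_branches h \<union> pole_branches h"
proof -
  obtain T0 Q where T0: "is_blowup_seq T0" "Q \<subseteq> T0" and \<kappa>: "\<kappa> = inf_class_union T0 Q"
    using assms(1) unfolding infinitesimal_class_def by blast
  have "\<forall>K\<in>S. \<exists>f. holomorphic_germ f \<and> \<not> germ_eq f (\<lambda>_. 0) \<and> same_germ K {z. f z = 0}"
    using assms(3) unfolding branch_def curve_germ_def by blast
  then obtain f where f: "\<And>K. K \<in> S \<Longrightarrow> holomorphic_germ (f K) \<and> \<not> germ_eq (f K) (\<lambda>_. 0) \<and> same_germ K {z. f K z = 0}"
    by metis
  define F where "F = (\<Prod>K\<in>S. germ_of (f K))"
  have "F \<noteq> 0" unfolding F_def using f assms(2) germ_of_eq_iff[of _ "\<lambda>_. 0"] by (simp add: germ_of_0)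
  from resolved_fraction[OF this T0] obtain N D T T2 where ND: "N \<noteq> 0" "D \<noteq> 0" "F dvd N" and T: "is_blowup_seq T" "[] \<in> T" "Q \<subseteq> T"
    and T2: "is_blowup_seq T2" "T \<subseteq> T2" and thr: "\<And>t. t \<in> T \<Longrightarrow> three_zeros T Q t (pull_at t N) (pull_at t D)"
    and mono_leaf: "\<And>p. p \<in> fibre T2 \<Longrightarrow> mono_leaf Q p (pull_at p N) (pull_at p D)" by metis
  have nT2: "[] \<in> T2" using T T2 by blast
  obtain n where n: "holomorphic_germ n" "N = germ_of n" by (rule germ_of_cases)
  obtain d where d: "holomorphic_germ d" "D = germ_of d" by (rule germ_of_cases)
  have "fst (level_pair N D) \<noteq> 0 \<or> snd (level_pair N D) \<noteq> 0" using level_pair_resolved_nonzero[OF T2(1) nT2 mono_leaf] by (metis prod.collapse)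
  from gcd_extract[OF this] obtain k A B where k: "k \<noteq> 0" "fst (level_pair N D) = k * A" "snd (level_pair N D) = k * B" "cop A B" by blast
  obtain a where a: "holomorphic_germ a" "A = germ_of a" by (rule germ_of_cases)
  obtain b where b: "holomorphic_germ b" "B = germ_of b" by (rule germ_of_cases)
  define \<omega> where "\<omega> = (a, b)"
  have hol: "hol_form \<omega>" and form_germs: "form_germs \<omega> = (A, B)" using a b by (simp_all add: \<omega>_def hol_form_def form_germs_def)
  have level_pair: "level_pair N D = scale k (form_germs \<omega>)" unfolding form_germs scale_def using k(2,3) by (simp add: prod_eq_iff)
  have w0: "form_germs \<omega> \<noteq> (0, 0)" using level_pair level_pair_resolved_nonzero[OF T2(1) nT2 mono_leaf] by (auto simp: scale_def)
  interpret resolved N D T T2 Q k \<omega>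
    by unfold_locales (use ND T T2 thr mono_leaf hol level_pair k(1) w0 in auto)
  have "level_foliation (n, d) \<omega>"
    unfolding level_foliation_def using level_form_germ_of[OF n(1) d(1)] k(1,4) level_pair hol form_germs
    by (auto simp: defines_foliation_iff n(2) d(2) form_germs_def)
  then have "indeterminacy_structure (n, d) \<kappa>" unfolding \<kappa> by (rule indeterminacy[OF _ T0])
  moreover have "meromorphic_germ (n, d)"
    unfolding meromorphic_germ_def
    using n d ND(2) coprime_germs_iff[OF n(1) d(1)] coprime_resolved[OF ND(1) T2(1) nT2 mono_leaf] germ_of_eq_iff[OF d(1), of "\<lambda>_. 0"]
    by (simp add: germ_of_0)
  \<comment> \<open>All given branches become zeros because \<open>F\<close> divides the
    numerator.\<close>
  moreover have "S \<subseteq> zero_branches (n, d)"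
  proof
    fix K assume K: "K \<in> S"
    have "germ_of (f K) dvd F" unfolding F_def using assms(2) K by (rule dvd_prodI)
    then have "germ_dvd (f K) n" using ND(3) n f[OF K] germ_dvd_iff by (metis dvd_trans)
    then obtain c where "germ_eq n (\<lambda>z. f K z * c z)" unfolding germ_dvd_def by blast
    moreover have "germ_subset K {z. f K z = 0}" using f[OF K] unfolding same_germ_def by blast
    ultimately have "germ_subset K {z. n z = 0}" unfolding germ_eq_def germ_subset_def by eventually_elim auto
    then show "K \<in> zero_branches (n, d)" using assms(3) K unfolding zero_branches_def branches_of_def by simp
  qed
  ultimately show ?thesis by blast
qed

end
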